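(* Let $n\ge 1$, $0<p\le1$ and $\delta>n/p-(n+1)/2$. Suppose that $\delta-(n-1)/2$ is not a positive integer. Then there exists a constant $C>0$ such that for every $f\in WH^p(\mathbb R^n)$ and every $0<R<\infty$, $$\big\|T^\delta_R(f)\big\|_{WH^p}\le C\,\|f\|_{WH^p},$$ where $C$ is independent of $f$ and $R$.
   Context: **Bochner-Riesz operators.** For $\delta>0$ and $0<R<\infty$, $T^\delta_R$ is defined initially for Schwartz functions $f$ on $\mathbb R^n$ by $\widehat{T^\delta_R f}(\xi)=\big(1-|\xi|^2/R^2\big)^\delta_+\,\hat f(\xi)$, where $\hat f(\xi)=\int f(x)e^{-2\pi i x\cdot\xi}\,dx$. Equivalently $T^\delta_R f=\phi_{1/R}*f$, where $\phi$ is the Fourier transform of $\xi\mapsto(1-|\xi|^2)^\delta_+$ and $\phi_{1/R}(x)=R^n\phi(Rx)$; explicitly $\phi(x)=\pi^{-\delta}\Gamma(\delta+1)|x|^{-(n/2+\delta)}J_{n/2+\delta}(2\pi|x|)$, with $J_\mu$ the Bessel function. For a tempered distribution $f\in WH^p(\mathbb R^n)$ (defined below), the function $T^\delta_R f=\phi_{1/R}*f$ is understood as the convolution $\phi_{1/R}*(\psi*f)$ of functions, where $\psi\in\mathscr S(\mathbb R^n)$ is any Schwartz function with $\hat\psi=1$ on a neighbourhood of $\{|\xi|\le R\}$. **Weak Lebesgue space.** $\|g\|_{WL^p}=\sup_{\lambda>0}\lambda\,|\{x\in\mathbb R^n:|g(x)|>\lambda\}|^{1/p}$ (Lebesgue measure),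 and $WL^p(\mathbb R^n)$ is the set of measurable $g$ for which this is finite. **Weak Hardy space.** Let $0<p\le1$ and fix an integer $N\ge[n(1/p-1)]$ ($[\cdot]$ is the integer part). Put $$\mathscr A_{N}=\Big\{\varphi\in\mathscr S(\mathbb R^n):\sup_{x\in\mathbb R^n}\sup_{|\alpha|\le N+1}(1+|x|)^{N+n+1}|D^\alpha\varphi(x)|\le1\Big\},$$ and $\varphi_t(x)=t^{-n}\varphi(x/t)$. For $f\in\mathscr S'(\mathbb R^n)$ let $Gf(x)=\sup_{\varphi\in\mathscr A_{N}}\sup_{|y-x|<t}|(\varphi_t*f)(y)|$. Then $WH^p(\mathbb R^n)=\{f\in\mathscr S'(\mathbb R^n):Gf\in WL^p(\mathbb R^n)\}$ with $\|f\|_{WH^p}=\|Gf\|_{WL^p}$. The same space, with an equivalent quasi-norm, is obtained by replacing $Gf$ by the radial grand maximal function $G^+f(x)=\sup_{\varphi\in\mathscr A_{N}}\sup_{t>0}|(\varphi_t*f)(x)|$. *)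

theory Defs
  imports "HOL-Analysis.Analysis"
begin

text \<open>
  The space \<open>\<real>\<^sup>n\<close> is an arbitrary Euclidean space \<^typ>\<open>'a::euclidean_space\<close>, with \<open>n = DIM('a)\<close>.
\<close>

section \<open>Schwartz functions and tempered distributions\<close>

text \<open>
  A list \<open>bs\<close> of coordinate vectors plays the role of a multi-index: the order of the
  derivative is \<^term>\<open>length bs\<close>. Distinct lists may denote the same multi-index; for smooth
  functions the partial derivatives commute, so the resulting derivative is the same.
\<close>

definition partial_deriv :: "'a::euclidean_space \<Rightarrow> ('a \<Rightarrow> complex) \<Rightarrow> 'a \<Rightarrow> complex" where
  "partial_deriv b f x = frechet_derivative f (at x) b"

definition iter_partial :: "'a::euclidean_space list \<Rightarrow> ('a \<Rightarrow> complex) \<Rightarrow> 'a \<Rightarrow> complex" where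
  "iter_partial bs f = foldr partial_deriv bs f"

definition smooth_fun :: "('a::euclidean_space \<Rightarrow> complex) \<Rightarrow> bool" where
  "smooth_fun f \<longleftrightarrow> (\<forall>bs\<in>lists Basis. \<forall>x. iter_partial bs f differentiable (at x))"

definition schwartz_seminorm :: "nat \<Rightarrow> nat \<Rightarrow> ('a::euclidean_space \<Rightarrow> complex) \<Rightarrow> ennreal" where
  "schwartz_seminorm M K \<phi> =
     (SUP x. SUP bs\<in>{bs \<in> lists Basis. length bs \<le> K}.
        ennreal ((1 + norm x) ^ M * norm (iter_partial bs \<phi> x)))"

definition schwartz :: "('a::euclidean_space \<Rightarrow> complex) set" where
  "schwartz = {\<phi>. smooth_fun \<phi> \<and> (\<forall>M K. schwartz_seminorm M K \<phi> < \<infinity>)}"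

text \<open>
  A tempered distribution is a continuous linear functional on the Schwartz space; its values at
  functions outside \<^term>\<open>schwartz\<close> are irrelevant and are never used below. Continuity is with
  respect to the topology generated by the (increasing) family of Schwartz seminorms.
\<close>

type_synonym 'a distribution = "('a \<Rightarrow> complex) \<Rightarrow> complex"

definition tempered :: "'a::euclidean_space distribution \<Rightarrow> bool" where
  "tempered f \<longleftrightarrow>
     (\<forall>\<phi>\<in>schwartz. \<forall>\<psi>\<in>schwartz. f (\<lambda>x. \<phi> x + \<psi> x) = f \<phi> + f \<psi>) \<and>
     (\<forall>c. \<forall>\<phi>\<in>schwartz. f (\<lambda>x. c * \<phi> x) = c * f \<phi>) \<and>
     (\<exists>C\<ge>0. \<exists>M K. \<forall>\<phi>\<in>schwartz. ennreal (norm (f \<phi>)) \<le> ennreal C * schwartz_seminorm M K \<phi>)"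

definition distr_of_fun :: "('a::euclidean_space \<Rightarrow> complex) \<Rightarrow> 'a distribution" where
  "distr_of_fun g = (\<lambda>\<phi>. LINT x|lborel. g x * \<phi> x)"

definition conv :: "('a::euclidean_space \<Rightarrow> complex) \<Rightarrow> ('a \<Rightarrow> complex) \<Rightarrow> 'a \<Rightarrow> complex" where
  "conv f g x = (LINT y|lborel. f (x - y) * g y)"

definition conv_distr :: "('a::euclidean_space \<Rightarrow> complex) \<Rightarrow> 'a distribution \<Rightarrow> 'a \<Rightarrow> complex" where
  "conv_distr \<phi> f x = f (\<lambda>y. \<phi> (x - y))"

definition dilate :: "real \<Rightarrow> ('a::euclidean_space \<Rightarrow> complex) \<Rightarrow> 'a \<Rightarrow> complex" where
  "dilate t \<phi> x = \<phi> (x /\<^sub>R t) /\<^sub>R t ^ DIM('a)"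

definition fourier :: "('a::euclidean_space \<Rightarrow> complex) \<Rightarrow> 'a \<Rightarrow> complex" where
  "fourier f \<xi> = (LINT x|lborel. f x * exp (- 2 * of_real pi * \<i> * of_real (x \<bullet> \<xi>)))"

section \<open>Weak Lebesgue and weak Hardy spaces\<close>

text \<open>
  Grand maximal functions may take the value infinity, so weak Lebesgue spaces are set up for
  extended nonnegative functions. The real function \<open>powr\<close> is extended to \<^typ>\<open>ennreal\<close> for
  positive exponents.
\<close>

definition ennreal_powr :: "ennreal \<Rightarrow> real \<Rightarrow> ennreal" where
  "ennreal_powr a s = (if a = \<infinity> then \<infinity> else ennreal (enn2real a powr s))"

definition weak_Lp_norm :: "real \<Rightarrow> ('a::euclidean_space \<Rightarrow> ennreal) \<Rightarrow> ennreal" where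
  "weak_Lp_norm p g =
     (SUP r\<in>{0<..}. ennreal r * ennreal_powr (emeasure lebesgue {x. g x > ennreal r}) (1 / p))"

definition weak_Lp :: "real \<Rightarrow> ('a::euclidean_space \<Rightarrow> ennreal) set" where
  "weak_Lp p = {g \<in> borel_measurable lebesgue. weak_Lp_norm p g < \<infinity>}"

definition test_class :: "nat \<Rightarrow> ('a::euclidean_space \<Rightarrow> complex) set" where
  "test_class N = {\<phi> \<in> schwartz. schwartz_seminorm (N + DIM('a) + 1) (N + 1) \<phi> \<le> 1}"

definition grand_maximal :: "nat \<Rightarrow> 'a::euclidean_space distribution \<Rightarrow> 'a \<Rightarrow> ennreal" where
  "grand_maximal N f x =
     (SUP \<phi>\<in>test_class N. SUP (y, t)\<in>{(y, t). norm (y - x) < t}.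
        ennreal (norm (conv_distr (dilate t \<phi>) f y)))"

definition weak_Hardy_norm :: "nat \<Rightarrow> real \<Rightarrow> 'a::euclidean_space distribution \<Rightarrow> ennreal" where
  "weak_Hardy_norm N p f = weak_Lp_norm p (grand_maximal N f)"

definition weak_Hardy :: "nat \<Rightarrow> real \<Rightarrow> 'a::euclidean_space distribution set" where
  "weak_Hardy N p = {f. tempered f \<and> grand_maximal N f \<in> weak_Lp p}"

section \<open>Bochner-Riesz operators\<close>

text \<open>Note that \<open>0 powr \<delta> = 0\<close>, so the multiplier vanishes for \<open>norm \<xi> \<ge> 1\<close>.\<close>

definition br_multiplier :: "real \<Rightarrow> 'a::euclidean_space \<Rightarrow> complex" where
  "br_multiplier \<delta> \<xi> = of_real (max 0 (1 - (norm \<xi>)\<^sup>2) powr \<delta>)"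

definition br_kernel :: "real \<Rightarrow> 'a::euclidean_space \<Rightarrow> complex" where
  "br_kernel \<delta> = fourier (br_multiplier \<delta>)"

definition br_cutoff :: "real \<Rightarrow> ('a::euclidean_space \<Rightarrow> complex) \<Rightarrow> bool" where
  "br_cutoff R \<psi> \<longleftrightarrow>
     \<psi> \<in> schwartz \<and> (\<exists>U. open U \<and> cball 0 R \<subseteq> U \<and> (\<forall>\<xi>\<in>U. fourier \<psi> \<xi> = 1))"

text \<open>
  The kernel is not a Schwartz function, so it is convolved with the function \<open>\<psi> * f\<close>, where
  \<open>\<psi>\<close> is an auxiliary function with \<^term>\<open>br_cutoff R \<psi>\<close>. On weak Hardy spaces, and for \<open>\<delta>\<close> above
  the critical index, the result does not depend on the choice of \<open>\<psi>\<close>.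
\<close>

definition bochner_riesz ::
  "('a::euclidean_space \<Rightarrow> complex) \<Rightarrow> real \<Rightarrow> real \<Rightarrow> 'a distribution \<Rightarrow> 'a \<Rightarrow> complex" where
  "bochner_riesz \<psi> \<delta> R f = conv (dilate (1 / R) (br_kernel \<delta>)) (conv_distr \<psi> f)"

end

theory Submission
  imports Defs
begin

text \<open>
  After rescaling, \<open>R = 1\<close>. The kernel of order \<open>\<beta>\<close> is radial and its profile solves a
  Bessel-type equation; an energy estimate bounds it by \<open>(1 + |x|) powr - (\<beta> + (n + 1) / 2)\<close>, which
  for \<open>\<beta> = \<delta>\<close> decays faster than \<open>|x| powr - (n / p)\<close>. A polynomial identity in \<open>|\<xi>|^2\<close> splits the
  multiplier of order \<open>\<delta>\<close> into one of large order \<open>\<delta> + J\<close> and one divisible by \<open>|\<xi>| ^ (2 * (N + 1))\<close>.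
  For test functions dilated by \<open>t \<le> 1\<close>, and for the divisible part when \<open>t \<ge> 1\<close>, the maximal function
  of the result is at most \<open>u * g\<close>, where \<open>u = (1 + |x|) powr - s\<close> with \<open>s > n / p\<close> and \<open>g\<close> is the
  supremum of \<open>|\<phi> * f|\<close> over undilated test functions \<open>\<phi>\<close>; the other part is controlled pointwise by
  the grand maximal function \<open>G\<close> of \<open>f\<close>. Finally \<open>g z \<le> G w\<close> for \<open>|z - w| < 1\<close>, so \<open>u * g\<close> is
  estimated by \<open>G\<close> in weak \<open>L powr p\<close> by interpolating between a bound on large values with an
  exponent \<open>q < p\<close> and a trivial bound on small values.
\<close>

section \<open>Affine substitutions and polynomial decay\<close>

text \<open>Two obstacles shape the argument. First, the kernel of order \<delta> may decay only
  slightly faster than \<open>|x| powr - (n / p)\<close>, less than the order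
  \<open>N + n + 1\<close> asked of test functions, so it cannot itself be merged into a test
  function at large scales. Its slow decay stems from the singularity of the multiplier on the unit
  sphere, whereas a test function dilated by \<open>t \<ge> 1\<close> mainly sees frequencies of
  size \<open>1 / t\<close>. The splitting separates the two regions: powers of
  \<open>1 - |\<xi>|^2\<close> smooth the sphere, powers of \<open>|\<xi>|^2\<close> vanish at the
  origin, and half of the resulting derivatives gain \<open>1 / t ^ (N + 1)\<close> on the test
  function. Second, functions in weak \<open>L powr p\<close> with \<open>p \<le> 1\<close> need not
  be locally integrable. What saves all integrals is that \<open>f\<close> smoothed at unit scale is
  a bounded function, so that convolutions with integrable kernels converge absolutely and can be
  rearranged. The condition on \<open>N\<close> says that \<open>N + n + 1 > n / p\<close>, which
  leaves room for the exponent \<open>s\<close>. No cutoff is ever constructed: the constant comes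
  from one fixed cutoff, and without any cutoff the claim is vacuous.\<close>

lemma nn_integral_lborel_affine:
  fixes f :: "'a::euclidean_space \<Rightarrow> ennreal"
  assumes [measurable]: "f \<in> borel_measurable borel" and c: "c \<noteq> 0"
  shows "(\<integral>\<^sup>+x. f x \<partial>lborel) = ennreal (\<bar>c\<bar> ^ DIM('a)) * (\<integral>\<^sup>+x. f (t + c *\<^sub>R x) \<partial>lborel)"
  by (subst lborel_affine[OF c, of t])
     (simp add: nn_integral_density nn_integral_distr nn_integral_cmult)

lemma integrable_lborel_affine:
  fixes f :: "'a::euclidean_space \<Rightarrow> 'b::{banach, second_countable_topology}"
  assumes f: "integrable lborel f"
  shows "c \<noteq> 0 \<Longrightarrow> integrable lborel (\<lambda>x. f (t + c *\<^sub>R x))"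
  using f f[THEN borel_measurable_integrable] unfolding integrable_iff_bounded
  by (subst (asm) nn_integral_lborel_affine[where c=c and t=t]) (auto simp: ennreal_mult_less_top)

lemma integrable_lborel_affine_iff:
  fixes f :: "'a::euclidean_space \<Rightarrow> 'b::{banach, second_countable_topology}"
  shows "c \<noteq> 0 \<Longrightarrow> integrable lborel (\<lambda>x. f (t + c *\<^sub>R x)) \<longleftrightarrow> integrable lborel f"
  using
    integrable_lborel_affine[of f c t]
    integrable_lborel_affine[of "\<lambda>x. f (t + c *\<^sub>R x)" "1/c" "- (t /\<^sub>R c)"]
  by (auto simp add: algebra_simps divide_inverse)

text \<open>No integrability is assumed: a non-integrable function has integral 0 by convention and
  the substitution preserves integrability, so both sides vanish together. Identities such as
  \<open>conv_commute\<close> are therefore unconditional.\<close>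

lemma integral_lborel_affine:
  fixes f :: "'a::euclidean_space \<Rightarrow> 'b::{banach, second_countable_topology}" and c :: real
  assumes c: "c \<noteq> 0" shows "(\<integral>x. f x \<partial> lborel) = \<bar>c\<bar> ^ DIM('a) *\<^sub>R (\<integral>x. f (t + c *\<^sub>R x) \<partial>lborel)"
proof cases
  assume f[measurable]: "integrable lborel f" then show ?thesis
    using c f f[THEN borel_measurable_integrable] f[THEN integrable_lborel_affine, of c t]
    by (subst lborel_affine[OF c, of t])
       (simp add: integral_density integral_distr)
next
  assume "\<not> integrable lborel f" with c show ?thesis
    by (simp add: integrable_lborel_affine_iff not_integrable_integral_eq)
qed

lemma nn_integral_reflect:
  fixes f :: "'a::euclidean_space \<Rightarrow> ennreal"
  assumes "f \<in> borel_measurable borel"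
  shows "(\<integral>\<^sup>+x. f (t - x) \<partial>lborel) = (\<integral>\<^sup>+x. f x \<partial>lborel)"
  using nn_integral_lborel_affine[OF assms, of "-1" t] by simp

lemma nn_integral_shift:
  fixes f :: "'a::euclidean_space \<Rightarrow> ennreal"
  assumes "f \<in> borel_measurable borel"
  shows "(\<integral>\<^sup>+x. f (x - t) \<partial>lborel) = (\<integral>\<^sup>+x. f x \<partial>lborel)"
  using nn_integral_lborel_affine[OF assms, of "1" "-t"] by simp

lemma integral_reflect:
  fixes f :: "'a::euclidean_space \<Rightarrow> 'b::{banach, second_countable_topology}"
  shows "(\<integral>x. f (t - x) \<partial>lborel) = (\<integral>x. f x \<partial>lborel)"
  using integral_lborel_affine[of "-1" f t] by simp

lemma integral_shift:
  fixes f :: "'a::euclidean_space \<Rightarrow> 'b::{banach, second_countable_topology}"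
  shows "(\<integral>x. f (t + x) \<partial>lborel) = (\<integral>x. f x \<partial>lborel)"
  using integral_lborel_affine[of "1" f t] by simp

lemma integrable_reflect:
  fixes f :: "'a::euclidean_space \<Rightarrow> 'b::{banach, second_countable_topology}"
  shows "integrable lborel (\<lambda>x. f (t - x)) \<longleftrightarrow> integrable lborel f"
  using integrable_lborel_affine_iff[of "-1" f t] by simp

lemma integrable_shift:
  fixes f :: "'a::euclidean_space \<Rightarrow> 'b::{banach, second_countable_topology}"
  shows "integrable lborel (\<lambda>x. f (t + x)) \<longleftrightarrow> integrable lborel f"
  using integrable_lborel_affine_iff[of "1" f t] by simp

section \<open>Polynomially decaying weights and their convolutions\<close>

definition decay :: "real \<Rightarrow> 'a::euclidean_space \<Rightarrow> real" where
  "decay s x = (1 + norm x) powr - s"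

lemma decay_pos: "0 < decay s x"
  using norm_ge_zero[of x] by (simp add: decay_def add_nonneg_eq_0_iff)

lemma decay_nonneg [simp]: "0 \<le> decay s x"
  using decay_pos[of s x] by linarith

lemma decay_measurable [measurable]: "decay s \<in> borel_measurable borel"
  unfolding decay_def[abs_def] by measurable

lemma decay_antimono: "s \<le> s' \<Longrightarrow> decay s' x \<le> decay s x"
  unfolding decay_def by (intro powr_mono) auto

lemma decay_le_1: "0 \<le> s \<Longrightarrow> decay s x \<le> 1"
  using decay_antimono[of 0 s x] by (simp add: decay_def add_nonneg_eq_0_iff)

lemma decay_powr: "decay s x powr q = decay (s * q) x"
  unfolding decay_def by (simp add: powr_powr)

lemma decay_nat: "decay (real M) x = 1 / (1 + norm x) ^ M"
  unfolding decay_def by (simp add: powr_minus powr_realpow divide_inverse add_pos_nonneg)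

text \<open>Bridge between two ways of expressing decay: Schwartz seminorms put the weight on the
  left, convolution estimates put it on the right.\<close>

lemma decay_bound_iff: "c \<le> C * decay (real M) x \<longleftrightarrow> (1 + norm x) ^ M * c \<le> C"
  by (simp add: decay_nat pos_le_divide_eq add_pos_nonneg mult.commute)

text \<open>A shift by at most 1 changes \<open>1 + norm x\<close> by a factor of at most 2. This
  absorbs every change of centre inside a unit ball.\<close>

lemma decay_shift:
  assumes "0 \<le> s" "norm h \<le> 1"
  shows "decay s (x + h) \<le> 2 powr s * decay s x"
proof -
  have "norm x \<le> norm (x + h) + norm h"
    using norm_triangle_ineq4[of "x + h" h] by simp
  with assms(2) have "1 + norm x \<le> 2 * (1 + norm (x + h))"
    using norm_ge_zero[of "x + h"] by argo
  then have "(2 * (1 + norm (x + h))) powr - s \<le> (1 + norm x) powr - s"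
    using assms(1) by (intro powr_mono2') (auto simp: add_pos_nonneg)
  then have "2 powr - s * decay s (x + h) \<le> decay s x"
    unfolding decay_def by (subst (asm) powr_mult) (auto simp: add_nonneg_nonneg)
  then show ?thesis by (simp add: powr_minus field_simps)
qed

lemma peetre: "1 + norm x \<le> (1 + norm (x + y)) * (1 + norm y)"
proof -
  have "norm x \<le> norm (x + y) + norm y"
    using norm_triangle_ineq4[of "x + y" y] by simp
  moreover have "0 \<le> norm (x+y) * norm y" by simp
  ultimately show ?thesis unfolding distrib_left distrib_right by linarith
qed

text \<open>Dyadic decomposition: where \<open>1 + norm x\<close> lies between \<open>2 ^ j\<close>
  and \<open>2 ^ Suc j\<close> the weight is at most \<open>2 powr (- s * real j)\<close>, and that
  region sits in a ball of volume comparable to \<open>2 ^ (n * j)\<close>. The geometric series so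
  obtained has ratio \<open>2 powr (n - s)\<close>, below 1.\<close>

lemma decay_nn_integral_finite:
  assumes s: "real DIM('a::euclidean_space) < s"
  shows "(\<integral>\<^sup>+(x::'a). ennreal (decay s x) \<partial>lborel) < \<infinity>"
proof -
  let ?n = "DIM('a)"
  define V where "V = unit_ball_vol (real ?n)"
  have V: "0 \<le> V" by (simp add: V_def)
  define u where "u j x = ennreal (2 powr (- s * real j)) * indicator (cball 0 (2 ^ Suc j)) x" for j and x :: 'a
  have um: "u j \<in> borel_measurable lborel" for j
    unfolding u_def[abs_def] by (intro borel_measurable_times_ennreal borel_measurable_indicator) auto
  have le: "ennreal (decay s x) \<le> (\<Sum>j. u j x)" for x :: 'a
  proof -
    define j where "j = nat \<lfloor>log 2 (1 + norm x)\<rfloor>"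
    have l0: "0 \<le> log 2 (1 + norm x)"
      by (subst zero_le_log_cancel_iff) (auto simp: add_pos_nonneg)
    then have "real j \<le> log 2 (1 + norm x)" "log 2 (1 + norm x) \<le> real (Suc j)"
      unfolding j_def by linarith+
    then have 1: "2 powr real j \<le> 1 + norm x" and 2: "1 + norm x \<le> 2 powr real (Suc j)"
      by (simp_all add: le_log_iff log_le_iff add_pos_nonneg)
    have "x \<in> cball 0 (2 ^ Suc j)"
      using 2 norm_ge_zero[of x] by (simp only: powr_realpow mem_cball) simp
    moreover have "decay s x \<le> 2 powr (- s * real j)"
      using powr_mono2'[OF _ _ 1, of "-s"] s by (simp add: decay_def powr_powr mult.commute)
    ultimately have "ennreal (decay s x) \<le> u j x" by (simp add: u_def ennreal_leI)
    also have "\<dots> \<le> (\<Sum>j. u j x)"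
      using sum_le_suminf[of "\<lambda>j. u j x" "{j}"] by simp
    finally show ?thesis .
  qed
  have "(\<integral>\<^sup>+(x::'a). ennreal (decay s x) \<partial>lborel) \<le> (\<integral>\<^sup>+x. (\<Sum>j. u j x) \<partial>lborel)"
    by (intro nn_integral_mono le)
  also have "\<dots> = (\<Sum>j. \<integral>\<^sup>+x. u j x \<partial>lborel)"
    by (rule nn_integral_suminf) (rule um)
  also have "\<dots> = (\<Sum>j. ennreal (V * 2 ^ ?n * (2 powr (real ?n - s)) ^ j))"
  proof (intro suminf_cong)
    fix j
    have "(\<integral>\<^sup>+x. u j x \<partial>lborel) = ennreal (2 powr (- s * real j)) * ennreal (V * (2 ^ Suc j) ^ ?n)"
      unfolding u_def by (simp add: nn_integral_cmult_indicator emeasure_cball V_def)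
    also have "\<dots> = ennreal (2 powr (- s * real j) * (V * (2 ^ Suc j) ^ ?n))"
      using V by (simp add: ennreal_mult)
    also have "2 powr (- s * real j) * (V * (2 ^ Suc j) ^ ?n) = V * 2 ^ ?n * (2 powr (real ?n - s)) ^ j"
    proof -
      have "(2::real) powr (real ?n * real j) = 2 ^ (?n * j)"
        using powr_realpow[of "2::real" "?n * j"] by simp
      moreover have "(2 powr (real ?n - s)) ^ j = 2 powr (real ?n * real j + - s * real j)"
        using powr_realpow[of "2 powr (real ?n - s)" j, symmetric] by (simp add: powr_powr algebra_simps)
      ultimately have "(2 powr (real ?n - s)) ^ j = 2 ^ (?n * j) * 2 powr (- s * real j)"
        by (simp only: powr_add)
      moreover have "((2::real) ^ Suc j) ^ ?n = 2 ^ ?n * 2 ^ (?n * j)"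
        by (simp add: power_mult_distrib power_mult[symmetric] mult.commute)
      ultimately show ?thesis by (simp only: mult_ac)
    qed
    finally show "(\<integral>\<^sup>+x. u j x \<partial>lborel) = ennreal (V * 2 ^ ?n * (2 powr (real ?n - s)) ^ j)" .
  qed
  also have "\<dots> = ennreal (\<Sum>j. V * 2 ^ ?n * (2 powr (real ?n - s)) ^ j)"
    using V s by (intro suminf_ennreal2 summable_mult summable_geometric) (auto simp: powr_less_one)
  finally show ?thesis by (rule le_less_trans) simp
qed

lemma decay_integrable:
  "real DIM('a::euclidean_space) < s \<Longrightarrow> integrable lborel (decay s :: 'a \<Rightarrow> real)"
  by (intro integrableI_nonneg) (auto simp: decay_nn_integral_finite[unfolded infinity_ennreal_def])

lemma integrable_decay_bound:
  fixes f :: "'a::euclidean_space \<Rightarrow> 'b::{banach, second_countable_topology}"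
  assumes [measurable]: "f \<in> borel_measurable borel"
    and "real DIM('a) < s" "\<And>x. norm (f x) \<le> C * decay s x"
  shows "integrable lborel f"
proof (rule Bochner_Integration.integrable_bound)
  show "integrable lborel (\<lambda>x::'a. C * decay s x)"
    using decay_integrable[OF assms(2)] by simp
qed (use assms(3) in \<open>auto intro: order_trans[OF _ abs_ge_self]\<close>)

text \<open>Either \<open>x - z\<close> or \<open>z\<close> has size comparable to \<open>x\<close>.
  In the first case the weight itself decays and the mass of \<open>b\<close> remains; in the second
  the pointwise bound on \<open>b\<close> supplies the decay and the integral of the weight remains.
  The hypotheses on \<open>b\<close> are its mass and a bound with weight
  \<open>norm z powr L\<close> because both survive dilations by \<open>t \<le> 1\<close>.\<close>

lemma decay_conv_nn:
  assumes L: "real DIM('a::euclidean_space) < L"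
  obtains C where "0 < C" and
    "\<And>b B (x::'a). \<lbrakk>b \<in> borel_measurable borel; (\<integral>\<^sup>+z. b z \<partial>lborel) \<le> ennreal B;
        \<And>z. ennreal (norm z powr L) * b z \<le> ennreal B; 0 \<le> B\<rbrakk> \<Longrightarrow>
        (\<integral>\<^sup>+z. ennreal (decay L (x - z)) * b z \<partial>lborel) \<le> ennreal (C * B * decay L x)"
proof -
  define I where "I = (\<integral>(x::'a). decay L x \<partial>lborel)"
  have I: "(\<integral>\<^sup>+(z::'a). ennreal (decay L z) \<partial>lborel) = ennreal I" "0 \<le> I"
    unfolding I_def using decay_integrable[OF L] by (auto simp: nn_integral_eq_integral)
  define C where "C = 2 powr L * (1 + I)"
  have L0: "0 < L" using L by (smt (verit) of_nat_0_le_iff)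
  show thesis
  proof (rule that[of C])
    show "0 < C" using I by (simp add: C_def add_pos_nonneg)
    fix b :: "'a \<Rightarrow> ennreal" and B :: real and x :: 'a
    assume [measurable]: "b \<in> borel_measurable borel" and b1: "(\<integral>\<^sup>+z. b z \<partial>lborel) \<le> ennreal B"
      and b2: "\<And>z. ennreal (norm z powr L) * b z \<le> ennreal B" and B: "0 \<le> B"
    have pt: "ennreal (decay L (x - z)) * b z \<le>
        ennreal (2 powr L * decay L x) * (b z + ennreal B * ennreal (decay L (x - z)))" for z
    proof -
      \<comment> \<open>Bounding \<open>m powr L\<close> by the sum of the two powers treats both
        cases at once.\<close>
      define m where "m = max (1 + norm (x - z)) (norm z)"
      have m: "0 < m" by (auto simp: m_def add_pos_nonneg less_max_iff_disj)
      have "1 + norm x \<le> 2 * m"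
        using norm_triangle_ineq[of "x - z" z] norm_ge_zero[of "x - z"] unfolding m_def max_def by (auto split: if_splits)
      then have "(1 + norm x) powr L \<le> (2 * m) powr L"
        using L0 by (intro powr_mono2) auto
      also have "\<dots> = 2 powr L * m powr L" using m by (simp add: powr_mult)
      also have "m powr L \<le> (1 + norm (x - z)) powr L + norm z powr L"
        unfolding m_def by (simp add: max_def)
      finally have "(1 + norm x) powr L \<le> 2 powr L * ((1 + norm (x - z)) powr L + norm z powr L)"
        by simp
      then have "1 \<le> 2 powr L * decay L x * ((1 + norm (x - z)) powr L + norm z powr L)"
        by (simp add: decay_def powr_minus field_simps add_nonneg_eq_0_iff)
      then have "decay L (x - z) * 1 \<le> decay L (x - z) * (2 powr L * decay L x * ((1 + norm (x - z)) powr L + norm z powr L))"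
        by (intro mult_left_mono) auto
      also have "\<dots> = 2 powr L * decay L x * (1 + norm z powr L * decay L (x - z))"
        by (simp add: decay_def powr_minus field_simps add_nonneg_eq_0_iff)
      finally have "ennreal (decay L (x - z)) * b z \<le>
          ennreal (2 powr L * decay L x * (1 + norm z powr L * decay L (x - z))) * b z"
        by (intro mult_right_mono ennreal_leI) auto
      also have "\<dots> = ennreal (2 powr L * decay L x) * (b z + ennreal (norm z powr L) * b z * ennreal (decay L (x - z)))"
        by (simp add: ennreal_mult ennreal_plus algebra_simps)
      also have "\<dots> \<le> ennreal (2 powr L * decay L x) * (b z + ennreal B * ennreal (decay L (x - z)))"
        by (intro mult_left_mono add_mono mult_right_mono b2) auto
      finally show ?thesis .
    qed
    have "(\<integral>\<^sup>+z. ennreal (decay L (x - z)) * b z \<partial>lborel) \<le>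
      (\<integral>\<^sup>+z. ennreal (2 powr L * decay L x) * (b z + ennreal B * ennreal (decay L (x - z))) \<partial>lborel)"
      by (intro nn_integral_mono pt)
    also have "\<dots> = ennreal (2 powr L * decay L x) * ((\<integral>\<^sup>+z. b z \<partial>lborel) +
        ennreal B * (\<integral>\<^sup>+z. ennreal (decay L (x - z)) \<partial>lborel))"
      by (simp add: nn_integral_cmult nn_integral_add)
    also have "(\<integral>\<^sup>+z. ennreal (decay L (x - z)) \<partial>lborel) = ennreal I"
      using nn_integral_reflect[of "\<lambda>z. ennreal (decay L z)" x] I by simp
    also have "ennreal (2 powr L * decay L x) * ((\<integral>\<^sup>+z. b z \<partial>lborel) + ennreal B * ennreal I) \<le>
       ennreal (2 powr L * decay L x) * (ennreal B + ennreal B * ennreal I)"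
      by (intro mult_left_mono add_mono b1) auto
    also have "\<dots> = ennreal (C * B * decay L x)"
      using B I by (simp add: C_def ennreal_mult[symmetric] ennreal_plus[symmetric] algebra_simps del: ennreal_plus)
    finally show "(\<integral>\<^sup>+z. ennreal (decay L (x - z)) * b z \<partial>lborel) \<le> ennreal (C * B * decay L x)" .
  qed
qed

text \<open>A non-integrable \<open>f\<close> has integral 0, so the bound can be applied without a
  separate integrability argument.\<close>

lemma norm_integral_le_nn:
  fixes f :: "'a \<Rightarrow> 'b::{banach, second_countable_topology}"
  assumes "(\<integral>\<^sup>+x. ennreal (norm (f x)) \<partial>M) \<le> ennreal B" "0 \<le> B"
  shows "norm (integral\<^sup>L M f) \<le> B"
proof (cases "integrable M f")
  case True
  have "ennreal (norm (integral\<^sup>L M f)) \<le> ennreal B"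
    using integral_norm_bound_ennreal[OF True] assms(1) by (rule order_trans)
  then show ?thesis using assms(2) by (simp add: ennreal_le_iff)
next
  case False
  then show ?thesis using assms(2) by (simp add: not_integrable_integral_eq)
qed

lemma decay_conv:
  assumes L: "real DIM('a::euclidean_space) < L"
  obtains C where "0 < C" and
    "\<And>a b A B (x::'a). \<lbrakk>b \<in> borel_measurable borel; \<And>z. norm (a z) \<le> A * decay L z;
        (\<integral>\<^sup>+z. ennreal (norm (b z)) \<partial>lborel) \<le> ennreal B;
        \<And>z. norm z powr L * norm (b z) \<le> B; 0 \<le> A; 0 \<le> B\<rbrakk> \<Longrightarrow>
        norm (conv a b x) \<le> C * A * B * decay L x"
proof -
  obtain C where C: "0 < C" and
    *: "\<And>b B (x::'a). \<lbrakk>b \<in> borel_measurable borel; (\<integral>\<^sup>+z. b z \<partial>lborel) \<le> ennreal B;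
        \<And>z. ennreal (norm z powr L) * b z \<le> ennreal B; 0 \<le> B\<rbrakk> \<Longrightarrow>
        (\<integral>\<^sup>+z. ennreal (decay L (x - z)) * b z \<partial>lborel) \<le> ennreal (C * B * decay L x)"
    using decay_conv_nn[OF L] by blast
  show thesis
  proof (rule that[OF C])
    fix a b :: "'a \<Rightarrow> complex" and A B :: real and x :: 'a
    assume [measurable]: "b \<in> borel_measurable borel" and a: "\<And>z. norm (a z) \<le> A * decay L z"
     and b: "(\<integral>\<^sup>+z. ennreal (norm (b z)) \<partial>lborel) \<le> ennreal B"
        "\<And>z. norm z powr L * norm (b z) \<le> B" and A: "0 \<le> A" and B: "0 \<le> B"
    show "norm (conv a b x) \<le> C * A * B * decay L x"
      unfolding conv_def
    proof (rule norm_integral_le_nn)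
      have "(\<integral>\<^sup>+z. ennreal (norm (a (x - z) * b z)) \<partial>lborel) \<le>
        (\<integral>\<^sup>+z. ennreal A * (ennreal (decay L (x - z)) * ennreal (norm (b z))) \<partial>lborel)"
        using a A by (intro nn_integral_mono)
          (simp add: norm_mult ennreal_mult[symmetric] mult.assoc[symmetric] mult_right_mono)
      also have "\<dots> = ennreal A * (\<integral>\<^sup>+z. ennreal (decay L (x - z)) * ennreal (norm (b z)) \<partial>lborel)"
        by (simp add: nn_integral_cmult)
      also have "\<dots> \<le> ennreal A * ennreal (C * B * decay L x)"
        using b B by (intro mult_left_mono *) (auto simp: ennreal_mult[symmetric])
      also have "\<dots> = ennreal (C * A * B * decay L x)"
        using A B C by (simp add: ennreal_mult[symmetric] mult_ac)
      finally show "(\<integral>\<^sup>+z. ennreal (norm (a (x - z) * b z)) \<partial>lborel) \<le> ennreal (C * A * B * decay L x)" .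
    qed (use A B C in auto)
  qed
qed

section \<open>Decay of the Bochner-Riesz kernel\<close>

text \<open>Translation invariance replaces the fundamental theorem of calculus: the difference
  quotients of \<open>f\<close> in direction \<open>v\<close> all have integral 0 and converge to
  \<open>D x v\<close>, while the mean value inequality and \<open>decay_shift\<close> provide an
  integrable majorant.\<close>

lemma integral_directional_derivative:
  fixes f :: "'a::euclidean_space \<Rightarrow> 'b::{banach, second_countable_topology}"
  assumes f: "integrable lborel f"
    and D: "\<And>x. (f has_derivative D x) (at x)"
    and s: "real DIM('a) < s"
    and bound: "\<And>x. norm (D x v) \<le> C * decay s x"
  shows "integrable lborel (\<lambda>x. D x v)" and "(\<integral>x. D x v \<partial>lborel) = 0"
proof -
  \<comment> \<open>The increments tend to 0 and are normalised so that
    \<open>h k *\<^sub>R v\<close> has norm at most 1, as \<open>decay_shift\<close>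
    requires.\<close>
  define h where "h k = 1 / (real (Suc k) * (1 + norm v))" for k
  have h: "0 < h k" for k by (simp add: h_def add_pos_nonneg)
  have hv: "norm (h k *\<^sub>R v) \<le> 1" for k
  proof -
    have "norm v \<le> 1 + norm v + (norm v * real k + real k)" by simp
    also have "\<dots> = real (Suc k) * (1 + norm v)" by (simp add: algebra_simps)
    finally show ?thesis using h[of k] by (simp add: h_def divide_le_eq add_pos_nonneg)
  qed
  have [measurable]: "f \<in> borel_measurable borel" using f by auto
  have C: "0 \<le> C" using bound[of 0] norm_ge_zero[of "D 0 v"] decay_pos[of s "0::'a"]
    by (smt (verit) mult_neg_pos)
  have line: "((\<lambda>\<tau>. f (x + \<tau> *\<^sub>R v)) has_vector_derivative D (x + \<tau> *\<^sub>R v) v) (at \<tau> within S)" for x \<tau> S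
  proof -
    have lin: "linear (D y)" for y using D[of y] has_derivative_linear by blast
    have "((\<lambda>\<tau>. f (x + \<tau> *\<^sub>R v)) has_derivative (\<lambda>d. D (x + \<tau> *\<^sub>R v) (d *\<^sub>R v))) (at \<tau> within S)"
      by (rule has_derivative_compose[OF _ D]) (auto intro!: derivative_eq_intros)
    then show ?thesis by (simp add: has_vector_derivative_def linear_scale[OF lin])
  qed
  define q where "q k x = (f (x + h k *\<^sub>R v) - f x) /\<^sub>R h k" for k x
  have q_lim: "(\<lambda>k. q k x) \<longlonglongrightarrow> D x v" for x
  proof -
    have "((\<lambda>\<tau>. (f (x + \<tau> *\<^sub>R v) - f x) /\<^sub>R \<tau>) \<longlongrightarrow> D x v) (at 0)"
      using line[of x 0 UNIV]
      unfolding has_vector_derivative_def has_derivative_at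
    proof -
      assume *: "bounded_linear (\<lambda>xa. xa *\<^sub>R D (x + 0 *\<^sub>R v) v) \<and>
        (\<lambda>h. norm (f (x + (0 + h) *\<^sub>R v) - f (x + 0 *\<^sub>R v) - h *\<^sub>R D (x + 0 *\<^sub>R v) v) / norm h) \<midarrow>0\<rightarrow> 0"
      then have "(\<lambda>h. norm (f (x + h *\<^sub>R v) - f x - h *\<^sub>R D x v) / norm h) \<midarrow>0\<rightarrow> 0" by simp
      then have "(\<lambda>h. norm ((f (x + h *\<^sub>R v) - f x) /\<^sub>R h - D x v)) \<midarrow>0\<rightarrow> 0"
      proof (rule Lim_transform_eventually)
        show "\<forall>\<^sub>F h in at 0. norm (f (x + h *\<^sub>R v) - f x - h *\<^sub>R D x v) / norm h =
            norm ((f (x + h *\<^sub>R v) - f x) /\<^sub>R h - D x v)"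
          unfolding eventually_at_filter
        proof (intro always_eventually allI impI)
          fix h :: real assume "h \<noteq> 0"
          then have "(f (x + h *\<^sub>R v) - f x) /\<^sub>R h - D x v = (f (x + h *\<^sub>R v) - f x - h *\<^sub>R D x v) /\<^sub>R h"
            by (simp add: scaleR_diff_right)
          then show "norm (f (x + h *\<^sub>R v) - f x - h *\<^sub>R D x v) / norm h =
            norm ((f (x + h *\<^sub>R v) - f x) /\<^sub>R h - D x v)" by (simp add: divide_inverse_commute)
        qed
      qed
      then show ?thesis by (simp add: tendsto_norm_zero_iff LIM_zero_iff)
    qed
    moreover have "filterlim h (at 0) sequentially"
      unfolding filterlim_at
    proof
      show "\<forall>\<^sub>F k in sequentially. h k \<in> UNIV \<and> h k \<noteq> 0" using h by (simp add: less_imp_neq[symmetric])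
      have "(\<lambda>k. (1 / real (Suc k)) * (1 / (1 + norm v))) \<longlonglongrightarrow> 0 * (1 / (1 + norm v))"
        using LIMSEQ_inverse_real_of_nat by (intro tendsto_intros) (simp add: divide_inverse)
      then show "h \<longlonglongrightarrow> 0" by (simp add: h_def[abs_def])
    qed
    ultimately show ?thesis unfolding q_def by (rule filterlim_compose)
  qed
  have q_bound: "norm (q k x) \<le> C * 2 powr s * decay s x" for k x
  proof -
    have "norm (f (x + h k *\<^sub>R v) - f (x + 0 *\<^sub>R v)) \<le> (C * 2 powr s * decay s x) * norm (h k - 0)"
    proof (rule differentiable_bound[where S="{0..h k}" and f="\<lambda>\<tau>. f (x + \<tau> *\<^sub>R v)" and f'="\<lambda>\<tau> d. d *\<^sub>R D (x + \<tau> *\<^sub>R v) v"])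
      fix \<tau> assume \<tau>: "\<tau> \<in> {0..h k}"
      show "((\<lambda>\<tau>. f (x + \<tau> *\<^sub>R v)) has_derivative (\<lambda>d. d *\<^sub>R D (x + \<tau> *\<^sub>R v) v)) (at \<tau> within {0..h k})"
        using line[of x \<tau> "{0..h k}"] by (simp add: has_vector_derivative_def)
      have "norm (\<tau> *\<^sub>R v) \<le> norm (h k *\<^sub>R v)" using \<tau> h[of k] by (simp add: mult_right_mono)
      then have "norm (\<tau> *\<^sub>R v) \<le> 1" using hv[of k] by linarith
      then have "decay s (x + \<tau> *\<^sub>R v) \<le> 2 powr s * decay s x"
        using s by (intro decay_shift) auto
      then have "norm (D (x + \<tau> *\<^sub>R v) v) \<le> C * (2 powr s * decay s x)"
        using bound[of "x + \<tau> *\<^sub>R v"] C by (meson mult_left_mono order_trans)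
      then show "onorm (\<lambda>d. d *\<^sub>R D (x + \<tau> *\<^sub>R v) v) \<le> C * 2 powr s * decay s x"
      proof (intro onorm_le)
        fix d :: real
        assume *: "norm (D (x + \<tau> *\<^sub>R v) v) \<le> C * (2 powr s * decay s x)"
        show "norm (d *\<^sub>R D (x + \<tau> *\<^sub>R v) v) \<le> C * 2 powr s * decay s x * norm d"
          using mult_left_mono[OF * abs_ge_zero[of d]] by (simp only: norm_scaleR real_norm_def mult_ac)
      qed
    qed (use h[of k] in auto)
    then show ?thesis using h[of k] by (simp add: q_def divide_le_eq divide_inverse_commute[symmetric])
  qed
  have qm: "q k \<in> borel_measurable lborel" for k
    unfolding q_def[abs_def] by measurable
  have Dm: "(\<lambda>x. D x v) \<in> borel_measurable lborel"
    by (rule borel_measurable_LIMSEQ_metric[OF qm q_lim])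
  have wi: "integrable lborel (\<lambda>x::'a. C * 2 powr s * decay s x)" using decay_integrable[OF s] by simp
  show "integrable lborel (\<lambda>x. D x v)"
    by (rule integrable_dominated_convergence[where s=q, OF Dm qm wi]) (simp_all add: q_lim q_bound)
  have "(\<lambda>k. \<integral>x. q k x \<partial>lborel) \<longlonglongrightarrow> (\<integral>x. D x v \<partial>lborel)"
    by (rule integral_dominated_convergence[where s=q, OF Dm qm wi]) (simp_all add: q_lim q_bound)
  moreover have "(\<integral>x. q k x \<partial>lborel) = 0" for k
  proof -
    have "integrable lborel (\<lambda>x. f (x + h k *\<^sub>R v))"
      using f integrable_shift[of f "h k *\<^sub>R v"] by (simp add: add.commute)
    moreover have "(\<integral>x. f (x + h k *\<^sub>R v) \<partial>lborel) = integral\<^sup>L lborel f"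
      using integral_shift[of f "h k *\<^sub>R v"] by (simp add: add.commute)
    ultimately show ?thesis using f by (simp add: q_def)
  qed
  ultimately show "(\<integral>x. D x v \<partial>lborel) = 0" by (simp add: LIMSEQ_const_iff)
qed

section \<open>The multiplier as a real weight, and its derivative\<close>

definition br_weight :: "real \<Rightarrow> 'a::euclidean_space \<Rightarrow> real" where
  "br_weight \<beta> \<xi> = max 0 (1 - (norm \<xi>)\<^sup>2) powr \<beta>"

lemma br_weight_measurable [measurable]: "br_weight \<beta> \<in> borel_measurable borel"
  unfolding br_weight_def[abs_def] by measurable

lemma br_weight_nonneg [simp]: "0 \<le> br_weight \<beta> \<xi>" by (simp add: br_weight_def)

lemma br_weight_outside: "1 \<le> norm \<xi> \<Longrightarrow> br_weight \<beta> \<xi> = 0"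
  using one_le_power[of "norm \<xi>" 2] unfolding br_weight_def max_def by (auto dest: order_antisym)

lemma br_weight_le_1: "0 \<le> \<beta> \<Longrightarrow> br_weight \<beta> \<xi> \<le> 1"
  unfolding br_weight_def by (intro powr_le1) auto

lemma br_weight_minus [simp]: "br_weight \<beta> (- \<xi>) = br_weight \<beta> \<xi>" by (simp add: br_weight_def)

lemma br_weight_Suc: "br_weight (\<beta> + 1) \<xi> = (1 - (norm \<xi>)\<^sup>2) * br_weight \<beta> \<xi>"
  by (cases "(norm \<xi>)\<^sup>2 < 1") (auto simp: br_weight_def powr_add max_def)

lemma br_weight_le_decay:
  fixes \<xi> :: "'a::euclidean_space"
  assumes "0 \<le> \<beta>" "0 \<le> s"
  shows "br_weight \<beta> \<xi> \<le> 2 powr s * decay s \<xi>"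
proof (cases "norm \<xi> \<le> 1")
  case True
  have "1 \<le> 2 powr s * decay s \<xi>"
    using decay_shift[of s "-\<xi>" \<xi>] True assms by (simp add: decay_def)
  then show ?thesis using br_weight_le_1[OF assms(1), of \<xi>] by linarith
qed (simp add: br_weight_outside)

lemma integrable_br_weight_bound:
  fixes f :: "'a::euclidean_space \<Rightarrow> 'b::{banach, second_countable_topology}"
  assumes "f \<in> borel_measurable borel" "0 \<le> \<beta>" "\<And>\<xi>. norm (f \<xi>) \<le> C * br_weight \<beta> \<xi>" "0 \<le> C"
  shows "integrable lborel f"
proof (rule integrable_decay_bound[where s="real DIM('a) + 1" and C="C * 2 powr (real DIM('a) + 1)"])
  show "norm (f \<xi>) \<le> C * 2 powr (real DIM('a) + 1) * decay (real DIM('a) + 1) \<xi>" for \<xi>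
    using assms(3)[of \<xi>] mult_left_mono[OF br_weight_le_decay[OF assms(2), of "real DIM('a) + 1" \<xi>] assms(4)]
    by (simp add: mult.assoc)
qed (use assms in auto)

text \<open>The critical point is \<open>y = 0\<close>, where the difference quotient is at most
  \<open>\<bar>h\<bar> powr \<beta>\<close> and tends to 0 because \<open>0 < \<beta>\<close>. Hence
  the identities below differentiate the weight of order \<open>\<beta> + 1\<close>, whose
  derivative across the unit sphere involves only the one of order \<open>\<beta>\<close>.\<close>

lemma max_powr_deriv:
  assumes "0 < \<beta>"
  shows "((\<lambda>y. max 0 y powr (\<beta> + 1)) has_real_derivative (\<beta> + 1) * max 0 y powr \<beta>) (at y)"
proof -
  consider "y > 0" | "y < 0" | "y = 0" by linarith
  then show ?thesis
  proof cases
    case 1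
    have "((\<lambda>y. y powr (\<beta> + 1)) has_real_derivative (\<beta> + 1) * max 0 y powr \<beta>) (at y)"
      using has_real_derivative_powr[OF 1, of "\<beta> + 1"] 1 by simp
    then show ?thesis
      by (rule has_field_derivative_transform_within[where d=y]) (use 1 in \<open>auto simp: dist_real_def\<close>)
  next
    case 2
    have "((\<lambda>y. 0) has_real_derivative (\<beta> + 1) * max 0 y powr \<beta>) (at y)"
      using 2 by (auto intro!: derivative_eq_intros)
    then show ?thesis
      by (rule has_field_derivative_transform_within[where d="-y"]) (use 2 in \<open>auto simp: dist_real_def max_def\<close>)
  next
    case 3
    have "(\<lambda>h. max 0 h powr (\<beta> + 1) / h) \<midarrow>0\<rightarrow> (0::real)"
    proof (rule Lim_null_comparison)
      show "\<forall>\<^sub>F h in at 0. norm (max 0 h powr (\<beta> + 1) / h) \<le> \<bar>h\<bar> powr \<beta>"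
        by (rule always_eventually) (auto simp: max_def powr_add)
      show "(\<lambda>h::real. \<bar>h\<bar> powr \<beta>) \<midarrow>0\<rightarrow> 0"
        using tendsto_powr2[OF tendsto_rabs[OF tendsto_ident_at[of "0::real" UNIV]] tendsto_const[of \<beta>]] assms by simp
    qed
    then show ?thesis using 3 assms by (simp add: DERIV_def)
  qed
qed

lemma br_weight_deriv:
  assumes "0 < \<beta>"
  shows "(br_weight (\<beta> + 1) has_derivative (\<lambda>v. - 2 * (\<beta> + 1) * br_weight \<beta> \<xi> * (\<xi> \<bullet> v))) (at \<xi>)"
proof -
  have "((\<lambda>\<xi>. 1 - (norm \<xi>)\<^sup>2) has_derivative (\<lambda>v. - (2 * (\<xi> \<bullet> v)))) (at \<xi>)"
    unfolding power2_norm_eq_inner by (auto intro!: derivative_eq_intros simp: inner_commute)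
  from has_derivative_compose[OF this max_powr_deriv[OF assms, unfolded has_field_derivative_def]]
  show ?thesis unfolding br_weight_def[abs_def] by (rule has_derivative_eq_rhs) (simp add: fun_eq_iff algebra_simps)
qed

lemma inner_br_weight_le:
  assumes "norm u \<le> 1"
  shows "\<bar>u \<bullet> \<xi>\<bar> * br_weight \<beta> \<xi> \<le> br_weight \<beta> \<xi>"
proof (cases "norm \<xi> \<le> 1")
  case True
  have "\<bar>u \<bullet> \<xi>\<bar> \<le> norm u * norm \<xi>" by (rule Cauchy_Schwarz_ineq2)
  also have "\<dots> \<le> 1" using assms True by (intro mult_le_one) auto
  finally show ?thesis by (simp add: mult_left_le_one_le)
qed (simp add: br_weight_outside)

section \<open>Trigonometric integrals depending on a parameter\<close>

lemma
  fixes a h :: real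
  shows cos_linearization: "\<bar>cos (a + h) - cos a + h * sin a\<bar> \<le> h\<^sup>2"
  and sin_linearization: "\<bar>sin (a + h) - sin a - h * cos a\<bar> \<le> h\<^sup>2"
proof -
  have lip: "\<bar>sin x - sin y\<bar> \<le> \<bar>x - y\<bar>" "\<bar>cos x - cos y\<bar> \<le> \<bar>x - y\<bar>" for x y :: real
  proof -
    have "norm (sin x - sin y) \<le> 1 * norm (x - y)"
      by (rule field_differentiable_bound[of UNIV _ cos]) (auto intro!: derivative_eq_intros)
    then show "\<bar>sin x - sin y\<bar> \<le> \<bar>x - y\<bar>" by simp
    have "norm (cos x - cos y) \<le> 1 * norm (x - y)"
      by (rule field_differentiable_bound[of UNIV _ "\<lambda>x. - sin x"]) (auto intro!: derivative_eq_intros)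
    then show "\<bar>cos x - cos y\<bar> \<le> \<bar>x - y\<bar>" by simp
  qed
  have seg: "x \<in> closed_segment a (a + h) \<Longrightarrow> \<bar>x - a\<bar> \<le> \<bar>h\<bar>" for x
    by (auto simp: closed_segment_eq_real_ivl split: if_splits)
  have "norm (cos (a + h) - cos a - ((a + h) - a) *\<^sub>R (- sin a)) \<le> norm ((a + h) - a) * \<bar>h\<bar>"
  proof (rule vector_differentiable_bound_linearization[where S="closed_segment a (a + h)" and ?x0.0=a and f'="\<lambda>x. - sin x"])
    fix x assume x: "x \<in> closed_segment a (a + h)"
    show "(cos has_vector_derivative - sin x) (at x within closed_segment a (a + h))"
      by (auto intro!: derivative_eq_intros simp: has_real_derivative_iff_has_vector_derivative[symmetric])
    show "norm (- sin x - - sin a) \<le> \<bar>h\<bar>" using lip(1)[of a x] seg[OF x] by auto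
  qed auto
  then show "\<bar>cos (a + h) - cos a + h * sin a\<bar> \<le> h\<^sup>2" by (simp add: power2_eq_square)
  have "norm (sin (a + h) - sin a - ((a + h) - a) *\<^sub>R (cos a)) \<le> norm ((a + h) - a) * \<bar>h\<bar>"
  proof (rule vector_differentiable_bound_linearization[where S="closed_segment a (a + h)" and ?x0.0=a and f'=cos])
    fix x assume x: "x \<in> closed_segment a (a + h)"
    show "(sin has_vector_derivative cos x) (at x within closed_segment a (a + h))"
      by (auto intro!: derivative_eq_intros simp: has_real_derivative_iff_has_vector_derivative[symmetric])
    show "norm (cos x - cos a) \<le> \<bar>h\<bar>" using lip(2)[of a x] seg[OF x] by auto
  qed auto
  then show "\<bar>sin (a + h) - sin a - h * cos a\<bar> \<le> h\<^sup>2" by (simp add: power2_eq_square)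
qed

text \<open>The quadratic remainder of \<open>\<phi>\<close>, integrated against \<open>w\<close>,
  gives the explicit error \<open>h\<^sup>2 * W\<close>, so no limit theorem for integrals is called
  for. The function \<open>\<phi>\<close> is abstract because the lemma serves first for
  \<open>cos\<close> and then for \<open>- sin\<close>, giving two derivatives of the radial
  profile.\<close>

lemma integral_param_deriv:
  fixes w c :: "'a \<Rightarrow> real" and \<phi> \<phi>' :: "real \<Rightarrow> real"
  assumes lin: "\<And>a h. \<bar>\<phi> (a + h) - \<phi> a - h * \<phi>' a\<bar> \<le> h\<^sup>2"
    and 1: "\<And>r. integrable M (\<lambda>\<xi>. w \<xi> * \<phi> (r * c \<xi>))"
    and 2: "\<And>r. integrable M (\<lambda>\<xi>. w \<xi> * c \<xi> * \<phi>' (r * c \<xi>))"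
    and 3: "integrable M (\<lambda>\<xi>. \<bar>w \<xi>\<bar> * (c \<xi>)\<^sup>2)"
  shows "((\<lambda>r. \<integral>\<xi>. w \<xi> * \<phi> (r * c \<xi>) \<partial>M) has_real_derivative (\<integral>\<xi>. w \<xi> * c \<xi> * \<phi>' (r * c \<xi>) \<partial>M)) (at r)"
proof -
  define I where "I r = (\<integral>\<xi>. w \<xi> * \<phi> (r * c \<xi>) \<partial>M)" for r
  define I' where "I' r = (\<integral>\<xi>. w \<xi> * c \<xi> * \<phi>' (r * c \<xi>) \<partial>M)" for r
  define W where "W = (\<integral>\<xi>. \<bar>w \<xi>\<bar> * (c \<xi>)\<^sup>2 \<partial>M)"
  have est: "\<bar>I (r + h) - I r - h * I' r\<bar> \<le> h\<^sup>2 * W" for h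
  proof -
    have "I (r + h) - I r - h * I' r = (\<integral>\<xi>. w \<xi> * \<phi> ((r + h) * c \<xi>) - w \<xi> * \<phi> (r * c \<xi>) - h * (w \<xi> * c \<xi> * \<phi>' (r * c \<xi>)) \<partial>M)"
      unfolding I_def I'_def using 1 2 by simp
    also have "\<bar>\<dots>\<bar> \<le> (\<integral>\<xi>. h\<^sup>2 * (\<bar>w \<xi>\<bar> * (c \<xi>)\<^sup>2) \<partial>M)"
    proof (rule integral_abs_bound[THEN order_trans], rule integral_mono)
      fix \<xi>
      have "\<bar>w \<xi>\<bar> * \<bar>\<phi> (r * c \<xi> + h * c \<xi>) - \<phi> (r * c \<xi>) - (h * c \<xi>) * \<phi>' (r * c \<xi>)\<bar> \<le> \<bar>w \<xi>\<bar> * (h * c \<xi>)\<^sup>2"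
        by (intro mult_left_mono lin) auto
      moreover have "w \<xi> * \<phi> ((r + h) * c \<xi>) - w \<xi> * \<phi> (r * c \<xi>) - h * (w \<xi> * c \<xi> * \<phi>' (r * c \<xi>)) =
          w \<xi> * (\<phi> (r * c \<xi> + h * c \<xi>) - \<phi> (r * c \<xi>) - (h * c \<xi>) * \<phi>' (r * c \<xi>))"
        by (simp only: distrib_right) (simp only: right_diff_distrib mult_ac)
      ultimately show "\<bar>w \<xi> * \<phi> ((r + h) * c \<xi>) - w \<xi> * \<phi> (r * c \<xi>) - h * (w \<xi> * c \<xi> * \<phi>' (r * c \<xi>))\<bar> \<le> h\<^sup>2 * (\<bar>w \<xi>\<bar> * (c \<xi>)\<^sup>2)"
        by (simp only: abs_mult power_mult_distrib mult_ac)
    qed (use 1 2 3 in \<open>auto intro!: Bochner_Integration.integrable_diff\<close>)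
    finally show ?thesis by (simp add: W_def)
  qed
  have "(\<lambda>h. (I (r + h) - I r) / h - I' r) \<midarrow>0\<rightarrow> 0"
  proof (rule Lim_null_comparison)
    show "\<forall>\<^sub>F h in at 0. norm ((I (r + h) - I r) / h - I' r) \<le> \<bar>h\<bar> * W"
      unfolding eventually_at_filter
    proof (intro always_eventually allI impI)
      fix h :: real assume h: "h \<noteq> 0"
      then have "norm ((I (r + h) - I r) / h - I' r) = \<bar>I (r + h) - I r - h * I' r\<bar> / \<bar>h\<bar>"
        by (simp add: diff_divide_distrib flip: abs_divide)
      also have "\<dots> \<le> h\<^sup>2 * W / \<bar>h\<bar>" using est[of h] by (intro divide_right_mono) auto
      also have "\<dots> = \<bar>h\<bar> * W" using h by (simp add: power2_eq_square abs_if)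
      finally show "norm ((I (r + h) - I r) / h - I' r) \<le> \<bar>h\<bar> * W" .
    qed
    have "(\<lambda>h::real. \<bar>h\<bar> * W) \<midarrow>0\<rightarrow> \<bar>0\<bar> * W" by (intro tendsto_intros)
    then show "(\<lambda>h::real. \<bar>h\<bar> * W) \<midarrow>0\<rightarrow> 0" by simp
  qed
  then show ?thesis unfolding I_def[symmetric] I'_def[symmetric] DERIV_def by (simp add: LIM_zero_iff)
qed

text \<open>
  The substitution \<open>w = r powr a * k\<close> removes the first order term of the Bessel-type equation,
  and the energy \<open>w'\<^sup>2 + 4 * pi\<^sup>2 * w\<^sup>2\<close> then grows at most by a bounded factor.
\<close>

lemma bessel_type_decay:
  fixes k k' k'' :: "real \<Rightarrow> real"
  assumes k: "\<And>r. 0 < r \<Longrightarrow> (k has_real_derivative k' r) (at r)"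
    and k': "\<And>r. 0 < r \<Longrightarrow> (k' has_real_derivative k'' r) (at r)"
    and ode: "\<And>r. 0 < r \<Longrightarrow> k'' r = - (2 * a / r) * k' r - 4 * pi\<^sup>2 * k r"
    and r: "1 \<le> r"
  shows "(r powr a * k r)\<^sup>2 \<le> ((k' 1 + a * k 1)\<^sup>2 + 4 * pi\<^sup>2 * (k 1)\<^sup>2) * exp \<bar>a * (a - 1)\<bar>"
proof -
  define w where "w r = r powr a * k r" for r
  define w' where "w' r = r powr a * k' r + a * r powr (a - 1) * k r" for r
  define c where "c = \<bar>a * (a - 1)\<bar>"
  define E where "E r = (w' r)\<^sup>2 + 4 * pi\<^sup>2 * (w r)\<^sup>2" for r
  have dw: "(w has_real_derivative w' r) (at r)" if "0 < r" for r
    unfolding w_def[abs_def] w'_def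
    by (rule DERIV_cong[OF DERIV_mult[OF has_real_derivative_powr[OF that] k[OF that]]]) (simp add: algebra_simps)
  \<comment> \<open>The power \<open>r powr a\<close> is chosen so that the first order terms
    cancel; only the potential \<open>a * (a - 1) / r\<^sup>2\<close> perturbs a harmonic oscillator
    of frequency \<open>2 * pi\<close>.\<close>
  have dw': "(w' has_real_derivative (a * (a - 1) / r\<^sup>2 - 4 * pi\<^sup>2) * w r) (at r)" if "0 < r" for r
  proof -
    have p1: "r powr (a - 1) = r powr a / r" and p2: "r powr (a - 2) = r powr a / r\<^sup>2"
      using that by (simp_all add: powr_diff)
    have "(w' has_real_derivative (a * r powr (a - 1) * k' r + r powr a * k'' r +
        (a * ((a - 1) * r powr (a - 2)) * k r + a * r powr (a - 1) * k' r))) (at r)"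
      unfolding w'_def[abs_def]
      by (rule DERIV_cong[OF DERIV_add[OF DERIV_mult[OF has_real_derivative_powr[OF that] k'[OF that]]
            DERIV_mult[OF DERIV_cmult[OF has_real_derivative_powr[OF that]] k[OF that]]]])
         (simp add: algebra_simps)
    also have "a * r powr (a - 1) * k' r + r powr a * k'' r +
        (a * ((a - 1) * r powr (a - 2)) * k r + a * r powr (a - 1) * k' r) = (a * (a - 1) / r\<^sup>2 - 4 * pi\<^sup>2) * w r"
      using that unfolding ode[OF that] p1 p2 w_def
      by (simp add: distrib_left distrib_right left_diff_distrib right_diff_distrib divide_inverse power2_eq_square mult_ac)
    finally show ?thesis .
  qed
  \<comment> \<open>In the derivative of the energy the oscillator terms cancel and
    \<open>2 * w * w' * a * (a - 1) / r\<^sup>2\<close> remains, at most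
    \<open>c * E / r\<^sup>2\<close> in modulus. Since \<open>exp (c / r)\<close> has logarithmic
    derivative \<open>- c / r\<^sup>2\<close>, the product cannot increase.\<close>
  have "E r * exp (c / r) \<le> E 1 * exp (c / 1)"
  proof (rule DERIV_nonpos_imp_nonincreasing[OF r])
    fix x assume x: "1 \<le> x" "x \<le> r"
    then have x0: "0 < x" by simp
    let ?d = "exp (c / x) * ((2 * w x * w' x * (a * (a - 1)) - c * E x) / x\<^sup>2)"
    have "((\<lambda>r. E r * exp (c / r)) has_real_derivative ?d) (at x)"
    proof -
      have e1: "((\<lambda>r. exp (c / r)) has_real_derivative exp (c / x) * (- c / x\<^sup>2)) (at x)"
        using x0 by (auto intro!: derivative_eq_intros simp: power2_eq_square)
      have e2: "(E has_real_derivative 2 * w' x * ((a * (a - 1) / x\<^sup>2 - 4 * pi\<^sup>2) * w x) + 4 * pi\<^sup>2 * (2 * w x * w' x)) (at x)"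
        unfolding E_def[abs_def]
        by (rule DERIV_cong[OF DERIV_add[OF DERIV_power[OF dw'[OF x0]] DERIV_cmult[OF DERIV_power[OF dw[OF x0]]]]]) simp
      show ?thesis
        by (rule DERIV_cong[OF DERIV_mult[OF e2 e1]])
          (simp only: diff_divide_distrib left_diff_distrib right_diff_distrib distrib_left distrib_right, simp add: divide_inverse mult_ac)
    qed
    moreover have "?d \<le> 0"
    proof -
      have "\<bar>2 * w x * w' x\<bar> \<le> (w' x)\<^sup>2 + (w x)\<^sup>2"
        using sum_squares_bound[of "\<bar>w x\<bar>" "\<bar>w' x\<bar>"] by (simp add: abs_mult)
      also have "\<dots> \<le> E x"
      proof -
        have "1 \<le> pi\<^sup>2" using pi_ge_two by (simp add: one_le_power)
        then have "1 * (w x)\<^sup>2 \<le> 4 * pi\<^sup>2 * (w x)\<^sup>2" by (intro mult_right_mono) auto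
        then show ?thesis by (simp add: E_def)
      qed
      finally have "\<bar>2 * w x * w' x\<bar> * c \<le> E x * c" by (intro mult_right_mono) (auto simp: c_def)
      then have "\<bar>2 * w x * w' x * (a * (a - 1))\<bar> \<le> c * E x" by (simp only: c_def abs_mult mult_ac)
      then have "2 * w x * w' x * (a * (a - 1)) - c * E x \<le> 0" by linarith
      then show ?thesis by (intro mult_nonneg_nonpos divide_nonpos_nonneg) auto
    qed
    ultimately show "\<exists>y. ((\<lambda>r. E r * exp (c / r)) has_real_derivative y) (at x) \<and> y \<le> 0" by blast
  qed
  moreover have "(w r)\<^sup>2 * 1 \<le> E r * exp (c / r)"
  proof (rule mult_mono)
    have "1 \<le> pi\<^sup>2" using pi_ge_two by (simp add: one_le_power)
    then have "1 * (w r)\<^sup>2 \<le> 4 * pi\<^sup>2 * (w r)\<^sup>2" by (intro mult_right_mono) auto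
    then show "(w r)\<^sup>2 \<le> E r" using zero_le_power2[of "w' r"] unfolding E_def by linarith
    show "1 \<le> exp (c / r)" using r by (simp add: c_def)
  qed (auto simp: E_def)
  ultimately show ?thesis by (simp add: E_def w_def w'_def c_def)
qed

section \<open>The radial profile of the kernel and its differential equation\<close>

lemma br_weight_Suc_le: "br_weight (\<beta> + 1) \<xi> \<le> br_weight \<beta> \<xi>"
proof (cases "norm \<xi> \<le> 1")
  case True
  then have "(norm \<xi>)\<^sup>2 \<le> 1" by (simp add: power_le_one)
  then show ?thesis unfolding br_weight_Suc by (intro mult_left_le_one_le) auto
qed (simp add: br_weight_outside)

lemma inner2_br_weight_le:
  assumes "norm u \<le> 1"
  shows "(u \<bullet> \<xi>)\<^sup>2 * br_weight \<beta> \<xi> \<le> br_weight \<beta> \<xi>"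
proof -
  have "\<bar>u \<bullet> \<xi>\<bar> * (\<bar>u \<bullet> \<xi>\<bar> * br_weight \<beta> \<xi>) \<le> \<bar>u \<bullet> \<xi>\<bar> * br_weight \<beta> \<xi>"
    using inner_br_weight_le[OF assms] by (intro mult_left_mono) auto
  also have "\<dots> \<le> br_weight \<beta> \<xi>" by (rule inner_br_weight_le[OF assms])
  finally show ?thesis by (simp add: power2_eq_square mult.assoc[symmetric] abs_mult_self_eq)
qed

text \<open>The last two identities state that the derivatives of
  \<open>(u \<bullet> \<xi>) * b1 \<xi> * cos\<close> along \<open>u\<close> and of
  \<open>b1 \<xi> * sin\<close> along \<open>e\<close> have integral 0, where the derivative of
  \<open>b1\<close> along \<open>v\<close> is
  \<open>- 2 * (\<beta> + 1) * b \<xi> * (\<xi> \<bullet> v)\<close>. They are the raw relations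
  behind the Bessel-type equation, obtained without polar coordinates or Bessel functions.\<close>

lemma br_weight_ibp:
  fixes e u :: "'a::euclidean_space"
  assumes \<beta>: "0 < \<beta>" and u: "norm u = 1" and e: "norm e = 1"
  defines "b \<equiv> br_weight \<beta>" and "b1 \<equiv> br_weight (\<beta> + 1)"
  shows "integrable lborel (\<lambda>\<xi>. b1 \<xi> * cos (r * (2 * pi * (e \<bullet> \<xi>))))"
    and "integrable lborel (\<lambda>\<xi>. (u \<bullet> \<xi>)\<^sup>2 * b \<xi> * cos (r * (2 * pi * (e \<bullet> \<xi>))))"
    and "integrable lborel (\<lambda>\<xi>. (u \<bullet> \<xi>) * b1 \<xi> * sin (r * (2 * pi * (e \<bullet> \<xi>))))"
    and "integrable lborel (\<lambda>\<xi>. (u \<bullet> \<xi>) * b \<xi> * sin (r * (2 * pi * (e \<bullet> \<xi>))))"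
    and "(\<integral>\<xi>. b1 \<xi> * cos (r * (2 * pi * (e \<bullet> \<xi>))) \<partial>lborel)
       - 2 * (\<beta> + 1) * (\<integral>\<xi>. (u \<bullet> \<xi>)\<^sup>2 * b \<xi> * cos (r * (2 * pi * (e \<bullet> \<xi>))) \<partial>lborel)
       - 2 * pi * r * (e \<bullet> u) * (\<integral>\<xi>. (u \<bullet> \<xi>) * b1 \<xi> * sin (r * (2 * pi * (e \<bullet> \<xi>))) \<partial>lborel) = 0"
    and "2 * pi * r * (\<integral>\<xi>. b1 \<xi> * cos (r * (2 * pi * (e \<bullet> \<xi>))) \<partial>lborel) =
       2 * (\<beta> + 1) * (\<integral>\<xi>. (e \<bullet> \<xi>) * b \<xi> * sin (r * (2 * pi * (e \<bullet> \<xi>))) \<partial>lborel)"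
proof -
  define \<theta> where "\<theta> \<xi> = r * (2 * pi * (e \<bullet> \<xi>))" for \<xi>
  have [measurable]: "\<theta> \<in> borel_measurable borel" unfolding \<theta>_def[abs_def] by measurable
  have [measurable]: "b \<in> borel_measurable borel" "b1 \<in> borel_measurable borel" by (simp_all add: b_def b1_def)
  have b0: "0 \<le> b \<xi>" "0 \<le> b1 \<xi>" and b1: "b1 \<xi> \<le> b \<xi>" for \<xi>
    by (auto simp: b_def b1_def br_weight_Suc_le)
  have bd1: "\<bar>x * c\<bar> \<le> B" if "\<bar>x\<bar> \<le> B" "\<bar>c\<bar> \<le> 1" for x c B :: real
    using mult_mono[OF that] that by (simp add: abs_mult)
  have trig: "\<bar>cos y\<bar> \<le> 1" "\<bar>sin y\<bar> \<le> 1" for y :: real by simp_all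
  have ub: "\<bar>(v \<bullet> \<xi>)\<^sup>2 * b \<xi>\<bar> \<le> b \<xi>" "\<bar>(v \<bullet> \<xi>) * b \<xi>\<bar> \<le> b \<xi>" "\<bar>(v \<bullet> \<xi>) * b1 \<xi>\<bar> \<le> b \<xi>"
    if "norm v = 1" for v \<xi>
  proof -
    show "\<bar>(v \<bullet> \<xi>)\<^sup>2 * b \<xi>\<bar> \<le> b \<xi>" "\<bar>(v \<bullet> \<xi>) * b \<xi>\<bar> \<le> b \<xi>"
      using inner2_br_weight_le[of v \<xi> \<beta>] inner_br_weight_le[of v \<xi> \<beta>] that b0
      by (simp_all add: abs_mult b_def)
    have "\<bar>(v \<bullet> \<xi>) * b1 \<xi>\<bar> \<le> b1 \<xi>"
      using inner_br_weight_le[of v \<xi> "\<beta> + 1"] that b0 by (simp add: abs_mult b1_def)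
    with b1 show "\<bar>(v \<bullet> \<xi>) * b1 \<xi>\<bar> \<le> b \<xi>" by (rule order_trans[rotated])
  qed
  have int: "integrable lborel f" if "f \<in> borel_measurable borel" "\<And>\<xi>. \<bar>f \<xi>\<bar> \<le> b \<xi>" for f :: "'a \<Rightarrow> real"
    by (rule integrable_br_weight_bound[where \<beta>=\<beta> and C=1]) (use that \<beta> in \<open>auto simp: b_def\<close>)
  have i1: "integrable lborel (\<lambda>\<xi>. b1 \<xi> * cos (\<theta> \<xi>))"
    using b0 b1 by (intro int bd1 trig) auto
  have i2: "integrable lborel (\<lambda>\<xi>. (u \<bullet> \<xi>)\<^sup>2 * b \<xi> * cos (\<theta> \<xi>))"
    by (intro int bd1 trig ub u) auto
  have i3: "integrable lborel (\<lambda>\<xi>. (u \<bullet> \<xi>) * b1 \<xi> * sin (\<theta> \<xi>))"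
    by (intro int bd1 trig ub u) auto
  have i4: "integrable lborel (\<lambda>\<xi>. (v \<bullet> \<xi>) * b \<xi> * sin (\<theta> \<xi>))" if "norm v = 1" for v
    by (intro int bd1 trig ub that) auto
  show "integrable lborel (\<lambda>\<xi>. b1 \<xi> * cos (r * (2 * pi * (e \<bullet> \<xi>))))"
    "integrable lborel (\<lambda>\<xi>. (u \<bullet> \<xi>)\<^sup>2 * b \<xi> * cos (r * (2 * pi * (e \<bullet> \<xi>))))"
    "integrable lborel (\<lambda>\<xi>. (u \<bullet> \<xi>) * b1 \<xi> * sin (r * (2 * pi * (e \<bullet> \<xi>))))"
    "integrable lborel (\<lambda>\<xi>. (u \<bullet> \<xi>) * b \<xi> * sin (r * (2 * pi * (e \<bullet> \<xi>))))"
    using i1 i2 i3 i4[OF u] by (simp_all only: \<theta>_def)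
  define s where "s = real DIM('a) + 1"
  have s: "real DIM('a) < s" "0 \<le> s" by (auto simp: s_def)
  have b_decay: "b \<xi> \<le> 2 powr s * decay s \<xi>" for \<xi> unfolding b_def using \<beta> s by (intro br_weight_le_decay) auto
  have uu: "u \<bullet> u = 1" "e \<bullet> e = 1" using u e by (simp_all add: norm_eq_1)
  have eu: "\<bar>e \<bullet> u\<bar> \<le> 1" using Cauchy_Schwarz_ineq2[of e u] u e by simp
  have d\<theta>: "(\<theta> has_derivative (\<lambda>v. r * (2 * pi * (e \<bullet> v)))) (at \<xi>)" for \<xi>
    unfolding \<theta>_def[abs_def] by (auto intro!: derivative_eq_intros)
  have db1: "(b1 has_derivative (\<lambda>v. - 2 * (\<beta> + 1) * b \<xi> * (\<xi> \<bullet> v))) (at \<xi>)" for \<xi>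
    unfolding b_def b1_def by (rule br_weight_deriv[OF \<beta>])
  have du: "((\<lambda>\<xi>. u \<bullet> \<xi>) has_derivative (\<lambda>v. u \<bullet> v)) (at \<xi>)" for \<xi>
    by (auto intro!: derivative_eq_intros)
  have dcos: "((\<lambda>\<xi>. cos (\<theta> \<xi>)) has_derivative (\<lambda>v. - sin (\<theta> \<xi>) * (r * (2 * pi * (e \<bullet> v))))) (at \<xi>)" for \<xi>
    by (rule has_derivative_eq_rhs[OF has_derivative_compose[OF d\<theta> DERIV_cos[unfolded has_field_derivative_def]]]) simp
  have dsin: "((\<lambda>\<xi>. sin (\<theta> \<xi>)) has_derivative (\<lambda>v. cos (\<theta> \<xi>) * (r * (2 * pi * (e \<bullet> v))))) (at \<xi>)" for \<xi>
    by (rule has_derivative_eq_rhs[OF has_derivative_compose[OF d\<theta> DERIV_sin[unfolded has_field_derivative_def]]]) simp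
  let ?C = "(1 + 2 * (\<beta> + 1) + \<bar>2 * pi * r\<bar>) * 2 powr s"
  have "(\<integral>\<xi>. b1 \<xi> * cos (\<theta> \<xi>) - 2 * (\<beta> + 1) * ((u \<bullet> \<xi>)\<^sup>2 * b \<xi> * cos (\<theta> \<xi>))
      - 2 * pi * r * (e \<bullet> u) * ((u \<bullet> \<xi>) * b1 \<xi> * sin (\<theta> \<xi>)) \<partial>lborel) = 0"
  proof -
    define D where "D \<xi> v = (u \<bullet> \<xi>) * (b1 \<xi> * (- sin (\<theta> \<xi>) * (r * (2 * pi * (e \<bullet> v)))) +
       (- 2 * (\<beta> + 1) * b \<xi> * (\<xi> \<bullet> v)) * cos (\<theta> \<xi>)) + (u \<bullet> v) * (b1 \<xi> * cos (\<theta> \<xi>))" for \<xi> v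
    have Deq: "D \<xi> u = b1 \<xi> * cos (\<theta> \<xi>) - 2 * (\<beta> + 1) * ((u \<bullet> \<xi>)\<^sup>2 * b \<xi> * cos (\<theta> \<xi>))
      - 2 * pi * r * (e \<bullet> u) * ((u \<bullet> \<xi>) * b1 \<xi> * sin (\<theta> \<xi>))" for \<xi>
      using uu by (simp add: D_def algebra_simps power2_eq_square inner_commute[of \<xi> u])
    have "(\<integral>\<xi>. D \<xi> u \<partial>lborel) = 0"
    proof (rule integral_directional_derivative(2)[where f="\<lambda>\<xi>. (u \<bullet> \<xi>) * (b1 \<xi> * cos (\<theta> \<xi>))", OF _ _ s(1)])
      show "((\<lambda>\<xi>. (u \<bullet> \<xi>) * (b1 \<xi> * cos (\<theta> \<xi>))) has_derivative D \<xi>) (at \<xi>)" for \<xi>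
        unfolding D_def[abs_def] by (intro has_derivative_mult du db1 dcos)
      show "integrable lborel (\<lambda>\<xi>. (u \<bullet> \<xi>) * (b1 \<xi> * cos (\<theta> \<xi>)))"
        by (rule int) (auto simp: mult.assoc[symmetric] intro!: bd1 ub u)
      fix \<xi>
      have "\<bar>b1 \<xi> * cos (\<theta> \<xi>)\<bar> \<le> b \<xi>" using b0 b1 by (intro bd1 trig) auto
      moreover have "\<bar>2 * (\<beta> + 1) * ((u \<bullet> \<xi>)\<^sup>2 * b \<xi> * cos (\<theta> \<xi>))\<bar> \<le> 2 * (\<beta> + 1) * b \<xi>"
        unfolding abs_mult[of "2 * (\<beta> + 1)"] using \<beta> by (intro mult_mono bd1[OF ub(1)[OF u]] trig) auto
      moreover have "\<bar>2 * pi * r * (e \<bullet> u) * ((u \<bullet> \<xi>) * b1 \<xi> * sin (\<theta> \<xi>))\<bar> \<le> \<bar>2 * pi * r\<bar> * b \<xi>"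
        unfolding abs_mult[of "2 * pi * r * (e \<bullet> u)"]
      proof (rule mult_mono)
        show "\<bar>2 * pi * r * (e \<bullet> u)\<bar> \<le> \<bar>2 * pi * r\<bar>" by (rule bd1[OF order_refl eu])
      qed (auto intro!: bd1[OF ub(3)[OF u]])
      ultimately have "\<bar>D \<xi> u\<bar> \<le> b \<xi> + 2 * (\<beta> + 1) * b \<xi> + \<bar>2 * pi * r\<bar> * b \<xi>"
        unfolding Deq by linarith
      also have "\<dots> = (1 + 2 * (\<beta> + 1) + \<bar>2 * pi * r\<bar>) * b \<xi>" by (simp add: distrib_right)
      also have "\<dots> \<le> (1 + 2 * (\<beta> + 1) + \<bar>2 * pi * r\<bar>) * (2 powr s * decay s \<xi>)"
        using \<beta> by (intro mult_left_mono b_decay) auto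
      finally show "norm (D \<xi> u) \<le> ?C * decay s \<xi>" by (simp add: mult.assoc)
    qed
    then show ?thesis by (simp only: Deq)
  qed
  then show "(\<integral>\<xi>. b1 \<xi> * cos (r * (2 * pi * (e \<bullet> \<xi>))) \<partial>lborel)
       - 2 * (\<beta> + 1) * (\<integral>\<xi>. (u \<bullet> \<xi>)\<^sup>2 * b \<xi> * cos (r * (2 * pi * (e \<bullet> \<xi>))) \<partial>lborel)
       - 2 * pi * r * (e \<bullet> u) * (\<integral>\<xi>. (u \<bullet> \<xi>) * b1 \<xi> * sin (r * (2 * pi * (e \<bullet> \<xi>))) \<partial>lborel) = 0"
    unfolding \<theta>_def[symmetric] using i1 i2 i3 by simp
  have "(\<integral>\<xi>. 2 * pi * r * (b1 \<xi> * cos (\<theta> \<xi>)) - 2 * (\<beta> + 1) * ((e \<bullet> \<xi>) * b \<xi> * sin (\<theta> \<xi>)) \<partial>lborel) = 0"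
  proof -
    define D where "D \<xi> v = b1 \<xi> * (cos (\<theta> \<xi>) * (r * (2 * pi * (e \<bullet> v)))) +
       (- 2 * (\<beta> + 1) * b \<xi> * (\<xi> \<bullet> v)) * sin (\<theta> \<xi>)" for \<xi> v
    have Deq: "D \<xi> e = 2 * pi * r * (b1 \<xi> * cos (\<theta> \<xi>)) - 2 * (\<beta> + 1) * ((e \<bullet> \<xi>) * b \<xi> * sin (\<theta> \<xi>))" for \<xi>
      using uu by (simp add: D_def algebra_simps inner_commute[of \<xi> e])
    have "(\<integral>\<xi>. D \<xi> e \<partial>lborel) = 0"
    proof (rule integral_directional_derivative(2)[where f="\<lambda>\<xi>. b1 \<xi> * sin (\<theta> \<xi>)", OF _ _ s(1)])
      show "((\<lambda>\<xi>. b1 \<xi> * sin (\<theta> \<xi>)) has_derivative D \<xi>) (at \<xi>)" for \<xi>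
        unfolding D_def[abs_def] by (intro has_derivative_mult db1 dsin)
      show "integrable lborel (\<lambda>\<xi>. b1 \<xi> * sin (\<theta> \<xi>))"
        using b0 b1 by (intro int bd1 trig) auto
      fix \<xi>
      have "\<bar>2 * pi * r * (b1 \<xi> * cos (\<theta> \<xi>))\<bar> \<le> \<bar>2 * pi * r\<bar> * b \<xi>"
        unfolding abs_mult[of "2 * pi * r"] using b0(2)[of \<xi>] b1[of \<xi>] by (intro mult_left_mono bd1[OF _ trig(1)]) auto
      moreover have "\<bar>2 * (\<beta> + 1) * ((e \<bullet> \<xi>) * b \<xi> * sin (\<theta> \<xi>))\<bar> \<le> 2 * (\<beta> + 1) * b \<xi>"
        unfolding abs_mult[of "2 * (\<beta> + 1)"] using \<beta> by (intro mult_mono bd1[OF ub(2)[OF e]] trig) auto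
      ultimately have "\<bar>D \<xi> e\<bar> \<le> b \<xi> + 2 * (\<beta> + 1) * b \<xi> + \<bar>2 * pi * r\<bar> * b \<xi>"
        unfolding Deq using b0(1)[of \<xi>] by linarith
      also have "\<dots> = (1 + 2 * (\<beta> + 1) + \<bar>2 * pi * r\<bar>) * b \<xi>" by (simp add: distrib_right)
      also have "\<dots> \<le> (1 + 2 * (\<beta> + 1) + \<bar>2 * pi * r\<bar>) * (2 powr s * decay s \<xi>)"
        using \<beta> by (intro mult_left_mono b_decay) auto
      finally show "norm (D \<xi> e) \<le> ?C * decay s \<xi>" by (simp add: mult.assoc)
    qed
    then show ?thesis by (simp only: Deq)
  qed
  then show "2 * pi * r * (\<integral>\<xi>. b1 \<xi> * cos (r * (2 * pi * (e \<bullet> \<xi>))) \<partial>lborel) =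
       2 * (\<beta> + 1) * (\<integral>\<xi>. (e \<bullet> \<xi>) * b \<xi> * sin (r * (2 * pi * (e \<bullet> \<xi>))) \<partial>lborel)"
    unfolding \<theta>_def[symmetric] using i1 i4[OF e] by simp
qed

text \<open>Along the ray through \<open>e\<close> the transform of the weight is the cosine
  integral \<open>k r\<close>. It solves the Bessel-type equation with first order coefficient
  \<open>2 * a / r\<close>, and \<open>bessel_type_decay\<close> gives the rate \<open>a\<close>.
  The initial data enter only through the mass \<open>B\<close> of the weight, which makes the
  constant independent of \<open>e\<close>.\<close>

lemma br_weight_trig_decay:
  assumes \<beta>: "0 < \<beta>"
  defines "a \<equiv> \<beta> + (real DIM('a::euclidean_space) + 1) / 2"
  obtains C where "0 < C" "\<And>(e::'a) r. norm e = 1 \<Longrightarrow> 0 \<le> r \<Longrightarrow>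
    \<bar>\<integral>\<xi>. br_weight \<beta> \<xi> * cos (r * (2 * pi * (e \<bullet> \<xi>))) \<partial>lborel\<bar> \<le> C * (1 + r) powr - a"
proof -
  define b :: "'a \<Rightarrow> real" where "b = br_weight \<beta>"
  define B where "B = (\<integral>\<xi>. b \<xi> \<partial>lborel)"
  have [measurable]: "b \<in> borel_measurable borel" by (simp add: b_def)
  have b0: "0 \<le> b \<xi>" for \<xi> by (simp add: b_def)
  have a0: "0 < a" using \<beta> by (simp add: a_def add_pos_nonneg)
  have int: "integrable lborel f" if "f \<in> borel_measurable borel" "\<And>\<xi>. \<bar>f \<xi>\<bar> \<le> M * b \<xi>" "0 \<le> M" for f :: "'a \<Rightarrow> real" and M
    by (rule integrable_br_weight_bound[where \<beta>=\<beta> and C=M]) (use that \<beta> in \<open>auto simp: b_def\<close>)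
  have bint: "integrable lborel b" using b0 by (intro int[of _ 1]) auto
  have B0: "0 \<le> B" unfolding B_def using b0 by (intro integral_nonneg_AE) auto
  have bd1: "\<bar>x * c\<bar> \<le> M" if "\<bar>x\<bar> \<le> M" "\<bar>c\<bar> \<le> 1" for x c M :: real
    using mult_mono[OF that] that by (simp add: abs_mult)
  \<comment> \<open>An upper bound for the right-hand side of \<open>bessel_type_decay\<close>, from
    \<open>\<bar>k 1\<bar> \<le> B\<close> and
    \<open>\<bar>k' 1\<bar> \<le> 2 * pi * B\<close>.\<close>
  define Q where "Q = ((2 * pi * B + a * B)\<^sup>2 + 4 * pi\<^sup>2 * B\<^sup>2) * exp \<bar>a * (a - 1)\<bar>"
  have Q0: "0 \<le> Q" by (simp add: Q_def)
  have main: "\<bar>\<integral>\<xi>. b \<xi> * cos (r * (2 * pi * (e \<bullet> \<xi>))) \<partial>lborel\<bar> \<le> B"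
    "1 \<le> r \<Longrightarrow> (r powr a * (\<integral>\<xi>. b \<xi> * cos (r * (2 * pi * (e \<bullet> \<xi>))) \<partial>lborel))\<^sup>2 \<le> Q"
    if e: "norm e = 1" for e :: 'a and r
  proof -
    define c where "c \<xi> = 2 * pi * (e \<bullet> \<xi>)" for \<xi> :: 'a
    have [measurable]: "c \<in> borel_measurable borel" unfolding c_def[abs_def] by measurable
    define k where "k r = (\<integral>\<xi>. b \<xi> * cos (r * c \<xi>) \<partial>lborel)" for r
    define k' where "k' r = (\<integral>\<xi>. b \<xi> * c \<xi> * (- sin (r * c \<xi>)) \<partial>lborel)" for r
    define k'' where "k'' r = (\<integral>\<xi>. b \<xi> * c \<xi> * c \<xi> * (- cos (r * c \<xi>)) \<partial>lborel)" for r
    have cb: "\<bar>b \<xi> * c \<xi>\<bar> \<le> (2 * pi) * b \<xi>" for \<xi>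
      using inner_br_weight_le[of e \<xi> \<beta>] e by (simp add: c_def abs_mult b_def mult_ac)
    have ccb: "\<bar>b \<xi> * c \<xi> * c \<xi>\<bar> \<le> (2 * pi)\<^sup>2 * b \<xi>" for \<xi>
      using inner2_br_weight_le[of e \<xi> \<beta>] e
      by (simp add: c_def abs_mult b_def power2_eq_square mult_ac abs_mult_self_eq mult_left_mono)
    have cccb: "\<bar>b \<xi> * c \<xi> * (c \<xi>)\<^sup>2\<bar> \<le> (2 * pi) ^ 3 * b \<xi>" for \<xi>
    proof -
      have "\<bar>b \<xi> * c \<xi> * (c \<xi>)\<^sup>2\<bar> = \<bar>c \<xi>\<bar> * \<bar>b \<xi> * c \<xi> * c \<xi>\<bar>"
        by (simp add: abs_mult power2_eq_square mult_ac)
      also have "\<dots> \<le> \<bar>c \<xi>\<bar> * ((2 * pi)\<^sup>2 * b \<xi>)" by (intro mult_left_mono ccb) auto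
      also have "\<dots> = (2 * pi)\<^sup>2 * \<bar>b \<xi> * c \<xi>\<bar>" using b0 by (simp add: abs_mult)
      also have "\<dots> \<le> (2 * pi)\<^sup>2 * ((2 * pi) * b \<xi>)" by (intro mult_left_mono cb) auto
      finally show ?thesis by (simp add: power2_eq_square power3_eq_cube)
    qed
    have i0: "integrable lborel (\<lambda>\<xi>. b \<xi> * cos (r * c \<xi>))" for r
      by (rule int[where M=1]) (auto intro!: bd1 simp: b0)
    have i1: "integrable lborel (\<lambda>\<xi>. b \<xi> * c \<xi> * (- sin (r * c \<xi>)))" for r
      by (rule int[where M="2 * pi"], measurable, rule bd1[OF cb]) auto
    have i2: "integrable lborel (\<lambda>\<xi>. b \<xi> * c \<xi> * c \<xi> * (- cos (r * c \<xi>)))" for r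
      by (rule int[where M="(2 * pi)\<^sup>2"], measurable, rule bd1[OF ccb]) auto
    have i3: "integrable lborel (\<lambda>\<xi>. \<bar>b \<xi>\<bar> * (c \<xi>)\<^sup>2)"
      by (rule int[where M="(2 * pi)\<^sup>2"]) (use ccb b0 in \<open>auto simp: abs_mult power2_eq_square mult_ac\<close>)
    have i4: "integrable lborel (\<lambda>\<xi>. \<bar>b \<xi> * c \<xi>\<bar> * (c \<xi>)\<^sup>2)"
      by (rule int[where M="(2 * pi) ^ 3"]) (use cccb in \<open>auto simp: abs_mult\<close>)
    have dk: "(k has_real_derivative k' r) (at r)" for r
      unfolding k_def[abs_def] k'_def
      by (rule integral_param_deriv[where \<phi>=cos and \<phi>'="\<lambda>x. - sin x"]) (use cos_linearization i0 i1 i3 in auto)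
    have dk': "(k' has_real_derivative k'' r) (at r)" for r
      unfolding k'_def[abs_def] k''_def
    proof (rule integral_param_deriv[where w="\<lambda>\<xi>. b \<xi> * c \<xi>" and \<phi>="\<lambda>x. - sin x" and \<phi>'="\<lambda>x. - cos x"])
      fix a h :: real
      show "\<bar>- sin (a + h) - - sin a - h * - cos a\<bar> \<le> h\<^sup>2"
        using sin_linearization[of a h] by (simp add: abs_le_iff)
    qed (use i1 i2 i4 in auto)
    \<comment> \<open>Summing the first integration by parts over an orthonormal basis and
      subtracting the case \<open>u = e\<close> eliminates \<open>S e\<close>. With
      \<open>A = k r - (\<Sum>j\<in>Basis. Qu j)\<close> this leaves
      \<open>2 * (\<beta> + 1) * (k r - Qu e) = 2 * a * A\<close>, the source of the value of
      \<open>a\<close>. The second integration by parts expresses \<open>A\<close> through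
      \<open>P\<close>, that is through \<open>k' r\<close>, while \<open>Qu e\<close> is
      \<open>k'' r\<close> up to a constant.\<close>
    have ode: "k'' r = - (2 * a / r) * k' r - 4 * pi\<^sup>2 * k r" if r: "0 < r" for r
    proof -
      define A where "A = (\<integral>\<xi>. br_weight (\<beta> + 1) \<xi> * cos (r * (2 * pi * (e \<bullet> \<xi>))) \<partial>lborel)"
      define Qu where "Qu u = (\<integral>\<xi>. (u \<bullet> \<xi>)\<^sup>2 * br_weight \<beta> \<xi> * cos (r * (2 * pi * (e \<bullet> \<xi>))) \<partial>lborel)" for u
      define S where "S u = (\<integral>\<xi>. (u \<bullet> \<xi>) * br_weight (\<beta> + 1) \<xi> * sin (r * (2 * pi * (e \<bullet> \<xi>))) \<partial>lborel)" for u
      define P where "P = (\<integral>\<xi>. (e \<bullet> \<xi>) * br_weight \<beta> \<xi> * sin (r * (2 * pi * (e \<bullet> \<xi>))) \<partial>lborel)"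
      note ibp = br_weight_ibp[OF \<beta> _ e, of _ r, folded A_def Qu_def S_def P_def]
      have eq1: "A - 2 * (\<beta> + 1) * Qu u - 2 * pi * r * (e \<bullet> u) * S u = 0" if "norm u = 1" for u
        using ibp(5)[OF that] .
      have eq2: "2 * pi * r * A = 2 * (\<beta> + 1) * P" using ibp(6)[OF e] .
      have nsq: "(norm \<xi>)\<^sup>2 = (\<Sum>j\<in>Basis. (j \<bullet> \<xi>)\<^sup>2)" for \<xi> :: 'a
        using euclidean_inner[of \<xi> \<xi>] unfolding power2_norm_eq_inner by (simp add: power2_eq_square inner_commute)
      have einner: "(\<Sum>j\<in>Basis. (e \<bullet> j) * (j \<bullet> \<xi>)) = e \<bullet> \<xi>" for \<xi>
        using euclidean_inner[of e \<xi>] by (simp only: inner_commute[of _ \<xi>])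
      have sQ: "(\<Sum>j\<in>Basis. Qu j) = (\<integral>\<xi>. (norm \<xi>)\<^sup>2 * b \<xi> * cos (r * c \<xi>) \<partial>lborel)"
      proof -
        have "(\<Sum>j\<in>Basis. Qu j) = (\<integral>\<xi>. (\<Sum>j\<in>Basis. (j \<bullet> \<xi>)\<^sup>2 * br_weight \<beta> \<xi> * cos (r * (2 * pi * (e \<bullet> \<xi>)))) \<partial>lborel)"
          unfolding Qu_def using ibp(2) by (subst Bochner_Integration.integral_sum) auto
        also have "\<dots> = (\<integral>\<xi>. (norm \<xi>)\<^sup>2 * b \<xi> * cos (r * c \<xi>) \<partial>lborel)"
          by (simp only: sum_distrib_right[symmetric] nsq c_def b_def)
        finally show ?thesis .
      qed
      have sS: "(\<Sum>j\<in>Basis. (e \<bullet> j) * S j) = S e"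
      proof -
        have "(\<Sum>j\<in>Basis. (e \<bullet> j) * S j) = (\<integral>\<xi>. (\<Sum>j\<in>Basis. (e \<bullet> j) * ((j \<bullet> \<xi>) * br_weight (\<beta> + 1) \<xi> * sin (r * (2 * pi * (e \<bullet> \<xi>))))) \<partial>lborel)"
          unfolding S_def using ibp(3) by (subst Bochner_Integration.integral_sum) auto
        also have "\<dots> = S e"
          unfolding S_def by (simp only: mult.assoc[symmetric] sum_distrib_right[symmetric] einner)
        finally show ?thesis .
      qed
      have Ak: "A = k r - (\<Sum>j\<in>Basis. Qu j)"
      proof -
        have "integrable lborel (\<lambda>\<xi>. (norm \<xi>)\<^sup>2 * b \<xi> * cos (r * c \<xi>))"
        proof (rule int[where M=1], measurable, goal_cases)
          case (1 \<xi>)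
          have "\<bar>(norm \<xi>)\<^sup>2 * b \<xi>\<bar> \<le> b \<xi>"
            using br_weight_Suc[of \<beta> \<xi>] br_weight_nonneg[of "\<beta> + 1" \<xi>] b0[of \<xi>]
            by (simp add: b_def abs_mult left_diff_distrib)
          then show ?case using bd1 by simp
        qed simp
        then have "k r - (\<integral>\<xi>. (norm \<xi>)\<^sup>2 * b \<xi> * cos (r * c \<xi>) \<partial>lborel) =
            (\<integral>\<xi>. b \<xi> * cos (r * c \<xi>) - (norm \<xi>)\<^sup>2 * b \<xi> * cos (r * c \<xi>) \<partial>lborel)"
          unfolding k_def using i0 by simp
        also have "\<dots> = A"
          unfolding A_def by (intro Bochner_Integration.integral_cong refl) (simp only: br_weight_Suc b_def c_def left_diff_distrib mult_1_left)
        finally show ?thesis using sQ by simp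
      qed
      have k'P: "k' r = - 2 * pi * P"
        unfolding k'_def P_def Bochner_Integration.integral_mult_right_zero[symmetric]
        by (intro Bochner_Integration.integral_cong refl) (simp add: c_def b_def mult_ac)
      have k''Q: "k'' r = - 4 * pi\<^sup>2 * Qu e"
        unfolding k''_def Qu_def Bochner_Integration.integral_mult_right_zero[symmetric]
        by (intro Bochner_Integration.integral_cong refl) (simp add: c_def b_def power2_eq_square mult_ac)
      have eqe: "A - 2 * (\<beta> + 1) * Qu e - 2 * pi * r * S e = 0"
        using eq1[OF e] e by (simp add: norm_eq_1)
      have "(\<Sum>j\<in>Basis. A - 2 * (\<beta> + 1) * Qu j - 2 * pi * r * (e \<bullet> j) * S j) = 0"
        using eq1 by (intro sum.neutral) auto
      then have eqs: "real DIM('a) * A - 2 * (\<beta> + 1) * (\<Sum>j\<in>Basis. Qu j) - 2 * pi * r * S e = 0"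
        by (simp add: sum_subtractf sum_distrib_left[symmetric] mult.assoc sS)
      define g where "g = 2 * (\<beta> + 1)"
      have ta: "2 * a = 2 * \<beta> + real DIM('a) + 1" by (simp add: a_def field_simps)
      have "g * (k r - Qu e) = g * A + (g * (\<Sum>j\<in>Basis. Qu j) - g * Qu e)"
        unfolding Ak by (simp add: algebra_simps)
      also have "\<dots> = g * A + (real DIM('a) * A - A)"
        using eqe eqs by (simp add: g_def)
      also have "\<dots> = 2 * a * A" unfolding ta by (simp add: g_def algebra_simps)
      finally have m1: "g * (k r - Qu e) = 2 * a * A" .
      have m2: "g * (2 * pi * P) = 4 * pi\<^sup>2 * r * A"
      proof -
        have "g * (2 * pi * P) = 2 * pi * (2 * (\<beta> + 1) * P)" by (simp only: g_def mult_ac)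
        also have "\<dots> = 4 * pi\<^sup>2 * r * A" unfolding eq2[symmetric] by (simp add: power2_eq_square)
        finally show ?thesis .
      qed
      have "g * (r * (k r - Qu e) * (4 * pi\<^sup>2)) = r * (4 * pi\<^sup>2) * (g * (k r - Qu e))" by (simp only: mult_ac)
      also have "\<dots> = 2 * a * (g * (2 * pi * P))" unfolding m1 m2 by (simp only: mult_ac)
      finally have "g * (r * (k r - Qu e) * (4 * pi\<^sup>2)) = g * (2 * a * (2 * pi * P))" by (simp only: mult_ac)
      then have "r * (k r - Qu e) * (4 * pi\<^sup>2) = 2 * a * (2 * pi * P)"
        using \<beta> by (simp add: g_def)
      then show ?thesis unfolding k'P k''Q using r by (simp add: field_simps)
    qed
    have kB: "\<bar>k r\<bar> \<le> B" for r
      unfolding k_def B_def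
      by (rule integral_abs_bound[THEN order_trans], rule integral_mono)
         (use i0 bint bd1 b0 in auto)
    have k'B: "\<bar>k' r\<bar> \<le> 2 * pi * B" for r
    proof -
      have "\<bar>k' r\<bar> \<le> (\<integral>\<xi>. 2 * pi * b \<xi> \<partial>lborel)"
        unfolding k'_def
      proof (rule integral_abs_bound[THEN order_trans], rule integral_mono)
        show "\<bar>b \<xi> * c \<xi> * - sin (r * c \<xi>)\<bar> \<le> 2 * pi * b \<xi>" for \<xi>
          by (intro bd1 cb) auto
      qed (use i1 bint in \<open>auto simp del: mult_minus_right\<close>)
      then show ?thesis by (simp add: B_def)
    qed
    show "\<bar>\<integral>\<xi>. b \<xi> * cos (r * (2 * pi * (e \<bullet> \<xi>))) \<partial>lborel\<bar> \<le> B"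
      using kB[of r] by (simp add: k_def c_def)
    show "(r powr a * (\<integral>\<xi>. b \<xi> * cos (r * (2 * pi * (e \<bullet> \<xi>))) \<partial>lborel))\<^sup>2 \<le> Q" if r: "1 \<le> r"
    proof -
      have "(r powr a * k r)\<^sup>2 \<le> ((k' 1 + a * k 1)\<^sup>2 + 4 * pi\<^sup>2 * (k 1)\<^sup>2) * exp \<bar>a * (a - 1)\<bar>"
        by (rule bessel_type_decay[OF dk dk' ode r])
      also have "\<dots> \<le> Q"
        unfolding Q_def
      proof (intro mult_right_mono add_mono mult_left_mono)
        have "\<bar>k' 1 + a * k 1\<bar> \<le> \<bar>k' 1\<bar> + a * \<bar>k 1\<bar>"
          using a0 by (metis abs_mult abs_of_pos abs_triangle_ineq)
        also have "\<dots> \<le> 2 * pi * B + a * B"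
          using kB k'B a0 by (intro add_mono mult_left_mono) auto
        finally have "\<bar>k' 1 + a * k 1\<bar>\<^sup>2 \<le> (2 * pi * B + a * B)\<^sup>2" by (intro power_mono) auto
        then show "(k' 1 + a * k 1)\<^sup>2 \<le> (2 * pi * B + a * B)\<^sup>2" by simp
        have "\<bar>k 1\<bar>\<^sup>2 \<le> B\<^sup>2" using kB by (intro power_mono) auto
        then show "(k 1)\<^sup>2 \<le> B\<^sup>2" by simp
      qed auto
      finally show ?thesis by (simp add: k_def c_def)
    qed
  qed
  \<comment> \<open>The mass \<open>B\<close> serves for \<open>r \<le> 1\<close> and
    \<open>sqrt Q\<close> for larger \<open>r\<close>; the factor \<open>2 powr a\<close> pays for
    \<open>1 + r \<le> 2 * max 1 r\<close>, and the summand 1 makes the constant positive.\<close>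
  define C where "C = (B + sqrt Q + 1) * 2 powr a"
  show thesis
  proof (rule that[of C])
    show "0 < C" using B0 Q0 by (simp add: C_def add_nonneg_pos)
    fix e :: 'a and r :: real assume e: "norm e = 1" and r: "0 \<le> r"
    define I where "I = \<bar>\<integral>\<xi>. br_weight \<beta> \<xi> * cos (r * (2 * pi * (e \<bullet> \<xi>))) \<partial>lborel\<bar>"
    have "I * (1 + r) powr a \<le> C"
    proof (cases "r \<le> 1")
      case True
      have "I * (1 + r) powr a \<le> B * 2 powr a"
        using main(1)[OF e, of r] True r a0 B0 unfolding I_def b_def
        by (intro mult_mono powr_mono2) auto
      also have "\<dots> \<le> C" unfolding C_def using Q0 by (intro mult_right_mono) auto
      finally show ?thesis .
    next
      case False
      have "(1 + r) powr a \<le> (2 * r) powr a" using False a0 by (intro powr_mono2) auto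
      also have "\<dots> = 2 powr a * r powr a" using False by (simp add: powr_mult)
      finally have "I * (1 + r) powr a \<le> I * (2 powr a * r powr a)" unfolding I_def by (intro mult_left_mono) auto
      also have "\<dots> = 2 powr a * \<bar>r powr a * (\<integral>\<xi>. b \<xi> * cos (r * (2 * pi * (e \<bullet> \<xi>))) \<partial>lborel)\<bar>"
        by (simp add: I_def b_def abs_mult)
      also have "\<dots> \<le> 2 powr a * sqrt Q"
        using main(2)[OF e, of r] False by (intro mult_left_mono real_le_rsqrt) auto
      also have "\<dots> \<le> C" unfolding C_def using B0 by (simp add: mult.commute)
      finally show ?thesis .
    qed
    then show "\<bar>\<integral>\<xi>. br_weight \<beta> \<xi> * cos (r * (2 * pi * (e \<bullet> \<xi>))) \<partial>lborel\<bar> \<le> C * (1 + r) powr - a"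
      using r by (simp add: I_def powr_minus field_simps)
  qed
qed

lemma br_multiplier_eq: "br_multiplier \<beta> \<xi> = of_real (br_weight \<beta> \<xi>)"
  by (simp add: br_multiplier_def br_weight_def)

lemma br_multiplier_measurable [measurable]: "br_multiplier \<beta> \<in> borel_measurable borel"
  unfolding br_multiplier_eq[abs_def] by measurable

lemma br_multiplier_integrable: "0 \<le> \<beta> \<Longrightarrow> integrable lborel (br_multiplier \<beta> :: 'a::euclidean_space \<Rightarrow> complex)"
  by (rule integrable_br_weight_bound[where C=1 and \<beta>=\<beta>]) (auto simp: br_multiplier_eq)

text \<open>With \<open>x\<close> written as \<open>norm x\<close> times a unit vector
  \<open>e\<close>, any one if \<open>x = 0\<close>, the sine part of the exponential integrates to
  0 because the weight is even. What remains is the cosine integral already estimated.\<close>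

lemma br_kernel_decay:
  assumes \<beta>: "0 < \<beta>"
  obtains C where "0 < C" "\<And>x::'a::euclidean_space. norm (br_kernel \<beta> x) \<le> C * decay (\<beta> + (real DIM('a) + 1) / 2) x"
proof -
  obtain C where C: "0 < C" and *: "\<And>(e::'a) r. norm e = 1 \<Longrightarrow> 0 \<le> r \<Longrightarrow>
    \<bar>\<integral>\<xi>. br_weight \<beta> \<xi> * cos (r * (2 * pi * (e \<bullet> \<xi>))) \<partial>lborel\<bar> \<le> C * (1 + r) powr - (\<beta> + (real DIM('a) + 1) / 2)"
    using br_weight_trig_decay[OF \<beta>] by blast
  show thesis
  proof (rule that[OF C])
    fix x :: 'a
    define e where "e = (if x = 0 then (SOME i. i \<in> Basis) else x /\<^sub>R norm x)"
    have e: "norm e = 1" by (auto simp: e_def SOME_Basis)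
    have xe: "x \<bullet> \<xi> = norm x * (e \<bullet> \<xi>)" for \<xi> by (simp add: e_def)
    let ?c = "\<lambda>\<xi>. br_weight \<beta> \<xi> * cos (norm x * (2 * pi * (e \<bullet> \<xi>)))"
    let ?s = "\<lambda>\<xi>. br_weight \<beta> \<xi> * sin (norm x * (2 * pi * (e \<bullet> \<xi>)))"
    have ci: "integrable lborel ?c" and si: "integrable lborel ?s"
      by (rule integrable_br_weight_bound[where C=1 and \<beta>=\<beta>]; use \<beta> in \<open>simp add: abs_mult mult_left_le\<close>)+
    have "br_kernel \<beta> x = (\<integral>\<xi>. of_real (?c \<xi>) - \<i> * of_real (?s \<xi>) \<partial>lborel)"
      unfolding br_kernel_def fourier_def
    proof (intro Bochner_Integration.integral_cong refl)
      fix \<xi> :: 'a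
      have "exp (- 2 * complex_of_real pi * \<i> * complex_of_real (\<xi> \<bullet> x)) = cis (- (norm x * (2 * pi * (e \<bullet> \<xi>))))"
        by (simp add: cis_conv_exp inner_commute[of \<xi> x] xe mult_ac)
      then show "br_multiplier \<beta> \<xi> * exp (- 2 * complex_of_real pi * \<i> * complex_of_real (\<xi> \<bullet> x)) = of_real (?c \<xi>) - \<i> * of_real (?s \<xi>)"
        by (simp add: br_multiplier_eq complex_eq_iff)
    qed
    also have "\<dots> = of_real (\<integral>\<xi>. ?c \<xi> \<partial>lborel) - \<i> * of_real (\<integral>\<xi>. ?s \<xi> \<partial>lborel)"
      using ci si by (simp add: integral_complex_of_real del: of_real_mult)
    also have "(\<integral>\<xi>. ?s \<xi> \<partial>lborel) = 0"
      using integral_reflect[of ?s 0] by simp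
    finally have "norm (br_kernel \<beta> x) = \<bar>\<integral>\<xi>. ?c \<xi> \<partial>lborel\<bar>" by simp
    also have "\<dots> \<le> C * decay (\<beta> + (real DIM('a) + 1) / 2) x"
      using *[OF e, of "norm x"] by (simp add: decay_def)
    finally show "norm (br_kernel \<beta> x) \<le> C * decay (\<beta> + (real DIM('a) + 1) / 2) x" .
  qed
qed

section \<open>Schwartz functions\<close>

lemma iter_partial_Nil [simp]: "iter_partial [] f = f"
  by (simp add: iter_partial_def)

lemma iter_partial_Cons: "iter_partial (b # bs) f = partial_deriv b (iter_partial bs f)"
  by (simp add: iter_partial_def)

lemma iter_partial_append: "iter_partial (bs @ cs) f = iter_partial bs (iter_partial cs f)"
  by (simp add: iter_partial_def)

lemma partial_deriv_eq: "(f has_derivative D) (at x) \<Longrightarrow> partial_deriv b f x = D b"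
  by (simp add: partial_deriv_def frechet_derivative_at[symmetric])

lemma has_derivative_partials:
  assumes "f differentiable (at x)"
  shows "(f has_derivative (\<lambda>v. \<Sum>b\<in>Basis. (v \<bullet> b) *\<^sub>R partial_deriv b f x)) (at x)"
proof -
  have D: "(f has_derivative frechet_derivative f (at x)) (at x)"
    using assms frechet_derivative_works by blast
  then have lin: "linear (frechet_derivative f (at x))" by (rule has_derivative_linear)
  have "frechet_derivative f (at x) v = (\<Sum>b\<in>Basis. (v \<bullet> b) *\<^sub>R partial_deriv b f x)" for v
  proof -
    have "frechet_derivative f (at x) v = frechet_derivative f (at x) (\<Sum>b\<in>Basis. (v \<bullet> b) *\<^sub>R b)"
      by (simp add: euclidean_representation)
    also have "\<dots> = (\<Sum>b\<in>Basis. (v \<bullet> b) *\<^sub>R partial_deriv b f x)"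
      by (simp add: linear_sum[OF lin] linear_scale[OF lin] partial_deriv_def)
    finally show ?thesis .
  qed
  then have "frechet_derivative f (at x) = (\<lambda>v. \<Sum>b\<in>Basis. (v \<bullet> b) *\<^sub>R partial_deriv b f x)" by blast
  with D show ?thesis by simp
qed

text \<open>Iterated derivatives are found by guessing: a family indexed by lists that starts at
  \<open>f\<close> and is reproduced by differentiation must consist of the iterated partial
  derivatives. Smoothness and the formula come out of the same guess.\<close>

lemma
  assumes D0: "D [] = f"
    and deriv: "\<And>bs x. bs \<in> lists Basis \<Longrightarrow> (D bs has_derivative D' bs x) (at x)"
    and step: "\<And>bs b x. bs \<in> lists Basis \<Longrightarrow> b \<in> Basis \<Longrightarrow> D' bs x b = D (b # bs) x"
  shows iter_partial_family: "bs \<in> lists Basis \<Longrightarrow> iter_partial bs f = D bs"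
    and smooth_fun_family: "smooth_fun f"
proof -
  have p: "partial_deriv b (D bs) = D (b # bs)" if "bs \<in> lists Basis" "b \<in> Basis" for b bs
    using partial_deriv_eq[OF deriv[OF that(1)]] step[OF that] by auto
  have fam: "bs \<in> lists Basis \<Longrightarrow> bs \<in> lists Basis \<Longrightarrow> iter_partial bs f = D bs" for bs
    by (induction bs) (auto simp: iter_partial_Cons D0 p)
  then show "bs \<in> lists Basis \<Longrightarrow> iter_partial bs f = D bs" .
  show "smooth_fun f" unfolding smooth_fun_def using fam deriv by (auto simp: differentiable_def)
qed

lemma schwartz_seminorm_le_iff:
  assumes "0 \<le> c"
  shows "schwartz_seminorm M K \<phi> \<le> ennreal c \<longleftrightarrow>
    (\<forall>x. \<forall>bs\<in>lists Basis. length bs \<le> K \<longrightarrow> (1 + norm x) ^ M * norm (iter_partial bs \<phi> x) \<le> c)"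
  using assms by (auto simp: schwartz_seminorm_def SUP_le_iff ennreal_le_iff)

lemma schwartz_seminorm_bound:
  assumes "\<phi> \<in> schwartz"
  obtains c where "0 < c" "schwartz_seminorm M K \<phi> \<le> ennreal c"
proof -
  have "schwartz_seminorm M K \<phi> < \<infinity>" using assms by (simp add: schwartz_def)
  then obtain r where r: "0 \<le> r" "schwartz_seminorm M K \<phi> = ennreal r"
    by (cases "schwartz_seminorm M K \<phi>") auto
  show thesis by (rule that[of "r + 1"]) (use r in \<open>auto intro: ennreal_leI\<close>)
qed

lemma schwartz_bound:
  assumes "\<phi> \<in> schwartz" "bs \<in> lists Basis"
  obtains C where "0 < C" "\<And>x. (1 + norm x) ^ M * norm (iter_partial bs \<phi> x) \<le> C"
proof -
  obtain c where c: "0 < c" "schwartz_seminorm M (length bs) \<phi> \<le> ennreal c"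
    using schwartz_seminorm_bound[OF assms(1)] by blast
  show thesis
    by (rule that[OF c(1)]) (use c assms(2) in \<open>simp add: schwartz_seminorm_le_iff\<close>)
qed

text \<open>There are only finitely many lists of basis vectors of length at most \<open>K\<close>,
  so bounds obtained separately for each list suffice.\<close>

lemma schwartzI:
  fixes \<phi> :: "'a::euclidean_space \<Rightarrow> complex"
  assumes "smooth_fun \<phi>"
    and "\<And>M bs. bs \<in> lists Basis \<Longrightarrow> \<exists>C. \<forall>x. (1 + norm x) ^ M * norm (iter_partial bs \<phi> x) \<le> C"
  shows "\<phi> \<in> schwartz"
proof -
  have "schwartz_seminorm M K \<phi> < \<infinity>" for M K
  proof -
    let ?S = "{bs \<in> lists (Basis :: 'a set). length bs \<le> K}"
    have "?S = {xs. set xs \<subseteq> Basis \<and> length xs \<le> K}" by auto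
    then have fin: "finite ?S" using finite_lists_length_le[of "Basis :: 'a set" K] by simp
    have "\<forall>bs\<in>?S. \<exists>C. \<forall>x. (1 + norm x) ^ M * norm (iter_partial bs \<phi> x) \<le> C" using assms(2) by blast
    then obtain C where C: "\<And>bs x. bs \<in> ?S \<Longrightarrow> (1 + norm x) ^ M * norm (iter_partial bs \<phi> x) \<le> C bs"
      by metis
    define c where "c = (\<Sum>bs\<in>?S. \<bar>C bs\<bar>)"
    have "C bs \<le> c" if "bs \<in> ?S" for bs
      using member_le_sum[OF that, of "\<lambda>bs. \<bar>C bs\<bar>"] fin by (simp add: c_def)
    then have "schwartz_seminorm M K \<phi> \<le> ennreal c"
      using C by (subst schwartz_seminorm_le_iff) (auto simp: c_def intro: sum_nonneg order_trans)
    then show ?thesis by (rule le_less_trans) simp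
  qed
  then show ?thesis using assms(1) by (simp add: schwartz_def)
qed

lemma schwartz_iter_differentiable:
  "\<phi> \<in> schwartz \<Longrightarrow> bs \<in> lists Basis \<Longrightarrow> iter_partial bs \<phi> differentiable (at x)"
  by (simp add: schwartz_def smooth_fun_def)

lemma schwartz_differentiable: "\<phi> \<in> schwartz \<Longrightarrow> \<phi> differentiable (at x)"
  using schwartz_iter_differentiable[of \<phi> "[]"] by simp

lemma schwartz_continuous: "\<phi> \<in> schwartz \<Longrightarrow> continuous_on UNIV \<phi>"
  by (simp add: continuous_on_eq_continuous_at schwartz_differentiable differentiable_imp_continuous_within)

lemma schwartz_measurable: "\<phi> \<in> schwartz \<Longrightarrow> \<phi> \<in> borel_measurable borel"
  by (intro borel_measurable_continuous_onI schwartz_continuous)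

lemma schwartz_iter_partial:
  assumes "\<phi> \<in> schwartz" "bs \<in> lists Basis"
  shows "iter_partial bs \<phi> \<in> schwartz"
proof (rule schwartzI)
  show "smooth_fun (iter_partial bs \<phi>)"
    unfolding smooth_fun_def iter_partial_append[symmetric]
    using assms schwartz_iter_differentiable[OF assms(1)] by simp
  fix M and cs :: "'a list" assume "cs \<in> lists Basis"
  then show "\<exists>C. \<forall>x. (1 + norm x) ^ M * norm (iter_partial cs (iter_partial bs \<phi>) x) \<le> C"
    unfolding iter_partial_append[symmetric]
    using schwartz_bound[OF assms(1), of "cs @ bs" M] assms(2) by (metis append_in_lists_conv)
qed

lemma schwartz_partial: "\<phi> \<in> schwartz \<Longrightarrow> b \<in> Basis \<Longrightarrow> partial_deriv b \<phi> \<in> schwartz"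
  using schwartz_iter_partial[of \<phi> "[b]"] by (simp add: iter_partial_Cons)

lemma schwartz_has_derivative:
  "\<phi> \<in> schwartz \<Longrightarrow> (\<phi> has_derivative (\<lambda>v. \<Sum>b\<in>Basis. (v \<bullet> b) *\<^sub>R partial_deriv b \<phi> x)) (at x)"
  by (intro has_derivative_partials schwartz_differentiable)

section \<open>Closure of the Schwartz space under linear and affine operations\<close>

lemma
  fixes \<phi> \<psi> :: "'a::euclidean_space \<Rightarrow> complex"
  assumes "\<phi> \<in> schwartz" "\<psi> \<in> schwartz"
  shows schwartz_add: "(\<lambda>x. \<phi> x + \<psi> x) \<in> schwartz"
    and iter_partial_add: "bs \<in> lists Basis \<Longrightarrow>
      iter_partial bs (\<lambda>x. \<phi> x + \<psi> x) = (\<lambda>x. iter_partial bs \<phi> x + iter_partial bs \<psi> x)"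
proof -
  let ?D = "\<lambda>bs x. iter_partial bs \<phi> x + iter_partial bs \<psi> x"
  have "((\<lambda>x. ?D bs x) has_derivative (\<lambda>v. frechet_derivative (iter_partial bs \<phi>) (at x) v +
      frechet_derivative (iter_partial bs \<psi>) (at x) v)) (at x)" if "bs \<in> lists Basis" for bs x
    using schwartz_iter_differentiable[OF assms(1) that] schwartz_iter_differentiable[OF assms(2) that]
    by (intro has_derivative_add) (simp_all add: frechet_derivative_works)
  note D = this
  have fam: "iter_partial bs (\<lambda>x. \<phi> x + \<psi> x) = ?D bs" if "bs \<in> lists Basis" for bs
    using that by (rule iter_partial_family[where D="?D", OF _ D, rotated -1]) (auto simp: iter_partial_Cons partial_deriv_def)
  have sm: "smooth_fun (\<lambda>x. \<phi> x + \<psi> x)"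
    by (rule smooth_fun_family[OF _ D]) (auto simp: iter_partial_Cons partial_deriv_def)
  show "bs \<in> lists Basis \<Longrightarrow> iter_partial bs (\<lambda>x. \<phi> x + \<psi> x) = ?D bs" by (rule fam)
  show "(\<lambda>x. \<phi> x + \<psi> x) \<in> schwartz"
  proof (rule schwartzI[OF sm])
    fix M bs assume bs: "bs \<in> lists (Basis :: 'a set)"
    obtain C1 C2 where C: "\<And>x. (1 + norm x) ^ M * norm (iter_partial bs \<phi> x) \<le> C1"
      "\<And>x. (1 + norm x) ^ M * norm (iter_partial bs \<psi> x) \<le> C2"
      using schwartz_bound[OF assms(1) bs] schwartz_bound[OF assms(2) bs] by metis
    have "(1 + norm x) ^ M * norm (?D bs x) \<le> C1 + C2" for x
    proof -
      have "(1 + norm x) ^ M * norm (?D bs x) \<le> (1 + norm x) ^ M * (norm (iter_partial bs \<phi> x) + norm (iter_partial bs \<psi> x))"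
        by (intro mult_left_mono norm_triangle_ineq) auto
      also have "\<dots> \<le> C1 + C2" unfolding distrib_left by (intro add_mono C)
      finally show ?thesis .
    qed
    then show "\<exists>C. \<forall>x. (1 + norm x) ^ M * norm (iter_partial bs (\<lambda>x. \<phi> x + \<psi> x) x) \<le> C"
      using fam[OF bs] by auto
  qed
qed

lemma
  fixes \<phi> :: "'a::euclidean_space \<Rightarrow> complex"
  assumes "\<phi> \<in> schwartz"
  shows schwartz_cmult: "(\<lambda>x. k * \<phi> x) \<in> schwartz"
    and iter_partial_cmult: "bs \<in> lists Basis \<Longrightarrow>
      iter_partial bs (\<lambda>x. k * \<phi> x) = (\<lambda>x. k * iter_partial bs \<phi> x)"
proof -
  let ?D = "\<lambda>bs x. k * iter_partial bs \<phi> x"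
  have "((\<lambda>x. ?D bs x) has_derivative (\<lambda>v. k * frechet_derivative (iter_partial bs \<phi>) (at x) v)) (at x)"
    if "bs \<in> lists Basis" for bs x
    using schwartz_iter_differentiable[OF assms that]
    by (intro has_derivative_mult_right) (simp add: frechet_derivative_works)
  note D = this
  have fam: "iter_partial bs (\<lambda>x. k * \<phi> x) = ?D bs" if "bs \<in> lists Basis" for bs
    using that by (rule iter_partial_family[where D="?D", OF _ D, rotated -1]) (auto simp: iter_partial_Cons partial_deriv_def)
  have sm: "smooth_fun (\<lambda>x. k * \<phi> x)"
    by (rule smooth_fun_family[OF _ D]) (auto simp: iter_partial_Cons partial_deriv_def)
  show "bs \<in> lists Basis \<Longrightarrow> iter_partial bs (\<lambda>x. k * \<phi> x) = ?D bs" by (rule fam)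
  show "(\<lambda>x. k * \<phi> x) \<in> schwartz"
  proof (rule schwartzI[OF sm])
    fix M bs assume bs: "bs \<in> lists (Basis :: 'a set)"
    obtain C where C: "\<And>x. (1 + norm x) ^ M * norm (iter_partial bs \<phi> x) \<le> C"
      using schwartz_bound[OF assms bs] by metis
    have "(1 + norm x) ^ M * norm (?D bs x) \<le> norm k * C" for x
      using mult_left_mono[OF C[of x], of "norm k"] by (simp add: norm_mult mult_ac)
    then show "\<exists>C. \<forall>x. (1 + norm x) ^ M * norm (iter_partial bs (\<lambda>x. k * \<phi> x) x) \<le> C"
      using fam[OF bs] by auto
  qed
qed

lemma
  fixes \<phi> :: "'a::euclidean_space \<Rightarrow> complex"
  assumes "\<phi> \<in> schwartz" and c: "c \<noteq> 0"
  shows schwartz_affine: "(\<lambda>x. \<phi> (d + c *\<^sub>R x)) \<in> schwartz"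
    and iter_partial_affine: "bs \<in> lists Basis \<Longrightarrow>
      iter_partial bs (\<lambda>x. \<phi> (d + c *\<^sub>R x)) = (\<lambda>x. c ^ length bs *\<^sub>R iter_partial bs \<phi> (d + c *\<^sub>R x))"
proof -
  let ?D = "\<lambda>bs x. c ^ length bs *\<^sub>R iter_partial bs \<phi> (d + c *\<^sub>R x)"
  have "((\<lambda>x. ?D bs x) has_derivative (\<lambda>v. c ^ length bs *\<^sub>R (c *\<^sub>R
      frechet_derivative (iter_partial bs \<phi>) (at (d + c *\<^sub>R x)) v))) (at x)"
    if "bs \<in> lists Basis" for bs x
  proof -
    have *: "(iter_partial bs \<phi> has_derivative frechet_derivative (iter_partial bs \<phi>) (at (d + c *\<^sub>R x))) (at (d + c *\<^sub>R x))"
      using schwartz_iter_differentiable[OF assms(1) that] frechet_derivative_works by blast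
    have lin: "linear (frechet_derivative (iter_partial bs \<phi>) (at (d + c *\<^sub>R x)))"
      using * by (rule has_derivative_linear)
    have "((\<lambda>x. d + c *\<^sub>R x) has_derivative (\<lambda>v. c *\<^sub>R v)) (at x)"
      by (auto intro!: derivative_eq_intros)
    from has_derivative_compose[OF this *]
    have "((\<lambda>x. iter_partial bs \<phi> (d + c *\<^sub>R x)) has_derivative
       (\<lambda>v. c *\<^sub>R frechet_derivative (iter_partial bs \<phi>) (at (d + c *\<^sub>R x)) v)) (at x)"
      by (simp add: linear_scale[OF lin])
    then show ?thesis by (rule has_derivative_scaleR_right)
  qed
  note D = this
  have fam: "iter_partial bs (\<lambda>x. \<phi> (d + c *\<^sub>R x)) = ?D bs" if "bs \<in> lists Basis" for bs
    using that by (rule iter_partial_family[where D="?D", OF _ D, rotated -1]) (auto simp: iter_partial_Cons partial_deriv_def)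
  have sm: "smooth_fun (\<lambda>x. \<phi> (d + c *\<^sub>R x))"
    by (rule smooth_fun_family[OF _ D]) (auto simp: iter_partial_Cons partial_deriv_def)
  show "bs \<in> lists Basis \<Longrightarrow> iter_partial bs (\<lambda>x. \<phi> (d + c *\<^sub>R x)) = ?D bs" by (rule fam)
  show "(\<lambda>x. \<phi> (d + c *\<^sub>R x)) \<in> schwartz"
  proof (rule schwartzI[OF sm])
    fix M bs assume bs: "bs \<in> lists (Basis :: 'a set)"
    obtain C where C: "\<And>x. (1 + norm x) ^ M * norm (iter_partial bs \<phi> x) \<le> C"
      using schwartz_bound[OF assms(1) bs] by metis
    \<comment> \<open>Undoing the affine map costs a translation by \<open>d\<close> and a factor
      \<open>1 / \<bar>c\<bar>\<close>; \<open>m\<close> accounts for both in the comparison of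
      \<open>1 + norm x\<close> with \<open>1 + norm (d + c *\<^sub>R x)\<close>.\<close>
    define m where "m = 1 + (1 + norm d) / \<bar>c\<bar>"
    have m: "1 + norm x \<le> m * (1 + norm (d + c *\<^sub>R x))" for x
    proof -
      have "norm (c *\<^sub>R x) \<le> norm (d + c *\<^sub>R x) + norm d"
        using norm_triangle_ineq4[of "d + c *\<^sub>R x" d] by simp
      then have "norm x \<le> (norm (d + c *\<^sub>R x) + norm d) / \<bar>c\<bar>"
        using c by (simp add: le_divide_eq mult.commute)
      also have "\<dots> \<le> ((1 + norm d) * (1 + norm (d + c *\<^sub>R x))) / \<bar>c\<bar>"
        by (intro divide_right_mono) (auto simp: algebra_simps)
      finally have "norm x \<le> ((1 + norm d) * (1 + norm (d + c *\<^sub>R x))) / \<bar>c\<bar>" .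
      moreover have "m * (1 + norm (d + c *\<^sub>R x)) = 1 + norm (d + c *\<^sub>R x) + ((1 + norm d) * (1 + norm (d + c *\<^sub>R x))) / \<bar>c\<bar>"
        unfolding m_def by (simp only: distrib_right mult_1_left times_divide_eq_left)
      ultimately show ?thesis using norm_ge_zero[of "d + c *\<^sub>R x"] by linarith
    qed
    have "(1 + norm x) ^ M * norm (?D bs x) \<le> m ^ M * (\<bar>c\<bar> ^ length bs * C)" for x
    proof -
      have "(1 + norm x) ^ M \<le> m ^ M * (1 + norm (d + c *\<^sub>R x)) ^ M"
        using power_mono[OF m[of x], of M] by (simp add: power_mult_distrib add_nonneg_nonneg)
      then have "(1 + norm x) ^ M * norm (?D bs x) \<le> (m ^ M * (1 + norm (d + c *\<^sub>R x)) ^ M) * norm (?D bs x)"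
        by (intro mult_right_mono) auto
      also have "\<dots> = m ^ M * (\<bar>c\<bar> ^ length bs * ((1 + norm (d + c *\<^sub>R x)) ^ M * norm (iter_partial bs \<phi> (d + c *\<^sub>R x))))"
        by (simp add: power_abs mult_ac)
      also have "\<dots> \<le> m ^ M * (\<bar>c\<bar> ^ length bs * C)"
        by (intro mult_left_mono C) (auto simp: m_def)
      finally show ?thesis .
    qed
    then show "\<exists>C. \<forall>x. (1 + norm x) ^ M * norm (iter_partial bs (\<lambda>x. \<phi> (d + c *\<^sub>R x)) x) \<le> C"
      using fam[OF bs] by auto
  qed
qed

lemma schwartz_zero: "(\<lambda>x. 0) \<in> (schwartz :: ('a::euclidean_space \<Rightarrow> complex) set)"
proof -
  have D: "((\<lambda>x::'a. 0 :: complex) has_derivative (\<lambda>v. 0)) (at x)" for x by simp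
  have "iter_partial bs (\<lambda>x. 0) = (\<lambda>x::'a. 0 :: complex)" if "bs \<in> lists Basis" for bs
    using that by (rule iter_partial_family[where D="\<lambda>bs x. 0", OF _ D, rotated -1]) auto
  moreover have "smooth_fun (\<lambda>x::'a. 0 :: complex)"
    by (rule smooth_fun_family[where D="\<lambda>bs x. 0", OF _ D]) auto
  ultimately show ?thesis by (intro schwartzI) auto
qed

lemma schwartz_sum:
  fixes \<phi> :: "'i \<Rightarrow> 'a::euclidean_space \<Rightarrow> complex"
  assumes "finite I" "\<And>i. i \<in> I \<Longrightarrow> \<phi> i \<in> schwartz"
  shows "(\<lambda>x. \<Sum>i\<in>I. \<phi> i x) \<in> schwartz"
  using assms by (induction I rule: finite_induct) (simp_all add: schwartz_zero schwartz_add)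

section \<open>Weighted difference estimates for Schwartz functions\<close>

lemma norm_integral_le_integral:
  fixes f :: "'a \<Rightarrow> 'b::{banach, second_countable_topology}"
  assumes "integrable M f" "integrable M g" "\<And>x. norm (f x) \<le> g x"
  shows "norm (integral\<^sup>L M f) \<le> integral\<^sup>L M g"
  by (rule order_trans[OF integral_norm_bound integral_mono[OF integrable_norm]]) (use assms in auto)

lemma peetre_power: "(1 + norm x) ^ M \<le> (1 + norm (x + y)) ^ M * (1 + norm y) ^ M"
  unfolding power_mult_distrib[symmetric] by (intro power_mono peetre) auto

lemma onorm_partials_le:
  fixes p :: "'a::euclidean_space \<Rightarrow> complex"
  assumes "\<And>b. b \<in> Basis \<Longrightarrow> norm (p b) \<le> c b"
  shows "onorm (\<lambda>v. \<Sum>b\<in>Basis. (v \<bullet> b) *\<^sub>R p b) \<le> (\<Sum>b\<in>Basis. c b)"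
proof (rule onorm_le)
  fix v :: 'a
  have "norm (\<Sum>b\<in>Basis. (v \<bullet> b) *\<^sub>R p b) \<le> (\<Sum>b\<in>Basis. norm v * c b)"
  proof (rule sum_norm_le)
    fix b :: 'a assume b: "b \<in> Basis"
    have "\<bar>v \<bullet> b\<bar> * norm (p b) \<le> norm v * c b"
      using assms[OF b] Basis_le_norm[OF b, of v] by (intro mult_mono) auto
    then show "norm ((v \<bullet> b) *\<^sub>R p b) \<le> norm v * c b" by simp
  qed
  then show "norm (\<Sum>b\<in>Basis. (v \<bullet> b) *\<^sub>R p b) \<le> (\<Sum>b\<in>Basis. c b) * norm v"
    by (simp add: sum_distrib_left[symmetric] mult.commute)
qed

lemma segment_offset:
  assumes "y \<in> closed_segment x (x + h)"
  obtains k where "y = x + k" "norm k \<le> norm h"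
proof -
  obtain u where u: "0 \<le> u" "u \<le> 1" "y = (1 - u) *\<^sub>R x + u *\<^sub>R (x + h)"
    using assms by (auto simp: closed_segment_def)
  then have "y = x + u *\<^sub>R h" by (simp add: algebra_simps)
  moreover have "norm (u *\<^sub>R h) \<le> norm h" using u by (simp add: mult_left_le_one_le)
  ultimately show thesis using that by blast
qed

text \<open>The mean value inequality bounds the derivative at an intermediate point of the segment;
  Peetre's inequality transports the weight from there back to \<open>x\<close>, at the price of
  \<open>(1 + norm h) ^ M\<close>.\<close>

lemma schwartz_lipschitz:
  fixes \<phi> :: "'a::euclidean_space \<Rightarrow> complex"
  assumes \<phi>: "\<phi> \<in> schwartz"
  obtains B where "0 \<le> B"
    "\<And>x h. (1 + norm x) ^ M * norm (\<phi> (x + h) - \<phi> x) \<le> B * norm h * (1 + norm h) ^ M"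
proof -
  have "\<forall>b\<in>Basis. \<exists>c. \<forall>x. (1 + norm x) ^ M * norm (partial_deriv b \<phi> x) \<le> c"
  proof
    fix b :: 'a assume "b \<in> Basis"
    then show "\<exists>c. \<forall>x. (1 + norm x) ^ M * norm (partial_deriv b \<phi> x) \<le> c"
      using schwartz_bound[OF \<phi>, of "[b]" M] by (auto simp: iter_partial_Cons)
  qed
  then obtain c where c: "\<And>b x. b \<in> Basis \<Longrightarrow> (1 + norm x) ^ M * norm (partial_deriv b \<phi> x) \<le> c b"
    by metis
  have c0: "0 \<le> c b" if "b \<in> Basis" for b
    using c[OF that, of 0] by (simp add: order_trans[OF norm_ge_zero])
  define B where "B = (\<Sum>b\<in>Basis. c b)"
  have B0: "0 \<le> B" unfolding B_def using c0 by (rule sum_nonneg)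
  show thesis
  proof (rule that[OF B0])
    fix x h :: 'a
    define K where "K = (1 + norm h) ^ M / (1 + norm x) ^ M"
    have "norm (\<phi> (x + h) - \<phi> x) \<le> (B * K) * norm ((x + h) - x)"
    proof (rule differentiable_bound[where S="closed_segment x (x + h)" and
          f'="\<lambda>y v. \<Sum>b\<in>Basis. (v \<bullet> b) *\<^sub>R partial_deriv b \<phi> y"])
      fix y assume "y \<in> closed_segment x (x + h)"
      then obtain k where k: "y = x + k" "norm k \<le> norm h" by (rule segment_offset)
      show "(\<phi> has_derivative (\<lambda>v. \<Sum>b\<in>Basis. (v \<bullet> b) *\<^sub>R partial_deriv b \<phi> y)) (at y within closed_segment x (x + h))"
        by (rule has_derivative_at_withinI[OF schwartz_has_derivative[OF \<phi>]])
      have "onorm (\<lambda>v. \<Sum>b\<in>Basis. (v \<bullet> b) *\<^sub>R partial_deriv b \<phi> y) \<le> (\<Sum>b\<in>Basis. c b * K)"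
      proof (rule onorm_partials_le)
        fix b :: 'a assume b: "b \<in> Basis"
        have "(1 + norm x) ^ M * norm (partial_deriv b \<phi> y) \<le> ((1 + norm y) ^ M * (1 + norm k) ^ M) * norm (partial_deriv b \<phi> y)"
          using peetre_power[of x M k] by (intro mult_right_mono) (auto simp: k)
        also have "\<dots> = (1 + norm k) ^ M * ((1 + norm y) ^ M * norm (partial_deriv b \<phi> y))" by (simp only: mult_ac)
        also have "\<dots> \<le> (1 + norm h) ^ M * c b"
          using k c[OF b] c0[OF b] by (intro mult_mono power_mono) auto
        finally show "norm (partial_deriv b \<phi> y) \<le> c b * K"
          by (simp add: K_def pos_le_divide_eq add_pos_nonneg mult_ac)
      qed
      then show "onorm (\<lambda>v. \<Sum>b\<in>Basis. (v \<bullet> b) *\<^sub>R partial_deriv b \<phi> y) \<le> B * K"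
        by (simp add: B_def sum_distrib_right)
    qed auto
    then have "norm (\<phi> (x + h) - \<phi> x) \<le> B * norm h * (1 + norm h) ^ M / (1 + norm x) ^ M"
      by (simp add: K_def mult_ac)
    then show "(1 + norm x) ^ M * norm (\<phi> (x + h) - \<phi> x) \<le> B * norm h * (1 + norm h) ^ M"
      by (simp add: pos_le_divide_eq add_pos_nonneg mult_ac)
  qed
qed

text \<open>The first derivatives are Lipschitz uniformly in \<open>x\<close>, hence a quadratic
  remainder with one constant. This uniformity permits differentiating \<open>conv h \<phi>\<close>
  for a merely integrable \<open>h\<close>.\<close>

lemma schwartz_linearization:
  fixes \<phi> :: "'a::euclidean_space \<Rightarrow> complex"
  assumes \<phi>: "\<phi> \<in> schwartz"
  obtains B where "0 \<le> B"
    "\<And>x h. norm (\<phi> (x + h) - \<phi> x - (\<Sum>b\<in>Basis. (h \<bullet> b) *\<^sub>R partial_deriv b \<phi> x)) \<le> B * (norm h)\<^sup>2"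
proof -
  have "\<forall>b\<in>Basis. \<exists>c\<ge>0. \<forall>x h. norm (partial_deriv b \<phi> (x + h) - partial_deriv b \<phi> x) \<le> c * norm h"
  proof
    fix b :: 'a assume "b \<in> Basis"
    then obtain c where "0 \<le> c" "\<And>x h. (1 + norm x) ^ 0 * norm (partial_deriv b \<phi> (x + h) - partial_deriv b \<phi> x) \<le> c * norm h * (1 + norm h) ^ 0"
      using schwartz_lipschitz[OF schwartz_partial[OF \<phi>], where M=0] by metis
    then show "\<exists>c\<ge>0. \<forall>x h. norm (partial_deriv b \<phi> (x + h) - partial_deriv b \<phi> x) \<le> c * norm h" by auto
  qed
  then obtain c where c: "\<And>b. b \<in> Basis \<Longrightarrow> 0 \<le> c b"
    "\<And>b x h. b \<in> Basis \<Longrightarrow> norm (partial_deriv b \<phi> (x + h) - partial_deriv b \<phi> x) \<le> c b * norm h"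
    by metis
  define B where "B = (\<Sum>b\<in>Basis. c b)"
  have B0: "0 \<le> B" unfolding B_def using c(1) by (rule sum_nonneg)
  show thesis
  proof (rule that[OF B0])
    fix x h :: 'a
    let ?D = "\<lambda>y v. \<Sum>b\<in>Basis. (v \<bullet> b) *\<^sub>R partial_deriv b \<phi> y"
    have "norm (\<phi> (x + h) - \<phi> x - ?D x ((x + h) - x)) \<le> norm ((x + h) - x) * (B * norm h)"
    proof (rule differentiable_bound_linearization[where S="closed_segment x (x + h)" and f'="?D"])
      show "x + t *\<^sub>R (x + h - x) \<in> closed_segment x (x + h)" if "t \<in> {0..1}" for t
        using that by (auto simp: closed_segment_def algebra_simps intro!: exI[of _ t])
      fix y assume "y \<in> closed_segment x (x + h)"
      then obtain k where k: "y = x + k" "norm k \<le> norm h" by (rule segment_offset)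
      show "(\<phi> has_derivative ?D y) (at y within closed_segment x (x + h))"
        by (rule has_derivative_at_withinI[OF schwartz_has_derivative[OF \<phi>]])
      have eq: "?D y - ?D x = (\<lambda>v. \<Sum>b\<in>Basis. (v \<bullet> b) *\<^sub>R (partial_deriv b \<phi> y - partial_deriv b \<phi> x))"
        by (simp add: fun_eq_iff scaleR_diff_right sum_subtractf)
      have "onorm (?D y - ?D x) \<le> (\<Sum>b\<in>Basis. c b * norm h)"
        unfolding eq
      proof (rule onorm_partials_le)
        fix b :: 'a assume b: "b \<in> Basis"
        show "norm (partial_deriv b \<phi> y - partial_deriv b \<phi> x) \<le> c b * norm h"
          using c(2)[OF b, of x k] mult_left_mono[OF k(2) c(1)[OF b]] unfolding k(1) by (rule order_trans)
      qed
      then show "onorm (?D y - ?D x) \<le> B * norm h" by (simp add: B_def sum_distrib_right)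
    qed auto
    then show "norm (\<phi> (x + h) - \<phi> x - ?D x h) \<le> B * (norm h)\<^sup>2"
      by (simp add: power2_eq_square mult_ac)
  qed
qed

section \<open>Convolutions\<close>

text \<open>Rapidly decreasing functions need not be smooth; truncated kernels are of this kind.\<close>

definition rapid :: "('a::euclidean_space \<Rightarrow> complex) \<Rightarrow> bool" where
  "rapid h \<longleftrightarrow> h \<in> borel_measurable borel \<and> (\<forall>M. \<exists>C. \<forall>x. (1 + norm x) ^ M * norm (h x) \<le> C)"

lemma schwartz_rapid: "\<phi> \<in> schwartz \<Longrightarrow> rapid \<phi>"
  unfolding rapid_def
proof (intro conjI allI)
  assume \<phi>: "\<phi> \<in> schwartz"
  show "\<phi> \<in> borel_measurable borel" by (rule schwartz_measurable[OF \<phi>])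
  show "\<exists>C. \<forall>x. (1 + norm x) ^ M * norm (\<phi> x) \<le> C" for M
    using schwartz_bound[OF \<phi>, of "[]" M] by auto
qed

lemma rapid_measurable: "rapid h \<Longrightarrow> h \<in> borel_measurable borel"
  by (simp add: rapid_def)

lemma rapid_bound:
  assumes "rapid h" obtains C where "0 < C" "\<And>x. (1 + norm x) ^ M * norm (h x) \<le> C"
proof -
  obtain C where C: "\<And>x. (1 + norm x) ^ M * norm (h x) \<le> C" using assms by (auto simp: rapid_def)
  then have "(1 + norm x) ^ M * norm (h x) \<le> \<bar>C\<bar> + 1" for x using C[of x] by linarith
  then show thesis by (intro that[of "\<bar>C\<bar> + 1"]) auto
qed

lemma rapid_weighted_integrable:
  fixes h :: "'a::euclidean_space \<Rightarrow> complex"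
  assumes "rapid h"
  shows "integrable lborel (\<lambda>x. (1 + norm x) ^ M * norm (h x))"
proof -
  have [measurable]: "h \<in> borel_measurable borel" using assms by (rule rapid_measurable)
  obtain C where C: "\<And>x. (1 + norm x) ^ (M + DIM('a) + 1) * norm (h x) \<le> C"
    using rapid_bound[OF assms] by metis
  show ?thesis
  proof (rule integrable_decay_bound[where s="real (DIM('a) + 1)"])
    show "norm ((1 + norm x) ^ M * norm (h x)) \<le> C * decay (real (DIM('a) + 1)) x" for x
      unfolding decay_bound_iff using C[of x] by (simp add: power_add mult_ac abs_mult)
  qed auto
qed

lemma rapid_integrable: "rapid h \<Longrightarrow> integrable lborel h"
  using rapid_weighted_integrable[of h 0] integrable_norm_iff[of h lborel]
  by (simp add: rapid_measurable)

lemma schwartz_integrable: "\<phi> \<in> schwartz \<Longrightarrow> integrable lborel \<phi>"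
  by (intro rapid_integrable schwartz_rapid)

section \<open>Algebra and differentiation of convolutions\<close>

lemma conv_commute: "conv f g = conv g f"
proof
  fix x
  show "conv f g x = conv g f x"
    unfolding conv_def using integral_reflect[of "\<lambda>y. f (x - y) * g y" x] by (simp add: mult.commute)
qed

lemma conv_alt: "conv f g x = (\<integral>y. f y * g (x - y) \<partial>lborel)"
  unfolding conv_commute[of f g] conv_def by (simp add: mult.commute)

lemma conv_measurable [measurable]:
  assumes [measurable]: "f \<in> borel_measurable borel" "g \<in> borel_measurable borel"
  shows "conv f g \<in> borel_measurable borel"
  unfolding conv_def[abs_def] by measurable

lemma conv_integrable_bounded:
  fixes F :: "'a::euclidean_space \<Rightarrow> complex"
  assumes K: "integrable lborel K" and [measurable]: "F \<in> borel_measurable borel" and F: "\<And>z. norm (F z) \<le> B"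
  shows "integrable lborel (\<lambda>y. K (x - y) * F y)"
proof (rule Bochner_Integration.integrable_bound[where f="\<lambda>y. B * norm (K (x - y))"])
  have [measurable]: "K \<in> borel_measurable borel" using K by auto
  show "integrable lborel (\<lambda>y. B * norm (K (x - y)))"
    using K integrable_reflect[of K x] by simp
  show "(\<lambda>y. K (x - y) * F y) \<in> borel_measurable lborel" by measurable
  show "AE y in lborel. norm (K (x - y) * F y) \<le> norm (B * norm (K (x - y)))"
    using F by (auto simp: norm_mult abs_mult mult.commute intro!: mult_right_mono order_trans[OF F abs_ge_self])
qed

lemma conv_bounded:
  fixes F :: "'a::euclidean_space \<Rightarrow> complex"
  assumes K: "integrable lborel K" and [measurable]: "F \<in> borel_measurable borel" and F: "\<And>z. norm (F z) \<le> B"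
  shows "norm (conv K F x) \<le> (\<integral>z. norm (K z) \<partial>lborel) * B"
proof -
  have "norm (conv K F x) \<le> (\<integral>y. norm (K (x - y)) * B \<partial>lborel)"
    unfolding conv_def
  proof (rule norm_integral_le_integral)
    show "integrable lborel (\<lambda>y. K (x - y) * F y)" by (rule conv_integrable_bounded[OF assms])
    show "integrable lborel (\<lambda>y. norm (K (x - y)) * B)" using K integrable_reflect[of K x] by simp
    show "norm (K (x - y) * F y) \<le> norm (K (x - y)) * B" for y
      unfolding norm_mult by (intro mult_left_mono F) auto
  qed
  also have "\<dots> = (\<integral>z. norm (K z) \<partial>lborel) * B"
    using integral_reflect[of "\<lambda>y. norm (K y)" x] by simp
  finally show ?thesis .
qed

text \<open>Fubini applies because the double integral is dominated by the integrable functions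
  \<open>K\<close> and \<open>a\<close> and the bound \<open>B\<close>. The factor \<open>F\<close>
  is only bounded: it will be a smoothed distribution, which need not decay.\<close>

lemma conv_assoc:
  fixes F :: "'a::euclidean_space \<Rightarrow> complex"
  assumes K: "integrable lborel K" and a: "integrable lborel a"
    and [measurable]: "F \<in> borel_measurable borel" and F: "\<And>z. norm (F z) \<le> B"
  shows "conv K (conv a F) = conv (conv K a) F"
proof
  fix x
  have [measurable]: "K \<in> borel_measurable borel" "a \<in> borel_measurable borel" using K a by auto
  define f where "f y z = K (x - y) * (a (y - z) * F z)" for y z
  define A where "A = (\<integral>z. norm (a z) \<partial>lborel)"
  have fm [measurable]: "(\<lambda>(y, z). f y z) \<in> borel_measurable (lborel \<Otimes>\<^sub>M lborel)"
    unfolding f_def by measurable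
  have aF: "integrable lborel (\<lambda>z. a (y - z) * F z)" for y
    by (rule conv_integrable_bounded[OF a _ F]) simp
  have inner_le: "(\<integral>z. norm (f y z) \<partial>lborel) \<le> norm (K (x - y)) * (A * B)" for y
  proof -
    have "(\<integral>z. norm (f y z) \<partial>lborel) = norm (K (x - y)) * (\<integral>z. norm (a (y - z) * F z) \<partial>lborel)"
      by (simp add: f_def norm_mult)
    also have "(\<integral>z. norm (a (y - z) * F z) \<partial>lborel) \<le> (\<integral>z. norm (a (y - z)) * B \<partial>lborel)"
    proof (rule integral_mono)
      show "integrable lborel (\<lambda>z. norm (a (y - z) * F z))" using aF by (rule integrable_norm)
      show "integrable lborel (\<lambda>z. norm (a (y - z)) * B)" using a integrable_reflect[of a y] by simp
      show "norm (a (y - z) * F z) \<le> norm (a (y - z)) * B" for z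
        unfolding norm_mult by (intro mult_left_mono F) auto
    qed
    also have "\<dots> = A * B" using integral_reflect[of "\<lambda>z. norm (a z)" y] by (simp add: A_def)
    finally show ?thesis by (simp add: mult_left_mono)
  qed
  have int: "integrable (lborel \<Otimes>\<^sub>M lborel) (\<lambda>(y, z). f y z)"
  proof (rule lborel_pair.Fubini_integrable[OF fm])
    show "integrable lborel (\<lambda>y. \<integral>z. norm (case (y, z) of (y, z) \<Rightarrow> f y z) \<partial>lborel)"
    proof (rule Bochner_Integration.integrable_bound[where f="\<lambda>y. norm (K (x - y)) * (A * B)"])
      show "integrable lborel (\<lambda>y. norm (K (x - y)) * (A * B))"
        using K integrable_reflect[of K x] by simp
      show "AE y in lborel. norm (\<integral>z. norm (case (y, z) of (y, z) \<Rightarrow> f y z) \<partial>lborel) \<le> norm (norm (K (x - y)) * (A * B))"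
        using inner_le by (auto intro!: AE_I2 order_trans[OF _ abs_ge_self])
    qed measurable
    show "AE y in lborel. integrable lborel (\<lambda>z. case (y, z) of (y, z) \<Rightarrow> f y z)"
      using aF by (auto simp: f_def)
  qed
  have "conv K (conv a F) x = (\<integral>y. \<integral>z. f y z \<partial>lborel \<partial>lborel)"
    unfolding conv_def f_def using aF by simp
  also have "\<dots> = (\<integral>z. \<integral>y. f y z \<partial>lborel \<partial>lborel)"
    using lborel_pair.Fubini_integral[OF int] by simp
  also have "\<dots> = (\<integral>z. conv K a (x - z) * F z \<partial>lborel)"
  proof (intro Bochner_Integration.integral_cong refl)
    fix z
    have "(\<integral>y. f y z \<partial>lborel) = (\<integral>y. f (z + y) z \<partial>lborel)" by (rule integral_shift[symmetric])
    also have "\<dots> = (\<integral>y. K (x - z - y) * a y * F z \<partial>lborel)"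
      by (intro Bochner_Integration.integral_cong refl) (simp add: f_def algebra_simps)
    also have "\<dots> = conv K a (x - z) * F z"
      unfolding conv_def by simp
    finally show "(\<integral>y. f y z \<partial>lborel) = conv K a (x - z) * F z" .
  qed
  also have "\<dots> = conv (conv K a) F x" unfolding conv_def[of "conv K a"] ..
  finally show "conv K (conv a F) x = conv (conv K a) F x" .
qed

text \<open>All differentiation falls on the Schwartz factor: the uniform quadratic remainder of
  \<open>\<phi>\<close>, integrated against \<open>norm (h y)\<close>, gives an error of at most
  \<open>H * B * (norm k)\<^sup>2\<close>.\<close>

lemma conv_has_derivative:
  fixes \<phi> h :: "'a::euclidean_space \<Rightarrow> complex"
  assumes h: "integrable lborel h" and \<phi>: "\<phi> \<in> schwartz"
  shows "(conv h \<phi> has_derivative (\<lambda>v. \<Sum>b\<in>Basis. (v \<bullet> b) *\<^sub>R conv h (partial_deriv b \<phi>) x)) (at x)"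
proof -
  let ?D = "\<lambda>v. \<Sum>b\<in>Basis. (v \<bullet> b) *\<^sub>R conv h (partial_deriv b \<phi>) x"
  have [measurable]: "h \<in> borel_measurable borel" using h by auto
  obtain B where B: "0 \<le> B"
    "\<And>x k. norm (\<phi> (x + k) - \<phi> x - (\<Sum>b\<in>Basis. (k \<bullet> b) *\<^sub>R partial_deriv b \<phi> x)) \<le> B * (norm k)\<^sup>2"
    using schwartz_linearization[OF \<phi>] by metis
  define H where "H = (\<integral>y. norm (h y) \<partial>lborel)"
  have bdd: "integrable lborel (\<lambda>y. h y * \<psi> (x - y))" if \<psi>: "\<psi> \<in> schwartz" for \<psi> x
  proof -
    obtain C where "\<And>x. (1 + norm x) ^ 0 * norm (\<psi> x) \<le> C" using rapid_bound[OF schwartz_rapid[OF \<psi>]] by metis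
    then have "norm (\<psi> (x - z)) \<le> C" for z by simp
    then have "integrable lborel (\<lambda>y. h (0 - (0 - y)) * \<psi> (x - y))"
      using schwartz_measurable[OF \<psi>] conv_integrable_bounded[of "\<lambda>y. h (0 - y)" "\<lambda>y. \<psi> (x - y)" C 0] h integrable_reflect[of h 0]
      by simp
    then show ?thesis by simp
  qed
  have est: "norm (conv h \<phi> (x + k) - conv h \<phi> x - ?D k) \<le> H * B * (norm k)\<^sup>2" for k
  proof -
    let ?R = "\<lambda>y. \<phi> (x - y + k) - \<phi> (x - y) - (\<Sum>b\<in>Basis. (k \<bullet> b) *\<^sub>R partial_deriv b \<phi> (x - y))"
    have i1: "integrable lborel (\<lambda>y. h y * \<phi> (x + k - y))" "integrable lborel (\<lambda>y. h y * \<phi> (x - y))"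
      by (intro bdd \<phi>)+
    have i2: "integrable lborel (\<lambda>y. (k \<bullet> b) *\<^sub>R (h y * partial_deriv b \<phi> (x - y)))" if "b \<in> Basis" for b
      using bdd[OF schwartz_partial[OF \<phi> that]] by simp
    have "conv h \<phi> (x + k) - conv h \<phi> x - ?D k = (\<integral>y. h y * \<phi> (x + k - y) - h y * \<phi> (x - y) -
        (\<Sum>b\<in>Basis. (k \<bullet> b) *\<^sub>R (h y * partial_deriv b \<phi> (x - y))) \<partial>lborel)"
      unfolding conv_alt using i1 i2 by simp
    also have "\<dots> = (\<integral>y. h y * ?R y \<partial>lborel)"
      by (intro Bochner_Integration.integral_cong refl)
        (simp add: algebra_simps sum_distrib_left)
    also have "norm \<dots> \<le> (\<integral>y. norm (h y) * (B * (norm k)\<^sup>2) \<partial>lborel)"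
    proof (rule norm_integral_le_integral)
      have "integrable lborel (\<lambda>y. h y * \<phi> (x + k - y) - h y * \<phi> (x - y) -
        (\<Sum>b\<in>Basis. (k \<bullet> b) *\<^sub>R (h y * partial_deriv b \<phi> (x - y))))"
        using i1 i2 by (intro Bochner_Integration.integrable_diff Bochner_Integration.integrable_sum) auto
      moreover have "(\<lambda>y. h y * \<phi> (x + k - y) - h y * \<phi> (x - y) -
        (\<Sum>b\<in>Basis. (k \<bullet> b) *\<^sub>R (h y * partial_deriv b \<phi> (x - y)))) = (\<lambda>y. h y * ?R y)"
        by (rule ext) (simp add: algebra_simps sum_distrib_left)
      ultimately show "integrable lborel (\<lambda>y. h y * ?R y)" by simp
      show "integrable lborel (\<lambda>y. norm (h y) * (B * (norm k)\<^sup>2))" using h by simp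
      show "norm (h y * ?R y) \<le> norm (h y) * (B * (norm k)\<^sup>2)" for y
        unfolding norm_mult by (intro mult_left_mono B) auto
    qed
    also have "\<dots> = H * B * (norm k)\<^sup>2" by (simp add: H_def)
    finally show ?thesis .
  qed
  show ?thesis
    unfolding has_derivative_at
  proof
    show "bounded_linear ?D"
      by (intro bounded_linear_sum bounded_linear_scaleR_const bounded_linear_inner_left)
    show "(\<lambda>k. norm (conv h \<phi> (x + k) - conv h \<phi> x - ?D k) / norm k) \<midarrow>0\<rightarrow> 0"
    proof (rule Lim_null_comparison)
      show "\<forall>\<^sub>F k in at 0. norm (norm (conv h \<phi> (x + k) - conv h \<phi> x - ?D k) / norm k) \<le> H * B * norm k"
      proof (rule always_eventually, rule allI)
        fix k :: 'a
        show "norm (norm (conv h \<phi> (x + k) - conv h \<phi> x - ?D k) / norm k) \<le> H * B * norm k"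
          using est[of k] by (cases "k = 0") (simp_all add: divide_le_eq power2_eq_square mult_ac)
      qed
      have "(\<lambda>k::'a. H * B * norm k) \<midarrow>0\<rightarrow> H * B * norm (0::'a)" by (intro tendsto_intros)
      then show "(\<lambda>k::'a. H * B * norm k) \<midarrow>0\<rightarrow> 0" by simp
    qed
  qed
qed

text \<open>Smoothness comes from the family \<open>conv h (iter_partial bs \<phi>)\<close>. Its
  decay comes from \<open>decay_conv\<close>, with the derivative of \<open>\<phi>\<close> as the
  pointwise decaying factor and \<open>h\<close> as the factor of finite mass.\<close>

lemma
  fixes \<phi> h :: "'a::euclidean_space \<Rightarrow> complex"
  assumes h: "rapid h" and \<phi>: "\<phi> \<in> schwartz"
  shows schwartz_conv: "conv h \<phi> \<in> schwartz"
    and iter_partial_conv: "bs \<in> lists Basis \<Longrightarrow> iter_partial bs (conv h \<phi>) = conv h (iter_partial bs \<phi>)"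
proof -
  let ?D = "\<lambda>bs. conv h (iter_partial bs \<phi>)"
  have D: "(?D bs has_derivative (\<lambda>v. \<Sum>b\<in>Basis. (v \<bullet> b) *\<^sub>R conv h (partial_deriv b (iter_partial bs \<phi>)) x)) (at x)"
    if "bs \<in> lists Basis" for bs x
    by (intro conv_has_derivative rapid_integrable h schwartz_iter_partial \<phi> that)
  have step: "(\<Sum>b'\<in>Basis. (b \<bullet> b') *\<^sub>R conv h (partial_deriv b' (iter_partial bs \<phi>)) x) = ?D (b # bs) x"
    if "b \<in> Basis" for b bs x
  proof -
    have "(\<Sum>b'\<in>Basis. (b \<bullet> b') *\<^sub>R conv h (partial_deriv b' (iter_partial bs \<phi>)) x) =
        (\<Sum>b'\<in>Basis. if b' = b then conv h (partial_deriv b' (iter_partial bs \<phi>)) x else 0)"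
      using that by (intro sum.cong refl) (auto simp: inner_Basis)
    then show ?thesis using that by (simp add: iter_partial_Cons)
  qed
  have fam: "iter_partial bs (conv h \<phi>) = ?D bs" if "bs \<in> lists Basis" for bs
    using that by (rule iter_partial_family[where D="?D", OF _ D, rotated -1]) (auto simp: step)
  have sm: "smooth_fun (conv h \<phi>)"
    by (rule smooth_fun_family[where D="?D", OF _ D]) (auto simp: step)
  show "bs \<in> lists Basis \<Longrightarrow> iter_partial bs (conv h \<phi>) = ?D bs" by (rule fam)
  show "conv h \<phi> \<in> schwartz"
  proof (rule schwartzI[OF sm])
    fix M and bs :: "'a list" assume bs: "bs \<in> lists Basis"
    \<comment> \<open>Enlarging \<open>M\<close> by \<open>n + 1\<close> makes the exponent exceed
      the dimension, as \<open>decay_conv\<close> requires.\<close>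
    define L where "L = M + DIM('a) + 1"
    obtain C where C: "0 < C" and
      *: "\<And>a b A B (x::'a). \<lbrakk>b \<in> borel_measurable borel; \<And>z. norm (a z) \<le> A * decay (real L) z;
        (\<integral>\<^sup>+z. ennreal (norm (b z)) \<partial>lborel) \<le> ennreal B;
        \<And>z. norm z powr (real L) * norm (b z) \<le> B; 0 \<le> A; 0 \<le> B\<rbrakk> \<Longrightarrow>
        norm (conv a b x) \<le> C * A * B * decay (real L) x"
      using decay_conv[where 'a='a and L="real L"] by (auto simp: L_def)
    obtain A where A: "0 < A" "\<And>x. (1 + norm x) ^ L * norm (iter_partial bs \<phi> x) \<le> A"
      using schwartz_bound[OF \<phi> bs] by metis
    obtain B1 where B1: "0 < B1" "\<And>x. (1 + norm x) ^ L * norm (h x) \<le> B1"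
      using rapid_bound[OF h] by metis
    define B where "B = B1 + (\<integral>x. norm (h x) \<partial>lborel)"
    have B0: "B1 \<le> B" "(\<integral>x. norm (h x) \<partial>lborel) \<le> B" using B1 by (auto simp: B_def)
    have "norm (conv (iter_partial bs \<phi>) h x) \<le> C * A * B * decay (real L) x" for x
    proof (rule *)
      show "norm (iter_partial bs \<phi> z) \<le> A * decay (real L) z" for z
        unfolding decay_bound_iff by (rule A)
      show "(\<integral>\<^sup>+z. ennreal (norm (h z)) \<partial>lborel) \<le> ennreal B"
        using B0 rapid_integrable[OF h] by (subst nn_integral_eq_integral) (auto intro: ennreal_leI)
      show "norm z powr (real L) * norm (h z) \<le> B" for z
      proof -
        have "norm z powr (real L) \<le> (1 + norm z) powr (real L)" by (intro powr_mono2) auto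
        also have "\<dots> = (1 + norm z) ^ L" by (simp add: powr_realpow add_pos_nonneg)
        finally have "norm z powr (real L) * norm (h z) \<le> (1 + norm z) ^ L * norm (h z)"
          by (intro mult_right_mono) auto
        then show ?thesis using B1(2)[of z] B0 by linarith
      qed
    qed (use A B0 B1 rapid_measurable[OF h] in auto)
    then have **: "(1 + norm x) ^ L * norm (?D bs x) \<le> C * A * B" for x
      unfolding decay_bound_iff conv_commute[of h] .
    have "(1 + norm x) ^ M * norm (?D bs x) \<le> C * A * B" for x
    proof -
      have "(1 + norm x) ^ M * norm (?D bs x) \<le> (1 + norm x) ^ L * norm (?D bs x)"
        by (intro mult_right_mono power_increasing) (auto simp: L_def)
      then show ?thesis using **[of x] by linarith
    qed
    then show "\<exists>C. \<forall>x. (1 + norm x) ^ M * norm (iter_partial bs (conv h \<phi>) x) \<le> C"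
      using fam[OF bs] by auto
  qed
qed

lemma
  fixes \<phi> \<psi> :: "'a::euclidean_space \<Rightarrow> complex"
  assumes "\<phi> \<in> schwartz" "\<psi> \<in> schwartz"
  shows schwartz_diff: "(\<lambda>x. \<phi> x - \<psi> x) \<in> schwartz"
    and iter_partial_diff: "bs \<in> lists Basis \<Longrightarrow>
      iter_partial bs (\<lambda>x. \<phi> x - \<psi> x) = (\<lambda>x. iter_partial bs \<phi> x - iter_partial bs \<psi> x)"
  using schwartz_add[OF assms(1) schwartz_cmult[OF assms(2), of "-1"]]
    iter_partial_add[OF assms(1) schwartz_cmult[OF assms(2), of "-1"], of bs]
    iter_partial_cmult[OF assms(2), of bs "-1"]
  by simp_all

lemma iter_partial_zero: "bs \<in> lists Basis \<Longrightarrow> iter_partial bs (\<lambda>x. 0) = (\<lambda>x. 0)"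
  using iter_partial_cmult[OF schwartz_zero, of bs 0] by simp

lemma iter_partial_sum:
  fixes \<phi> :: "'i \<Rightarrow> 'a::euclidean_space \<Rightarrow> complex"
  assumes "finite I" "\<And>i. i \<in> I \<Longrightarrow> \<phi> i \<in> schwartz" "bs \<in> lists Basis"
  shows "iter_partial bs (\<lambda>x. \<Sum>i\<in>I. \<phi> i x) = (\<lambda>x. \<Sum>i\<in>I. iter_partial bs (\<phi> i) x)"
  using assms by (induction I rule: finite_induct)
    (simp_all add: iter_partial_zero iter_partial_add schwartz_sum)

lemma
  fixes \<phi> :: "'a::euclidean_space \<Rightarrow> complex"
  assumes "\<phi> \<in> schwartz"
  shows schwartz_reflect: "(\<lambda>y. \<phi> (x - y)) \<in> schwartz"
    and iter_partial_reflect: "bs \<in> lists Basis \<Longrightarrow>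
      iter_partial bs (\<lambda>y. \<phi> (x - y)) = (\<lambda>y. (- 1) ^ length bs *\<^sub>R iter_partial bs \<phi> (x - y))"
  using schwartz_affine[OF assms, of "-1" x] iter_partial_affine[OF assms, of "-1" bs x] by simp_all

lemma schwartz_lipschitz_uniform:
  fixes \<phi> :: "'a::euclidean_space \<Rightarrow> complex"
  assumes \<phi>: "\<phi> \<in> schwartz"
  obtains B where "0 \<le> B"
    "\<And>bs x h. \<lbrakk>bs \<in> lists Basis; length bs \<le> K\<rbrakk> \<Longrightarrow>
      (1 + norm x) ^ M * norm (iter_partial bs \<phi> (x + h) - iter_partial bs \<phi> x) \<le> B * (norm h * (1 + norm h) ^ M)"
proof -
  let ?S = "{bs \<in> lists (Basis :: 'a set). length bs \<le> K}"
  have "?S = {xs. set xs \<subseteq> Basis \<and> length xs \<le> K}" by auto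
  then have fin: "finite ?S" using finite_lists_length_le[of "Basis :: 'a set" K] by simp
  have "\<forall>bs\<in>?S. \<exists>B\<ge>0. \<forall>x h. (1 + norm x) ^ M * norm (iter_partial bs \<phi> (x + h) - iter_partial bs \<phi> x) \<le> B * norm h * (1 + norm h) ^ M"
  proof
    fix bs assume "bs \<in> ?S"
    then have "iter_partial bs \<phi> \<in> schwartz" by (intro schwartz_iter_partial[OF \<phi>]) simp
    then show "\<exists>B\<ge>0. \<forall>x h. (1 + norm x) ^ M * norm (iter_partial bs \<phi> (x + h) - iter_partial bs \<phi> x) \<le> B * norm h * (1 + norm h) ^ M"
      using schwartz_lipschitz[of "iter_partial bs \<phi>" M] by metis
  qed
  from bchoice[OF this] obtain B where BB: "\<forall>bs\<in>?S. 0 \<le> B bs \<and> (\<forall>x h. (1 + norm x) ^ M * norm (iter_partial bs \<phi> (x + h) - iter_partial bs \<phi> x) \<le> B bs * norm h * (1 + norm h) ^ M)"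
    by blast
  have B: "bs \<in> ?S \<Longrightarrow> 0 \<le> B bs"
    "bs \<in> ?S \<Longrightarrow> (1 + norm x) ^ M * norm (iter_partial bs \<phi> (x + h) - iter_partial bs \<phi> x) \<le> B bs * norm h * (1 + norm h) ^ M" for bs and x h :: 'a
    using BB by blast+
  define b where "b = (\<Sum>bs\<in>?S. B bs)"
  show thesis
  proof (rule that[of b])
    show "0 \<le> b" unfolding b_def using B(1) by (rule sum_nonneg)
    fix bs and x h :: 'a assume bs: "bs \<in> lists (Basis :: 'a set)" "length bs \<le> K"
    then have "B bs \<le> b"
      using member_le_sum[of bs ?S B] B(1) fin by (auto simp: b_def)
    then have "B bs * norm h * (1 + norm h) ^ M \<le> b * norm h * (1 + norm h) ^ M"
      by (intro mult_right_mono) auto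
    with B(2)[where bs=bs and x=x and h=h] bs show "(1 + norm x) ^ M * norm (iter_partial bs \<phi> (x + h) - iter_partial bs \<phi> x) \<le> b * (norm h * (1 + norm h) ^ M)"
      by (simp add: mult.assoc)
  qed
qed

section \<open>Tempered distributions\<close>

lemma tempered_add: "tempered f \<Longrightarrow> \<phi> \<in> schwartz \<Longrightarrow> \<psi> \<in> schwartz \<Longrightarrow> f (\<lambda>x. \<phi> x + \<psi> x) = f \<phi> + f \<psi>"
  by (simp add: tempered_def)

lemma tempered_cmult: "tempered f \<Longrightarrow> \<phi> \<in> schwartz \<Longrightarrow> f (\<lambda>x. c * \<phi> x) = c * f \<phi>"
  by (simp add: tempered_def)

lemma tempered_diff: "tempered f \<Longrightarrow> \<phi> \<in> schwartz \<Longrightarrow> \<psi> \<in> schwartz \<Longrightarrow> f (\<lambda>x. \<phi> x - \<psi> x) = f \<phi> - f \<psi>"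
  using tempered_add[of f \<phi> "\<lambda>x. - 1 * \<psi> x"] tempered_cmult[of f \<psi> "-1"] schwartz_cmult[of \<psi> "-1"]
  by simp

lemma tempered_sum:
  assumes f: "tempered f" and "finite I" "\<And>i. i \<in> I \<Longrightarrow> \<phi> i \<in> schwartz"
  shows "f (\<lambda>x. \<Sum>i\<in>I. c i * \<phi> i x) = (\<Sum>i\<in>I. c i * f (\<phi> i))"
  using assms(2,3)
proof (induction I rule: finite_induct)
  case empty
  then show ?case using tempered_cmult[OF f schwartz_zero, of 0] by simp
next
  case (insert i I)
  then show ?case
    by (simp add: tempered_add[OF f] tempered_cmult[OF f] schwartz_cmult schwartz_sum)
qed

lemma tempered_bound:
  assumes "tempered f"
  obtains C M K where "0 \<le> C"
    "\<And>\<phi> c. \<lbrakk>\<phi> \<in> schwartz; 0 \<le> c; schwartz_seminorm M K \<phi> \<le> ennreal c\<rbrakk> \<Longrightarrow> norm (f \<phi>) \<le> C * c"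
proof -
  obtain C M K where C: "0 \<le> C" and
    *: "\<And>\<phi>. \<phi> \<in> schwartz \<Longrightarrow> ennreal (norm (f \<phi>)) \<le> ennreal C * schwartz_seminorm M K \<phi>"
    using assms unfolding tempered_def by blast
  show thesis
  proof (rule that[OF C])
    fix \<phi> :: "'a \<Rightarrow> complex" and c :: real
    assume "\<phi> \<in> schwartz" "0 \<le> c" and c: "schwartz_seminorm M K \<phi> \<le> ennreal c"
    then have "ennreal (norm (f \<phi>)) \<le> ennreal C * ennreal c"
      using *[of \<phi>] mult_left_mono[OF c, of "ennreal C"] by (meson order_trans zero_le)
    also have "\<dots> = ennreal (C * c)" using C \<open>0 \<le> c\<close> by (simp add: ennreal_mult)
    finally show "norm (f \<phi>) \<le> C * c" using C \<open>0 \<le> c\<close> by (simp add: ennreal_le_iff)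
  qed
qed

text \<open>The continuity bound of \<open>f\<close> is applied to the difference of two reflected
  translates of \<open>\<phi>\<close>. The seminorm weight sits at \<open>y\<close> while the
  difference is small with weight at \<open>x - y\<close>; Peetre's inequality converts one into the
  other and produces \<open>(1 + norm x) ^ M\<close>. Continuity and polynomial growth of the
  smoothed distribution are both read off from this.\<close>

lemma conv_distr_modulus:
  fixes f :: "'a::euclidean_space distribution"
  assumes f: "tempered f" and \<phi>: "\<phi> \<in> schwartz"
  obtains B M where "0 \<le> B"
    "\<And>x h. norm (conv_distr \<phi> f (x + h) - conv_distr \<phi> f x) \<le> B * (norm h * (1 + norm h) ^ M * (1 + norm x) ^ M)"
proof -
  obtain C M K where C: "0 \<le> C" and
    fC: "\<And>\<phi> c. \<lbrakk>\<phi> \<in> schwartz; 0 \<le> c; schwartz_seminorm M K \<phi> \<le> ennreal c\<rbrakk> \<Longrightarrow> norm (f \<phi>) \<le> C * c"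
    using tempered_bound[OF f] by metis
  obtain B where B: "0 \<le> B" "\<And>bs x h. \<lbrakk>bs \<in> lists Basis; length bs \<le> K\<rbrakk> \<Longrightarrow>
      (1 + norm x) ^ M * norm (iter_partial bs \<phi> (x + h) - iter_partial bs \<phi> x) \<le> B * (norm h * (1 + norm h) ^ M)"
    using schwartz_lipschitz_uniform[OF \<phi>] by metis
  show thesis
  proof (rule that[of "C * B"])
    show "0 \<le> C * B" using C B by simp
    fix x h :: 'a
    let ?c = "B * (norm h * (1 + norm h) ^ M * (1 + norm x) ^ M)"
    let ?g = "\<lambda>y. \<phi> (x + h - y) - \<phi> (x - y)"
    have c0: "0 \<le> ?c" using B by simp
    have "schwartz_seminorm M K ?g \<le> ennreal ?c"
      unfolding schwartz_seminorm_le_iff[OF c0]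
    proof (intro allI ballI impI)
      fix y :: 'a and bs :: "'a list" assume bs: "bs \<in> lists Basis" "length bs \<le> K"
      let ?a = "iter_partial bs \<phi>"
      have "norm (iter_partial bs ?g y) = norm ((- 1) ^ length bs *\<^sub>R (?a (x + h - y) - ?a (x - y)))"
        using bs by (simp add: iter_partial_diff iter_partial_reflect schwartz_reflect \<phi> scaleR_diff_right)
      also have "\<dots> = norm (?a ((x - y) + h) - ?a (x - y))"
      proof -
        have eq: "x + h - y = (x - y) + h" by simp
        show ?thesis unfolding eq by (simp add: power_abs)
      qed
      finally have "(1 + norm y) ^ M * norm (iter_partial bs ?g y) = (1 + norm y) ^ M * norm (?a ((x - y) + h) - ?a (x - y))"
        by simp
      also have "\<dots> \<le> ((1 + norm (y + - x)) ^ M * (1 + norm (- x)) ^ M) * norm (?a ((x - y) + h) - ?a (x - y))"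
        by (intro mult_right_mono peetre_power) auto
      also have "\<dots> = (1 + norm x) ^ M * ((1 + norm (x - y)) ^ M * norm (?a ((x - y) + h) - ?a (x - y)))"
        by (simp add: norm_minus_commute mult_ac)
      also have "\<dots> \<le> (1 + norm x) ^ M * (B * (norm h * (1 + norm h) ^ M))"
        by (intro mult_left_mono B bs) auto
      finally show "(1 + norm y) ^ M * norm (iter_partial bs ?g y) \<le> ?c" by (simp add: mult_ac)
    qed
    then have "norm (f ?g) \<le> C * ?c"
      by (intro fC c0 schwartz_diff schwartz_reflect \<phi>)
    moreover have "f ?g = conv_distr \<phi> f (x + h) - conv_distr \<phi> f x"
      unfolding conv_distr_def by (intro tempered_diff f schwartz_reflect \<phi>)
    ultimately show "norm (conv_distr \<phi> f (x + h) - conv_distr \<phi> f x) \<le> (C * B) * (norm h * (1 + norm h) ^ M * (1 + norm x) ^ M)"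
      by (simp add: mult.assoc)
  qed
qed

lemma conv_distr_continuous:
  fixes f :: "'a::euclidean_space distribution"
  assumes f: "tempered f" and \<phi>: "\<phi> \<in> schwartz"
  shows "continuous_on UNIV (conv_distr \<phi> f)"
  unfolding continuous_on_eq_continuous_at[OF open_UNIV]
proof
  fix x :: 'a
  obtain B M where B: "\<And>x h. norm (conv_distr \<phi> f (x + h) - conv_distr \<phi> f x) \<le> B * (norm h * (1 + norm h) ^ M * (1 + norm x) ^ M)"
    using conv_distr_modulus[OF assms] by metis
  have "(\<lambda>h. conv_distr \<phi> f (x + h) - conv_distr \<phi> f x) \<midarrow>0\<rightarrow> 0"
  proof (rule Lim_null_comparison)
    show "\<forall>\<^sub>F h in at 0. norm (conv_distr \<phi> f (x + h) - conv_distr \<phi> f x) \<le> B * (norm h * (1 + norm h) ^ M * (1 + norm x) ^ M)"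
      using B by (intro always_eventually allI)
    have "(\<lambda>h::'a. B * (norm h * (1 + norm h) ^ M * (1 + norm x) ^ M)) \<midarrow>0\<rightarrow> B * (norm (0::'a) * (1 + norm (0::'a)) ^ M * (1 + norm x) ^ M)"
      by (intro tendsto_intros)
    then show "(\<lambda>h::'a. B * (norm h * (1 + norm h) ^ M * (1 + norm x) ^ M)) \<midarrow>0\<rightarrow> 0" by simp
  qed
  then show "isCont (conv_distr \<phi> f) x" unfolding isCont_iff by (simp add: LIM_zero_iff)
qed

lemma conv_distr_measurable:
  "tempered f \<Longrightarrow> \<phi> \<in> schwartz \<Longrightarrow> conv_distr \<phi> f \<in> borel_measurable borel"
  by (intro borel_measurable_continuous_onI conv_distr_continuous)

lemma conv_distr_growth:
  fixes f :: "'a::euclidean_space distribution"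
  assumes f: "tempered f" and \<phi>: "\<phi> \<in> schwartz"
  obtains B M where "0 \<le> B" "\<And>x. norm (conv_distr \<phi> f x) \<le> B * (1 + norm x) ^ M"
proof -
  obtain B M where B: "0 \<le> B" "\<And>x h. norm (conv_distr \<phi> f (x + h) - conv_distr \<phi> f x) \<le> B * (norm h * (1 + norm h) ^ M * (1 + norm x) ^ M)"
    using conv_distr_modulus[OF assms] by metis
  define A where "A = norm (conv_distr \<phi> f 0)"
  show thesis
  proof (rule that[of "A + B" "Suc M"])
    show "0 \<le> A + B" using B by (simp add: A_def)
    fix x :: 'a
    have "norm (conv_distr \<phi> f x) \<le> norm (conv_distr \<phi> f 0) + norm (conv_distr \<phi> f x - conv_distr \<phi> f 0)"
      by (simp add: norm_triangle_sub)
    also have "\<dots> \<le> A * 1 + B * (norm x * (1 + norm x) ^ M)"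
      using B(2)[of 0 x] by (simp add: A_def)
    also have "\<dots> \<le> A * (1 + norm x) ^ Suc M + B * ((1 + norm x) * (1 + norm x) ^ M)"
      using B(1) by (intro add_mono mult_left_mono mult_right_mono one_le_power) (auto simp: A_def)
    finally show "norm (conv_distr \<phi> f x) \<le> (A + B) * (1 + norm x) ^ Suc M" by (simp add: distrib_right)
  qed
qed

text \<open>
  A distribution commutes with the integral defining \<open>conv h \<phi>\<close>: replacing the integration
  variable \<open>y\<close> in the translates by simple functions \<open>s i\<close> tending to it turns the integral into
  finite sums which converge in every Schwartz seminorm.
\<close>

lemma conv_distr_conv:
  fixes f :: "'a::euclidean_space distribution"
  assumes f: "tempered f" and h: "rapid h" and \<phi>: "\<phi> \<in> schwartz"
  shows "conv_distr (conv h \<phi>) f = conv h (conv_distr \<phi> f)"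
proof
  fix x :: 'a
  have [measurable]: "h \<in> borel_measurable borel" using h by (rule rapid_measurable)
  have hint: "integrable lborel h" using h by (rule rapid_integrable)
  \<comment> \<open>Simple functions approximating the identity map. The bound
    \<open>norm (s i y) \<le> 2 * norm y\<close> keeps polynomial weights under control in both
    dominated convergence arguments.\<close>
  have "(\<lambda>x::'a. x) \<in> borel_measurable lborel" by simp
  from borel_measurable_implies_sequence_metric[OF this, of 0]
  obtain s :: "nat \<Rightarrow> 'a \<Rightarrow> 'a" where s: "\<And>i. simple_function lborel (s i)"
    "\<And>y. (\<lambda>i. s i y) \<longlonglongrightarrow> y" "\<And>i y. norm (s i y) \<le> 2 * norm y"
    by (auto simp: dist_norm)
  have sm [measurable]: "s i \<in> borel_measurable borel" for i
    using borel_measurable_simple_function[OF s(1)] by simp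
  have fin: "finite (range (s i))" for i using simple_functionD(1)[OF s(1)] by simp
  have vm: "s i -` {v} \<in> sets borel" for i v
    using measurable_sets[OF sm, of "{v}" i] by simp
  \<comment> \<open>The mass of \<open>h\<close> on a level set of \<open>s i\<close>. With these
    coefficients an integral over \<open>y\<close> becomes a finite sum, to which linearity of
    \<open>f\<close> applies.\<close>
  define c where "c i v = (\<integral>y. h y * indicator (s i -` {v}) y \<partial>lborel)" for i v
  have cint: "integrable lborel (\<lambda>y. h y * indicator (s i -` {v}) y)" for i v
    using integrable_mult_indicator[OF _ hint, of "s i -` {v}"] vm
    by (simp add: scaleR_conv_of_real of_real_indicator mult.commute)
  have simple: "(\<integral>y. h y * G (s i y) \<partial>lborel) = (\<Sum>v\<in>range (s i). c i v * G v)" 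
    and simple_int: "integrable lborel (\<lambda>y. h y * G (s i y))" for G :: "'a \<Rightarrow> complex" and i
  proof -
    have eq: "(\<lambda>y. h y * G (s i y)) = (\<lambda>y. \<Sum>v\<in>range (s i). (h y * indicator (s i -` {v}) y) * G v)"
    proof
      fix y
      have "(\<Sum>v\<in>range (s i). (h y * indicator (s i -` {v}) y) * G v) =
          (\<Sum>v\<in>range (s i). if v = s i y then h y * G v else 0)"
        by (intro sum.cong refl) (auto simp: indicator_def)
      then show "h y * G (s i y) = (\<Sum>v\<in>range (s i). (h y * indicator (s i -` {v}) y) * G v)"
        using fin by simp
    qed
    have ci: "integrable lborel (\<lambda>y. (h y * indicator (s i -` {v}) y) * G v)" for v
      using cint by simp
    show "(\<integral>y. h y * G (s i y) \<partial>lborel) = (\<Sum>v\<in>range (s i). c i v * G v)"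
      unfolding eq c_def using ci cint by (subst Bochner_Integration.integral_sum) auto
    show "integrable lborel (\<lambda>y. h y * G (s i y))"
      unfolding eq using ci by simp
  qed
  let ?g = "conv_distr \<phi> f"
  define I where "I i z = (\<Sum>v\<in>range (s i). c i v * \<phi> (x - v - z))" for i z
  have I_schwartz: "I i \<in> schwartz" for i
    unfolding I_def[abs_def] by (intro schwartz_sum fin schwartz_cmult schwartz_reflect \<phi>)
  have fI: "f (I i) = (\<integral>y. h y * ?g (x - s i y) \<partial>lborel)" for i
  proof -
    have "f (I i) = (\<Sum>v\<in>range (s i). c i v * ?g (x - v))"
      unfolding I_def[abs_def] conv_distr_def by (intro tempered_sum f fin schwartz_reflect \<phi>)
    then show ?thesis using simple[where G="\<lambda>v. ?g (x - v)"] by simp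
  qed
  \<comment> \<open>First evaluation of the limit: the smoothed distribution is continuous and grows
    at most polynomially, so the rapid decay of \<open>h\<close> supplies a majorant.\<close>
  have "(\<lambda>i. f (I i)) \<longlonglongrightarrow> (\<integral>y. h y * ?g (x - y) \<partial>lborel)"
    unfolding fI
  proof -
    obtain B M where B: "0 \<le> B" "\<And>x. norm (?g x) \<le> B * (1 + norm x) ^ M"
      using conv_distr_growth[OF f \<phi>] by metis
    have gm [measurable]: "?g \<in> borel_measurable borel" by (rule conv_distr_measurable[OF f \<phi>])
    let ?w = "\<lambda>y. (B * (2 * (1 + norm x)) ^ M) * ((1 + norm y) ^ M * norm (h y))"
    show "(\<lambda>i. \<integral>y. h y * ?g (x - s i y) \<partial>lborel) \<longlonglongrightarrow> (\<integral>y. h y * ?g (x - y) \<partial>lborel)"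
    proof (rule integral_dominated_convergence[where w="?w"])
      show "integrable lborel ?w" using rapid_weighted_integrable[OF h, of M] by simp
      show "AE y in lborel. (\<lambda>i. h y * ?g (x - s i y)) \<longlonglongrightarrow> h y * ?g (x - y)"
      proof (rule AE_I2)
        fix y
        have "isCont ?g (x - y)"
          using conv_distr_continuous[OF f \<phi>] by (simp add: continuous_on_eq_continuous_at)
        moreover have "(\<lambda>i. x - s i y) \<longlonglongrightarrow> x - y" by (intro tendsto_intros s)
        ultimately have "(\<lambda>i. ?g (x - s i y)) \<longlonglongrightarrow> ?g (x - y)" by (rule isCont_tendsto_compose)
        then show "(\<lambda>i. h y * ?g (x - s i y)) \<longlonglongrightarrow> h y * ?g (x - y)" by (intro tendsto_intros)
      qed
      show "AE y in lborel. norm (h y * ?g (x - s i y)) \<le> ?w y" for i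
      proof (rule AE_I2)
        fix y
        have "norm (x - s i y) \<le> norm x + 2 * norm y"
          using norm_triangle_ineq4[of x "s i y"] s(3)[of i y] by linarith
        moreover have "0 \<le> norm x * norm y" by simp
        ultimately have "1 + norm (x - s i y) \<le> 2 * (1 + norm x) * (1 + norm y)"
          using norm_ge_zero[of x] norm_ge_zero[of y] unfolding distrib_left distrib_right by linarith
        then have "(1 + norm (x - s i y)) ^ M \<le> (2 * (1 + norm x) * (1 + norm y)) ^ M"
          by (intro power_mono) auto
        then have "norm (?g (x - s i y)) \<le> B * ((2 * (1 + norm x)) ^ M * (1 + norm y) ^ M)"
          using B(2)[of "x - s i y"] B(1) unfolding power_mult_distrib[symmetric]
          by (meson mult_left_mono order_trans)
        then have "norm (h y) * norm (?g (x - s i y)) \<le> norm (h y) * (B * ((2 * (1 + norm x)) ^ M * (1 + norm y) ^ M))"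
          by (intro mult_left_mono) auto
        then show "norm (h y * ?g (x - s i y)) \<le> ?w y" by (simp only: norm_mult mult_ac)
      qed
    qed measurable
  qed
  moreover have "(\<lambda>i. f (I i)) \<longlonglongrightarrow> f (\<lambda>z. conv h \<phi> (x - z))"
  proof -
    let ?I = "\<lambda>z. conv h \<phi> (x - z)"
    have conv_s: "conv h \<phi> \<in> schwartz" by (rule schwartz_conv[OF h \<phi>])
    obtain C M K where C: "0 \<le> C" and
      fC: "\<And>\<phi> c. \<lbrakk>\<phi> \<in> schwartz; 0 \<le> c; schwartz_seminorm M K \<phi> \<le> ennreal c\<rbrakk> \<Longrightarrow> norm (f \<phi>) \<le> C * c"
      using tempered_bound[OF f] by metis
    obtain B where B: "0 \<le> B" "\<And>bs x h. \<lbrakk>bs \<in> lists Basis; length bs \<le> K\<rbrakk> \<Longrightarrow>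
      (1 + norm x) ^ M * norm (iter_partial bs \<phi> (x + h) - iter_partial bs \<phi> x) \<le> B * (norm h * (1 + norm h) ^ M)"
      using schwartz_lipschitz_uniform[OF \<phi>] by metis
    \<comment> \<open>Up to the constant \<open>B\<close>, \<open>W i y\<close> bounds what the
      point \<open>y\<close> contributes to the seminorm of the error: a Lipschitz bound for the
      displacement \<open>y - s i y\<close>, and a weight shift by \<open>x - y\<close>. Its
      integral \<open>w i\<close> does not depend on the evaluation point \<open>z\<close>, so a
      single limit controls the whole seminorm.\<close>
    define \<kappa> where "\<kappa> i y = norm (y - s i y) * (1 + norm (y - s i y)) ^ M" for i y
    define W where "W i y = norm (h y) * (\<kappa> i y * (1 + norm (x - y)) ^ M)" for i y
    define w where "w i = (\<integral>y. W i y \<partial>lborel)" for i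
    have [measurable]: "\<kappa> i \<in> borel_measurable borel" for i unfolding \<kappa>_def[abs_def] by measurable
    have Wm [measurable]: "W i \<in> borel_measurable borel" for i unfolding W_def[abs_def] by measurable
    have \<kappa>0: "0 \<le> \<kappa> i y" for i y by (simp add: \<kappa>_def)
    let ?w = "\<lambda>y. (3 * 3 ^ M * (1 + norm x) ^ M) * ((1 + norm y) ^ (M + M + 1) * norm (h y))"
    have wint: "integrable lborel ?w" using rapid_weighted_integrable[OF h, of "M + M + 1"] by simp
    have Wle: "norm (W i y) \<le> ?w y" for i y
    proof -
      have "norm (y - s i y) \<le> 3 * norm y" using norm_triangle_ineq4[of y "s i y"] s(3)[of i y] by linarith
      then have 1: "norm (y - s i y) \<le> 3 * (1 + norm y)" "1 + norm (y - s i y) \<le> 3 * (1 + norm y)"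
        unfolding distrib_left by simp_all
      have "\<kappa> i y \<le> (3 * (1 + norm y)) * (3 * (1 + norm y)) ^ M"
        unfolding \<kappa>_def by (intro mult_mono power_mono 1) auto
      moreover have "(1 + norm (x - y)) ^ M \<le> (1 + norm x) ^ M * (1 + norm y) ^ M"
        using peetre_power[of "x - y" M y]
      proof -
        have "1 + norm (x - y) \<le> (1 + norm x) * (1 + norm y)"
          using norm_triangle_ineq4[of x y] mult_nonneg_nonneg[of "norm x" "norm y"]
          using norm_ge_zero[of x] norm_ge_zero[of y] unfolding distrib_left distrib_right by linarith
        then show ?thesis unfolding power_mult_distrib[symmetric] by (intro power_mono) auto
      qed
      ultimately have "\<kappa> i y * (1 + norm (x - y)) ^ M \<le>
         ((3 * (1 + norm y)) * (3 * (1 + norm y)) ^ M) * ((1 + norm x) ^ M * (1 + norm y) ^ M)"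
        by (intro mult_mono) auto
      also have "\<dots> = (3 * 3 ^ M * (1 + norm x) ^ M) * (1 + norm y) ^ (M + M + 1)"
        by (simp only: power_mult_distrib power_add power_one_right mult_ac)
      finally have "norm (h y) * (\<kappa> i y * (1 + norm (x - y)) ^ M) \<le> norm (h y) * ((3 * 3 ^ M * (1 + norm x) ^ M) * (1 + norm y) ^ (M + M + 1))"
        by (intro mult_left_mono) auto
      moreover have "0 \<le> W i y" using \<kappa>0 by (simp add: W_def)
      ultimately show ?thesis by (simp add: W_def mult_ac)
    qed
    have Wint: "integrable lborel (W i)" for i
      by (rule Bochner_Integration.integrable_bound[OF wint]) (use Wle in \<open>auto intro!: AE_I2 order_trans[OF _ abs_ge_self]\<close>)
    have w0: "0 \<le> w i" for i unfolding w_def W_def using \<kappa>0 by (intro integral_nonneg_AE) auto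
    have wlim: "w \<longlonglongrightarrow> 0"
    proof -
      have "(\<lambda>i. \<integral>y. W i y \<partial>lborel) \<longlonglongrightarrow> (\<integral>(y::'a). 0 \<partial>lborel)"
      proof (rule integral_dominated_convergence[where w="?w"])
        show "AE y in lborel. (\<lambda>i. W i y) \<longlonglongrightarrow> 0"
        proof (rule AE_I2)
          fix y
          have "(\<lambda>i. W i y) \<longlonglongrightarrow> norm (h y) * (norm (y - y) * (1 + norm (y - y)) ^ M * (1 + norm (x - y)) ^ M)"
            unfolding W_def \<kappa>_def by (intro tendsto_intros s)
          then show "(\<lambda>i. W i y) \<longlonglongrightarrow> 0" by simp
        qed
        show "AE y in lborel. norm (W i y) \<le> ?w y" for i using Wle by auto
      qed (use wint in measurable)
      then show ?thesis by (simp add: w_def[abs_def])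
    qed
    have semi: "schwartz_seminorm M K (\<lambda>z. I i z - ?I z) \<le> ennreal (B * w i)" for i
      unfolding schwartz_seminorm_le_iff[OF mult_nonneg_nonneg[OF B(1) w0]]
    proof (intro allI ballI impI)
      fix z :: 'a and bs :: "'a list" assume bs: "bs \<in> lists Basis" "length bs \<le> K"
      let ?a = "iter_partial bs \<phi>"
      have as: "?a \<in> schwartz" by (rule schwartz_iter_partial[OF \<phi> bs(1)])
      let ?sg = "(- 1) ^ length bs :: real"
      have "iter_partial bs (I i) z = (\<Sum>v\<in>range (s i). c i v * (?sg *\<^sub>R ?a (x - v - z)))"
        unfolding I_def[abs_def] using bs
        by (simp add: iter_partial_sum fin schwartz_cmult schwartz_reflect \<phi> iter_partial_cmult iter_partial_reflect)
      also have "\<dots> = ?sg *\<^sub>R (\<Sum>v\<in>range (s i). c i v * ?a (x - v - z))"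
        by (simp add: scaleR_sum_right)
      also have "\<dots> = ?sg *\<^sub>R (\<integral>y. h y * ?a (x - s i y - z) \<partial>lborel)"
        using simple[where G="\<lambda>v. ?a (x - v - z)"] by simp
      finally have 1: "iter_partial bs (I i) z = ?sg *\<^sub>R (\<integral>y. h y * ?a (x - s i y - z) \<partial>lborel)" .
      have 2: "iter_partial bs ?I z = ?sg *\<^sub>R (\<integral>y. h y * ?a (x - y - z) \<partial>lborel)"
        by (subst iter_partial_reflect[OF conv_s bs(1)], subst iter_partial_conv[OF h \<phi> bs(1)], subst conv_alt)
          (simp add: diff_diff_add add.commute)
      have ai: "integrable lborel (\<lambda>y. h y * ?a (x - y - z))"
      proof -
        obtain A where "\<And>x. (1 + norm x) ^ 0 * norm (?a x) \<le> A" using rapid_bound[OF schwartz_rapid[OF as]] by metis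
        then have A: "norm (?a u) \<le> A" for u by simp
        have [measurable]: "?a \<in> borel_measurable borel" by (rule schwartz_measurable[OF as])
        have "integrable lborel (\<lambda>y. h (0 - (0 - y)) * ?a (x - y - z))"
          using conv_integrable_bounded[of "\<lambda>y. h (0 - y)" "\<lambda>y. ?a (x - y - z)" A 0] hint integrable_reflect[of h 0] A by simp
        then show ?thesis by simp
      qed
      have "norm (iter_partial bs (\<lambda>z. I i z - ?I z) z) =
          norm (?sg *\<^sub>R ((\<integral>y. h y * ?a (x - s i y - z) \<partial>lborel) - (\<integral>y. h y * ?a (x - y - z) \<partial>lborel)))"
        using bs by (simp add: iter_partial_diff[OF I_schwartz schwartz_reflect[OF conv_s]] 1 2 scaleR_diff_right)
      also have "\<dots> = norm (\<integral>y. h y * ?a (x - s i y - z) - h y * ?a (x - y - z) \<partial>lborel)"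
        using ai simple_int[where G="\<lambda>v. ?a (x - v - z)"] by (simp add: power_abs)
      finally have 3: "(1 + norm z) ^ M * norm (iter_partial bs (\<lambda>z. I i z - ?I z) z) =
          norm (\<integral>y. (1 + norm z) ^ M *\<^sub>R (h y * ?a (x - s i y - z) - h y * ?a (x - y - z)) \<partial>lborel)"
        by (simp add: power_abs)
      also have "\<dots> \<le> (\<integral>y. B * W i y \<partial>lborel)"
      proof (rule norm_integral_le_integral)
        show "integrable lborel (\<lambda>y. (1 + norm z) ^ M *\<^sub>R (h y * ?a (x - s i y - z) - h y * ?a (x - y - z)))"
          using ai simple_int[where G="\<lambda>v. ?a (x - v - z)"] by (intro integrable_scaleR_right Bochner_Integration.integrable_diff) auto
        show "integrable lborel (\<lambda>y. B * W i y)" using Wint by simp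
        fix y
        let ?X = "x - y - z" and ?k = "y - s i y"
        have "(1 + norm z) ^ M * norm (?a (?X + ?k) - ?a ?X) \<le>
           ((1 + norm (z + (y - x))) ^ M * (1 + norm (y - x)) ^ M) * norm (?a (?X + ?k) - ?a ?X)"
          by (intro mult_right_mono peetre_power) auto
        also have "norm (z + (y - x)) = norm ?X" by (metis minus_diff_eq norm_minus_cancel add.commute diff_diff_eq2 diff_diff_add add_diff_eq)
        also have "((1 + norm ?X) ^ M * (1 + norm (y - x)) ^ M) * norm (?a (?X + ?k) - ?a ?X) =
           (1 + norm (y - x)) ^ M * ((1 + norm ?X) ^ M * norm (?a (?X + ?k) - ?a ?X))" by (simp only: mult_ac)
        also have "\<dots> \<le> (1 + norm (y - x)) ^ M * (B * (norm ?k * (1 + norm ?k) ^ M))"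
          by (intro mult_left_mono B bs) auto
        finally have "norm (h y) * ((1 + norm z) ^ M * norm (?a (?X + ?k) - ?a ?X)) \<le> norm (h y) * ((1 + norm (x - y)) ^ M * (B * \<kappa> i y))"
          by (intro mult_left_mono) (auto simp: \<kappa>_def norm_minus_commute)
        moreover have "?X + ?k = x - s i y - z" by simp
        ultimately show "norm ((1 + norm z) ^ M *\<^sub>R (h y * ?a (x - s i y - z) - h y * ?a (x - y - z))) \<le> B * W i y"
          by (simp add: W_def norm_mult right_diff_distrib[symmetric] power_abs mult_ac)
      qed
      also have "\<dots> = B * w i" by (simp add: w_def)
      finally show "(1 + norm z) ^ M * norm (iter_partial bs (\<lambda>z. I i z - ?I z) z) \<le> B * w i" .
    qed
    have est: "norm (f (I i) - f ?I) \<le> C * (B * w i)" for i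
    proof -
      have "f (I i) - f ?I = f (\<lambda>z. I i z - ?I z)"
        by (rule tempered_diff[OF f I_schwartz schwartz_reflect[OF conv_s], symmetric])
      also have "norm \<dots> \<le> C * (B * w i)"
        using B(1) w0 semi by (intro fC schwartz_diff I_schwartz schwartz_reflect conv_s mult_nonneg_nonneg)
      finally show ?thesis .
    qed
    have "(\<lambda>i. C * (B * w i)) \<longlonglongrightarrow> C * (B * 0)" by (intro tendsto_mult tendsto_const wlim)
    then have lim0: "(\<lambda>i. C * (B * w i)) \<longlonglongrightarrow> 0" by simp
    have "(\<lambda>i. f (I i) - f ?I) \<longlonglongrightarrow> 0"
      by (rule Lim_null_comparison[OF always_eventually lim0]) (intro allI est)
    then show ?thesis by (simp only: LIM_zero_iff)
  qed
  ultimately have "f (\<lambda>z. conv h \<phi> (x - z)) = (\<integral>y. h y * ?g (x - y) \<partial>lborel)"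
    by (rule LIMSEQ_unique[rotated])
  then show "conv_distr (conv h \<phi>) f x = conv h ?g x"
    by (simp add: conv_distr_def conv_alt)
qed

lemma conv_integrable:
  fixes f g :: "'a::euclidean_space \<Rightarrow> complex"
  assumes f: "integrable lborel f" and g: "integrable lborel g"
  shows "integrable lborel (conv f g)"
proof -
  have [measurable]: "f \<in> borel_measurable borel" "g \<in> borel_measurable borel" using f g by auto
  have int: "integrable (lborel \<Otimes>\<^sub>M lborel) (\<lambda>(y, x). f (x - y) * g y)"
  proof (rule lborel_pair.Fubini_integrable)
    have "(\<integral>x. norm (f (x - y) * g y) \<partial>lborel) = (\<integral>x. norm (f x) \<partial>lborel) * norm (g y)" for y
      using integral_shift[of "\<lambda>x. norm (f x)" "- y"] by (simp add: norm_mult)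
    then show "integrable lborel (\<lambda>y. \<integral>x. norm (case (y, x) of (y, x) \<Rightarrow> f (x - y) * g y) \<partial>lborel)"
      using g by simp
    show "AE y in lborel. integrable lborel (\<lambda>x. case (y, x) of (y, x) \<Rightarrow> f (x - y) * g y)"
      using f integrable_shift[of f "- y" for y] by simp
  qed measurable
  show ?thesis
    unfolding conv_def[abs_def] using lborel_pair.integrable_snd[OF int] by simp
qed

section \<open>Fourier transforms and a decomposition of the kernel\<close>

definition cchar :: "real \<Rightarrow> complex" where
  "cchar t = exp (- 2 * of_real pi * \<i> * of_real t)"

lemma norm_cchar [simp]: "norm (cchar t) = 1"
proof -
  have "cchar t = cis (- 2 * pi * t)" by (simp add: cchar_def cis_conv_exp mult_ac)
  then show ?thesis by simp
qed

lemma cchar_add: "cchar (s + t) = cchar s * cchar t"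
  by (simp add: cchar_def exp_add[symmetric] algebra_simps)

lemma cchar_measurable [measurable]: "cchar \<in> borel_measurable borel"
  unfolding cchar_def[abs_def] by (intro borel_measurable_continuous_onI continuous_intros)

lemma fourier_cchar: "fourier f \<xi> = (\<integral>x. f x * cchar (x \<bullet> \<xi>) \<partial>lborel)"
  by (simp add: fourier_def cchar_def)

lemma integrable_cchar:
  fixes f :: "'a::euclidean_space \<Rightarrow> complex"
  assumes "integrable lborel f"
  shows "integrable lborel (\<lambda>x. f x * cchar (x \<bullet> \<xi>))"
proof (rule Bochner_Integration.integrable_bound[OF assms])
  have [measurable]: "f \<in> borel_measurable borel" using assms by auto
  show "(\<lambda>x. f x * cchar (x \<bullet> \<xi>)) \<in> borel_measurable lborel" by measurable
qed (simp add: norm_mult)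

lemma cchar_has_derivative:
  "((\<lambda>x. cchar (x \<bullet> \<xi>)) has_derivative (\<lambda>v. cchar (x \<bullet> \<xi>) * (- 2 * of_real pi * \<i> * of_real (v \<bullet> \<xi>)))) (at x)"
proof -
  have 1: "((\<lambda>x. - 2 * of_real pi * \<i> * of_real (x \<bullet> \<xi>)) has_derivative
      (\<lambda>v. - 2 * complex_of_real pi * \<i> * of_real (v \<bullet> \<xi>))) (at x)"
    by (intro has_derivative_mult_right has_derivative_of_real has_derivative_inner_left has_derivative_ident)
  show ?thesis unfolding cchar_def
    by (rule has_derivative_eq_rhs[OF has_derivative_compose[OF 1 DERIV_exp[unfolded has_field_derivative_def]]])
      (simp add: fun_eq_iff)
qed

text \<open>The derivative of \<open>\<theta>\<close> times the character has integral 0, and the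
  two terms of the product rule are the two sides.\<close>

lemma fourier_partial:
  fixes \<theta> :: "'a::euclidean_space \<Rightarrow> complex"
  assumes \<theta>: "\<theta> \<in> schwartz" and b: "b \<in> Basis"
  shows "fourier (partial_deriv b \<theta>) \<xi> = (2 * of_real pi * \<i> * of_real (b \<bullet> \<xi>)) * fourier \<theta> \<xi>"
proof -
  define n1 where "n1 = DIM('a) + 1"
  define D where "D x v = \<theta> x * (cchar (x \<bullet> \<xi>) * (- 2 * of_real pi * \<i> * of_real (v \<bullet> \<xi>))) +
    (\<Sum>b\<in>Basis. (v \<bullet> b) *\<^sub>R partial_deriv b \<theta> x) * cchar (x \<bullet> \<xi>)" for x v
  have Db: "D x b = partial_deriv b \<theta> x * cchar (x \<bullet> \<xi>) - (2 * of_real pi * \<i> * of_real (b \<bullet> \<xi>)) * (\<theta> x * cchar (x \<bullet> \<xi>))" for x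
  proof -
    have "(\<Sum>b'\<in>Basis. (b \<bullet> b') *\<^sub>R partial_deriv b' \<theta> x) = (\<Sum>b'\<in>Basis. if b' = b then partial_deriv b' \<theta> x else 0)"
      using b by (intro sum.cong refl) (auto simp: inner_Basis)
    also have "\<dots> = partial_deriv b \<theta> x" using b by simp
    finally show ?thesis by (simp add: D_def)
  qed
  obtain C1 C2 where C1: "\<And>x. (1 + norm x) ^ n1 * norm (\<theta> x) \<le> C1"
    and C2: "\<And>x. (1 + norm x) ^ n1 * norm (partial_deriv b \<theta> x) \<le> C2"
    using rapid_bound[OF schwartz_rapid[OF \<theta>]] rapid_bound[OF schwartz_rapid[OF schwartz_partial[OF \<theta> b]]] by metis
  have "(\<integral>x. D x b \<partial>lborel) = 0"
  proof (rule integral_directional_derivative(2)[where f="\<lambda>x. \<theta> x * cchar (x \<bullet> \<xi>)" and s="real n1"])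
    show "integrable lborel (\<lambda>x. \<theta> x * cchar (x \<bullet> \<xi>))" by (intro integrable_cchar schwartz_integrable \<theta>)
    show "((\<lambda>x. \<theta> x * cchar (x \<bullet> \<xi>)) has_derivative D x) (at x)" for x
      unfolding D_def[abs_def] by (intro has_derivative_mult schwartz_has_derivative \<theta> cchar_has_derivative)
    show "real DIM('a) < real n1" by (simp add: n1_def)
    fix x
    have "norm (D x b) \<le> norm (partial_deriv b \<theta> x) + \<bar>2 * pi * (b \<bullet> \<xi>)\<bar> * norm (\<theta> x)"
      unfolding Db by (rule order_trans[OF norm_triangle_ineq4]) (simp add: norm_mult abs_mult)
    then have "(1 + norm x) ^ n1 * norm (D x b) \<le> (1 + norm x) ^ n1 * (norm (partial_deriv b \<theta> x) + \<bar>2 * pi * (b \<bullet> \<xi>)\<bar> * norm (\<theta> x))"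
      by (intro mult_left_mono) auto
    also have "\<dots> = (1 + norm x) ^ n1 * norm (partial_deriv b \<theta> x) + \<bar>2 * pi * (b \<bullet> \<xi>)\<bar> * ((1 + norm x) ^ n1 * norm (\<theta> x))"
      by (simp only: distrib_left mult_ac)
    also have "\<dots> \<le> C2 + \<bar>2 * pi * (b \<bullet> \<xi>)\<bar> * C1" by (intro add_mono mult_left_mono C1 C2) auto
    finally show "norm (D x b) \<le> (C2 + \<bar>2 * pi * (b \<bullet> \<xi>)\<bar> * C1) * decay (real n1) x"
      by (simp only: decay_bound_iff)
  qed
  then show ?thesis
    unfolding Db fourier_cchar
    using integrable_cchar[OF schwartz_integrable[OF schwartz_partial[OF \<theta> b]]] integrable_cchar[OF schwartz_integrable[OF \<theta>]]
    by simp
qed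

lemma fourier_iter_partial:
  fixes \<theta> :: "'a::euclidean_space \<Rightarrow> complex"
  assumes \<theta>: "\<theta> \<in> schwartz" and "bs \<in> lists Basis"
  shows "fourier (iter_partial bs \<theta>) \<xi> = (\<Prod>b\<leftarrow>bs. 2 * of_real pi * \<i> * of_real (b \<bullet> \<xi>)) * fourier \<theta> \<xi>"
  using assms(2)
proof (induction bs)
  case (Cons b bs)
  then show ?case
    using fourier_partial[OF schwartz_iter_partial[OF \<theta>], of bs b \<xi>]
    by (simp add: iter_partial_Cons mult.assoc)
qed simp

lemma fourier_add:
  "integrable lborel f \<Longrightarrow> integrable lborel g \<Longrightarrow> fourier (\<lambda>x. f x + g x) \<xi> = fourier f \<xi> + fourier g \<xi>"
  unfolding fourier_cchar distrib_right
  by (rule Bochner_Integration.integral_add) (intro integrable_cchar; assumption)+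

lemma fourier_cmult: "fourier (\<lambda>x. c * f x) \<xi> = c * fourier f \<xi>"
  unfolding fourier_cchar by (simp add: mult.assoc)

lemma fourier_sum:
  assumes "\<And>i. i \<in> I \<Longrightarrow> integrable lborel (f i)"
  shows "fourier (\<lambda>x. \<Sum>i\<in>I. f i x) \<xi> = (\<Sum>i\<in>I. fourier (f i) \<xi>)"
  unfolding fourier_cchar sum_distrib_right
  by (rule Bochner_Integration.integral_sum) (intro integrable_cchar assms)

text \<open>Expanding over ordered lists instead of multi-indices avoids multinomial coefficients.
  It is used to write a power of \<open>(norm \<xi>)\<^sup>2\<close> as a sum of symbols of iterated
  partial derivatives.\<close>

lemma sum_lists_prod:
  fixes g :: "'b \<Rightarrow> 'c::comm_semiring_1"
  assumes "finite B"
  shows "(\<Sum>bs | bs \<in> lists B \<and> length bs = M. \<Prod>b\<leftarrow>bs. g b) = (\<Sum>b\<in>B. g b) ^ M"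
proof (induction M)
  case 0
  have "{bs. bs \<in> lists B \<and> length bs = 0} = {[]}" by auto
  then show ?case by simp
next
  case (Suc M)
  let ?S = "{bs. bs \<in> lists B \<and> length bs = M}"
  have eq: "{bs. bs \<in> lists B \<and> length bs = Suc M} = (\<lambda>(b, bs). b # bs) ` (B \<times> ?S)"
    by (auto simp: length_Suc_conv image_iff)
  have "(\<Sum>bs | bs \<in> lists B \<and> length bs = Suc M. \<Prod>b\<leftarrow>bs. g b) = (\<Sum>(b, bs)\<in>B \<times> ?S. g b * (\<Prod>b\<leftarrow>bs. g b))"
    unfolding eq by (subst sum.reindex) (auto simp: inj_on_def intro!: sum.cong)
  also have "\<dots> = (\<Sum>b\<in>B. \<Sum>bs\<in>?S. g b * (\<Prod>b\<leftarrow>bs. g b))"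
    by (simp add: sum.cartesian_product)
  also have "\<dots> = (\<Sum>b\<in>B. g b) * (\<Sum>bs\<in>?S. \<Prod>b\<leftarrow>bs. g b)"
    by (simp add: sum_product)
  finally show ?case using Suc by simp
qed

lemma finite_lists_of_length:
  "finite {bs. bs \<in> lists (Basis :: 'a::euclidean_space set) \<and> length bs = M}"
proof -
  have "{bs. bs \<in> lists (Basis :: 'a set) \<and> length bs = M} = {xs. set xs \<subseteq> Basis \<and> length xs = M}" by auto
  then show ?thesis using finite_lists_length_eq[of "Basis :: 'a set" M] by simp
qed

section \<open>Convolution with the Bochner-Riesz kernel on the Fourier side\<close>

lemma br_kernel_measurable [measurable]: "br_kernel \<beta> \<in> borel_measurable borel"
proof -
  have eq: "br_kernel \<beta> = (\<lambda>x. \<integral>\<xi>. br_multiplier \<beta> \<xi> * cchar (\<xi> \<bullet> x) \<partial>lborel)"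
    by (simp add: br_kernel_def fourier_cchar fun_eq_iff)
  show ?thesis unfolding eq by measurable
qed

text \<open>The decay exponent \<open>\<beta> + (n + 1) / 2\<close> exceeds \<open>n\<close> exactly
  when \<open>\<beta>\<close> is above the critical index \<open>(n - 1) / 2\<close>.\<close>

lemma br_kernel_integrable:
  assumes "(real DIM('a::euclidean_space) - 1) / 2 < \<beta>" "0 < \<beta>"
  shows "integrable lborel (br_kernel \<beta> :: 'a \<Rightarrow> complex)"
proof -
  obtain C where C: "\<And>x::'a. norm (br_kernel \<beta> x) \<le> C * decay (\<beta> + (real DIM('a) + 1) / 2) x"
    using br_kernel_decay[OF assms(2)] by metis
  show ?thesis
    by (rule integrable_decay_bound[OF _ _ C]) (use assms in \<open>auto simp: field_simps\<close>)
qed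

text \<open>Only Fubini is used, no inversion theorem, because the kernel is by definition an
  integral over frequencies. As it is a forward transform, \<open>\<theta>\<close> enters at the
  reflected frequency.\<close>

lemma conv_br_kernel:
  fixes \<theta> :: "'a::euclidean_space \<Rightarrow> complex"
  assumes \<beta>: "0 \<le> \<beta>" and \<theta>: "integrable lborel \<theta>"
  shows "conv (br_kernel \<beta>) \<theta> x = (\<integral>\<xi>. br_multiplier \<beta> \<xi> * cchar (\<xi> \<bullet> x) * fourier \<theta> (- \<xi>) \<partial>lborel)"
proof -
  have [measurable]: "\<theta> \<in> borel_measurable borel" using \<theta> by auto
  define m :: "'a \<Rightarrow> complex" where "m = br_multiplier \<beta>"
  have m: "integrable lborel m" unfolding m_def by (rule br_multiplier_integrable[OF \<beta>])
  have [measurable]: "m \<in> borel_measurable borel" by (simp add: m_def)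
  define f where "f y \<xi> = \<theta> y * (m \<xi> * cchar (\<xi> \<bullet> (x - y)))" for y \<xi>
  have fm [measurable]: "(\<lambda>(y, \<xi>). f y \<xi>) \<in> borel_measurable (lborel \<Otimes>\<^sub>M lborel)"
    unfolding f_def by measurable
  have fn: "norm (f y \<xi>) = norm (\<theta> y) * norm (m \<xi>)" for y \<xi> by (simp add: f_def norm_mult)
  have int: "integrable (lborel \<Otimes>\<^sub>M lborel) (\<lambda>(y, \<xi>). f y \<xi>)"
  proof (rule lborel_pair.Fubini_integrable[OF fm])
    show "integrable lborel (\<lambda>y. \<integral>\<xi>. norm (case (y, \<xi>) of (y, \<xi>) \<Rightarrow> f y \<xi>) \<partial>lborel)"
      using \<theta> by (simp add: fn)
    show "AE y in lborel. integrable lborel (\<lambda>\<xi>. case (y, \<xi>) of (y, \<xi>) \<Rightarrow> f y \<xi>)"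
      using integrable_cchar[OF m] by (simp add: f_def)
  qed
  have "conv (br_kernel \<beta>) \<theta> x = (\<integral>y. \<integral>\<xi>. f y \<xi> \<partial>lborel \<partial>lborel)"
    unfolding conv_def br_kernel_def fourier_cchar f_def m_def[symmetric]
    using integrable_cchar[OF m] by (simp add: mult.commute)
  also have "\<dots> = (\<integral>\<xi>. \<integral>y. f y \<xi> \<partial>lborel \<partial>lborel)"
    using lborel_pair.Fubini_integral[OF int] by simp
  also have "\<dots> = (\<integral>\<xi>. m \<xi> * cchar (\<xi> \<bullet> x) * fourier \<theta> (- \<xi>) \<partial>lborel)"
  proof (intro Bochner_Integration.integral_cong refl)
    fix \<xi>
    have "f y \<xi> = m \<xi> * cchar (\<xi> \<bullet> x) * (\<theta> y * cchar (y \<bullet> (- \<xi>)))" for y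
    proof -
      have "\<xi> \<bullet> (x - y) = \<xi> \<bullet> x + y \<bullet> (- \<xi>)" by (simp add: inner_diff_right inner_commute)
      then show ?thesis unfolding f_def by (simp only: cchar_add mult_ac)
    qed
    then show "(\<integral>y. f y \<xi> \<partial>lborel) = m \<xi> * cchar (\<xi> \<bullet> x) * fourier \<theta> (- \<xi>)"
      by (simp add: fourier_cchar del: inner_minus_right)
  qed
  finally show ?thesis by (simp add: m_def)
qed

lemma br_multiplier_outside: "1 < norm \<xi> \<Longrightarrow> br_multiplier \<beta> \<xi> = 0"
  by (simp add: br_multiplier_eq br_weight_outside)

text \<open>The multiplier lives in the closed unit ball, where the cutoff has transform 1, so
  inserting the cutoff leaves the integrand unchanged.\<close>

lemma conv_br_kernel_cutoff:
  fixes \<psi> :: "'a::euclidean_space \<Rightarrow> complex"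
  assumes \<beta>: "0 \<le> \<beta>" and \<psi>: "\<psi> \<in> schwartz" "\<And>\<xi>. norm \<xi> \<le> 1 \<Longrightarrow> fourier \<psi> \<xi> = 1"
  shows "conv (br_kernel \<beta>) \<psi> = br_kernel \<beta>"
proof
  fix x
  have eq: "br_multiplier \<beta> \<xi> * cchar (\<xi> \<bullet> x) * fourier \<psi> (- \<xi>) = br_multiplier \<beta> \<xi> * cchar (\<xi> \<bullet> x)" for \<xi>
    using \<psi>(2)[of "- \<xi>"] by (cases "norm \<xi> \<le> 1") (auto simp: br_multiplier_outside)
  show "conv (br_kernel \<beta>) \<psi> x = br_kernel \<beta> x"
    unfolding conv_br_kernel[OF \<beta> schwartz_integrable[OF \<psi>(1)]] eq
    unfolding br_kernel_def fourier_cchar ..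
qed

text \<open>The Laplacian times \<open>- 1 / (2 * pi)\<^sup>2\<close> has symbol
  \<open>(norm \<xi>)\<^sup>2\<close>, and polynomials are built by Horner's scheme, one coefficient
  per induction step. The function \<open>\<psi>\<close> stands in for the delta distribution, whose
  transform would be 1.\<close>

lemma schwartz_radial_symbol:
  fixes \<psi> :: "'a::euclidean_space \<Rightarrow> complex"
  assumes \<psi>: "\<psi> \<in> schwartz"
  shows "\<exists>\<theta>\<in>schwartz. \<forall>\<xi>. fourier \<theta> \<xi> = of_real (poly q ((norm \<xi>)\<^sup>2)) * fourier \<psi> \<xi>"
proof (induction q)
  case 0
  show ?case by (rule bexI[OF _ schwartz_zero]) (simp add: fourier_cchar)
next
  case (pCons a q)
  then obtain \<theta> where \<theta>: "\<theta> \<in> schwartz" "\<And>\<xi>. fourier \<theta> \<xi> = of_real (poly q ((norm \<xi>)\<^sup>2)) * fourier \<psi> \<xi>"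
    by blast
  define \<Delta> where "\<Delta> x = (\<Sum>b\<in>Basis. iter_partial [b, b] \<theta> x)" for x
  have it: "iter_partial [b, b] \<theta> \<in> schwartz" if "b \<in> Basis" for b
    using that by (intro schwartz_iter_partial \<theta>) simp
  have \<Delta>s: "\<Delta> \<in> schwartz" unfolding \<Delta>_def[abs_def] by (intro schwartz_sum it) auto
  have F\<Delta>: "fourier \<Delta> \<xi> = of_real (- (2 * pi)\<^sup>2 * (norm \<xi>)\<^sup>2) * fourier \<theta> \<xi>" for \<xi>
  proof -
    have "fourier \<Delta> \<xi> = (\<Sum>b\<in>Basis. fourier (iter_partial [b, b] \<theta>) \<xi>)"
      unfolding \<Delta>_def[abs_def] by (intro fourier_sum schwartz_integrable it)
    also have "\<dots> = (\<Sum>b\<in>Basis. of_real (- (2 * pi)\<^sup>2 * (b \<bullet> \<xi>)\<^sup>2) * fourier \<theta> \<xi>)"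
      by (intro sum.cong refl) (simp add: fourier_iter_partial \<theta> power2_eq_square)
    also have "\<dots> = of_real (- (2 * pi)\<^sup>2 * (\<Sum>b\<in>Basis. (b \<bullet> \<xi>)\<^sup>2)) * fourier \<theta> \<xi>"
      by (simp only: sum_distrib_left of_real_sum sum_distrib_right)
    also have "(\<Sum>b\<in>Basis. (b \<bullet> \<xi>)\<^sup>2) = (norm \<xi>)\<^sup>2"
      using euclidean_inner[of \<xi> \<xi>] unfolding power2_norm_eq_inner by (simp add: power2_eq_square inner_commute)
    finally show ?thesis .
  qed
  let ?\<theta> = "\<lambda>x. of_real a * \<psi> x + of_real (- 1 / (2 * pi)\<^sup>2) * \<Delta> x"
  have s: "?\<theta> \<in> schwartz" by (intro schwartz_add schwartz_cmult \<psi> \<Delta>s)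
  have "fourier ?\<theta> \<xi> = of_real (poly (pCons a q) ((norm \<xi>)\<^sup>2)) * fourier \<psi> \<xi>" for \<xi>
  proof -
    have "fourier ?\<theta> \<xi> = of_real a * fourier \<psi> \<xi> + of_real (- 1 / (2 * pi)\<^sup>2) * fourier \<Delta> \<xi>"
      by (simp only: fourier_add[OF schwartz_integrable[OF schwartz_cmult[OF \<psi>]] schwartz_integrable[OF schwartz_cmult[OF \<Delta>s]]] fourier_cmult)
    also have "of_real (- 1 / (2 * pi)\<^sup>2) * fourier \<Delta> \<xi> = of_real ((- 1 / (2 * pi)\<^sup>2) * (- (2 * pi)\<^sup>2 * (norm \<xi>)\<^sup>2)) * fourier \<theta> \<xi>"
      unfolding F\<Delta> by (simp only: of_real_mult mult.assoc)
    also have "(- 1 / (2 * pi)\<^sup>2) * (- (2 * pi)\<^sup>2 * (norm \<xi>)\<^sup>2) = (norm \<xi>)\<^sup>2" by simp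
    finally show ?thesis by (simp add: \<theta>(2) distrib_right mult.assoc)
  qed
  with s show ?case by blast
qed

text \<open>The polynomials \<open>1 - x\<close> and \<open>x ^ M\<close> are coprime by the
  geometric sum. Multiplying the first term of the relation for \<open>J\<close> by
  \<open>1 = (1 - x) * poly s x + x ^ M\<close> raises the power of \<open>1 - x\<close> by
  one.\<close>

lemma poly_bezout_powers:
  "\<exists>q r :: real poly. \<forall>x. (1 - x) ^ J * poly q x + x ^ M * poly r x = 1"
proof (induction J)
  case 0
  show ?case by (rule exI[of _ 1], rule exI[of _ 0]) simp
next
  case (Suc J)
  then obtain q r :: "real poly" where qr: "\<And>x. (1 - x) ^ J * poly q x + x ^ M * poly r x = 1" by blast
  define s :: "real poly" where "s = (\<Sum>i<M. monom 1 i)"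
  have s: "(1 - x) * poly s x + x ^ M = 1" for x
    using one_diff_power_eq[of x M] by (simp add: s_def poly_sum poly_monom)
  have "(1 - x) ^ Suc J * poly (q * s) x + x ^ M * poly ([:1, -1:] ^ J * q + r) x = 1" for x
  proof -
    have "(1 - x) ^ Suc J * poly (q * s) x + x ^ M * poly ([:1, -1:] ^ J * q + r) x =
        ((1 - x) ^ J * poly q x) * ((1 - x) * poly s x + x ^ M) + x ^ M * poly r x"
      by (simp add: algebra_simps)
    then show ?thesis using s[of x] qr[of x] by simp
  qed
  then show ?case by blast
qed

text \<open>
  The identity \<open>1 = (1 - \<rho>) ^ J * q \<rho> + \<rho> ^ M * r \<rho>\<close> at \<open>\<rho> = (norm \<xi>)\<^sup>2\<close> splits the multiplier:
  the first part has a kernel of arbitrarily fast decay, the second one is a sum of derivatives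
  of order \<open>2 * M\<close>.
\<close>

lemma br_kernel_decomposition:
  fixes \<psi> :: "'a::euclidean_space \<Rightarrow> complex"
  assumes \<beta>: "0 \<le> \<beta>" and \<psi>: "\<psi> \<in> schwartz" "\<And>\<xi>. norm \<xi> \<le> 1 \<Longrightarrow> fourier \<psi> \<xi> = 1"
  obtains \<theta>0 \<theta>1 where "\<theta>0 \<in> schwartz" "\<theta>1 \<in> schwartz"
    "\<And>x::'a. br_kernel \<beta> x = conv (br_kernel (\<beta> + real J)) \<theta>0 x +
      conv (br_kernel \<beta>) (\<lambda>x. \<Sum>bs | bs \<in> lists Basis \<and> length bs = M. iter_partial bs (iter_partial bs \<theta>1) x) x"
proof -
  obtain q r :: "real poly" where qr: "\<And>x. (1 - x) ^ J * poly q x + x ^ M * poly r x = 1"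
    using poly_bezout_powers by metis
  obtain \<theta>0 where \<theta>0: "\<theta>0 \<in> schwartz" "\<And>\<xi>. fourier \<theta>0 \<xi> = of_real (poly q ((norm \<xi>)\<^sup>2)) * fourier \<psi> \<xi>"
    using schwartz_radial_symbol[OF \<psi>(1)] by metis
  obtain \<theta>r where \<theta>r: "\<theta>r \<in> schwartz" "\<And>\<xi>. fourier \<theta>r \<xi> = of_real (poly r ((norm \<xi>)\<^sup>2)) * fourier \<psi> \<xi>"
    using schwartz_radial_symbol[OF \<psi>(1)] by metis
  \<comment> \<open>The constant cancels the factor \<open>(- (2 * pi)\<^sup>2) ^ M\<close> produced
    by \<open>2 * M\<close> differentiations.\<close>
  define \<theta>1 where "\<theta>1 x = of_real (1 / (- (2 * pi)\<^sup>2) ^ M) * \<theta>r x" for x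
  have \<theta>1: "\<theta>1 \<in> schwartz" unfolding \<theta>1_def[abs_def] by (intro schwartz_cmult \<theta>r)
  let ?S = "{bs. bs \<in> lists (Basis :: 'a set) \<and> length bs = M}"
  let ?\<theta>2 = "\<lambda>x. \<Sum>bs\<in>?S. iter_partial bs (iter_partial bs \<theta>1) x"
  have it: "iter_partial bs (iter_partial bs \<theta>1) \<in> schwartz" if "bs \<in> ?S" for bs
    using that by (intro schwartz_iter_partial \<theta>1) auto
  have \<theta>2: "?\<theta>2 \<in> schwartz" by (intro schwartz_sum it finite_lists_of_length)
  have F2: "fourier ?\<theta>2 \<xi> = of_real (((norm \<xi>)\<^sup>2) ^ M * poly r ((norm \<xi>)\<^sup>2)) * fourier \<psi> \<xi>" for \<xi>
  proof -
    let ?c = "\<lambda>b. 2 * complex_of_real pi * \<i> * of_real (b \<bullet> \<xi>)"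
    have "fourier ?\<theta>2 \<xi> = (\<Sum>bs\<in>?S. fourier (iter_partial bs (iter_partial bs \<theta>1)) \<xi>)"
      by (intro fourier_sum schwartz_integrable it)
    also have "\<dots> = (\<Sum>bs\<in>?S. (\<Prod>b\<leftarrow>bs. ?c b * ?c b) * fourier \<theta>1 \<xi>)"
    proof (rule sum.cong[OF refl])
      fix bs assume bs: "bs \<in> ?S"
      have "(\<Prod>b\<leftarrow>bs. ?c b) * (\<Prod>b\<leftarrow>bs. ?c b) = (\<Prod>b\<leftarrow>bs. ?c b * ?c b)"
        by (induction bs) (simp_all add: mult_ac)
      then show "fourier (iter_partial bs (iter_partial bs \<theta>1)) \<xi> = (\<Prod>b\<leftarrow>bs. ?c b * ?c b) * fourier \<theta>1 \<xi>"
        using bs by (simp add: fourier_iter_partial schwartz_iter_partial \<theta>1 mult.assoc[symmetric])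
    qed
    also have "\<dots> = (\<Sum>b\<in>Basis. ?c b * ?c b) ^ M * fourier \<theta>1 \<xi>"
      by (simp only: sum_distrib_right[symmetric] sum_lists_prod[OF finite_Basis])
    also have "(\<Sum>b\<in>Basis. ?c b * ?c b) = (\<Sum>b\<in>Basis. of_real (- (2 * pi)\<^sup>2 * (b \<bullet> \<xi>)\<^sup>2))"
      by (intro sum.cong refl) (simp add: power2_eq_square)
    also have "\<dots> = of_real (- (2 * pi)\<^sup>2 * (\<Sum>b\<in>Basis. (b \<bullet> \<xi>)\<^sup>2))"
      by (simp only: sum_distrib_left of_real_sum)
    also have "(\<Sum>b\<in>Basis. (b \<bullet> \<xi>)\<^sup>2) = (norm \<xi>)\<^sup>2"
      using euclidean_inner[of \<xi> \<xi>] unfolding power2_norm_eq_inner by (simp add: power2_eq_square inner_commute)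
    also have "fourier \<theta>1 \<xi> = of_real (1 / (- (2 * pi)\<^sup>2) ^ M) * fourier \<theta>r \<xi>"
      unfolding \<theta>1_def[abs_def] by (rule fourier_cmult)
    also have "of_real (- (2 * pi)\<^sup>2 * (norm \<xi>)\<^sup>2) ^ M * (of_real (1 / (- (2 * pi)\<^sup>2) ^ M) * fourier \<theta>r \<xi>) =
        of_real ((- (2 * pi)\<^sup>2 * (norm \<xi>)\<^sup>2) ^ M * (1 / (- (2 * pi)\<^sup>2) ^ M)) * fourier \<theta>r \<xi>"
      by (simp only: of_real_mult of_real_power mult.assoc)
    also have "(- (2 * pi)\<^sup>2 * (norm \<xi>)\<^sup>2) ^ M * (1 / (- (2 * pi)\<^sup>2) ^ M) = ((norm \<xi>)\<^sup>2) ^ M"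
      by (simp only: power_mult_distrib) simp
    finally show ?thesis by (simp only: \<theta>r(2) of_real_mult mult.assoc)
  qed
  \<comment> \<open>Each factor \<open>1 - (norm \<xi>)\<^sup>2\<close> raises the order of the
    multiplier by one, and with it the decay of the kernel by one power.\<close>
  have weight: "br_weight (\<beta> + real j) \<xi> = (1 - (norm \<xi>)\<^sup>2) ^ j * br_weight \<beta> \<xi>" for j and \<xi> :: 'a
  proof (induction j)
    case (Suc j)
    have "br_weight (\<beta> + real (Suc j)) \<xi> = (1 - (norm \<xi>)\<^sup>2) * br_weight (\<beta> + real j) \<xi>"
      using br_weight_Suc[of "\<beta> + real j" \<xi>] by (simp add: add_ac)
    then show ?case using Suc by (simp add: mult_ac)
  qed simp
  have main: "br_kernel \<beta> x = conv (br_kernel (\<beta> + real J)) \<theta>0 x + conv (br_kernel \<beta>) ?\<theta>2 x" for x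
  proof -
    have bd: "integrable lborel (\<lambda>\<xi>. br_multiplier \<beta>' \<xi> * cchar (\<xi> \<bullet> x) * fourier \<theta> (- \<xi>))"
      if "0 \<le> \<beta>'" and \<theta>: "\<theta> \<in> schwartz" for \<beta>' and \<theta> :: "'a \<Rightarrow> complex"
    proof (rule Bochner_Integration.integrable_bound[where f="\<lambda>\<xi>. (\<integral>x. norm (\<theta> x) \<partial>lborel) * norm (br_multiplier \<beta>' \<xi>)"])
      have [measurable]: "\<theta> \<in> borel_measurable borel" by (rule schwartz_measurable[OF \<theta>])
      show "integrable lborel (\<lambda>\<xi>. (\<integral>x. norm (\<theta> x) \<partial>lborel) * norm (br_multiplier \<beta>' \<xi> :: complex))"
        by (intro integrable_mult_right integrable_norm br_multiplier_integrable that)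
      show "(\<lambda>\<xi>. br_multiplier \<beta>' \<xi> * cchar (\<xi> \<bullet> x) * fourier \<theta> (- \<xi>)) \<in> borel_measurable lborel"
        unfolding fourier_cchar by measurable
      have "norm (fourier \<theta> \<xi>) \<le> (\<integral>x. norm (\<theta> x) \<partial>lborel)" for \<xi>
        unfolding fourier_cchar using integral_norm_bound[of lborel "\<lambda>x. \<theta> x * cchar (x \<bullet> \<xi>)"]
        by (simp add: norm_mult)
      then show "AE \<xi> in lborel. norm (br_multiplier \<beta>' \<xi> * cchar (\<xi> \<bullet> x) * fourier \<theta> (- \<xi>)) \<le>
          norm ((\<integral>x. norm (\<theta> x) \<partial>lborel) * norm (br_multiplier \<beta>' \<xi> :: complex))"
        by (auto simp: norm_mult abs_mult mult.commute intro!: AE_I2 mult_left_mono order_trans[OF _ abs_ge_self])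
    qed
    have "conv (br_kernel (\<beta> + real J)) \<theta>0 x + conv (br_kernel \<beta>) ?\<theta>2 x =
       (\<integral>\<xi>. br_multiplier (\<beta> + real J) \<xi> * cchar (\<xi> \<bullet> x) * fourier \<theta>0 (- \<xi>) +
          br_multiplier \<beta> \<xi> * cchar (\<xi> \<bullet> x) * fourier ?\<theta>2 (- \<xi>) \<partial>lborel)"
      using \<beta> bd[OF _ \<theta>0(1), of "\<beta> + real J"] bd[OF \<beta> \<theta>2]
      by (simp add: conv_br_kernel schwartz_integrable \<theta>0(1) \<theta>2)
    also have "\<dots> = (\<integral>\<xi>. br_multiplier \<beta> \<xi> * cchar (\<xi> \<bullet> x) \<partial>lborel)"
    proof (intro Bochner_Integration.integral_cong refl)
      \<comment> \<open>Outside the unit ball both multipliers vanish; inside, the cutoff has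
        transform 1 and the polynomial identity applies.\<close>
      fix \<xi> :: 'a
      show "br_multiplier (\<beta> + real J) \<xi> * cchar (\<xi> \<bullet> x) * fourier \<theta>0 (- \<xi>) +
          br_multiplier \<beta> \<xi> * cchar (\<xi> \<bullet> x) * fourier ?\<theta>2 (- \<xi>) = br_multiplier \<beta> \<xi> * cchar (\<xi> \<bullet> x)"
      proof (cases "norm \<xi> \<le> 1")
        case True
        let ?\<rho> = "(norm \<xi>)\<^sup>2"
        have \<psi>1: "fourier \<psi> (- \<xi>) = 1" using True \<psi>(2)[of "- \<xi>"] by simp
        have "br_multiplier (\<beta> + real J) \<xi> * cchar (\<xi> \<bullet> x) * fourier \<theta>0 (- \<xi>) +
          br_multiplier \<beta> \<xi> * cchar (\<xi> \<bullet> x) * fourier ?\<theta>2 (- \<xi>) =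
          br_multiplier \<beta> \<xi> * cchar (\<xi> \<bullet> x) * of_real ((1 - ?\<rho>) ^ J * poly q ?\<rho> + ?\<rho> ^ M * poly r ?\<rho>)"
          unfolding F2 \<theta>0(2) \<psi>1 br_multiplier_eq weight
          by (simp only: of_real_mult of_real_add norm_minus_cancel mult_1_left mult_1_right distrib_left mult_ac)
        then show ?thesis by (simp only: qr) simp
      qed (simp add: br_multiplier_outside)
    qed
    finally show ?thesis by (simp add: br_kernel_def fourier_cchar)
  qed
  show thesis by (rule that[OF \<theta>0(1) \<theta>1 main])
qed

text \<open>In particular, the Bochner-Riesz operator does not depend on the cutoff \<open>\<psi>'\<close>.\<close>

lemma br_operator_decomposition:
  fixes f :: "'a::euclidean_space distribution" and \<psi>' :: "'a \<Rightarrow> complex"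
  assumes \<beta>: "(real DIM('a) - 1) / 2 < \<beta>" "0 < \<beta>"
    and f: "tempered f" and bdd: "\<And>\<phi>. \<phi> \<in> schwartz \<Longrightarrow> \<exists>B. \<forall>z. norm (conv_distr \<phi> f z) \<le> B"
    and dec: "\<And>x. br_kernel \<beta> x = conv (br_kernel (\<beta> + real J)) \<theta>0 x + conv (br_kernel \<beta>) \<theta>2 x"
    and \<theta>: "\<theta>0 \<in> schwartz" "\<theta>2 \<in> schwartz"
    and \<psi>': "\<psi>' \<in> schwartz" "\<And>\<xi>. norm \<xi> \<le> 1 \<Longrightarrow> fourier \<psi>' \<xi> = 1"
  shows "conv (br_kernel \<beta>) (conv_distr \<psi>' f) x =
    conv (br_kernel (\<beta> + real J)) (conv_distr \<theta>0 f) x + conv (br_kernel \<beta>) (conv_distr \<theta>2 f) x"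
proof -
  let ?K = "br_kernel \<beta> :: 'a \<Rightarrow> complex" and ?KJ = "br_kernel (\<beta> + real J) :: 'a \<Rightarrow> complex"
  have K: "integrable lborel ?K" "integrable lborel ?KJ"
    by (rule br_kernel_integrable; use \<beta> of_nat_0_le_iff[of J] in linarith)+
  \<comment> \<open>The cutoff \<open>\<psi>'\<close> is exchanged for \<open>\<theta>\<close>: the
    two smoothings of \<open>f\<close> commute, after which the kernel absorbs
    \<open>\<psi>'\<close>. Boundedness of the smoothed distributions justifies
    associativity.\<close>
  have swap: "conv (conv (br_kernel \<beta>') \<theta>) (conv_distr \<psi>' f) = conv (br_kernel \<beta>') (conv_distr \<theta> f)"
    if Ki: "integrable lborel (br_kernel \<beta>' :: 'a \<Rightarrow> complex)" and \<beta>': "0 \<le> \<beta>'" and \<theta>: "\<theta> \<in> schwartz" for \<beta>' and \<theta> :: "'a \<Rightarrow> complex"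
  proof -
    obtain B where B: "\<And>z. norm (conv_distr \<psi>' f z) \<le> B" using bdd[OF \<psi>'(1)] by blast
    obtain B' where B': "\<And>z. norm (conv_distr \<theta> f z) \<le> B'" using bdd[OF \<theta>] by blast
    have "conv (conv (br_kernel \<beta>') \<theta>) (conv_distr \<psi>' f) = conv (br_kernel \<beta>') (conv \<theta> (conv_distr \<psi>' f))"
      by (rule conv_assoc[OF Ki schwartz_integrable[OF \<theta>] conv_distr_measurable[OF f \<psi>'(1)] B, symmetric])
    also have "conv \<theta> (conv_distr \<psi>' f) = conv_distr (conv \<theta> \<psi>') f"
      by (rule conv_distr_conv[OF f schwartz_rapid[OF \<theta>] \<psi>'(1), symmetric])
    also have "conv \<theta> \<psi>' = conv \<psi>' \<theta>" by (rule conv_commute)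
    also have "conv_distr (conv \<psi>' \<theta>) f = conv \<psi>' (conv_distr \<theta> f)"
      by (rule conv_distr_conv[OF f schwartz_rapid[OF \<psi>'(1)] \<theta>])
    also have "conv (br_kernel \<beta>') (conv \<psi>' (conv_distr \<theta> f)) = conv (conv (br_kernel \<beta>') \<psi>') (conv_distr \<theta> f)"
      by (rule conv_assoc[OF Ki schwartz_integrable[OF \<psi>'(1)] conv_distr_measurable[OF f \<theta>] B'])
    also have "conv (br_kernel \<beta>') \<psi>' = br_kernel \<beta>'" by (rule conv_br_kernel_cutoff[OF \<beta>' \<psi>'])
    finally show ?thesis .
  qed
  obtain B where B: "\<And>z. norm (conv_distr \<psi>' f z) \<le> B" using bdd[OF \<psi>'(1)] by blast
  have int: "integrable lborel (\<lambda>y. conv k \<theta> (x - y) * conv_distr \<psi>' f y)"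
    if k: "integrable lborel k" and \<theta>: "\<theta> \<in> schwartz" for k \<theta> :: "'a \<Rightarrow> complex"
  proof -
    have "integrable lborel (conv k \<theta>)" using conv_integrable[OF k schwartz_integrable[OF \<theta>]] .
    then show ?thesis by (rule conv_integrable_bounded[OF _ conv_distr_measurable[OF f \<psi>'(1)] B])
  qed
  have "conv ?K (conv_distr \<psi>' f) x = (\<integral>y. (conv ?KJ \<theta>0 (x - y) + conv ?K \<theta>2 (x - y)) * conv_distr \<psi>' f y \<partial>lborel)"
    unfolding conv_def[of ?K "conv_distr \<psi>' f"] dec[symmetric] ..
  also have "\<dots> = conv (conv ?KJ \<theta>0) (conv_distr \<psi>' f) x + conv (conv ?K \<theta>2) (conv_distr \<psi>' f) x"
    unfolding conv_def[of "conv ?KJ \<theta>0"] conv_def[of "conv ?K \<theta>2"] distrib_right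
    by (intro Bochner_Integration.integral_add int K \<theta>)
  also have "\<dots> = conv ?KJ (conv_distr \<theta>0 f) x + conv ?K (conv_distr \<theta>2 f) x"
    using swap[OF K(2) _ \<theta>(1)] swap[OF K(1) _ \<theta>(2)] \<beta> by simp
  finally show ?thesis .
qed

section \<open>A weak-type estimate\<close>

text \<open>A pointwise value is bounded by an average: \<open>v z powr q\<close> is at most
  \<open>V w powr q\<close> for every \<open>w\<close> in the unit ball around \<open>z\<close>,
  hence at most \<open>I / b\<close>. Splitting \<open>v\<close> as
  \<open>v powr (1 - q) * v powr q\<close> then gives an \<open>L powr 1\<close> bound, which an
  \<open>L powr q\<close> bound with \<open>q < 1\<close> alone could not.\<close>

lemma nn_integral_local_sup:
  fixes v V :: "'a::euclidean_space \<Rightarrow> real"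
  assumes q: "0 < q" "q < 1"
    and [measurable]: "v \<in> borel_measurable borel" "V \<in> borel_measurable borel"
    and v0: "\<And>z. 0 \<le> v z" and vV: "\<And>z w. norm (z - w) < 1 \<Longrightarrow> v z \<le> V w"
    and I: "(\<integral>\<^sup>+w. ennreal (V w powr q) \<partial>lborel) \<le> ennreal I" "0 \<le> I"
  shows "(\<integral>\<^sup>+z. ennreal (v z) \<partial>lborel) \<le> ennreal ((I / measure lborel (ball (0::'a) 1)) powr ((1 - q) / q) * I)"
proof -
  define b where "b = measure lborel (ball (0::'a) 1)"
  have b: "0 < b" by (simp add: b_def)
  have V0: "0 \<le> V w" for w using v0[of w] vV[of w w] by simp
  have vq: "v z powr q \<le> I / b" for z
  proof -
    have "ennreal (v z powr q * b) = ennreal (v z powr q) * emeasure lborel (ball z 1)"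
      by (simp add: ennreal_mult b_def emeasure_ball content_ball)
    also have "\<dots> = (\<integral>\<^sup>+w. ennreal (v z powr q) * indicator (ball z 1) w \<partial>lborel)"
      by (simp add: nn_integral_cmult_indicator)
    also have "\<dots> \<le> (\<integral>\<^sup>+w. ennreal (V w powr q) \<partial>lborel)"
      using q v0 by (intro nn_integral_mono)
        (auto simp: indicator_def dist_norm intro!: ennreal_leI powr_mono2 vV)
    also have "\<dots> \<le> ennreal I" by (rule I)
    finally have "v z powr q * b \<le> I" using I(2) by (simp add: ennreal_le_iff)
    then show ?thesis using b by (simp add: pos_le_divide_eq)
  qed
  define m where "m = (I / b) powr ((1 - q) / q)"
  have m0: "0 \<le> m" by (simp add: m_def)
  have v1q: "v z powr (1 - q) \<le> m" for z
  proof -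
    have "(v z powr q) powr ((1 - q) / q) \<le> m"
      unfolding m_def using q vq by (intro powr_mono2) auto
    then show ?thesis using q by (simp add: powr_powr)
  qed
  have vm: "v z \<le> m * V z powr q" for z
  proof (cases "v z = 0")
    case False
    then have "v z = v z powr (1 - q) * v z powr q"
      using v0[of z] by (simp add: powr_add[symmetric])
    also have "\<dots> \<le> m * V z powr q"
      using v1q[of z] vV[of z z] v0[of z] q by (intro mult_mono powr_mono2) (auto simp: m_def)
    finally show ?thesis .
  qed (simp add: m_def)
  have "(\<integral>\<^sup>+z. ennreal (v z) \<partial>lborel) \<le> (\<integral>\<^sup>+z. ennreal m * ennreal (V z powr q) \<partial>lborel)"
    using vm m0 by (intro nn_integral_mono) (simp add: ennreal_mult'[symmetric] ennreal_leI)
  also have "\<dots> = ennreal m * (\<integral>\<^sup>+z. ennreal (V z powr q) \<partial>lborel)"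
    by (simp add: nn_integral_cmult)
  also have "\<dots> \<le> ennreal m * ennreal I" by (intro mult_left_mono I) auto
  also have "\<dots> = ennreal (m * I)" using I(2) by (simp add: ennreal_mult m_def)
  finally show ?thesis by (simp add: m_def b_def)
qed

text \<open>Slicing at the levels \<open>2 ^ j * \<mu>\<close>, the weak estimate turns the slices
  into a geometric series with ratio \<open>2 powr (q - p)\<close>, convergent because
  \<open>q < p\<close>; the factor \<open>1 / (1 - 2 powr (q - p))\<close> is its sum.\<close>

lemma nn_integral_tail_powr:
  fixes G :: "'a::euclidean_space \<Rightarrow> real"
  assumes q: "0 < q" "q < p" and [measurable]: "G \<in> borel_measurable borel" and A: "0 < A" and \<mu>: "0 < \<mu>"
    and weak: "\<And>r. 0 < r \<Longrightarrow> emeasure lborel {w. r < G w} \<le> ennreal ((A / r) powr p)"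
  shows "(\<integral>\<^sup>+w. ennreal (if \<mu> < G w then G w powr q else 0) \<partial>lborel) \<le>
    ennreal (2 powr q * (1 / (1 - 2 powr (q - p))) * A powr p * \<mu> powr (q - p))"
proof -
  define u where "u j w = ennreal ((2 ^ Suc j * \<mu>) powr q) * indicator {w. 2 ^ j * \<mu> < G w} w" for j w
  have set [measurable]: "{w. 2 ^ j * \<mu> < G w} \<in> sets lborel" for j by measurable
  have um: "u j \<in> borel_measurable lborel" for j
    unfolding u_def[abs_def] by (intro borel_measurable_times_ennreal borel_measurable_indicator set) auto
  have le: "ennreal (if \<mu> < G w then G w powr q else 0) \<le> (\<Sum>j. u j w)" for w
  proof (cases "\<mu> < G w")
    case True
    have ex: "\<exists>j. G w \<le> 2 ^ Suc j * \<mu>"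
    proof -
      obtain j where "G w / \<mu> < 2 ^ j" using real_arch_pow[of 2 "G w / \<mu>"] by auto
      then have "G w < 2 ^ j * \<mu>" using \<mu> by (simp add: divide_less_eq)
      also have "2 ^ j * \<mu> \<le> 2 ^ Suc j * \<mu>" using \<mu> by simp
      finally show ?thesis by (intro exI[of _ j]) simp
    qed
    \<comment> \<open>Minimality also yields the lower bound \<open>2 ^ j * \<mu> < G w\<close>; for
      \<open>j = 0\<close> this is the case assumption on \<open>w\<close>.\<close>
    define j where "j = (LEAST j. G w \<le> 2 ^ Suc j * \<mu>)"
    have j: "G w \<le> 2 ^ Suc j * \<mu>" unfolding j_def by (rule LeastI_ex[OF ex])
    have j2: "2 ^ j * \<mu> < G w"
    proof (cases j)
      case (Suc k)
      then have "\<not> G w \<le> 2 ^ Suc k * \<mu>" using not_less_Least[of k "\<lambda>j. G w \<le> 2 ^ Suc j * \<mu>"] by (simp add: j_def)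
      then show ?thesis using Suc by simp
    qed (use True in simp)
    have "G w powr q \<le> (2 ^ Suc j * \<mu>) powr q" using j q True \<mu> by (intro powr_mono2) auto
    then have "ennreal (if \<mu> < G w then G w powr q else 0) \<le> u j w"
      using True j2 by (simp add: u_def ennreal_leI)
    also have "\<dots> \<le> (\<Sum>j. u j w)"
      using sum_le_suminf[of "\<lambda>j. u j w" "{j}"] by simp
    finally show ?thesis .
  qed simp
  have "(\<integral>\<^sup>+w. ennreal (if \<mu> < G w then G w powr q else 0) \<partial>lborel) \<le> (\<integral>\<^sup>+w. (\<Sum>j. u j w) \<partial>lborel)"
    by (intro nn_integral_mono le)
  also have "\<dots> = (\<Sum>j. \<integral>\<^sup>+w. u j w \<partial>lborel)" by (rule nn_integral_suminf) (rule um)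
  also have "\<dots> \<le> (\<Sum>j. ennreal (2 powr q * A powr p * \<mu> powr (q - p) * (2 powr (q - p)) ^ j))"
  proof (intro suminf_le summableI)
    fix j
    have "(\<integral>\<^sup>+w. u j w \<partial>lborel) = ennreal ((2 ^ Suc j * \<mu>) powr q) * emeasure lborel {w. 2 ^ j * \<mu> < G w}"
      unfolding u_def by (rule nn_integral_cmult_indicator[OF set])
    also have "\<dots> \<le> ennreal ((2 ^ Suc j * \<mu>) powr q) * ennreal ((A / (2 ^ j * \<mu>)) powr p)"
      using \<mu> by (intro mult_left_mono weak) auto
    also have "\<dots> = ennreal ((2 ^ Suc j * \<mu>) powr q * (A / (2 ^ j * \<mu>)) powr p)"
      by (simp add: ennreal_mult)
    also have "(2 ^ Suc j * \<mu>) powr q * (A / (2 ^ j * \<mu>)) powr p = 2 powr q * A powr p * \<mu> powr (q - p) * (2 powr (q - p)) ^ j"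
    proof -
      define t where "t = (2::real) ^ j"
      have t: "0 < t" by (simp add: t_def)
      have "(2 powr (q - p)) ^ j = (2 powr (q - p)) powr real j" by (simp add: powr_realpow)
      also have "\<dots> = (2 powr real j) powr (q - p)" by (simp add: powr_powr mult.commute)
      also have "2 powr real j = t" by (simp add: t_def powr_realpow)
      finally have e: "(2 powr (q - p)) ^ j = t powr q / t powr p" by (simp add: powr_diff)
      have h1: "(2 ^ Suc j * \<mu>) powr q = 2 powr q * t powr q * \<mu> powr q"
        using t \<mu> by (simp add: t_def[symmetric] powr_mult)
      have h2: "(A / (2 ^ j * \<mu>)) powr p = A powr p / (t powr p * \<mu> powr p)"
        using t \<mu> A by (simp add: t_def[symmetric] powr_divide powr_mult)
      show ?thesis unfolding h1 h2 e powr_diff[of \<mu>] by (simp add: divide_inverse mult_ac)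
    qed
    finally show "(\<integral>\<^sup>+w. u j w \<partial>lborel) \<le> ennreal (2 powr q * A powr p * \<mu> powr (q - p) * (2 powr (q - p)) ^ j)" .
  qed
  also have "\<dots> = ennreal (\<Sum>j. 2 powr q * A powr p * \<mu> powr (q - p) * (2 powr (q - p)) ^ j)"
    using q by (intro suminf_ennreal2 summable_mult summable_geometric) (auto simp: powr_less_one)
  also have "(\<Sum>j. 2 powr q * A powr p * \<mu> powr (q - p) * (2 powr (q - p)) ^ j) = 
     2 powr q * A powr p * \<mu> powr (q - p) * (1 / (1 - 2 powr (q - p)))"
    using q by (subst suminf_mult) (auto simp: suminf_geometric powr_less_one summable_geometric)
  finally show ?thesis by (simp only: mult_ac)
qed

text \<open>
  On a weak Lebesgue space with \<open>p \<le> 1\<close> the convolution integral itself need not be finite. It is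
  here, because \<open>g\<close> is controlled by \<open>G\<close> on unit balls; the part of \<open>g\<close> above the level \<open>\<mu>\<close> is
  estimated in \<open>L powr q\<close> for some \<open>q < p\<close>, the part below it trivially.
\<close>

lemma weak_type_decay:
  fixes s p :: real
  assumes p: "0 < p" "p \<le> 1" and s: "real DIM('a::euclidean_space) / p < s"
  obtains C where "0 < C"
    "\<And>(g::'a \<Rightarrow> real) G A \<mu>. \<lbrakk>g \<in> borel_measurable borel; G \<in> borel_measurable borel; \<And>z. 0 \<le> g z;
      \<And>z w. norm (z - w) < 1 \<Longrightarrow> g z \<le> G w; 0 < A;
      \<And>r. 0 < r \<Longrightarrow> emeasure lborel {w. r < G w} \<le> ennreal ((A / r) powr p); 0 < \<mu>\<rbrakk> \<Longrightarrow>
      emeasure lborel {x. ennreal \<mu> < (\<integral>\<^sup>+z. ennreal (decay s (x - z) * g z) \<partial>lborel)} \<le> ennreal (C * (A / \<mu>) powr p)"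
proof -
  let ?n = "real DIM('a)"
  have n0: "0 < ?n" by simp
  have np: "?n < s * p" using s p by (simp add: divide_less_eq)
  have "?n \<le> ?n / p" using p n0 by (simp add: le_divide_eq mult_left_le)
  then have sn: "?n < s" using s by linarith
  then have s0: "0 < s" using n0 by linarith
  \<comment> \<open>The window for \<open>q\<close> is nonempty because \<open>s > n / p\<close>.
    The bound \<open>q > n / s\<close> makes \<open>decay (s * q)\<close> integrable, and
    \<open>q < p\<close> makes the tail of \<open>G\<close> integrable to the power
    \<open>q\<close>.\<close>
  have "?n / s < p" using np s0 by (simp add: divide_less_eq mult.commute)
  then obtain q where q23: "?n / s < q" "q < p" using dense by blast
  have "0 < ?n / s" using n0 s0 by (rule divide_pos_pos)
  then have q: "0 < q" "q < p" "?n / s < q" using q23 by linarith+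
  then have q1: "q < 1" using p by linarith
  have sq: "?n < s * q" using q(3) s0 by (simp add: divide_less_eq mult.commute)
  define D1 where "D1 = (\<integral>(x::'a). decay s x \<partial>lborel)"
  have D1: "(\<integral>\<^sup>+(x::'a). ennreal (decay s x) \<partial>lborel) = ennreal D1" "0 \<le> D1"
    unfolding D1_def using decay_integrable[OF sn] by (auto simp: nn_integral_eq_integral)
  define D2 where "D2 = (\<integral>(x::'a). decay (s * q) x \<partial>lborel)"
  have D2: "(\<integral>\<^sup>+(x::'a). ennreal (decay (s * q) x) \<partial>lborel) = ennreal D2" "0 \<le> D2"
    unfolding D2_def using decay_integrable[OF sq] by (auto simp: nn_integral_eq_integral)
  define b where "b = measure lborel (ball (0::'a) 1)"
  have b: "0 < b" by (simp add: b_def)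
  define \<kappa> where "\<kappa> = (1 / b) powr ((1 - q) / q)"
  have \<kappa>: "0 < \<kappa>" using b by (simp add: \<kappa>_def)
  define T where "T = 2 powr q * (1 / (1 - 2 powr (q - p)))"
  have T: "0 < T" using q by (simp add: T_def powr_less_one)
  define C3 where "C3 = 2 powr (s * q) * D2 * T * \<kappa> powr q"
  have C3: "0 \<le> C3" using D2 T by (simp add: C3_def)
  have main: "emeasure lborel {x. ennreal ((D1 + 1) * \<mu>) < (\<integral>\<^sup>+z. ennreal (decay s (x - z) * g z) \<partial>lborel)} \<le> ennreal (C3 * (A / \<mu>) powr p)"
    if [measurable]: "g \<in> borel_measurable borel" "G \<in> borel_measurable borel" and g0: "\<And>z. 0 \<le> g z"
      and gG: "\<And>z w. norm (z - w) < 1 \<Longrightarrow> g z \<le> G w" and A: "0 < A"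
      and weak: "\<And>r. 0 < r \<Longrightarrow> emeasure lborel {w. r < G w} \<le> ennreal ((A / r) powr p)" and \<mu>: "0 < \<mu>"
    for g G :: "'a \<Rightarrow> real" and A \<mu>
  proof -
    have G0: "0 \<le> G w" for w using g0[of w] gG[of w w] by simp
    define gh where "gh z = (if \<mu> < g z then g z else 0)" for z
    define Gh where "Gh w = (if \<mu> < G w then G w else 0)" for w
    have [measurable]: "gh \<in> borel_measurable borel" "Gh \<in> borel_measurable borel"
      unfolding gh_def[abs_def] Gh_def[abs_def] by measurable
    have Gh0: "0 \<le> Gh w" for w using G0 by (simp add: Gh_def)
    have gh0: "0 \<le> gh z" for z using g0 by (simp add: gh_def)
    \<comment> \<open>A majorant of \<open>decay s (x - z) * gh z\<close> at all points
      \<open>w\<close> within distance 1 of \<open>z\<close>; the factor \<open>2 powr s\<close>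
      pays for moving the weight.\<close>
    define V where "V x w = 2 powr s * decay s (x - w) * Gh w" for x w
    define J where "J x = (\<integral>\<^sup>+w. ennreal (V x w powr q) \<partial>lborel)" for x
    have Vm [measurable]: "(\<lambda>(x, w). V x w) \<in> borel_measurable (lborel \<Otimes>\<^sub>M lborel)"
      unfolding V_def by measurable
    have Jm [measurable]: "J \<in> borel_measurable borel"
      unfolding J_def[abs_def] V_def by measurable
    \<comment> \<open>Solves \<open>(\<nu> / b) powr ((1 - q) / q) * \<nu> = \<mu>\<close>, so that
      \<open>J x \<le> \<nu>\<close> yields exactly \<open>\<mu>\<close> in
      \<open>nn_integral_local_sup\<close>.\<close>
    define \<nu> where "\<nu> = (\<mu> / \<kappa>) powr q"
    have \<nu>: "0 < \<nu>" using \<mu> \<kappa> by (simp add: \<nu>_def)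
    \<comment> \<open>By contradiction: if \<open>J x\<close> is at most \<open>\<nu>\<close>, the
      part of \<open>g\<close> above \<open>\<mu>\<close> contributes at most \<open>\<mu>\<close>
      and the rest at most \<open>D1 * \<mu>\<close>.\<close>
    have sub: "{x. ennreal ((D1 + 1) * \<mu>) < (\<integral>\<^sup>+z. ennreal (decay s (x - z) * g z) \<partial>lborel)} \<subseteq> {x. ennreal \<nu> \<le> J x}"
    proof (rule subsetI, rule CollectI, rule ccontr)
      fix x assume "x \<in> {x. ennreal ((D1 + 1) * \<mu>) < (\<integral>\<^sup>+z. ennreal (decay s (x - z) * g z) \<partial>lborel)}"
      then have x: "ennreal ((D1 + 1) * \<mu>) < (\<integral>\<^sup>+z. ennreal (decay s (x - z) * g z) \<partial>lborel)" by simp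
      assume "\<not> ennreal \<nu> \<le> J x"
      then have J: "J x \<le> ennreal \<nu>" by simp
      have "(\<integral>\<^sup>+z. ennreal (decay s (x - z) * gh z) \<partial>lborel) \<le> ennreal ((\<nu> / b) powr ((1 - q) / q) * \<nu>)"
        unfolding b_def
      proof (rule nn_integral_local_sup[OF q(1) q1, where V="V x"])
        show "V x \<in> borel_measurable borel" unfolding V_def[abs_def] by measurable
        show "(\<integral>\<^sup>+w. ennreal (V x w powr q) \<partial>lborel) \<le> ennreal \<nu>" using J by (simp add: J_def)
        fix z w :: 'a assume zw: "norm (z - w) < 1"
        have "decay s ((x - w) + (w - z)) \<le> 2 powr s * decay s (x - w)"
          using zw s0 by (intro decay_shift) (auto simp: norm_minus_commute)
        then have "decay s (x - z) \<le> 2 powr s * decay s (x - w)" by simp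
        moreover have "gh z \<le> Gh w" using gG[OF zw] G0 by (auto simp: gh_def Gh_def)
        ultimately show "decay s (x - z) * gh z \<le> V x w"
          unfolding V_def using gh0 by (intro mult_mono) auto
      qed (use \<nu> gh0 in auto)
      also have "(\<nu> / b) powr ((1 - q) / q) * \<nu> = \<mu>"
      proof -
        have "(\<nu> / b) powr ((1 - q) / q) = \<nu> powr ((1 - q) / q) * \<kappa>"
          using \<nu> b by (simp add: \<kappa>_def powr_divide)
        moreover have "\<nu> powr ((1 - q) / q) * \<nu> = \<nu> powr (1 / q)"
          using \<nu> q by (simp add: powr_mult_base mult.commute diff_divide_distrib)
        moreover have "\<nu> powr (1 / q) = \<mu> / \<kappa>"
          using q \<mu> \<kappa> by (simp add: \<nu>_def powr_powr)
        ultimately show ?thesis using \<kappa> by (simp add: mult_ac)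
      qed
      finally have high: "(\<integral>\<^sup>+z. ennreal (decay s (x - z) * gh z) \<partial>lborel) \<le> ennreal \<mu>" .
      have "(\<integral>\<^sup>+z. ennreal (decay s (x - z) * g z) \<partial>lborel) \<le>
          (\<integral>\<^sup>+z. ennreal \<mu> * ennreal (decay s (x - z)) + ennreal (decay s (x - z) * gh z) \<partial>lborel)"
      proof (rule nn_integral_mono)
        fix z
        have "decay s (x - z) * g z \<le> \<mu> * decay s (x - z) + decay s (x - z) * gh z"
          using \<mu> g0[of z] mult_left_mono[of "g z" \<mu> "decay s (x - z)"] by (auto simp: gh_def mult.commute)
        then have "ennreal (decay s (x - z) * g z) \<le> ennreal (\<mu> * decay s (x - z) + decay s (x - z) * gh z)"
          by (rule ennreal_leI)
        then show "ennreal (decay s (x - z) * g z) \<le> ennreal \<mu> * ennreal (decay s (x - z)) + ennreal (decay s (x - z) * gh z)"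
          using \<mu> gh0[of z] by (simp add: ennreal_mult)
      qed
      also have "\<dots> = ennreal \<mu> * (\<integral>\<^sup>+z. ennreal (decay s (x - z)) \<partial>lborel) + (\<integral>\<^sup>+z. ennreal (decay s (x - z) * gh z) \<partial>lborel)"
        by (simp add: nn_integral_add nn_integral_cmult)
      also have "(\<integral>\<^sup>+z. ennreal (decay s (x - z)) \<partial>lborel) = ennreal D1"
        using nn_integral_reflect[of "\<lambda>z. ennreal (decay s z)" x] D1 by simp
      also have "ennreal \<mu> * ennreal D1 + (\<integral>\<^sup>+z. ennreal (decay s (x - z) * gh z) \<partial>lborel) \<le> ennreal \<mu> * ennreal D1 + ennreal \<mu>"
        by (intro add_left_mono high)
      also have "\<dots> = ennreal ((D1 + 1) * \<mu>)"
      proof -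
        have "(D1 + 1) * \<mu> = \<mu> * D1 + \<mu>" by (simp only: distrib_right mult_1_left mult.commute[of D1])
        then show ?thesis using \<mu> D1 by (simp add: ennreal_mult)
      qed
      finally show False using x by (simp add: not_less)
    qed
    \<comment> \<open>Integrating in \<open>x\<close> first leaves \<open>D2\<close> and the tail of
      \<open>G\<close>. Markov's inequality at the level \<open>\<nu>\<close>, a multiple of
      \<open>\<mu> powr q\<close>, then restores the homogeneity
      \<open>(A / \<mu>) powr p\<close>.\<close>
    have "(\<integral>\<^sup>+x. J x \<partial>lborel) \<le> ennreal (2 powr (s * q) * D2 * T * A powr p * \<mu> powr (q - p))"
    proof -
      have "(\<integral>\<^sup>+x. J x \<partial>lborel) = (\<integral>\<^sup>+w. \<integral>\<^sup>+x. ennreal (V x w powr q) \<partial>lborel \<partial>lborel)"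
        unfolding J_def by (rule lborel_pair.Fubini') measurable
      also have "\<dots> = (\<integral>\<^sup>+w. ennreal (2 powr (s * q) * D2) * ennreal (if \<mu> < G w then G w powr q else 0) \<partial>lborel)"
      proof (rule nn_integral_cong)
        fix w
        have "V x w powr q = (2 powr (s * q) * (if \<mu> < G w then G w powr q else 0)) * decay (s * q) (x - w)" for x
          using G0[of w] by (simp add: V_def Gh_def powr_mult powr_powr decay_powr)
        then have "(\<integral>\<^sup>+x. ennreal (V x w powr q) \<partial>lborel) =
            (\<integral>\<^sup>+x. ennreal (2 powr (s * q) * (if \<mu> < G w then G w powr q else 0)) * ennreal (decay (s * q) (x - w)) \<partial>lborel)"
          by (simp add: ennreal_mult)
        also have "\<dots> = ennreal (2 powr (s * q) * (if \<mu> < G w then G w powr q else 0)) * (\<integral>\<^sup>+x. ennreal (decay (s * q) (x - w)) \<partial>lborel)"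
          by (rule nn_integral_cmult) measurable
        also have "(\<integral>\<^sup>+x. ennreal (decay (s * q) (x - w)) \<partial>lborel) = ennreal D2"
          using nn_integral_shift[of "\<lambda>x. ennreal (decay (s * q) x)" w] D2 by simp
        finally show "(\<integral>\<^sup>+x. ennreal (V x w powr q) \<partial>lborel) = ennreal (2 powr (s * q) * D2) * ennreal (if \<mu> < G w then G w powr q else 0)"
          using D2 by (simp add: ennreal_mult[symmetric] mult_ac)
      qed
      also have "\<dots> = ennreal (2 powr (s * q) * D2) * (\<integral>\<^sup>+w. ennreal (if \<mu> < G w then G w powr q else 0) \<partial>lborel)"
        by (rule nn_integral_cmult) measurable
      also have "\<dots> \<le> ennreal (2 powr (s * q) * D2) * ennreal (T * A powr p * \<mu> powr (q - p))"
        unfolding T_def by (intro mult_left_mono nn_integral_tail_powr q A \<mu> weak) auto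
      also have "\<dots> = ennreal (2 powr (s * q) * D2 * T * A powr p * \<mu> powr (q - p))"
        using D2 T by (simp add: ennreal_mult[symmetric] mult_ac)
      finally show ?thesis .
    qed
    note Jint = this
    have "emeasure lborel {x. ennreal ((D1 + 1) * \<mu>) < (\<integral>\<^sup>+z. ennreal (decay s (x - z) * g z) \<partial>lborel)} \<le> emeasure lborel {x. ennreal \<nu> \<le> J x}"
      by (intro emeasure_mono sub) measurable
    also have "{x. ennreal \<nu> \<le> J x} = {x \<in> space lborel. 1 \<le> ennreal (1 / \<nu>) * J x}"
    proof -
      have "ennreal \<nu> \<le> y \<longleftrightarrow> 1 \<le> ennreal (1 / \<nu>) * y" for y
      proof (cases y)
        case (real r)
        then show ?thesis using \<nu>
          by (simp add: ennreal_mult[symmetric] ennreal_le_iff le_divide_eq flip: ennreal_1)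
      next
        case top
        then show ?thesis using \<nu> by (simp add: ennreal_mult_top)
      qed
      then show ?thesis by simp
    qed
    also have "emeasure lborel \<dots> \<le> ennreal (1 / \<nu>) * (\<integral>\<^sup>+x. J x * indicator (space lborel) x \<partial>lborel)"
      using nn_integral_Markov_inequality[of J "space lborel" lborel "ennreal (1 / \<nu>)"] by simp
    also have "(\<integral>\<^sup>+x. J x * indicator (space lborel) x \<partial>lborel) = (\<integral>\<^sup>+x. J x \<partial>lborel)" by simp
    also have "ennreal (1 / \<nu>) * \<dots> \<le> ennreal (1 / \<nu>) * ennreal (2 powr (s * q) * D2 * T * A powr p * \<mu> powr (q - p))"
      by (intro mult_left_mono Jint) auto
    also have "\<dots> = ennreal (1 / \<nu> * (2 powr (s * q) * D2 * T * A powr p * \<mu> powr (q - p)))"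
      using \<nu> by (intro ennreal_mult'[symmetric]) auto
    also have "1 / \<nu> * (2 powr (s * q) * D2 * T * A powr p * \<mu> powr (q - p)) = C3 * (A / \<mu>) powr p"
      using \<mu> \<kappa> A by (simp add: \<nu>_def C3_def powr_divide powr_diff)
    finally show ?thesis .
  qed
  \<comment> \<open>The estimate is applied at level \<open>\<mu> / (D1 + 1)\<close>, and
    \<open>C3 + 1\<close> keeps the constant positive.\<close>
  define C where "C = (C3 + 1) * (D1 + 1) powr p"
  show thesis
  proof (rule that[of C])
    show "0 < C" using C3 D1 by (simp add: C_def)
    fix g G :: "'a \<Rightarrow> real" and A \<mu> :: real
    assume *: "g \<in> borel_measurable borel" "G \<in> borel_measurable borel" "\<And>z. 0 \<le> g z"
      "\<And>z w. norm (z - w) < 1 \<Longrightarrow> g z \<le> G w" "0 < A"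
      "\<And>r. 0 < r \<Longrightarrow> emeasure lborel {w. r < G w} \<le> ennreal ((A / r) powr p)" and \<mu>: "0 < \<mu>"
    have "0 < \<mu> / (D1 + 1)" using \<mu> D1 by simp
    from main[OF * this]
    have "emeasure lborel {x. ennreal \<mu> < (\<integral>\<^sup>+z. ennreal (decay s (x - z) * g z) \<partial>lborel)} \<le> ennreal (C3 * (A / (\<mu> / (D1 + 1))) powr p)"
      using D1 by simp
    also have "\<dots> \<le> ennreal (C * (A / \<mu>) powr p)"
    proof (rule ennreal_leI)
      have "(A / (\<mu> / (D1 + 1))) powr p = (D1 + 1) powr p * (A / \<mu>) powr p"
        using D1 \<mu> *(5) powr_mult[of "D1 + 1" "A / \<mu>" p] by (simp add: mult.commute)
      then show "C3 * (A / (\<mu> / (D1 + 1))) powr p \<le> C * (A / \<mu>) powr p"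
        by (simp add: C_def distrib_right)
    qed
    finally show "emeasure lborel {x. ennreal \<mu> < (\<integral>\<^sup>+z. ennreal (decay s (x - z) * g z) \<partial>lborel)} \<le> ennreal (C * (A / \<mu>) powr p)" .
  qed
qed

section \<open>Dilations and grand maximal functions\<close>

lemma dilate_one [simp]: "dilate 1 \<phi> = \<phi>"
  by (simp add: dilate_def fun_eq_iff)

lemma dilate_dilate: "dilate a (dilate b \<phi>) = dilate (a * b) \<phi>"
  by (simp add: dilate_def fun_eq_iff power_mult_distrib mult.commute)

lemma
  fixes \<phi> :: "'a::euclidean_space \<Rightarrow> complex"
  assumes \<phi>: "\<phi> \<in> schwartz" and t: "0 < t"
  shows schwartz_dilate: "dilate t \<phi> \<in> schwartz"
    and iter_partial_dilate: "bs \<in> lists Basis \<Longrightarrow>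
      iter_partial bs (dilate t \<phi>) = (\<lambda>x. inverse t ^ length bs *\<^sub>R dilate t (iter_partial bs \<phi>) x)"
proof -
  have eq: "dilate t \<phi> = (\<lambda>x. of_real (inverse (t ^ DIM('a))) * \<phi> (0 + inverse t *\<^sub>R x))"
    by (simp add: dilate_def fun_eq_iff scaleR_conv_of_real)
  have t': "inverse t \<noteq> 0" using t by simp
  note aff = schwartz_affine[OF \<phi> t', of 0]
  show "dilate t \<phi> \<in> schwartz" unfolding eq by (intro schwartz_cmult aff)
  assume bs: "bs \<in> lists Basis"
  show "iter_partial bs (dilate t \<phi>) = (\<lambda>x. inverse t ^ length bs *\<^sub>R dilate t (iter_partial bs \<phi>) x)"
    unfolding eq iter_partial_cmult[OF aff bs] iter_partial_affine[OF \<phi> t' bs]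
    by (simp add: dilate_def fun_eq_iff scaleR_conv_of_real)
qed

lemma dilate_measurable [measurable]:
  assumes [measurable]: "\<phi> \<in> borel_measurable borel"
  shows "dilate t \<phi> \<in> borel_measurable borel"
  unfolding dilate_def[abs_def] by measurable

lemma nn_integral_dilate:
  fixes \<phi> :: "'a::euclidean_space \<Rightarrow> complex"
  assumes [measurable]: "\<phi> \<in> borel_measurable borel" and t: "0 < t"
  shows "(\<integral>\<^sup>+x. ennreal (norm (dilate t \<phi> x)) \<partial>lborel) = (\<integral>\<^sup>+x. ennreal (norm (\<phi> x)) \<partial>lborel)"
proof -
  have "(\<integral>\<^sup>+x. ennreal (norm (dilate t \<phi> x)) \<partial>lborel) =
      ennreal (\<bar>t\<bar> ^ DIM('a)) * (\<integral>\<^sup>+x. ennreal (norm (dilate t \<phi> (0 + t *\<^sub>R x))) \<partial>lborel)"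
    using t by (intro nn_integral_lborel_affine) auto
  also have "\<dots> = (\<integral>\<^sup>+x. ennreal (\<bar>t\<bar> ^ DIM('a)) * ennreal (norm (dilate t \<phi> (0 + t *\<^sub>R x))) \<partial>lborel)"
    by (rule nn_integral_cmult[symmetric]) measurable
  also have "\<dots> = (\<integral>\<^sup>+x. ennreal (norm (\<phi> x)) \<partial>lborel)"
    using t by (intro nn_integral_cong) (simp add: dilate_def ennreal_mult[symmetric])
  finally show ?thesis .
qed

lemma conv_dilate:
  fixes f g :: "'a::euclidean_space \<Rightarrow> complex"
  assumes t: "0 < t"
  shows "conv (dilate t f) (dilate t g) = dilate t (conv f g)"
proof
  fix x
  have "conv (dilate t f) (dilate t g) x = \<bar>t\<bar> ^ DIM('a) *\<^sub>R (\<integral>y. dilate t f (x - (0 + t *\<^sub>R y)) * dilate t g (0 + t *\<^sub>R y) \<partial>lborel)"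
    unfolding conv_def using t by (intro integral_lborel_affine) simp
  also have "\<dots> = \<bar>t\<bar> ^ DIM('a) *\<^sub>R (\<integral>y. of_real (inverse (t ^ DIM('a)) * inverse (t ^ DIM('a))) * (f (x /\<^sub>R t - y) * g y) \<partial>lborel)"
    using t by (intro arg_cong2[where f=scaleR] refl Bochner_Integration.integral_cong)
      (simp add: dilate_def scaleR_diff_right scaleR_conv_of_real)
  also have "\<dots> = dilate t (conv f g) x"
    using t by (simp add: dilate_def conv_def scaleR_conv_of_real)
  finally show "conv (dilate t f) (dilate t g) x = dilate t (conv f g) x" .
qed

lemma conv_distr_distr_of_fun: "conv_distr \<phi> (distr_of_fun h) = conv \<phi> h"
  by (simp add: fun_eq_iff conv_distr_def distr_of_fun_def conv_def mult.commute)

lemma conv_distr_cmult: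
  assumes "tempered f" "\<phi> \<in> schwartz"
  shows "conv_distr (\<lambda>x. c * \<phi> x) f x = c * conv_distr \<phi> f x"
  unfolding conv_distr_def by (intro tempered_cmult assms schwartz_reflect)

lemma conv_distr_sum:
  assumes "tempered f" "finite I" "\<And>i. i \<in> I \<Longrightarrow> \<phi> i \<in> schwartz"
  shows "conv_distr (\<lambda>x. \<Sum>i\<in>I. \<phi> i x) f x = (\<Sum>i\<in>I. conv_distr (\<phi> i) f x)"
  using tempered_sum[OF assms(1,2), of "\<lambda>i y. \<phi> i (x - y)" "\<lambda>_. 1"] assms(3)
  by (simp add: conv_distr_def schwartz_reflect)

lemma conv_sum_right:
  fixes F :: "'i \<Rightarrow> 'a::euclidean_space \<Rightarrow> complex"
  assumes k: "integrable lborel k" and "\<And>i. i \<in> I \<Longrightarrow> F i \<in> borel_measurable borel"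
    and "\<And>i. i \<in> I \<Longrightarrow> \<exists>B. \<forall>z. norm (F i z) \<le> B"
  shows "conv k (\<lambda>z. \<Sum>i\<in>I. F i z) x = (\<Sum>i\<in>I. conv k (F i) x)"
proof -
  have "integrable lborel (\<lambda>y. k (x - y) * F i y)" if i: "i \<in> I" for i
  proof -
    obtain B where "\<And>z. norm (F i z) \<le> B" using assms(3)[OF i] by blast
    then show ?thesis by (intro conv_integrable_bounded[OF k assms(2)[OF i]])
  qed
  then show ?thesis unfolding conv_def sum_distrib_left by (rule Bochner_Integration.integral_sum)
qed

lemma ennreal_norm_conv_le:
  "ennreal (norm (conv f g x)) \<le> (\<integral>\<^sup>+z. ennreal (norm (f (x - z))) * ennreal (norm (g z)) \<partial>lborel)"
proof (cases "integrable lborel (\<lambda>z. f (x - z) * g z)")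
  case True
  show ?thesis unfolding conv_def
    using integral_norm_bound_ennreal[OF True] by (simp add: norm_mult ennreal_mult)
next
  case False
  then show ?thesis by (simp add: conv_def not_integrable_integral_eq)
qed

section \<open>Test classes, maximal functions and weak norms\<close>

lemma test_class_schwartz: "\<phi> \<in> test_class N \<Longrightarrow> \<phi> \<in> schwartz"
  by (simp add: test_class_def)

lemma test_class_bound:
  fixes \<phi> :: "'a::euclidean_space \<Rightarrow> complex"
  assumes "\<phi> \<in> test_class N" "bs \<in> lists Basis" "length bs \<le> N + 1"
  shows "norm (iter_partial bs \<phi> x) \<le> decay (real (N + DIM('a) + 1)) x"
proof -
  have "schwartz_seminorm (N + DIM('a) + 1) (N + 1) \<phi> \<le> ennreal 1" using assms(1) by (simp add: test_class_def)
  then have "(1 + norm x) ^ (N + DIM('a) + 1) * norm (iter_partial bs \<phi> x) \<le> 1"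
    using assms(2,3) schwartz_seminorm_le_iff[of 1 "N + DIM('a) + 1" "N + 1" \<phi>] by simp
  then show ?thesis using decay_bound_iff[of "norm (iter_partial bs \<phi> x)" 1 "N + DIM('a) + 1" x] by simp
qed

lemma schwartz_seminorm_decayI:
  fixes \<phi> :: "'a::euclidean_space \<Rightarrow> complex"
  assumes "0 \<le> c" "\<And>bs x. bs \<in> lists Basis \<Longrightarrow> length bs \<le> K \<Longrightarrow> norm (iter_partial bs \<phi> x) \<le> c * decay (real M) x"
  shows "schwartz_seminorm M K \<phi> \<le> ennreal c"
  unfolding schwartz_seminorm_le_iff[OF assms(1)] using assms(2) by (simp only: decay_bound_iff) blast

lemma scaled_test_class:
  fixes \<phi> :: "'a::euclidean_space \<Rightarrow> complex"
  assumes "\<phi> \<in> schwartz" "0 < c" "schwartz_seminorm (N + DIM('a) + 1) (N + 1) \<phi> \<le> ennreal c"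
  shows "(\<lambda>x. of_real (1 / c) * \<phi> x) \<in> test_class N"
proof -
  have "schwartz_seminorm (N + DIM('a) + 1) (N + 1) (\<lambda>x. of_real (1 / c) * \<phi> x) \<le> ennreal 1"
  proof (subst schwartz_seminorm_le_iff, simp, intro allI ballI impI)
    fix x :: 'a and bs :: "'a list" assume bs: "bs \<in> lists Basis" "length bs \<le> N + 1"
    have *: "(1 + norm x) ^ (N + DIM('a) + 1) * norm (iter_partial bs \<phi> x) \<le> c"
      using assms(3) bs assms(2) by (simp add: schwartz_seminorm_le_iff)
    show "(1 + norm x) ^ (N + DIM('a) + 1) * norm (iter_partial bs (\<lambda>x. of_real (1 / c) * \<phi> x) x) \<le> 1"
    proof -
      have "norm (of_real (1 / c) * iter_partial bs \<phi> x) = norm (iter_partial bs \<phi> x) / c"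
        using assms(2) by (simp add: norm_divide)
      then show ?thesis
        unfolding iter_partial_cmult[OF assms(1) bs(1)] using * assms(2)
        by (simp only: times_divide_eq_right pos_divide_le_eq mult_1_left)
    qed
  qed
  then show ?thesis unfolding test_class_def ennreal_1 by (intro CollectI conjI schwartz_cmult assms(1))
qed

text \<open>Homogeneity: dividing by any upper bound of the seminorm gives a member of the test
  class, so seminorms never have to be computed exactly.\<close>

lemma grand_maximal_bound:
  fixes f :: "'a::euclidean_space distribution"
  assumes f: "tempered f" and \<phi>: "\<phi> \<in> schwartz" and c: "0 < c"
    and "schwartz_seminorm (N + DIM('a) + 1) (N + 1) \<phi> \<le> ennreal c" and t: "norm (y - x) < t"
  shows "ennreal (norm (conv_distr (dilate t \<phi>) f y)) \<le> ennreal c * grand_maximal N f x"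
proof -
  let ?\<phi> = "\<lambda>x. of_real (1 / c) * \<phi> x"
  have t0: "0 < t" using t norm_ge_zero[of "y - x"] by linarith
  have test: "?\<phi> \<in> test_class N" by (rule scaled_test_class) fact+
  have "dilate t \<phi> = (\<lambda>x. of_real c * dilate t ?\<phi> x)"
    using c by (simp add: dilate_def fun_eq_iff)
  then have "conv_distr (dilate t \<phi>) f y = of_real c * conv_distr (dilate t ?\<phi>) f y"
    by (simp only: conv_distr_cmult[OF f schwartz_dilate[OF schwartz_cmult[OF \<phi>] t0]])
  then have "ennreal (norm (conv_distr (dilate t \<phi>) f y)) = ennreal c * ennreal (norm (conv_distr (dilate t ?\<phi>) f y))"
    using c by (simp add: norm_mult ennreal_mult)
  also have "\<dots> \<le> ennreal c * grand_maximal N f x"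
    unfolding grand_maximal_def
    by (intro mult_left_mono SUP_upper2[OF test] SUP_upper2[of "(y, t)"]) (use t in auto)
  finally show ?thesis .
qed

text \<open>The supremum runs over cones, so a triple \<open>(\<phi>, y, t)\<close> that beats
  \<open>c\<close> at \<open>x\<close> does so on all of \<open>ball y t\<close>. Borel
  measurability is an immediate consequence.\<close>

lemma open_grand_maximal:
  fixes f :: "'a::euclidean_space distribution"
  shows "open {x. c < grand_maximal N f x}"
proof (subst open_subopen, rule ballI)
  fix x assume "x \<in> {x. c < grand_maximal N f x}"
  then obtain \<phi> y t where *: "\<phi> \<in> test_class N" "norm (y - x) < t" "c < ennreal (norm (conv_distr (dilate t \<phi>) f y))"
    by (auto simp: grand_maximal_def less_SUP_iff)
  have "c < grand_maximal N f x'" if "x' \<in> ball y t" for x'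
  proof -
    have "norm (y - x') < t" using that by (simp add: dist_norm)
    with * show ?thesis unfolding grand_maximal_def less_SUP_iff by force
  qed
  moreover have "open (ball y t)" "x \<in> ball y t" using *(2) by (auto simp: dist_norm)
  ultimately show "\<exists>T. open T \<and> x \<in> T \<and> T \<subseteq> {x. c < grand_maximal N f x}" by blast
qed

lemma grand_maximal_measurable [measurable]: "grand_maximal N f \<in> borel_measurable borel"
  by (rule borel_measurableI_greater) (simp add: borel_open open_grand_maximal)

lemma grand_maximal_measurable_lebesgue: "grand_maximal N f \<in> borel_measurable lebesgue"
  using measurable_completion[of "grand_maximal N f" lborel borel] by simp

text \<open>Unwinds the quasi-norm into a bound for the distribution function, the form in which all
  estimates are carried out. A level set of infinite measure is a separate case, in which both sides
  fail.\<close>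

lemma weak_Lp_norm_le_iff:
  fixes g :: "'a::euclidean_space \<Rightarrow> ennreal"
  assumes p: "0 < p" and A: "0 \<le> A"
  shows "weak_Lp_norm p g \<le> ennreal A \<longleftrightarrow> (\<forall>r>0. emeasure lebesgue {x. ennreal r < g x} \<le> ennreal ((A / r) powr p))"
proof -
  have "ennreal r * ennreal_powr m (1 / p) \<le> ennreal A \<longleftrightarrow> m \<le> ennreal ((A / r) powr p)" if r: "0 < r" for r m
  proof (cases m)
    case (real x)
    have "ennreal r * ennreal_powr m (1 / p) = ennreal (r * x powr (1 / p))"
      using real r by (simp add: ennreal_powr_def ennreal_mult)
    then have "ennreal r * ennreal_powr m (1 / p) \<le> ennreal A \<longleftrightarrow> x powr (1 / p) \<le> A / r"
      using A r by (simp add: ennreal_le_iff le_divide_eq mult.commute)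
    also have "\<dots> \<longleftrightarrow> x \<le> (A / r) powr p"
    proof
      assume "x powr (1 / p) \<le> A / r"
      then have "(x powr (1 / p)) powr p \<le> (A / r) powr p" using p by (intro powr_mono2) auto
      then show "x \<le> (A / r) powr p" using p real by (simp add: powr_powr)
    next
      assume "x \<le> (A / r) powr p"
      then have "x powr (1 / p) \<le> ((A / r) powr p) powr (1 / p)" using p real by (intro powr_mono2) auto
      then show "x powr (1 / p) \<le> A / r" using p A r by (simp add: powr_powr)
    qed
    finally show ?thesis using real by (simp add: ennreal_le_iff)
  next
    case top
    then show ?thesis using r by (simp add: ennreal_powr_def ennreal_mult_top top_unique)
  qed
  then show ?thesis unfolding weak_Lp_norm_def SUP_le_iff by auto
qed

text \<open>The function \<open>g\<close> of the overview. With the scale frozen at 1 and no cone,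
  its value at one point is dominated by the grand maximal function throughout a unit ball.\<close>

definition unit_maximal :: "nat \<Rightarrow> 'a::euclidean_space distribution \<Rightarrow> 'a \<Rightarrow> ennreal" where
  "unit_maximal N f z = (SUP \<phi>\<in>test_class N. ennreal (norm (conv_distr \<phi> f z)))"

lemma unit_maximal_le: "norm (z - w) < 1 \<Longrightarrow> unit_maximal N f z \<le> grand_maximal N f w"
  unfolding unit_maximal_def
proof (rule SUP_least)
  fix \<phi> :: "'a \<Rightarrow> complex" assume "norm (z - w) < 1" "\<phi> \<in> test_class N"
  then show "ennreal (norm (conv_distr \<phi> f z)) \<le> grand_maximal N f w"
    unfolding grand_maximal_def
    by (intro SUP_upper2[of \<phi>] SUP_upper2[of "(z, 1)"]) auto
qed

lemma unit_maximal_bound: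
  fixes f :: "'a::euclidean_space distribution"
  assumes f: "tempered f" and \<phi>: "\<phi> \<in> schwartz" and c: "0 < c"
    and "schwartz_seminorm (N + DIM('a) + 1) (N + 1) \<phi> \<le> ennreal c"
  shows "ennreal (norm (conv_distr \<phi> f y)) \<le> ennreal c * unit_maximal N f y"
proof -
  let ?\<phi> = "\<lambda>x. of_real (1 / c) * \<phi> x"
  have test: "?\<phi> \<in> test_class N" by (rule scaled_test_class) fact+
  have "conv_distr (\<lambda>x. of_real c * ?\<phi> x) f y = of_real c * conv_distr ?\<phi> f y"
    by (rule conv_distr_cmult[OF f schwartz_cmult[OF \<phi>]])
  moreover have "(\<lambda>x. of_real c * ?\<phi> x) = \<phi>" using c by (simp add: fun_eq_iff)
  ultimately have "ennreal (norm (conv_distr \<phi> f y)) = ennreal c * ennreal (norm (conv_distr ?\<phi> f y))"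
    using c by (simp add: norm_mult ennreal_mult)
  also have "\<dots> \<le> ennreal c * unit_maximal N f y"
    unfolding unit_maximal_def by (intro mult_left_mono SUP_upper2[OF test]) auto
  finally show ?thesis .
qed

text \<open>A supremum of continuous functions is lower semicontinuous. The test class is
  uncountable, so measurability is obtained from open superlevel sets and not from countable
  suprema.\<close>

lemma unit_maximal_measurable:
  assumes f: "tempered f"
  shows "unit_maximal N f \<in> borel_measurable borel"
proof (rule borel_measurableI_greater)
  fix c
  have "open {z. c < ennreal (norm (conv_distr \<phi> f z))}" if "\<phi> \<in> test_class N" for \<phi>
  proof -
    have "continuous_on UNIV (\<lambda>z. ennreal (norm (conv_distr \<phi> f z)))"
      using conv_distr_continuous[OF f test_class_schwartz[OF that]]
      by (intro continuous_on_ennreal continuous_on_norm)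
    then show ?thesis using open_Collect_less[of "\<lambda>_. c"] by simp
  qed
  then have "open (\<Union>\<phi>\<in>test_class N. {z. c < ennreal (norm (conv_distr \<phi> f z))})" by blast
  moreover have "{z. c < unit_maximal N f z} = (\<Union>\<phi>\<in>test_class N. {z. c < ennreal (norm (conv_distr \<phi> f z))})"
    by (auto simp: unit_maximal_def less_SUP_iff)
  ultimately show "{z \<in> space borel. c < unit_maximal N f z} \<in> sets borel" by simp
qed

lemma emeasure_lebesgue_borel: "S \<in> sets borel \<Longrightarrow> emeasure lebesgue S = emeasure lborel S"
  by (simp add: emeasure_completion)

text \<open>
  The unit maximal function is bounded, because a large value forces the grand maximal function to
  be large on a whole unit ball.
\<close>

lemma weak_Hardy_real_majorant:
  fixes f :: "'a::euclidean_space distribution"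
  assumes p: "0 < p" and f: "tempered f" and A: "0 < A" "weak_Hardy_norm N p f \<le> ennreal A"
  obtains g G :: "'a \<Rightarrow> real" where "g \<in> borel_measurable borel" "G \<in> borel_measurable borel"
    "\<And>z. 0 \<le> g z" "\<And>z w. norm (z - w) < 1 \<Longrightarrow> g z \<le> G w"
    "\<And>r. 0 < r \<Longrightarrow> emeasure lborel {w. r < G w} \<le> ennreal ((A / r) powr p)"
    "\<And>z. unit_maximal N f z = ennreal (g z)" "\<exists>B. \<forall>z. g z \<le> B"
proof -
  have weak: "emeasure lborel {w. ennreal r < grand_maximal N f w} \<le> ennreal ((A / r) powr p)" if "0 < r" for r
    using A p that weak_Lp_norm_le_iff[of p A "grand_maximal N f"] emeasure_lebesgue_borel[of "{w. ennreal r < grand_maximal N f w}"]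
    by (simp add: weak_Hardy_norm_def)
  define b where "b = measure lborel (ball (0::'a) 1)"
  have b: "0 < b" by (simp add: b_def)
  \<comment> \<open>With this value \<open>(A / B) powr p\<close> is \<open>b / 2 powr p\<close>,
    too small for a set that contains a unit ball.\<close>
  define B where "B = 2 * A / b powr (1 / p)"
  have B: "0 < B" using A b by (simp add: B_def)
  have bdd: "unit_maximal N f z \<le> ennreal B" for z
  proof (rule ccontr)
    assume "\<not> unit_maximal N f z \<le> ennreal B"
    then have "ennreal B < unit_maximal N f z" by simp
    then have "ball z 1 \<subseteq> {w. ennreal B < grand_maximal N f w}"
      using unit_maximal_le[of z] by (auto simp: dist_norm intro: less_le_trans)
    then have "emeasure lborel (ball z 1) \<le> emeasure lborel {w. ennreal B < grand_maximal N f w}"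
      by (intro emeasure_mono) auto
    also have "\<dots> \<le> ennreal ((A / B) powr p)" by (rule weak[OF B])
    finally have "ennreal b \<le> ennreal ((A / B) powr p)"
      by (simp add: b_def emeasure_ball content_ball)
    then have "b \<le> (A / B) powr p" by (simp add: ennreal_le_iff)
    also have "A / B = b powr (1 / p) / 2" using A b by (simp add: B_def)
    also have "(b powr (1 / p) / 2) powr p = b / 2 powr p" using p b by (simp add: powr_divide powr_powr)
    also have "\<dots> < b / 1" using p b by (intro divide_strict_left_mono) auto
    finally show False by simp
  qed
  define g where "g z = enn2real (unit_maximal N f z)" for z
  \<comment> \<open>Truncating at \<open>B\<close> makes \<open>G\<close> finite everywhere and
    preserves \<open>g z \<le> G w\<close>, since \<open>g\<close> never exceeds
    \<open>B\<close>.\<close>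
  define G where "G w = enn2real (min (grand_maximal N f w) (ennreal B))" for w
  have g: "unit_maximal N f z = ennreal (g z)" for z
    using bdd[of z] by (simp add: g_def ennreal_enn2real_if) (metis ennreal_less_top not_less top.not_eq_extremum)
  have G: "ennreal (G w) = min (grand_maximal N f w) (ennreal B)" for w
    unfolding G_def by (rule ennreal_enn2real) (simp add: min_less_iff_disj)
  show thesis
  proof (rule that[of g G])
    show "g \<in> borel_measurable borel" unfolding g_def[abs_def] using unit_maximal_measurable[OF f, of N] by measurable
    show "G \<in> borel_measurable borel" unfolding G_def[abs_def] by measurable
    show "0 \<le> g z" for z by (simp add: g_def)
    show "g z \<le> G w" if "norm (z - w) < 1" for z w
    proof -
      have "ennreal (g z) \<le> ennreal (G w)"
        unfolding G g[symmetric] using unit_maximal_le[OF that] bdd by simp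
      then show ?thesis by (simp add: ennreal_le_iff G_def)
    qed
    show "emeasure lborel {w. r < G w} \<le> ennreal ((A / r) powr p)" if r: "0 < r" for r
    proof -
      have "{w. r < G w} \<subseteq> {w. ennreal r < grand_maximal N f w}"
      proof
        fix w assume "w \<in> {w. r < G w}"
        then have "ennreal r < ennreal (G w)" using r by (simp add: ennreal_less_iff)
        then show "w \<in> {w. ennreal r < grand_maximal N f w}" unfolding G by simp
      qed
      then have "emeasure lborel {w. r < G w} \<le> emeasure lborel {w. ennreal r < grand_maximal N f w}"
        by (intro emeasure_mono) auto
      then show ?thesis using weak[OF r] by (rule order_trans)
    qed
    show "unit_maximal N f z = ennreal (g z)" for z by (rule g)
    have "g z \<le> B" for z using bdd[of z] B unfolding g by (simp add: ennreal_le_iff)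
    then show "\<exists>B. \<forall>z. g z \<le> B" by blast
  qed
qed

section \<open>Pointwise estimates\<close>

text \<open>Collects what the pointwise estimates rest on: a real version of the unit maximal
  function, bounded so that convolutions of smoothed distributions with integrable kernels converge
  absolutely.\<close>

definition unit_majorant :: "nat \<Rightarrow> 'a::euclidean_space distribution \<Rightarrow> ('a \<Rightarrow> real) \<Rightarrow> bool" where
  "unit_majorant N f g \<longleftrightarrow> tempered f \<and> g \<in> borel_measurable borel \<and> (\<forall>z. 0 \<le> g z) \<and>
     (\<forall>z. unit_maximal N f z = ennreal (g z)) \<and> (\<exists>B. \<forall>z. g z \<le> B)"

text \<open>The function \<open>u * g\<close> of the overview; as a nonnegative integral it can be
  estimated before its finiteness is known.\<close>

definition decay_avg :: "real \<Rightarrow> ('a::euclidean_space \<Rightarrow> real) \<Rightarrow> 'a \<Rightarrow> ennreal" where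
  "decay_avg s g x = (\<integral>\<^sup>+z. ennreal (decay s (x - z) * g z) \<partial>lborel)"

lemma unit_majorant_bound:
  fixes f :: "'a::euclidean_space distribution"
  assumes fg: "unit_majorant N f g" and "\<phi> \<in> schwartz" and c: "0 < c"
    and "schwartz_seminorm (N + DIM('a) + 1) (N + 1) \<phi> \<le> ennreal c"
  shows "norm (conv_distr \<phi> f y) \<le> c * g y"
proof -
  have f: "tempered f" and g: "0 \<le> g y" "unit_maximal N f y = ennreal (g y)"
    using fg by (auto simp: unit_majorant_def)
  have "ennreal (norm (conv_distr \<phi> f y)) \<le> ennreal c * ennreal (g y)"
    using unit_maximal_bound[OF f assms(2-4), of y] g by simp
  then show ?thesis using c g by (simp add: ennreal_mult[symmetric] ennreal_le_iff)
qed

lemma unit_majorant_bounded: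
  fixes f :: "'a::euclidean_space distribution"
  assumes fg: "unit_majorant N f g" and \<phi>: "\<phi> \<in> schwartz"
  shows "\<exists>B. \<forall>z. norm (conv_distr \<phi> f z) \<le> B"
proof -
  obtain c where c: "0 < c" "schwartz_seminorm (N + DIM('a) + 1) (N + 1) \<phi> \<le> ennreal c"
    using schwartz_seminorm_bound[OF \<phi>] by blast
  obtain B where "\<And>z. g z \<le> B" using fg by (auto simp: unit_majorant_def)
  then have "norm (conv_distr \<phi> f z) \<le> c * B" for z
    using unit_majorant_bound[OF fg \<phi> c, of z] c(1) by (meson mult_left_mono order_less_imp_le order_trans)
  then show ?thesis by blast
qed

lemma conv_swap:
  fixes F :: "'a::euclidean_space \<Rightarrow> complex"
  assumes h: "integrable lborel h" and k: "integrable lborel k"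
    and F: "F \<in> borel_measurable borel" "\<exists>B. \<forall>z. norm (F z) \<le> B"
  shows "conv h (conv k F) = conv k (conv h F)"
proof -
  obtain B where B: "\<And>z. norm (F z) \<le> B" using F(2) by blast
  show ?thesis
    unfolding conv_assoc[OF h k F(1) B] conv_assoc[OF k h F(1) B] conv_commute[of h k] ..
qed

text \<open>At scale one the smoothed distribution is at most \<open>c * g\<close> and the kernel at
  most \<open>Ck * decay s\<close>; the bound is the convolution of these two.\<close>

lemma conv_kernel_bound:
  fixes f :: "'a::euclidean_space distribution" and k :: "'a \<Rightarrow> complex"
  assumes fg: "unit_majorant N f g" and \<phi>: "\<phi> \<in> schwartz" and c: "0 < c"
    "schwartz_seminorm (N + DIM('a) + 1) (N + 1) \<phi> \<le> ennreal c"
    and k: "\<And>z. norm (k z) \<le> Ck * decay s z" "0 \<le> Ck"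
  shows "ennreal (norm (conv k (conv_distr \<phi> f) y)) \<le> ennreal (Ck * c) * decay_avg s g y"
proof -
  have [measurable]: "g \<in> borel_measurable borel" using fg by (simp add: unit_majorant_def)
  have g0: "0 \<le> g z" for z using fg by (simp add: unit_majorant_def)
  have "ennreal (norm (conv k (conv_distr \<phi> f) y)) \<le> (\<integral>\<^sup>+z. ennreal (norm (k (y - z))) * ennreal (norm (conv_distr \<phi> f z)) \<partial>lborel)"
    by (rule ennreal_norm_conv_le)
  also have "\<dots> \<le> (\<integral>\<^sup>+z. ennreal (Ck * c) * ennreal (decay s (y - z) * g z) \<partial>lborel)"
  proof (rule nn_integral_mono)
    fix z
    have "norm (k (y - z)) * norm (conv_distr \<phi> f z) \<le> (Ck * decay s (y - z)) * (c * g z)"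
      using k g0 c unit_majorant_bound[OF fg \<phi> c, of z] by (intro mult_mono) auto
    then have "ennreal (norm (k (y - z)) * norm (conv_distr \<phi> f z)) \<le> ennreal ((Ck * c) * (decay s (y - z) * g z))"
      by (intro ennreal_leI) (simp only: mult_ac)
    then show "ennreal (norm (k (y - z))) * ennreal (norm (conv_distr \<phi> f z)) \<le> ennreal (Ck * c) * ennreal (decay s (y - z) * g z)"
      using k(2) c(1) g0[of z] by (simp add: ennreal_mult)
  qed
  also have "\<dots> = ennreal (Ck * c) * decay_avg s g y"
    unfolding decay_avg_def by (rule nn_integral_cmult) measurable
  finally show ?thesis .
qed

lemma decay_avg_shift:
  assumes g: "g \<in> borel_measurable borel" "\<And>z. 0 \<le> g z" and "0 \<le> s" "norm (y - x) \<le> 1"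
  shows "decay_avg s g y \<le> ennreal (2 powr s) * decay_avg s g x"
proof -
  note [measurable] = g(1)
  have "decay_avg s g y \<le> (\<integral>\<^sup>+z. ennreal (2 powr s) * ennreal (decay s (x - z) * g z) \<partial>lborel)"
    unfolding decay_avg_def
  proof (rule nn_integral_mono)
    fix z
    have "decay s ((x - z) + (y - x)) \<le> 2 powr s * decay s (x - z)" using assms by (intro decay_shift) auto
    then have "decay s (y - z) * g z \<le> (2 powr s * decay s (x - z)) * g z"
      using g(2) by (intro mult_right_mono) auto
    then have "ennreal (decay s (y - z) * g z) \<le> ennreal (2 powr s * (decay s (x - z) * g z))"
      by (intro ennreal_leI) (simp only: mult_ac)
    then show "ennreal (decay s (y - z) * g z) \<le> ennreal (2 powr s) * ennreal (decay s (x - z) * g z)"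
      using g(2)[of z] by (simp add: ennreal_mult)
  qed
  also have "\<dots> = ennreal (2 powr s) * decay_avg s g x"
    unfolding decay_avg_def by (rule nn_integral_cmult) measurable
  finally show ?thesis .
qed

text \<open>For \<open>s > n\<close> the weight convolved with itself is at most a multiple of
  itself, by the same dichotomy as in \<open>decay_conv_nn\<close>; Tonelli carries this over to the
  average of \<open>g\<close>.\<close>

lemma decay_avg_avg:
  assumes s: "real DIM('a::euclidean_space) < s"
  obtains C where "0 < C"
    "\<And>(g::'a \<Rightarrow> real) x. g \<in> borel_measurable borel \<Longrightarrow> (\<And>z. 0 \<le> g z) \<Longrightarrow>
      (\<integral>\<^sup>+z. ennreal (decay s (x - z)) * decay_avg s g z \<partial>lborel) \<le> ennreal C * decay_avg s g x"
proof -
  obtain C where C: "0 < C" and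
    *: "\<And>b B (x::'a). \<lbrakk>b \<in> borel_measurable borel; (\<integral>\<^sup>+z. b z \<partial>lborel) \<le> ennreal B;
        \<And>z. ennreal (norm z powr s) * b z \<le> ennreal B; 0 \<le> B\<rbrakk> \<Longrightarrow>
        (\<integral>\<^sup>+z. ennreal (decay s (x - z)) * b z \<partial>lborel) \<le> ennreal (C * B * decay s x)"
    using decay_conv_nn[OF s] by blast
  have s0: "0 < s" using s by (smt (verit) of_nat_0_le_iff)
  define D where "D = (\<integral>(x::'a). decay s x \<partial>lborel)"
  have D: "(\<integral>\<^sup>+(x::'a). ennreal (decay s x) \<partial>lborel) = ennreal D" "0 \<le> D"
    unfolding D_def using decay_integrable[OF s] by (auto simp: nn_integral_eq_integral)
  define C' where "C' = C * (D + 1)"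
  have dd: "(\<integral>\<^sup>+z. ennreal (decay s (x - z)) * ennreal (decay s z) \<partial>lborel) \<le> ennreal (C' * decay s x)" for x :: 'a
    unfolding C'_def
  proof (rule *)
    show "(\<integral>\<^sup>+(z::'a). ennreal (decay s z) \<partial>lborel) \<le> ennreal (D + 1)" using D by (simp add: ennreal_leI)
    show "ennreal (norm z powr s) * ennreal (decay s z) \<le> ennreal (D + 1)" for z :: 'a
    proof -
      have "norm z powr s \<le> (1 + norm z) powr s" using s0 by (intro powr_mono2) auto
      then have "norm z powr s * decay s z \<le> (1 + norm z) powr s * decay s z" by (intro mult_right_mono) auto
      also have "\<dots> = 1" by (simp add: decay_def powr_minus add_nonneg_eq_0_iff)
      finally have "norm z powr s * decay s z \<le> D + 1" using D(2) by linarith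
      then show ?thesis unfolding ennreal_mult[symmetric, OF powr_ge_zero decay_nonneg] by (rule ennreal_leI)
    qed
  qed (use D in auto)
  show thesis
  proof (rule that[of C'])
    show "0 < C'" using C D by (simp add: C'_def)
    fix g :: "'a \<Rightarrow> real" and x :: 'a
    assume [measurable]: "g \<in> borel_measurable borel" and g: "\<And>z. 0 \<le> g z"
    have "(\<integral>\<^sup>+z. ennreal (decay s (x - z)) * decay_avg s g z \<partial>lborel) =
      (\<integral>\<^sup>+z. \<integral>\<^sup>+w. ennreal (decay s (x - z)) * ennreal (decay s (z - w) * g w) \<partial>lborel \<partial>lborel)"
      unfolding decay_avg_def by (intro nn_integral_cong nn_integral_cmult[symmetric]) measurable
    also have "\<dots> = (\<integral>\<^sup>+w. \<integral>\<^sup>+z. ennreal (decay s (x - z)) * ennreal (decay s (z - w) * g w) \<partial>lborel \<partial>lborel)"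
      by (rule lborel_pair.Fubini') measurable
    also have "\<dots> \<le> (\<integral>\<^sup>+w. ennreal C' * ennreal (decay s (x - w) * g w) \<partial>lborel)"
    proof (rule nn_integral_mono)
      fix w
      have "(\<integral>\<^sup>+z. ennreal (decay s (x - z)) * ennreal (decay s (z - w) * g w) \<partial>lborel) =
          (\<integral>\<^sup>+z. (ennreal (decay s (x - z)) * ennreal (decay s (z - w))) * ennreal (g w) \<partial>lborel)"
        using g[of w] by (intro nn_integral_cong) (simp add: ennreal_mult mult_ac)
      also have "\<dots> = (\<integral>\<^sup>+z. ennreal (decay s (x - z)) * ennreal (decay s (z - w)) \<partial>lborel) * ennreal (g w)"
        by (rule nn_integral_multc) measurable
      also have "(\<integral>\<^sup>+z. ennreal (decay s (x - z)) * ennreal (decay s (z - w)) \<partial>lborel) =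
         (\<integral>\<^sup>+z. ennreal (decay s ((x - w) - z)) * ennreal (decay s z) \<partial>lborel)"
        using nn_integral_shift[of "\<lambda>z. ennreal (decay s ((x - w) - z)) * ennreal (decay s z)" w] by simp
      also have "\<dots> * ennreal (g w) \<le> ennreal (C' * decay s (x - w)) * ennreal (g w)"
        by (intro mult_right_mono dd) auto
      also have "\<dots> = ennreal C' * ennreal (decay s (x - w) * g w)"
        using C D g[of w] by (simp add: ennreal_mult C'_def mult_ac)
      finally show "(\<integral>\<^sup>+z. ennreal (decay s (x - z)) * ennreal (decay s (z - w) * g w) \<partial>lborel) \<le> ennreal C' * ennreal (decay s (x - w) * g w)" .
    qed
    also have "\<dots> = ennreal C' * decay_avg s g x"
      unfolding decay_avg_def by (rule nn_integral_cmult) measurable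
    finally show "(\<integral>\<^sup>+z. ennreal (decay s (x - z)) * decay_avg s g z \<partial>lborel) \<le> ennreal C' * decay_avg s g x" .
  qed
qed

section \<open>Convolutions with dilated functions, uniformly in the scale\<close>

lemma nn_integral_norm_decay_le:
  fixes a :: "'a::euclidean_space \<Rightarrow> complex"
  assumes L: "real DIM('a) < L" and a: "\<And>z. norm (a z) \<le> A * decay L z" "0 \<le> A"
  shows "(\<integral>\<^sup>+z. ennreal (norm (a z)) \<partial>lborel) \<le> ennreal (A * (\<integral>(z::'a). decay L z \<partial>lborel))"
proof -
  have "(\<integral>\<^sup>+z. ennreal (norm (a z)) \<partial>lborel) \<le> (\<integral>\<^sup>+(z::'a). ennreal (A * decay L z) \<partial>lborel)"
    by (intro nn_integral_mono ennreal_leI a)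
  also have "\<dots> = ennreal (A * (\<integral>(z::'a). decay L z \<partial>lborel))"
    using decay_integrable[OF L] a(2) by (subst nn_integral_eq_integral) auto
  finally show ?thesis .
qed

lemma powr_norm_decay_le: "0 \<le> L \<Longrightarrow> norm z powr L * decay L z \<le> 1"
proof -
  assume "0 \<le> L"
  then have "norm z powr L \<le> (1 + norm z) powr L" by (intro powr_mono2) auto
  then have "norm z powr L * decay L z \<le> (1 + norm z) powr L * decay L z" by (intro mult_right_mono) auto
  also have "\<dots> = 1" by (simp add: decay_def powr_minus add_nonneg_eq_0_iff)
  finally show ?thesis .
qed

text \<open>Under dilation the left-hand side acquires the factor \<open>t powr (L - n)\<close>, at
  most 1. This is why \<open>decay_conv\<close> asks for the weight \<open>norm z powr L\<close>:
  with \<open>(1 + norm z) powr L\<close> the bound would blow up at the origin as \<open>t\<close>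
  tends to 0.\<close>

lemma dilate_decay:
  fixes b :: "'a::euclidean_space \<Rightarrow> complex"
  assumes L: "real DIM('a) \<le> L" and b: "\<And>z. norm (b z) \<le> B * decay L z" "0 \<le> B" and t: "0 < t" "t \<le> 1"
  shows "norm z powr L * norm (dilate t b z) \<le> B"
proof -
  have L0: "0 \<le> L" using L by (smt (verit) of_nat_0_le_iff)
  have "norm z powr L * norm (dilate t b z) = t powr (L - real DIM('a)) * (norm (z /\<^sub>R t) powr L * norm (b (z /\<^sub>R t)))"
  proof -
    have "norm z powr L = t powr L * norm (z /\<^sub>R t) powr L"
      using t by (simp add: divide_inverse_commute[symmetric] powr_divide)
    moreover have "t powr (L - real DIM('a)) = t powr L / t ^ DIM('a)"
      using t by (simp add: powr_diff powr_realpow)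
    ultimately show ?thesis using t by (simp add: dilate_def divide_inverse mult_ac)
  qed
  also have "\<dots> \<le> 1 * B"
  proof (rule mult_mono)
    show "t powr (L - real DIM('a)) \<le> 1" using t L by (intro powr_le1) auto
    have "norm (z /\<^sub>R t) powr L * norm (b (z /\<^sub>R t)) \<le> norm (z /\<^sub>R t) powr L * (B * decay L (z /\<^sub>R t))"
      by (intro mult_left_mono b) auto
    also have "\<dots> = B * (norm (z /\<^sub>R t) powr L * decay L (z /\<^sub>R t))" by (simp only: mult_ac)
    also have "\<dots> \<le> B * 1" by (intro mult_left_mono powr_norm_decay_le L0 b)
    finally show "norm (z /\<^sub>R t) powr L * norm (b (z /\<^sub>R t)) \<le> B" by simp
  qed auto
  finally show ?thesis by simp
qed

text \<open>The point is uniformity in \<open>t\<close>: dilation preserves the mass of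
  \<open>b\<close> and, for \<open>t \<le> 1\<close>, its bound with weight
  \<open>norm z powr L\<close>.\<close>

lemma conv_dilate_decay:
  assumes L: "real DIM('a::euclidean_space) < L"
  obtains C where "0 < C"
    "\<And>a b A B t (x::'a). \<lbrakk>b \<in> borel_measurable borel; \<And>z. norm (a z) \<le> A * decay L z; \<And>z. norm (b z) \<le> B * decay L z;
        0 \<le> A; 0 \<le> B; 0 < t; t \<le> 1\<rbrakk> \<Longrightarrow> norm (conv a (dilate t b) x) \<le> C * A * B * decay L x"
proof -
  obtain C where C: "0 < C" and
    *: "\<And>a b A B (x::'a). \<lbrakk>b \<in> borel_measurable borel; \<And>z. norm (a z) \<le> A * decay L z;
        (\<integral>\<^sup>+z. ennreal (norm (b z)) \<partial>lborel) \<le> ennreal B;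
        \<And>z. norm z powr L * norm (b z) \<le> B; 0 \<le> A; 0 \<le> B\<rbrakk> \<Longrightarrow>
        norm (conv a b x) \<le> C * A * B * decay L x"
    using decay_conv[OF L] by blast
  define D where "D = (\<integral>(x::'a). decay L x \<partial>lborel)"
  have D: "0 \<le> D" unfolding D_def by (intro integral_nonneg_AE) auto
  show thesis
  proof (rule that[of "C * (D + 1)"])
    show "0 < C * (D + 1)" using C D by simp
    fix a b :: "'a \<Rightarrow> complex" and A B t :: real and x :: 'a
    assume [measurable]: "b \<in> borel_measurable borel" and a: "\<And>z. norm (a z) \<le> A * decay L z"
      and b: "\<And>z. norm (b z) \<le> B * decay L z" and AB: "0 \<le> A" "0 \<le> B" and t: "0 < t" "t \<le> 1"
    have BD: "B * D \<le> B * (D + 1)" "B * 1 \<le> B * (D + 1)"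
      by (rule mult_left_mono; use AB D in simp)+
    have "norm (conv a (dilate t b) x) \<le> C * A * (B * (D + 1)) * decay L x"
    proof (rule *[OF _ a])
      have "(\<integral>\<^sup>+z. ennreal (norm (dilate t b z)) \<partial>lborel) \<le> ennreal (B * D)"
        unfolding D_def using nn_integral_norm_decay_le[OF L b AB(2)] t by (simp add: nn_integral_dilate)
      also have "\<dots> \<le> ennreal (B * (D + 1))" using BD by (intro ennreal_leI)
      finally show "(\<integral>\<^sup>+z. ennreal (norm (dilate t b z)) \<partial>lborel) \<le> ennreal (B * (D + 1))" .
      show "norm z powr L * norm (dilate t b z) \<le> B * (D + 1)" for z
        using dilate_decay[OF order_less_imp_le[OF L] b AB(2) t, of z] BD by linarith
    qed (use AB D in auto)
    then show "norm (conv a (dilate t b) x) \<le> C * (D + 1) * A * B * decay L x" by (simp only: mult_ac)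
  qed
qed

text \<open>A dilation by \<open>t \<le> 1\<close> is harmless once all derivatives are put on the
  fixed function \<open>\<theta>\<close>: the convolution is then a bounded multiple of a test
  function at scale one.\<close>

lemma small_scale_seminorm:
  fixes \<theta> :: "'a::euclidean_space \<Rightarrow> complex"
  assumes \<theta>: "\<theta> \<in> schwartz"
  obtains c where "0 < c" "\<And>\<phi> t. \<lbrakk>\<phi> \<in> test_class N; 0 < t; t \<le> 1\<rbrakk> \<Longrightarrow>
    schwartz_seminorm (N + DIM('a) + 1) (N + 1) (conv (dilate t \<phi>) \<theta>) \<le> ennreal c"
proof -
  let ?L = "real (N + DIM('a) + 1)"
  have "real DIM('a) < ?L" by simp
  from conv_dilate_decay[OF this] obtain C where C: "0 < C" and
    *: "\<And>a b A B t (x::'a). \<lbrakk>b \<in> borel_measurable borel; \<And>z. norm (a z) \<le> A * decay ?L z; \<And>z. norm (b z) \<le> B * decay ?L z;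
        0 \<le> A; 0 \<le> B; 0 < t; t \<le> 1\<rbrakk> \<Longrightarrow> norm (conv a (dilate t b) x) \<le> C * A * B * decay ?L x"
    by blast
  obtain A where A: "0 < A" "schwartz_seminorm (N + DIM('a) + 1) (N + 1) \<theta> \<le> ennreal A"
    using schwartz_seminorm_bound[OF \<theta>] by blast
  show thesis
  proof (rule that[of "C * A * 1"])
    show "0 < C * A * 1" using C A by simp
    fix \<phi> :: "'a \<Rightarrow> complex" and t :: real assume \<phi>: "\<phi> \<in> test_class N" and t: "0 < t" "t \<le> 1"
    show "schwartz_seminorm (N + DIM('a) + 1) (N + 1) (conv (dilate t \<phi>) \<theta>) \<le> ennreal (C * A * 1)"
    proof (rule schwartz_seminorm_decayI)
      fix bs and x :: 'a assume bs: "bs \<in> lists (Basis :: 'a set)" "length bs \<le> N + 1"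
      have "iter_partial bs (conv (dilate t \<phi>) \<theta>) = conv (iter_partial bs \<theta>) (dilate t \<phi>)"
        unfolding iter_partial_conv[OF schwartz_rapid[OF schwartz_dilate[OF test_class_schwartz[OF \<phi>] t(1)]] \<theta> bs(1)]
        by (rule conv_commute)
      moreover have "norm (conv (iter_partial bs \<theta>) (dilate t \<phi>) x) \<le> C * A * 1 * decay ?L x"
      proof (rule *[OF schwartz_measurable[OF test_class_schwartz[OF \<phi>]] _ _ _ _ t])
        show "norm (iter_partial bs \<theta> z) \<le> A * decay ?L z" for z
          using A bs unfolding decay_bound_iff by (simp add: schwartz_seminorm_le_iff)
        show "norm (\<phi> z) \<le> 1 * decay ?L z" for z
          using test_class_bound[OF \<phi>, of "[]" z] by simp
      qed (use A in auto)
      ultimately show "norm (iter_partial bs (conv (dilate t \<phi>) \<theta>) x) \<le> C * A * 1 * decay ?L x" by simp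
    qed (use C A in auto)
  qed
qed

text \<open>The dilated test function is moved past the kernel and merged with
  \<open>\<theta>\<close>, which leaves the kernel acting on \<open>f\<close> tested at scale one.
  Since the cone has width below 1, moving the centre from \<open>y\<close> to \<open>x\<close>
  costs only \<open>2 powr s\<close>.\<close>

lemma estimate_small_scales:
  fixes k \<theta> :: "'a::euclidean_space \<Rightarrow> complex"
  assumes s: "0 \<le> s" and k: "integrable lborel k" "\<And>z. norm (k z) \<le> Ck * decay s z" "0 < Ck" and \<theta>: "\<theta> \<in> schwartz"
  shows "\<exists>C>0. \<forall>f g \<phi> t x y. unit_majorant N f g \<longrightarrow> \<phi> \<in> test_class N \<longrightarrow> 0 < t \<longrightarrow> t \<le> 1 \<longrightarrow> norm (y - x) < t \<longrightarrow>
    ennreal (norm (conv (dilate t \<phi>) (conv k (conv_distr \<theta> f)) y)) \<le> ennreal C * decay_avg s g x"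
proof -
  obtain c where c: "0 < c" "\<And>\<phi> t. \<lbrakk>\<phi> \<in> test_class N; 0 < t; t \<le> 1\<rbrakk> \<Longrightarrow>
    schwartz_seminorm (N + DIM('a) + 1) (N + 1) (conv (dilate t \<phi>) \<theta>) \<le> ennreal c"
    using small_scale_seminorm[OF \<theta>] by blast
  have "ennreal (norm (conv (dilate t \<phi>) (conv k (conv_distr \<theta> f)) y)) \<le> ennreal (Ck * c * 2 powr s) * decay_avg s g x"
    if fg: "unit_majorant N f g" and \<phi>: "\<phi> \<in> test_class N" and t: "0 < t" "t \<le> 1" and yx: "norm (y - x) < t"
    for f g \<phi> t x y
  proof -
    have f: "tempered f" and g: "g \<in> borel_measurable borel" "\<And>z. 0 \<le> g z" using fg by (auto simp: unit_majorant_def)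
    have dil: "dilate t \<phi> \<in> schwartz" by (intro schwartz_dilate test_class_schwartz[OF \<phi>] t)
    have "conv (dilate t \<phi>) (conv k (conv_distr \<theta> f)) = conv k (conv (dilate t \<phi>) (conv_distr \<theta> f))"
      by (intro conv_swap schwartz_integrable dil k(1) conv_distr_measurable f \<theta> unit_majorant_bounded[OF fg])
    also have "conv (dilate t \<phi>) (conv_distr \<theta> f) = conv_distr (conv (dilate t \<phi>) \<theta>) f"
      by (rule conv_distr_conv[OF f schwartz_rapid[OF dil] \<theta>, symmetric])
    finally have "ennreal (norm (conv (dilate t \<phi>) (conv k (conv_distr \<theta> f)) y)) \<le> ennreal (Ck * c) * decay_avg s g y"
      using conv_kernel_bound[OF fg schwartz_conv[OF schwartz_rapid[OF dil] \<theta>] c(1) c(2)[OF \<phi> t] k(2), of y] k(3) by simp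
    also have "\<dots> \<le> ennreal (Ck * c) * (ennreal (2 powr s) * decay_avg s g x)"
      using yx t by (intro mult_left_mono decay_avg_shift g s) auto
    also have "\<dots> = ennreal (Ck * c * 2 powr s) * decay_avg s g x"
      using k(3) c(1) by (simp add: ennreal_mult mult.assoc)
    finally show ?thesis .
  qed
  moreover have "0 < Ck * c * 2 powr s" using k(3) c(1) by simp
  ultimately show ?thesis by blast
qed

text \<open>
  For large scales \<open>N + 1\<close> derivatives are moved from the frequency-localised part to the test
  function, where each of them gains a factor \<open>1 / t\<close>.
\<close>

lemma estimate_large_scales_derivative:
  fixes k a :: "'a::euclidean_space \<Rightarrow> complex"
  assumes s: "real DIM('a) < s" "s \<le> real (N + DIM('a) + 1)"
    and k: "integrable lborel k" "\<And>z. norm (k z) \<le> Ck * decay s z" "0 < Ck"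
    and a: "a \<in> schwartz" and bs: "bs \<in> lists Basis" "length bs = N + 1"
  shows "\<exists>C>0. \<forall>f g \<phi> t x y. unit_majorant N f g \<longrightarrow> \<phi> \<in> test_class N \<longrightarrow> 1 \<le> t \<longrightarrow> norm (y - x) < t \<longrightarrow>
    ennreal (norm (conv (dilate t \<phi>) (conv k (conv_distr (iter_partial bs a) f)) y)) \<le> ennreal C * decay_avg s g x"
proof -
  define L where "L = N + DIM('a) + 1"
  obtain c where c: "0 < c" "schwartz_seminorm (N + DIM('a) + 1) (N + 1) a \<le> ennreal c"
    using schwartz_seminorm_bound[OF a] by blast
  obtain C where C: "0 < C"
    "\<And>(g::'a \<Rightarrow> real) x. g \<in> borel_measurable borel \<Longrightarrow> (\<And>z. 0 \<le> g z) \<Longrightarrow>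
      (\<integral>\<^sup>+z. ennreal (decay s (x - z)) * decay_avg s g z \<partial>lborel) \<le> ennreal C * decay_avg s g x"
    using decay_avg_avg[OF s(1)] by blast
  have "ennreal (norm (conv (dilate t \<phi>) (conv k (conv_distr (iter_partial bs a) f)) y)) \<le> ennreal (2 ^ L * (Ck * c) * C) * decay_avg s g x"
    if fg: "unit_majorant N f g" and \<phi>: "\<phi> \<in> test_class N" and t: "1 \<le> t" and yx: "norm (y - x) < t"
    for f g \<phi> t x y
  proof -
    have t0: "0 < t" using t by simp
    have f: "tempered f" and g: "g \<in> borel_measurable borel" "\<And>z. 0 \<le> g z" using fg by (auto simp: unit_majorant_def)
    note [measurable] = g(1)
    have \<phi>s: "\<phi> \<in> schwartz" by (rule test_class_schwartz[OF \<phi>])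
    have dil: "dilate t \<phi> \<in> schwartz" by (intro schwartz_dilate \<phi>s t0)
    let ?b = "iter_partial bs (dilate t \<phi>)"
    have bS: "?b \<in> schwartz" by (intro schwartz_iter_partial dil bs)
    have aS: "iter_partial bs a \<in> schwartz" by (intro schwartz_iter_partial a bs)
    have ga: "conv_distr a f \<in> borel_measurable borel" by (rule conv_distr_measurable[OF f a])
    \<comment> \<open>Commuting the convolutions back and forth moves the derivative, which may be
      taken on either factor of \<open>conv a (dilate t \<phi>)\<close>.\<close>
    have "conv (dilate t \<phi>) (conv k (conv_distr (iter_partial bs a) f)) = conv k (conv (dilate t \<phi>) (conv_distr (iter_partial bs a) f))"
      by (intro conv_swap schwartz_integrable dil k(1) conv_distr_measurable f aS unit_majorant_bounded[OF fg])
    also have "conv (dilate t \<phi>) (conv_distr (iter_partial bs a) f) = conv_distr (conv (dilate t \<phi>) (iter_partial bs a)) f"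
      by (rule conv_distr_conv[OF f schwartz_rapid[OF dil] aS, symmetric])
    also have "conv (dilate t \<phi>) (iter_partial bs a) = iter_partial bs (conv (dilate t \<phi>) a)"
      by (rule iter_partial_conv[OF schwartz_rapid[OF dil] a bs(1), symmetric])
    also have "conv (dilate t \<phi>) a = conv a (dilate t \<phi>)" by (rule conv_commute)
    also have "iter_partial bs (conv a (dilate t \<phi>)) = conv a ?b"
      by (rule iter_partial_conv[OF schwartz_rapid[OF a] dil bs(1)])
    also have "conv a ?b = conv ?b a" by (rule conv_commute)
    also have "conv_distr (conv ?b a) f = conv ?b (conv_distr a f)"
      by (rule conv_distr_conv[OF f schwartz_rapid[OF bS] a])
    also have "conv k (conv ?b (conv_distr a f)) = conv ?b (conv k (conv_distr a f))"
      by (intro conv_swap schwartz_integrable bS k(1) ga unit_majorant_bounded[OF fg a])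
    finally have eq: "conv (dilate t \<phi>) (conv k (conv_distr (iter_partial bs a) f)) = conv ?b (conv k (conv_distr a f))" .
    \<comment> \<open>The derivatives put \<open>t ^ (N + 1)\<close> into the denominator and the
      dilation puts \<open>t ^ n\<close> there; combined with decay of order
      \<open>L = N + n + 1\<close> this makes \<open>(t + norm (y - z)) ^ L\<close>. As
      \<open>1 \<le> t\<close> and \<open>norm (y - x) < t\<close>, the base is at least half of
      \<open>1 + norm (x - z)\<close>, so the scale disappears and the centre becomes
      \<open>x\<close>.\<close>
    have b_bound: "norm (?b (y - z)) \<le> 2 ^ L * decay s (x - z)" for z
    proof -
      let ?u = "y - z"
      have "norm (?b ?u) = inverse t ^ (N + 1) * (norm (iter_partial bs \<phi> (?u /\<^sub>R t)) / t ^ DIM('a))"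
        using t0 by (simp add: iter_partial_dilate[OF \<phi>s t0 bs(1)] bs(2) dilate_def divide_inverse mult_ac)
      also have "\<dots> = norm (iter_partial bs \<phi> (?u /\<^sub>R t)) / t ^ L"
        by (simp add: L_def power_add power_inverse divide_inverse mult_ac)
      also have "\<dots> \<le> decay (real L) (?u /\<^sub>R t) / t ^ L"
        using test_class_bound[OF \<phi> bs(1), of "?u /\<^sub>R t"] bs(2) t0 by (intro divide_right_mono) (auto simp: L_def)
      also have "\<dots> = 1 / ((1 + norm (?u /\<^sub>R t)) * t) ^ L"
        by (simp add: decay_nat power_mult_distrib)
      also have "(1 + norm (?u /\<^sub>R t)) * t = t + norm ?u" using t0 by (simp add: distrib_right)
      also have "1 / (t + norm ?u) ^ L \<le> 1 / ((1 + norm (x - z)) / 2) ^ L"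
      proof (rule divide_left_mono)
        have "norm (x - z) \<le> norm (y - x) + norm ?u"
          using norm_triangle_ineq4[of ?u "y - x"] by simp
        then have "1 + norm (x - z) \<le> 2 * (t + norm ?u)"
          using yx t norm_ge_zero[of ?u] unfolding distrib_left by linarith
        then have "(1 + norm (x - z)) / 2 \<le> t + norm ?u" by simp
        then show "((1 + norm (x - z)) / 2) ^ L \<le> (t + norm ?u) ^ L" by (intro power_mono) auto
        show "0 < (t + norm ?u) ^ L * ((1 + norm (x - z)) / 2) ^ L"
          using t0 by (intro mult_pos_pos zero_less_power) (auto simp: add_pos_nonneg)
      qed simp
      also have "\<dots> = 2 ^ L * decay (real L) (x - z)" by (simp add: decay_nat power_divide)
      also have "\<dots> \<le> 2 ^ L * decay s (x - z)" using s(2) by (intro mult_left_mono decay_antimono) (auto simp: L_def)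
      finally show ?thesis .
    qed
    have dm: "decay_avg s g \<in> borel_measurable borel"
      unfolding decay_avg_def[abs_def] by measurable
    have "ennreal (norm (conv ?b (conv k (conv_distr a f)) y)) \<le> (\<integral>\<^sup>+z. ennreal (norm (?b (y - z))) * ennreal (norm (conv k (conv_distr a f) z)) \<partial>lborel)"
      by (rule ennreal_norm_conv_le)
    also have "\<dots> \<le> (\<integral>\<^sup>+z. ennreal (2 ^ L * (Ck * c)) * (ennreal (decay s (x - z)) * decay_avg s g z) \<partial>lborel)"
    proof (rule nn_integral_mono)
      fix z
      have "ennreal (norm (?b (y - z))) * ennreal (norm (conv k (conv_distr a f) z)) \<le>
         ennreal (2 ^ L * decay s (x - z)) * (ennreal (Ck * c) * decay_avg s g z)"
        using k(3) by (intro mult_mono ennreal_leI b_bound conv_kernel_bound[OF fg a c k(2)]) auto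
      also have "\<dots> = ennreal (2 ^ L * (Ck * c)) * (ennreal (decay s (x - z)) * decay_avg s g z)"
        using k(3) c(1) by (simp add: ennreal_mult mult_ac)
      finally show "ennreal (norm (?b (y - z))) * ennreal (norm (conv k (conv_distr a f) z)) \<le>
         ennreal (2 ^ L * (Ck * c)) * (ennreal (decay s (x - z)) * decay_avg s g z)" .
    qed
    also have "\<dots> = ennreal (2 ^ L * (Ck * c)) * (\<integral>\<^sup>+z. ennreal (decay s (x - z)) * decay_avg s g z \<partial>lborel)"
      using dm by (intro nn_integral_cmult) measurable
    also have "\<dots> \<le> ennreal (2 ^ L * (Ck * c)) * (ennreal C * decay_avg s g x)"
      by (intro mult_left_mono C g) auto
    also have "\<dots> = ennreal (2 ^ L * (Ck * c) * C) * decay_avg s g x"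
      using k(3) c(1) C(1) by (simp add: ennreal_mult mult.assoc)
    finally show ?thesis unfolding eq .
  qed
  moreover have "0 < 2 ^ L * (Ck * c) * C" using k(3) c(1) C(1) by simp
  ultimately show ?thesis by blast
qed

section \<open>Large scales for the fast decaying kernel\<close>

lemma truncation_rapid:
  fixes k :: "'a::euclidean_space \<Rightarrow> complex"
  assumes [measurable]: "k \<in> borel_measurable borel" and k: "\<And>z. norm (k z) \<le> C"
  shows "rapid (\<lambda>z. k z * indicator (ball 0 (real m)) z)"
  unfolding rapid_def
proof (intro conjI allI)
  show "(\<lambda>z. k z * indicator (ball 0 (real m)) z) \<in> borel_measurable borel"
    by (intro borel_measurable_times borel_measurable_indicator assms(1)) simp
  fix M
  have C: "0 \<le> C" using k[of 0] norm_ge_zero order_trans by blast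
  have "(1 + norm z) ^ M * norm (k z * indicator (ball 0 (real m)) z) \<le> (1 + real m) ^ M * C" for z
  proof (cases "z \<in> ball 0 (real m)")
    case True
    then show ?thesis using k[of z] by (auto intro!: mult_mono power_mono)
  qed (use C in simp)
  then show "\<exists>C. \<forall>z. (1 + norm z) ^ M * norm (k z * indicator (ball 0 (real m)) z) \<le> C" by blast
qed

text \<open>For \<open>t \<ge> 1\<close> the roles are reversed: seen at scale \<open>t\<close>, the
  localised kernel is dilated by \<open>1 / t \<le> 1\<close>, and the derivatives fall on
  \<open>\<phi>\<close>. The constant depends on \<open>h\<close> only through \<open>Ck\<close>,
  hence is common to all truncations of a kernel.\<close>

lemma large_scale_seminorm:
  fixes \<theta> :: "'a::euclidean_space \<Rightarrow> complex"
  assumes \<theta>: "\<theta> \<in> schwartz" and Ck: "0 < Ck"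
  obtains c where "0 < c"
    "\<And>h \<phi> t. \<lbrakk>rapid h; \<And>z. norm (h z) \<le> Ck * decay (real (N + DIM('a) + 1)) z; \<phi> \<in> test_class N; 1 \<le> t\<rbrakk> \<Longrightarrow>
      schwartz_seminorm (N + DIM('a) + 1) (N + 1) (conv \<phi> (dilate (1 / t) (conv h \<theta>))) \<le> ennreal c"
proof -
  let ?L = "real (N + DIM('a) + 1)"
  have "real DIM('a) < ?L" by simp
  from conv_dilate_decay[OF this] obtain C where C: "0 < C" and
    *: "\<And>a b A B t (x::'a). \<lbrakk>b \<in> borel_measurable borel; \<And>z. norm (a z) \<le> A * decay ?L z; \<And>z. norm (b z) \<le> B * decay ?L z;
        0 \<le> A; 0 \<le> B; 0 < t; t \<le> 1\<rbrakk> \<Longrightarrow> norm (conv a (dilate t b) x) \<le> C * A * B * decay ?L x"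
    by blast
  obtain A where A: "0 < A" "\<And>x. (1 + norm x) ^ (N + DIM('a) + 1) * norm (\<theta> x) \<le> A"
    using rapid_bound[OF schwartz_rapid[OF \<theta>]] by blast
  define E where "E = C * A * Ck"
  have E: "0 < E" using C A Ck by (simp add: E_def)
  show thesis
  proof (rule that[of "C * 1 * E"])
    show "0 < C * 1 * E" using C E by simp
    fix h \<phi> :: "'a \<Rightarrow> complex" and t :: real
    assume h: "rapid h" "\<And>z. norm (h z) \<le> Ck * decay ?L z" and \<phi>: "\<phi> \<in> test_class N" and t: "1 \<le> t"
    have \<phi>s: "\<phi> \<in> schwartz" by (rule test_class_schwartz[OF \<phi>])
    let ?\<eta> = "conv h \<theta>"
    have \<eta>s: "?\<eta> \<in> schwartz" by (rule schwartz_conv[OF h(1) \<theta>])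
    have \<eta>: "norm (?\<eta> z) \<le> E * decay ?L z" for z
    proof -
      have "norm (conv \<theta> (dilate 1 h) z) \<le> C * A * Ck * decay ?L z"
      proof (rule *[OF rapid_measurable[OF h(1)] _ h(2)])
        show "norm (\<theta> z) \<le> A * decay ?L z" for z unfolding decay_bound_iff by (rule A)
      qed (use A Ck in auto)
      then show ?thesis by (simp add: E_def conv_commute[of h])
    qed
    have dil: "dilate (1 / t) ?\<eta> \<in> schwartz" using t by (intro schwartz_dilate \<eta>s) simp
    show "schwartz_seminorm (N + DIM('a) + 1) (N + 1) (conv \<phi> (dilate (1 / t) ?\<eta>)) \<le> ennreal (C * 1 * E)"
    proof (rule schwartz_seminorm_decayI)
      fix bs and x :: 'a assume bs: "bs \<in> lists (Basis :: 'a set)" "length bs \<le> N + 1"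
      have "iter_partial bs (conv \<phi> (dilate (1 / t) ?\<eta>)) = conv (iter_partial bs \<phi>) (dilate (1 / t) ?\<eta>)"
        unfolding conv_commute[of \<phi>] iter_partial_conv[OF schwartz_rapid[OF dil] \<phi>s bs(1)]
        by (rule conv_commute)
      moreover have "norm (conv (iter_partial bs \<phi>) (dilate (1 / t) ?\<eta>) x) \<le> C * 1 * E * decay ?L x"
      proof (rule *[OF schwartz_measurable[OF \<eta>s] _ \<eta>])
        show "norm (iter_partial bs \<phi> z) \<le> 1 * decay ?L z" for z
          using test_class_bound[OF \<phi> bs, of z] by simp
      qed (use E t in auto)
      ultimately show "norm (iter_partial bs (conv \<phi> (dilate (1 / t) ?\<eta>)) x) \<le> C * 1 * E * decay ?L x" by simp
    qed (use C E in auto)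
  qed
qed

text \<open>
  The kernel \<open>k\<close> decays fast enough, but it is not a Schwartz function; the estimate is obtained
  for its truncations and passes to the limit.
\<close>

lemma estimate_large_scales_smooth:
  fixes k \<theta> :: "'a::euclidean_space \<Rightarrow> complex"
  assumes [measurable]: "k \<in> borel_measurable borel"
    and k: "\<And>z. norm (k z) \<le> Ck * decay (real (N + DIM('a) + 1)) z" "0 < Ck" and \<theta>: "\<theta> \<in> schwartz"
  shows "\<exists>C>0. \<forall>f g \<phi> t x y. unit_majorant N f g \<longrightarrow> \<phi> \<in> test_class N \<longrightarrow> 1 \<le> t \<longrightarrow> norm (y - x) < t \<longrightarrow>
    ennreal (norm (conv (dilate t \<phi>) (conv k (conv_distr \<theta> f)) y)) \<le> ennreal C * grand_maximal N f x"
proof -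
  let ?L = "real (N + DIM('a) + 1)"
  have kint: "integrable lborel k" by (rule integrable_decay_bound[OF _ _ k(1)]) auto
  obtain c where c: "0 < c"
    "\<And>h \<phi> t. \<lbrakk>rapid h; \<And>z. norm (h z) \<le> Ck * decay ?L z; \<phi> \<in> test_class N; 1 \<le> t\<rbrakk> \<Longrightarrow>
      schwartz_seminorm (N + DIM('a) + 1) (N + 1) (conv \<phi> (dilate (1 / t) (conv h \<theta>))) \<le> ennreal c"
    using large_scale_seminorm[OF \<theta> k(2)] by blast
  have "ennreal (norm (conv (dilate t \<phi>) (conv k (conv_distr \<theta> f)) y)) \<le> ennreal c * grand_maximal N f x"
    if fg: "unit_majorant N f g" and \<phi>: "\<phi> \<in> test_class N" and t: "1 \<le> t" and yx: "norm (y - x) < t"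
    for f g \<phi> t x y
  proof -
    have t0: "0 < t" using t by simp
    have f: "tempered f" using fg by (simp add: unit_majorant_def)
    have \<phi>s: "\<phi> \<in> schwartz" by (rule test_class_schwartz[OF \<phi>])
    have dil: "dilate t \<phi> \<in> schwartz" by (intro schwartz_dilate \<phi>s t0)
    let ?F = "conv_distr \<theta> f"
    have [measurable]: "?F \<in> borel_measurable borel" by (rule conv_distr_measurable[OF f \<theta>])
    obtain B where B: "\<And>z. norm (?F z) \<le> B" using unit_majorant_bounded[OF fg \<theta>] by blast
    have B0: "0 \<le> B" using B[of 0] norm_ge_zero order_trans by blast
    define h where "h m z = k z * indicator (ball 0 (real m)) z" for m z
    have kC: "norm (k z) \<le> Ck" for z
      using k(1)[of z] mult_left_mono[OF decay_le_1[of ?L z], of Ck] k(2) by linarith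
    have h: "rapid (h m)" for m unfolding h_def[abs_def] by (rule truncation_rapid[OF _ kC]) simp
    have [measurable]: "h m \<in> borel_measurable borel" for m by (rule rapid_measurable[OF h])
    have hk: "norm (h m z) \<le> norm (k z)" for m z by (simp add: h_def norm_mult indicator_def)
    have hL: "norm (h m z) \<le> Ck * decay ?L z" for m z using hk k(1) by (rule order_trans)
    have hlim: "(\<lambda>m. h m z) \<longlonglongrightarrow> k z" for z
    proof (rule tendsto_eventually)
      obtain m0 where "norm z < real m0" using reals_Archimedean2 by blast
      then have "h m z = k z" if "m0 \<le> m" for m using that by (simp add: h_def)
      then show "\<forall>\<^sub>F m in sequentially. h m z = k z" by (rule eventually_sequentiallyI)
    qed
    have bound: "ennreal (norm (conv (dilate t \<phi>) (conv (h m) ?F) y)) \<le> ennreal c * grand_maximal N f x" for m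
    proof -
      \<comment> \<open>With a truncated kernel everything is a Schwartz function, and
        \<open>conv (dilate t \<phi>) ?\<eta>\<close> is the dilate by the same \<open>t\<close> of
        a bounded multiple of a test function. It therefore competes in the grand maximal function
        at \<open>x\<close>.\<close>
      let ?\<eta> = "conv (h m) \<theta>"
      let ?\<Phi> = "conv \<phi> (dilate (1 / t) ?\<eta>)"
      have \<eta>s: "?\<eta> \<in> schwartz" by (rule schwartz_conv[OF h \<theta>])
      have dils: "dilate (1 / t) ?\<eta> \<in> schwartz" using t0 by (intro schwartz_dilate \<eta>s) simp
      have \<Phi>s: "?\<Phi> \<in> schwartz" by (intro schwartz_conv schwartz_rapid \<phi>s dils)
      have "conv (h m) ?F = conv_distr ?\<eta> f" by (rule conv_distr_conv[OF f h \<theta>, symmetric])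
      then have "conv (dilate t \<phi>) (conv (h m) ?F) = conv_distr (conv (dilate t \<phi>) ?\<eta>) f"
        by (simp add: conv_distr_conv[OF f schwartz_rapid[OF dil] \<eta>s])
      also have "conv (dilate t \<phi>) ?\<eta> = dilate t ?\<Phi>"
        using t0 by (simp add: conv_dilate[symmetric] dilate_dilate)
      finally show ?thesis
        using grand_maximal_bound[OF f \<Phi>s c(1) c(2)[OF h hL \<phi> t] yx] by simp
    qed
    \<comment> \<open>Dominated convergence is used twice: here with majorant \<open>norm k\<close>
      times \<open>B\<close>, later in the outer convolution, where the inner values are uniformly
      bounded.\<close>
    have inner: "(\<lambda>m. conv (h m) ?F z) \<longlonglongrightarrow> conv k ?F z" for z
      unfolding conv_def
    proof (rule integral_dominated_convergence[where w="\<lambda>w. norm (k (z - w)) * B"])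
      show "integrable lborel (\<lambda>w. norm (k (z - w)) * B)" using kint integrable_reflect[of k z] by simp
      show "AE w in lborel. (\<lambda>m. h m (z - w) * ?F w) \<longlonglongrightarrow> k (z - w) * ?F w"
        by (intro AE_I2 tendsto_mult tendsto_const hlim)
      show "AE w in lborel. norm (h m (z - w) * ?F w) \<le> norm (k (z - w)) * B" for m
        unfolding norm_mult by (intro AE_I2 mult_mono hk B) auto
      show "(\<lambda>w. h m (z - w) * ?F w) \<in> borel_measurable lborel" for m
        by measurable
    qed measurable
    have inner_bd: "norm (conv (h m) ?F z) \<le> (\<integral>z. norm (k z) \<partial>lborel) * B" for m z
    proof -
      have "norm (conv (h m) ?F z) \<le> (\<integral>z. norm (h m z) \<partial>lborel) * B"
        by (rule conv_bounded[OF rapid_integrable[OF h] _ B]) simp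
      also have "\<dots> \<le> (\<integral>z. norm (k z) \<partial>lborel) * B"
        using kint rapid_integrable[OF h] by (intro mult_right_mono integral_mono hk B0) auto
      finally show ?thesis .
    qed
    have [measurable]: "dilate t \<phi> \<in> borel_measurable borel" by (rule schwartz_measurable[OF dil])
    have "(\<lambda>m. conv (dilate t \<phi>) (conv (h m) ?F) y) \<longlonglongrightarrow> conv (dilate t \<phi>) (conv k ?F) y"
      unfolding conv_def[of "dilate t \<phi>"]
    proof (rule integral_dominated_convergence[where w="\<lambda>z. norm (dilate t \<phi> (y - z)) * ((\<integral>z. norm (k z) \<partial>lborel) * B)"])
      show "integrable lborel (\<lambda>z. norm (dilate t \<phi> (y - z)) * ((\<integral>z. norm (k z) \<partial>lborel) * B))"
        using schwartz_integrable[OF dil] integrable_reflect[of "dilate t \<phi>" y] by simp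
      show "AE z in lborel. (\<lambda>m. dilate t \<phi> (y - z) * conv (h m) ?F z) \<longlonglongrightarrow> dilate t \<phi> (y - z) * conv k ?F z"
        by (intro AE_I2 tendsto_mult tendsto_const inner)
      show "AE z in lborel. norm (dilate t \<phi> (y - z) * conv (h m) ?F z) \<le> norm (dilate t \<phi> (y - z)) * ((\<integral>z. norm (k z) \<partial>lborel) * B)" for m
        unfolding norm_mult by (intro AE_I2 mult_left_mono inner_bd) auto
    qed measurable
    then have "(\<lambda>m. ennreal (norm (conv (dilate t \<phi>) (conv (h m) ?F) y))) \<longlonglongrightarrow> ennreal (norm (conv (dilate t \<phi>) (conv k ?F) y))"
      by (intro tendsto_ennrealI tendsto_norm)
    then show ?thesis by (rule LIMSEQ_le_const2) (use bound in blast)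
  qed
  then show ?thesis using c(1) by blast
qed

section \<open>Assembling the pointwise bound\<close>

lemma tempered_distr_of_fun:
  fixes h :: "'a::euclidean_space \<Rightarrow> complex"
  assumes [measurable]: "h \<in> borel_measurable borel" and h: "\<And>z. norm (h z) \<le> B"
  shows "tempered (distr_of_fun h)"
proof -
  have B0: "0 \<le> B" using h[of 0] norm_ge_zero order_trans by blast
  have int: "integrable lborel (\<lambda>x. h x * \<phi> x)" if \<phi>: "\<phi> \<in> schwartz" for \<phi>
  proof (rule Bochner_Integration.integrable_bound[where f="\<lambda>x. B * norm (\<phi> x)"])
    have [measurable]: "\<phi> \<in> borel_measurable borel" by (rule schwartz_measurable[OF \<phi>])
    show "integrable lborel (\<lambda>x. B * norm (\<phi> x))" using schwartz_integrable[OF \<phi>] by simp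
    show "(\<lambda>x. h x * \<phi> x) \<in> borel_measurable lborel" by measurable
    show "AE x in lborel. norm (h x * \<phi> x) \<le> norm (B * norm (\<phi> x))"
      using h B0 by (auto simp: norm_mult abs_mult intro!: mult_right_mono)
  qed
  define n1 where "n1 = DIM('a) + 1"
  define D where "D = (\<integral>(x::'a). decay (real n1) x \<partial>lborel)"
  have Dint: "integrable lborel (decay (real n1) :: 'a \<Rightarrow> real)" by (rule decay_integrable) (simp add: n1_def)
  have D: "0 \<le> D" unfolding D_def by (intro integral_nonneg_AE) auto
  have bound: "ennreal (norm (distr_of_fun h \<phi>)) \<le> ennreal (B * D) * schwartz_seminorm n1 0 \<phi>" if \<phi>: "\<phi> \<in> schwartz" for \<phi>
  proof -
    have "schwartz_seminorm n1 0 \<phi> < \<infinity>" using \<phi> by (simp add: schwartz_def)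
    then obtain c where c: "0 \<le> c" "schwartz_seminorm n1 0 \<phi> = ennreal c" by (cases "schwartz_seminorm n1 0 \<phi>") auto
    then have "schwartz_seminorm n1 0 \<phi> \<le> ennreal c" by simp
    then have "(1 + norm x) ^ n1 * norm (iter_partial [] \<phi> x) \<le> c" for x
      unfolding schwartz_seminorm_le_iff[OF c(1)] by (metis lists.Nil list.size(3) order_refl)
    then have \<phi>c: "norm (\<phi> x) \<le> c * decay (real n1) x" for x unfolding decay_bound_iff by simp
    have "norm (distr_of_fun h \<phi>) \<le> (\<integral>(x::'a). B * (c * decay (real n1) x) \<partial>lborel)"
      unfolding distr_of_fun_def
    proof (rule norm_integral_le_integral[OF int[OF \<phi>]])
      show "norm (h x * \<phi> x) \<le> B * (c * decay (real n1) x)" for x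
        unfolding norm_mult by (intro mult_mono h \<phi>c B0) auto
    qed (use Dint in simp)
    also have "\<dots> = (B * D) * c" by (simp add: D_def)
    finally show ?thesis using c B0 D by (simp add: ennreal_mult[symmetric] ennreal_leI)
  qed
  show ?thesis
    unfolding tempered_def
  proof (intro conjI ballI allI)
    show "distr_of_fun h (\<lambda>x. \<phi> x + \<psi> x) = distr_of_fun h \<phi> + distr_of_fun h \<psi>"
      if "\<phi> \<in> schwartz" "\<psi> \<in> schwartz" for \<phi> \<psi>
      using int[OF that(1)] int[OF that(2)] by (simp add: distr_of_fun_def distrib_left)
    show "distr_of_fun h (\<lambda>x. c * \<phi> x) = c * distr_of_fun h \<phi>" for c \<phi>
      by (simp add: distr_of_fun_def mult.left_commute)
    show "\<exists>C\<ge>0. \<exists>M K. \<forall>\<phi>\<in>schwartz. ennreal (norm (distr_of_fun h \<phi>)) \<le> ennreal C * schwartz_seminorm M K \<phi>"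
      using bound B0 D by (intro exI[of _ "B * D"] conjI exI[of _ n1] exI[of _ 0]) auto
  qed
qed

lemma conv_add_right:
  fixes P Q :: "'a::euclidean_space \<Rightarrow> complex"
  assumes k: "integrable lborel k" and P: "P \<in> borel_measurable borel" "\<And>z. norm (P z) \<le> B"
    and Q: "Q \<in> borel_measurable borel" "\<And>z. norm (Q z) \<le> B'"
  shows "conv k (\<lambda>z. P z + Q z) x = conv k P x + conv k Q x"
  unfolding conv_def distrib_left
  by (intro Bochner_Integration.integral_add conv_integrable_bounded[OF k P] conv_integrable_bounded[OF k Q])

text \<open>Taking \<open>J = L = N + n + 1\<close> gives the first kernel at least the decay of a
  test function, and \<open>M = N + 1\<close> leaves that many derivatives to move while as many
  stay on \<open>\<theta>1\<close>. The function \<open>\<psi>0\<close> only fixes the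
  decomposition, so the constant is chosen before \<open>f\<close> and
  \<open>\<psi>\<close>.\<close>

lemma grand_maximal_br_le:
  fixes \<psi>0 :: "'a::euclidean_space \<Rightarrow> complex"
  assumes \<beta>: "(real DIM('a) - 1) / 2 < \<beta>" "0 < \<beta>"
    and s: "real DIM('a) < s" "s \<le> \<beta> + (real DIM('a) + 1) / 2" "s \<le> real (N + DIM('a) + 1)"
    and \<psi>0: "\<psi>0 \<in> schwartz" "\<And>\<xi>. norm \<xi> \<le> 1 \<Longrightarrow> fourier \<psi>0 \<xi> = 1"
  shows "\<exists>C>0. \<forall>f g \<psi>. unit_majorant N f g \<longrightarrow> \<psi> \<in> schwartz \<longrightarrow> (\<forall>\<xi>::'a. norm \<xi> \<le> 1 \<longrightarrow> fourier \<psi> \<xi> = 1) \<longrightarrow>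
    tempered (distr_of_fun (conv (br_kernel \<beta>) (conv_distr \<psi> f))) \<and>
    (\<forall>x. grand_maximal N (distr_of_fun (conv (br_kernel \<beta>) (conv_distr \<psi> f))) x \<le>
      ennreal C * (grand_maximal N f x + decay_avg s g x))"
proof -
  define L where "L = N + DIM('a) + 1"
  let ?K = "br_kernel \<beta> :: 'a \<Rightarrow> complex" and ?KJ = "br_kernel (\<beta> + real L) :: 'a \<Rightarrow> complex"
  let ?S = "{bs. bs \<in> lists (Basis :: 'a set) \<and> length bs = N + 1}"
  have finS: "finite ?S" by (rule finite_lists_of_length)
  have s0: "0 \<le> s" using s(1) by (smt (verit) of_nat_0_le_iff)
  have \<beta>J: "(real DIM('a) - 1) / 2 < \<beta> + real L" "0 < \<beta> + real L" using \<beta> by (simp_all add: add_strict_increasing add_pos_nonneg)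
  have Kint: "integrable lborel ?K" by (rule br_kernel_integrable[OF \<beta>])
  have KJint: "integrable lborel ?KJ" by (rule br_kernel_integrable[OF \<beta>J])
  obtain C1 where C1: "0 < C1" "\<And>x. norm (?K x) \<le> C1 * decay (\<beta> + (real DIM('a) + 1) / 2) x"
    using br_kernel_decay[OF \<beta>(2), where 'a='a] by blast
  have K: "norm (?K x) \<le> C1 * decay s x" for x
    using C1(2)[of x] mult_left_mono[OF decay_antimono[OF s(2), of x], of C1] C1(1) by linarith
  obtain C2 where C2: "0 < C2" "\<And>x. norm (?KJ x) \<le> C2 * decay (\<beta> + real L + (real DIM('a) + 1) / 2) x"
    using br_kernel_decay[OF \<beta>J(2), where 'a='a] by blast
  have KJ: "norm (?KJ x) \<le> C2 * decay (real (N + DIM('a) + 1)) x" for x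
  proof -
    have "real (N + DIM('a) + 1) \<le> \<beta> + real L + (real DIM('a) + 1) / 2"
      unfolding L_def using \<beta>(2) by (simp add: add_nonneg_nonneg)
    from decay_antimono[OF this, of x] show ?thesis
      using C2(2)[of x] mult_left_mono[of _ _ C2] C2(1) by (meson order_trans order_less_imp_le)
  qed
  have KJs: "norm (?KJ x) \<le> C2 * decay s x" for x
    using KJ[of x] mult_left_mono[OF decay_antimono[OF s(3), of x], of C2] C2(1) by linarith
  obtain \<theta>0 \<theta>1 where \<theta>0: "\<theta>0 \<in> schwartz" and \<theta>1: "\<theta>1 \<in> schwartz" and
    dec: "\<And>x::'a. br_kernel \<beta> x = conv (br_kernel (\<beta> + real L)) \<theta>0 x +
      conv (br_kernel \<beta>) (\<lambda>x. \<Sum>bs | bs \<in> lists Basis \<and> length bs = N + 1. iter_partial bs (iter_partial bs \<theta>1) x) x"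
    using br_kernel_decomposition[OF order_less_imp_le[OF \<beta>(2)] \<psi>0, where J=L and M="N + 1"] by blast
  define \<theta>2 where "\<theta>2 x = (\<Sum>bs\<in>?S. iter_partial bs (iter_partial bs \<theta>1) x)" for x
  have it: "iter_partial bs \<theta>1 \<in> schwartz" "iter_partial bs (iter_partial bs \<theta>1) \<in> schwartz" if "bs \<in> ?S" for bs
    using that by (auto intro!: schwartz_iter_partial \<theta>1)
  have \<theta>2: "\<theta>2 \<in> schwartz" unfolding \<theta>2_def[abs_def] by (intro schwartz_sum it finS)
  obtain Ca where Ca: "0 < Ca" "\<And>f g \<phi> t x y. \<lbrakk>unit_majorant N f g; \<phi> \<in> test_class N; 0 < t; t \<le> 1; norm (y - x) < t\<rbrakk> \<Longrightarrow>
    ennreal (norm (conv (dilate t \<phi>) (conv ?KJ (conv_distr \<theta>0 f)) y)) \<le> ennreal Ca * decay_avg s g x"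
    using estimate_small_scales[OF s0 KJint KJs C2(1) \<theta>0, of N] by blast
  obtain Cb where Cb: "0 < Cb" "\<And>f g \<phi> t x y. \<lbrakk>unit_majorant N f g; \<phi> \<in> test_class N; 0 < t; t \<le> 1; norm (y - x) < t\<rbrakk> \<Longrightarrow>
    ennreal (norm (conv (dilate t \<phi>) (conv ?K (conv_distr \<theta>2 f)) y)) \<le> ennreal Cb * decay_avg s g x"
    using estimate_small_scales[OF s0 Kint K C1(1) \<theta>2, of N] by blast
  obtain Cc where Cc: "0 < Cc" "\<And>f g \<phi> t x y. \<lbrakk>unit_majorant N f g; \<phi> \<in> test_class N; 1 \<le> t; norm (y - x) < t\<rbrakk> \<Longrightarrow>
    ennreal (norm (conv (dilate t \<phi>) (conv ?KJ (conv_distr \<theta>0 f)) y)) \<le> ennreal Cc * grand_maximal N f x"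
    using estimate_large_scales_smooth[OF br_kernel_measurable KJ C2(1) \<theta>0] by blast
  \<comment> \<open>Each of the finitely many lists has its own constant; their sum
    \<open>Ce\<close> serves for \<open>\<theta>2\<close>.\<close>
  have "\<forall>bs\<in>?S. \<exists>C. 0 < C \<and> (\<forall>f g \<phi> t x y. unit_majorant N f g \<longrightarrow> \<phi> \<in> test_class N \<longrightarrow> 1 \<le> t \<longrightarrow> norm (y - x) < t \<longrightarrow>
    ennreal (norm (conv (dilate t \<phi>) (conv ?K (conv_distr (iter_partial bs (iter_partial bs \<theta>1)) f)) y)) \<le> ennreal C * decay_avg s g x)"
  proof
    fix bs assume bs: "bs \<in> ?S"
    then have "bs \<in> lists Basis" "length bs = N + 1" by auto
    from estimate_large_scales_derivative[OF s(1,3) Kint K C1(1) it(1)[OF bs] this]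
    show "\<exists>C. 0 < C \<and> (\<forall>f g \<phi> t x y. unit_majorant N f g \<longrightarrow> \<phi> \<in> test_class N \<longrightarrow> 1 \<le> t \<longrightarrow> norm (y - x) < t \<longrightarrow>
      ennreal (norm (conv (dilate t \<phi>) (conv ?K (conv_distr (iter_partial bs (iter_partial bs \<theta>1)) f)) y)) \<le> ennreal C * decay_avg s g x)" .
  qed
  from bchoice[OF this] obtain Cd where Cd: "\<forall>bs\<in>?S. 0 < Cd bs \<and> (\<forall>f g \<phi> t x y. unit_majorant N f g \<longrightarrow> \<phi> \<in> test_class N \<longrightarrow> 1 \<le> t \<longrightarrow> norm (y - x) < t \<longrightarrow>
    ennreal (norm (conv (dilate t \<phi>) (conv ?K (conv_distr (iter_partial bs (iter_partial bs \<theta>1)) f)) y)) \<le> ennreal (Cd bs) * decay_avg s g x)"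
    by blast
  define Ce where "Ce = (\<Sum>bs\<in>?S. Cd bs)"
  have Ce: "0 \<le> Ce" unfolding Ce_def using Cd by (intro sum_nonneg) (auto intro: order_less_imp_le)
  define C where "C = Ca + Cb + Cc + Ce"
  have C: "0 < C" using Ca Cb Cc Ce by (simp add: C_def)
  have main: "tempered (distr_of_fun (conv ?K (conv_distr \<psi> f))) \<and>
      (\<forall>x. grand_maximal N (distr_of_fun (conv ?K (conv_distr \<psi> f))) x \<le> ennreal C * (grand_maximal N f x + decay_avg s g x))"
    if fg: "unit_majorant N f g" and \<psi>: "\<psi> \<in> schwartz" "\<And>\<xi>. norm \<xi> \<le> 1 \<Longrightarrow> fourier \<psi> \<xi> = 1" for f g \<psi>
  proof -
    have f: "tempered f" using fg by (simp add: unit_majorant_def)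
    note bdd = unit_majorant_bounded[OF fg]
    let ?T = "conv ?K (conv_distr \<psi> f)"
    define P where "P = conv ?KJ (conv_distr \<theta>0 f)"
    define Q where "Q = conv ?K (conv_distr \<theta>2 f)"
    have T: "?T = (\<lambda>x. P x + Q x)"
      unfolding P_def Q_def
      by (rule ext, rule br_operator_decomposition[OF \<beta> f bdd _ \<theta>0 \<theta>2 \<psi>]) (simp_all add: dec \<theta>2_def[abs_def])
    have conv_bd: "conv k (conv_distr \<theta> f) \<in> borel_measurable borel" "\<exists>B. \<forall>z. norm (conv k (conv_distr \<theta> f) z) \<le> B"
      if k: "integrable lborel k" and \<theta>: "\<theta> \<in> schwartz" for k \<theta>
    proof -
      obtain B where B: "\<And>z. norm (conv_distr \<theta> f z) \<le> B" using bdd[OF \<theta>] by blast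
      show "conv k (conv_distr \<theta> f) \<in> borel_measurable borel"
        by (intro conv_measurable conv_distr_measurable f \<theta> borel_measurable_integrable[OF k, simplified])
      show "\<exists>B. \<forall>z. norm (conv k (conv_distr \<theta> f) z) \<le> B"
        using conv_bounded[OF k conv_distr_measurable[OF f \<theta>] B] by blast
    qed
    have "tempered (distr_of_fun ?T)"
      using conv_bd[OF Kint \<psi>(1)] tempered_distr_of_fun by blast
    moreover have "grand_maximal N (distr_of_fun ?T) x \<le> ennreal C * (grand_maximal N f x + decay_avg s g x)" for x :: 'a
      unfolding grand_maximal_def[of N "distr_of_fun ?T"] conv_distr_distr_of_fun
    proof (intro SUP_least)
      fix \<phi> :: "'a \<Rightarrow> complex" and yt assume \<phi>: "\<phi> \<in> test_class N" and "yt \<in> {(y, t). norm (y - x) < t}"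
      then obtain y t where yt: "yt = (y, t)" "norm (y - x) < t" by auto
      have t: "0 < t" using yt(2) norm_ge_zero[of "y - x"] by linarith
      have dil: "integrable lborel (dilate t \<phi>)" by (intro schwartz_integrable schwartz_dilate test_class_schwartz[OF \<phi>] t)
      have Pm: "P \<in> borel_measurable borel" "\<exists>B. \<forall>z. norm (P z) \<le> B"
        using conv_bd[OF KJint \<theta>0] by (simp_all add: P_def)
      have Qm: "Q \<in> borel_measurable borel" "\<exists>B. \<forall>z. norm (Q z) \<le> B"
        using conv_bd[OF Kint \<theta>2] by (simp_all add: Q_def)
      have "conv (dilate t \<phi>) ?T y = conv (dilate t \<phi>) P y + conv (dilate t \<phi>) Q y"
        unfolding T using Pm Qm conv_add_right[OF dil] by blast
      then have "ennreal (norm (conv (dilate t \<phi>) ?T y)) \<le> ennreal (norm (conv (dilate t \<phi>) P y)) + ennreal (norm (conv (dilate t \<phi>) Q y))"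
        by (simp add: ennreal_plus[symmetric] ennreal_leI norm_triangle_ineq del: ennreal_plus)
      \<comment> \<open>For \<open>t \<le> 1\<close> both parts are bounded by the average of
        \<open>g\<close>. For larger \<open>t\<close> the fast decaying part calls for the grand
        maximal function, the divisible part still only for the average.\<close>
      also have "\<dots> \<le> ennreal C * (grand_maximal N f x + decay_avg s g x)"
      proof (cases "t \<le> 1")
        case True
        have "ennreal (norm (conv (dilate t \<phi>) P y)) + ennreal (norm (conv (dilate t \<phi>) Q y)) \<le>
            ennreal Ca * decay_avg s g x + ennreal Cb * decay_avg s g x"
          unfolding P_def Q_def by (intro add_mono Ca(2) Cb(2) fg \<phi> t True yt)
        also have "\<dots> = ennreal (Ca + Cb) * decay_avg s g x" using Ca(1) Cb(1) by (simp add: distrib_right)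
        also have "\<dots> \<le> ennreal C * (grand_maximal N f x + decay_avg s g x)"
          using Ca Cb Cc Ce by (intro mult_mono ennreal_leI) (auto simp: C_def)
        finally show ?thesis .
      next
        case False
        then have t1: "1 \<le> t" by simp
        let ?F = "\<lambda>bs. conv_distr (iter_partial bs (iter_partial bs \<theta>1)) f"
        have "conv_distr \<theta>2 f z = (\<Sum>bs\<in>?S. ?F bs z)" for z
          unfolding \<theta>2_def[abs_def] by (intro conv_distr_sum f finS it)
        then have eqF: "conv_distr \<theta>2 f = (\<lambda>z. \<Sum>bs\<in>?S. ?F bs z)" by blast
        have "Q = (\<lambda>z. \<Sum>bs\<in>?S. conv ?K (?F bs) z)"
          unfolding Q_def eqF
          by (rule ext, rule conv_sum_right[OF Kint]) (intro conv_distr_measurable f it bdd; assumption)+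
        then have Q: "conv (dilate t \<phi>) Q y = (\<Sum>bs\<in>?S. conv (dilate t \<phi>) (conv ?K (?F bs)) y)"
          using conv_sum_right[OF dil conv_bd(1)[OF Kint it(2)] conv_bd(2)[OF Kint it(2)], of ?S "\<lambda>bs. bs"] by simp
        have "ennreal (norm (conv (dilate t \<phi>) Q y)) \<le> (\<Sum>bs\<in>?S. ennreal (norm (conv (dilate t \<phi>) (conv ?K (?F bs)) y)))"
          unfolding Q by (subst sum_ennreal) (auto intro!: ennreal_leI norm_sum)
        also have "\<dots> \<le> (\<Sum>bs\<in>?S. ennreal (Cd bs) * decay_avg s g x)"
          using Cd fg \<phi> t1 yt(2) by (intro sum_mono) blast
        also have "\<dots> = ennreal Ce * decay_avg s g x"
          unfolding Ce_def using Cd by (subst sum_ennreal[symmetric]) (auto simp: sum_distrib_right intro: order_less_imp_le)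
        finally have Qle: "ennreal (norm (conv (dilate t \<phi>) Q y)) \<le> ennreal Ce * decay_avg s g x" .
        have "ennreal (norm (conv (dilate t \<phi>) P y)) + ennreal (norm (conv (dilate t \<phi>) Q y)) \<le>
            ennreal Cc * grand_maximal N f x + ennreal Ce * decay_avg s g x"
          unfolding P_def by (intro add_mono Cc(2)[OF fg] \<phi> t1 yt) (use Qle in \<open>simp add: Q_def\<close>)
        also have "\<dots> \<le> ennreal C * grand_maximal N f x + ennreal C * decay_avg s g x"
          using Ca Cb Cc Ce by (intro add_mono mult_right_mono ennreal_leI) (auto simp: C_def)
        finally show ?thesis by (simp add: distrib_left)
      qed
      finally show "(case yt of (y, t) \<Rightarrow> ennreal (norm (conv (dilate t \<phi>) ?T y))) \<le> ennreal C * (grand_maximal N f x + decay_avg s g x)"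
        by (simp add: yt)
    qed
    ultimately show ?thesis by blast
  qed
  then show ?thesis using C by blast
qed

section \<open>The weak-type estimate at scale one\<close>

text \<open>The pointwise majorant is a sum of two functions of weak type, so a value above
  \<open>r\<close> forces one of them above \<open>r / (2 * C)\<close>. The norm of \<open>f\<close>
  enters through an arbitrary positive bound \<open>A\<close>, so that a vanishing norm needs no
  special treatment here.\<close>

lemma weak_Hardy_br_unit:
  fixes p \<delta> :: real and \<psi>0 :: "'a::euclidean_space \<Rightarrow> complex"
  assumes p: "0 < p" "p \<le> 1"
    and N: "\<lfloor>real DIM('a) * (1 / p - 1)\<rfloor> \<le> int N"
    and \<delta>: "\<delta> > real DIM('a) / p - (real DIM('a) + 1) / 2"
    and \<psi>0: "\<psi>0 \<in> schwartz" "\<And>\<xi>. norm \<xi> \<le> 1 \<Longrightarrow> fourier \<psi>0 \<xi> = 1"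
  shows "\<exists>C>0. \<forall>f \<psi> A. tempered f \<longrightarrow> 0 < A \<longrightarrow> weak_Hardy_norm N p f \<le> ennreal A \<longrightarrow>
    \<psi> \<in> schwartz \<longrightarrow> (\<forall>\<xi>::'a. norm \<xi> \<le> 1 \<longrightarrow> fourier \<psi> \<xi> = 1) \<longrightarrow>
    tempered (distr_of_fun (conv (br_kernel \<delta>) (conv_distr \<psi> f))) \<and>
    weak_Hardy_norm N p (distr_of_fun (conv (br_kernel \<delta>) (conv_distr \<psi> f))) \<le> ennreal (C * A)"
proof -
  let ?n = "real DIM('a)"
  have n1: "1 \<le> ?n" by simp
  have nnp: "?n \<le> ?n / p" using p n1 by (simp add: le_divide_eq mult_left_le)
  have e: "?n - (?n + 1) / 2 = (?n - 1) / 2" by (simp add: field_simps)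
  have \<delta>n: "(?n - 1) / 2 < \<delta>" using \<delta> nnp e by linarith
  then have \<delta>0: "0 < \<delta>" using n1 by (meson diff_ge_0_iff_ge divide_nonneg_pos le_less_trans zero_less_numeral)
  \<comment> \<open>An integer part is at most \<open>N\<close> exactly when the number is below
    \<open>N + 1\<close>; the condition on \<open>N\<close> thus means
    \<open>n / p < N + n + 1\<close>.\<close>
  have "?n * (1 / p - 1) < real N + 1"
    using N by linarith
  then have Ln: "?n / p < real (N + DIM('a) + 1)" by (simp add: right_diff_distrib)
  \<comment> \<open>The smaller of the decay of the kernel and the decay of test functions; both
    exceed \<open>n / p\<close>.\<close>
  define s where "s = min (\<delta> + (?n + 1) / 2) (real (N + DIM('a) + 1))"
  have sp: "?n / p < s" using \<delta> Ln by (simp add: s_def)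
  then have sn: "?n < s" using nnp by linarith
  obtain C where C: "0 < C" and G: "\<And>f g \<psi>. \<lbrakk>unit_majorant N f g; \<psi> \<in> schwartz; \<And>\<xi>::'a. norm \<xi> \<le> 1 \<Longrightarrow> fourier \<psi> \<xi> = 1\<rbrakk> \<Longrightarrow>
    tempered (distr_of_fun (conv (br_kernel \<delta>) (conv_distr \<psi> f))) \<and>
    (\<forall>x. grand_maximal N (distr_of_fun (conv (br_kernel \<delta>) (conv_distr \<psi> f))) x \<le>
      ennreal C * (grand_maximal N f x + decay_avg s g x))"
    using grand_maximal_br_le[OF \<delta>n \<delta>0 sn _ _ \<psi>0, of N] by (force simp: s_def)
  obtain Cw where Cw: "0 < Cw" and weak:
    "\<And>(g::'a \<Rightarrow> real) G A \<mu>. \<lbrakk>g \<in> borel_measurable borel; G \<in> borel_measurable borel; \<And>z. 0 \<le> g z;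
      \<And>z w. norm (z - w) < 1 \<Longrightarrow> g z \<le> G w; 0 < A;
      \<And>r. 0 < r \<Longrightarrow> emeasure lborel {w. r < G w} \<le> ennreal ((A / r) powr p); 0 < \<mu>\<rbrakk> \<Longrightarrow>
      emeasure lborel {x. ennreal \<mu> < (\<integral>\<^sup>+z. ennreal (decay s (x - z) * g z) \<partial>lborel)} \<le> ennreal (Cw * (A / \<mu>) powr p)"
    using weak_type_decay[OF p sp] by blast
  \<comment> \<open>Comes from writing \<open>(1 + Cw) * (A / \<mu>) powr p\<close> with
    \<open>\<mu> = r / (2 * C)\<close> as a single power with exponent \<open>p\<close>.\<close>
  define C' where "C' = (2 * C) * (1 + Cw) powr (1 / p)"
  have C': "0 < C'" using C Cw by (simp add: C'_def)
  have "tempered (distr_of_fun (conv (br_kernel \<delta>) (conv_distr \<psi> f))) \<and>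
    weak_Hardy_norm N p (distr_of_fun (conv (br_kernel \<delta>) (conv_distr \<psi> f))) \<le> ennreal (C' * A)"
    if f: "tempered f" and A: "0 < A" "weak_Hardy_norm N p f \<le> ennreal A"
      and \<psi>: "\<psi> \<in> schwartz" "\<And>\<xi>::'a. norm \<xi> \<le> 1 \<Longrightarrow> fourier \<psi> \<xi> = 1" for f \<psi> A
  proof -
    obtain g G :: "'a \<Rightarrow> real" where g: "g \<in> borel_measurable borel" "G \<in> borel_measurable borel"
      "\<And>z. 0 \<le> g z" "\<And>z w. norm (z - w) < 1 \<Longrightarrow> g z \<le> G w"
      "\<And>r. 0 < r \<Longrightarrow> emeasure lborel {w. r < G w} \<le> ennreal ((A / r) powr p)"
      "\<And>z. unit_maximal N f z = ennreal (g z)" "\<exists>B. \<forall>z. g z \<le> B"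
      using weak_Hardy_real_majorant[OF p(1) f A] by metis
    have fg: "unit_majorant N f g" unfolding unit_majorant_def using f g by blast
    let ?T = "distr_of_fun (conv (br_kernel \<delta>) (conv_distr \<psi> f))"
    have T: "tempered ?T" and GT: "\<And>x. grand_maximal N ?T x \<le> ennreal C * (grand_maximal N f x + decay_avg s g x)"
      using G[OF fg \<psi>] by blast+
    have [measurable]: "decay_avg s g \<in> borel_measurable borel"
      using g(1) unfolding decay_avg_def[abs_def] by measurable
    have "weak_Lp_norm p (grand_maximal N ?T) \<le> ennreal (C' * A)"
    proof (subst weak_Lp_norm_le_iff[OF p(1)], use C' A in simp, intro allI impI)
      fix r :: real assume r: "0 < r"
      define \<mu> where "\<mu> = r / (2 * C)"
      have \<mu>: "0 < \<mu>" using r C by (simp add: \<mu>_def)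
      have sub: "{x. ennreal r < grand_maximal N ?T x} \<subseteq> {x. ennreal \<mu> < grand_maximal N f x} \<union> {x. ennreal \<mu> < decay_avg s g x}"
      proof
        fix x assume x: "x \<in> {x. ennreal r < grand_maximal N ?T x}"
        show "x \<in> {x. ennreal \<mu> < grand_maximal N f x} \<union> {x. ennreal \<mu> < decay_avg s g x}"
        proof (rule ccontr)
          assume "\<not> ?thesis"
          then have "grand_maximal N f x \<le> ennreal \<mu>" "decay_avg s g x \<le> ennreal \<mu>" by auto
          then have "grand_maximal N ?T x \<le> ennreal C * (ennreal \<mu> + ennreal \<mu>)"
            by (intro order_trans[OF GT] mult_left_mono add_mono) auto
          also have "ennreal \<mu> + ennreal \<mu> = ennreal (\<mu> + \<mu>)" using \<mu> by (intro ennreal_plus[symmetric]) auto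
          also have "ennreal C * ennreal (\<mu> + \<mu>) = ennreal (C * (\<mu> + \<mu>))" using C \<mu> by (intro ennreal_mult[symmetric]) auto
          also have "C * (\<mu> + \<mu>) = r" using C by (simp add: \<mu>_def)
          finally show False using x by simp
        qed
      qed
      have "emeasure lebesgue {x. ennreal r < grand_maximal N ?T x} = emeasure lborel {x. ennreal r < grand_maximal N ?T x}"
        by (rule emeasure_lebesgue_borel) measurable
      also have "\<dots> \<le> emeasure lborel ({x. ennreal \<mu> < grand_maximal N f x} \<union> {x. ennreal \<mu> < decay_avg s g x})"
        by (intro emeasure_mono sub) measurable
      also have "\<dots> \<le> emeasure lborel {x. ennreal \<mu> < grand_maximal N f x} + emeasure lborel {x. ennreal \<mu> < decay_avg s g x}"
        by (intro emeasure_subadditive) measurable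
      also have "\<dots> \<le> ennreal ((A / \<mu>) powr p) + ennreal (Cw * (A / \<mu>) powr p)"
      proof (rule add_mono)
        show "emeasure lborel {x. ennreal \<mu> < decay_avg s g x} \<le> ennreal (Cw * (A / \<mu>) powr p)"
          unfolding decay_avg_def by (rule weak[OF g(1-4) A(1) g(5) \<mu>])
        have "emeasure lborel {x. ennreal \<mu> < grand_maximal N f x} = emeasure lebesgue {x. ennreal \<mu> < grand_maximal N f x}"
          by (rule emeasure_lebesgue_borel[symmetric]) measurable
        then show "emeasure lborel {x. ennreal \<mu> < grand_maximal N f x} \<le> ennreal ((A / \<mu>) powr p)"
          using A \<mu> weak_Lp_norm_le_iff[OF p(1), of A "grand_maximal N f"] by (simp add: weak_Hardy_norm_def)
      qed
      also have "\<dots> = ennreal ((C' * A / r) powr p)"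
      proof -
        have "C' * A / r = (1 + Cw) powr (1 / p) * (A / \<mu>)" using C r by (simp add: C'_def \<mu>_def)
        also have "\<dots> powr p = (1 + Cw) * (A / \<mu>) powr p"
          using Cw A \<mu> p(1) powr_mult[of "(1 + Cw) powr (1 / p)" "A / \<mu>" p] by (simp add: powr_powr)
        finally show ?thesis using Cw by (simp add: ennreal_plus[symmetric] distrib_right del: ennreal_plus)
      qed
      finally show "emeasure lebesgue {x. ennreal r < grand_maximal N ?T x} \<le> ennreal ((C' * A / r) powr p)" .
    qed
    then show ?thesis using T by (simp add: weak_Hardy_norm_def)
  qed
  then show ?thesis using C' by blast
qed

section \<open>Scaling\<close>

text \<open>For a function this is \<open>f (x /\<^sub>R R)\<close> as a function of
  \<open>x\<close>; the dilation of the test function carries the Jacobian.\<close>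

definition scale_distr :: "real \<Rightarrow> 'a::euclidean_space distribution \<Rightarrow> 'a distribution" where
  "scale_distr R f = (\<lambda>\<phi>. f (dilate (1 / R) \<phi>))"

lemma schwartz_seminorm_dilate:
  fixes \<phi> :: "'a::euclidean_space \<Rightarrow> complex"
  assumes t: "0 < t"
  obtains C where "0 \<le> C" "\<And>\<phi>::'a \<Rightarrow> complex. \<phi> \<in> schwartz \<Longrightarrow> schwartz_seminorm M K (dilate t \<phi>) \<le> ennreal C * schwartz_seminorm M K \<phi>"
proof -
  define a where "a = max 1 t"
  define b where "b = max 1 (inverse t)"
  define C where "C = a ^ M * b ^ K / t ^ DIM('a)"
  have C: "0 \<le> C" using t by (simp add: C_def a_def b_def)
  show thesis
  proof (rule that[OF C])
    fix \<phi> :: "'a \<Rightarrow> complex" assume \<phi>: "\<phi> \<in> schwartz"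
    then have "schwartz_seminorm M K \<phi> < \<infinity>" by (simp add: schwartz_def)
    then obtain c where c: "0 \<le> c" "schwartz_seminorm M K \<phi> = ennreal c" by (cases "schwartz_seminorm M K \<phi>") auto
    then have "schwartz_seminorm M K \<phi> \<le> ennreal c" by simp
    then have bd: "(1 + norm x) ^ M * norm (iter_partial bs \<phi> x) \<le> c" if "bs \<in> lists Basis" "length bs \<le> K" for bs x
      unfolding schwartz_seminorm_le_iff[OF c(1)] using that by blast
    have "schwartz_seminorm M K (dilate t \<phi>) \<le> ennreal (C * c)"
      unfolding schwartz_seminorm_le_iff[OF mult_nonneg_nonneg[OF C c(1)]]
    proof (intro allI ballI impI)
      fix x :: 'a and bs :: "'a list" assume bs: "bs \<in> lists Basis" "length bs \<le> K"
      have "norm x = t * norm (x /\<^sub>R t)" using t by simp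
      also have "\<dots> \<le> a * norm (x /\<^sub>R t)" by (intro mult_right_mono) (auto simp: a_def)
      finally have "1 + norm x \<le> a * (1 + norm (x /\<^sub>R t))"
        unfolding distrib_left by (auto simp: a_def)
      then have 1: "(1 + norm x) ^ M \<le> a ^ M * (1 + norm (x /\<^sub>R t)) ^ M"
        unfolding power_mult_distrib[symmetric] by (intro power_mono) auto
      have "inverse t ^ length bs \<le> b ^ length bs" using t by (intro power_mono) (auto simp: b_def)
      also have "\<dots> \<le> b ^ K" using bs by (intro power_increasing) (auto simp: b_def)
      finally have 2: "inverse t ^ length bs \<le> b ^ K" .
      have "(1 + norm x) ^ M * norm (iter_partial bs (dilate t \<phi>) x) =
          (1 + norm x) ^ M * (inverse t ^ length bs * (norm (iter_partial bs \<phi> (x /\<^sub>R t)) / t ^ DIM('a)))"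
        using t by (simp add: iter_partial_dilate[OF \<phi> t bs(1)] dilate_def divide_inverse mult_ac)
      also have "\<dots> \<le> (a ^ M * (1 + norm (x /\<^sub>R t)) ^ M) * (b ^ K * (norm (iter_partial bs \<phi> (x /\<^sub>R t)) / t ^ DIM('a)))"
        using t by (intro mult_mono 1 2 order_refl) (auto simp: a_def b_def)
      also have "\<dots> = C * ((1 + norm (x /\<^sub>R t)) ^ M * norm (iter_partial bs \<phi> (x /\<^sub>R t)))"
        by (simp add: C_def mult_ac)
      also have "\<dots> \<le> C * c" by (intro mult_left_mono bd bs C)
      finally show "(1 + norm x) ^ M * norm (iter_partial bs (dilate t \<phi>) x) \<le> C * c" .
    qed
    then show "schwartz_seminorm M K (dilate t \<phi>) \<le> ennreal C * schwartz_seminorm M K \<phi>"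
      using c C by (simp add: ennreal_mult)
  qed
qed

lemma tempered_scale_distr:
  fixes f :: "'a::euclidean_space distribution"
  assumes f: "tempered f" and R: "0 < R"
  shows "tempered (scale_distr R f)"
proof -
  have R': "0 < 1 / R" using R by simp
  have dil: "dilate (1 / R) \<phi> \<in> schwartz" if "\<phi> \<in> schwartz" for \<phi> :: "'a \<Rightarrow> complex"
    by (rule schwartz_dilate[OF that R'])
  obtain C M K where C: "0 \<le> C" and
    fC: "\<And>\<phi>. \<phi> \<in> schwartz \<Longrightarrow> ennreal (norm (f \<phi>)) \<le> ennreal C * schwartz_seminorm M K \<phi>"
    using f unfolding tempered_def by blast
  obtain D where D: "0 \<le> D" "\<And>\<phi>::'a \<Rightarrow> complex. \<phi> \<in> schwartz \<Longrightarrow> schwartz_seminorm M K (dilate (1 / R) \<phi>) \<le> ennreal D * schwartz_seminorm M K \<phi>"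
    using schwartz_seminorm_dilate[OF R'] by blast
  show ?thesis
    unfolding tempered_def
  proof (intro conjI ballI allI)
    fix \<phi> \<psi> :: "'a \<Rightarrow> complex" assume \<phi>: "\<phi> \<in> schwartz" and \<psi>: "\<psi> \<in> schwartz"
    have "dilate (1 / R) (\<lambda>x. \<phi> x + \<psi> x) = (\<lambda>x. dilate (1 / R) \<phi> x + dilate (1 / R) \<psi> x)"
      by (simp add: dilate_def fun_eq_iff scaleR_add_right)
    then show "scale_distr R f (\<lambda>x. \<phi> x + \<psi> x) = scale_distr R f \<phi> + scale_distr R f \<psi>"
      by (simp add: scale_distr_def tempered_add[OF f dil[OF \<phi>] dil[OF \<psi>]])
  next
    fix c and \<phi> :: "'a \<Rightarrow> complex" assume \<phi>: "\<phi> \<in> schwartz"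
    have "dilate (1 / R) (\<lambda>x. c * \<phi> x) = (\<lambda>x. c * dilate (1 / R) \<phi> x)"
      by (simp add: dilate_def fun_eq_iff)
    then show "scale_distr R f (\<lambda>x. c * \<phi> x) = c * scale_distr R f \<phi>"
      by (simp add: scale_distr_def tempered_cmult[OF f dil[OF \<phi>]])
  next
    have "ennreal (norm (scale_distr R f \<phi>)) \<le> ennreal (C * D) * schwartz_seminorm M K \<phi>" if \<phi>: "\<phi> \<in> schwartz" for \<phi>
    proof -
      have "ennreal (norm (scale_distr R f \<phi>)) \<le> ennreal C * schwartz_seminorm M K (dilate (1 / R) \<phi>)"
        unfolding scale_distr_def by (rule fC[OF dil[OF \<phi>]])
      also have "\<dots> \<le> ennreal C * (ennreal D * schwartz_seminorm M K \<phi>)" by (intro mult_left_mono D \<phi>) auto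
      finally show ?thesis using C D(1) by (simp add: ennreal_mult mult.assoc)
    qed
    then show "\<exists>C\<ge>0. \<exists>M K. \<forall>\<phi>\<in>schwartz. ennreal (norm (scale_distr R f \<phi>)) \<le> ennreal C * schwartz_seminorm M K \<phi>"
      using C D(1) by (intro exI[of _ "C * D"] conjI exI[of _ M] exI[of _ K]) auto
  qed
qed

lemma conv_distr_scale:
  fixes \<phi> :: "'a::euclidean_space \<Rightarrow> complex"
  assumes R: "0 < R"
  shows "conv_distr \<phi> (scale_distr R f) x = conv_distr (dilate (1 / R) \<phi>) f (x /\<^sub>R R)"
proof -
  have "dilate (1 / R) (\<lambda>y. \<phi> (x - y)) = (\<lambda>y. dilate (1 / R) \<phi> (x /\<^sub>R R - y))"
    using R by (simp add: dilate_def fun_eq_iff scaleR_diff_right)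
  then show ?thesis by (simp add: conv_distr_def scale_distr_def)
qed

text \<open>Dividing \<open>y\<close> and \<open>t\<close> by \<open>R\<close> maps the cone at
  \<open>x\<close> to the cone at \<open>x /\<^sub>R R\<close> and keeps the same test function, so
  the test class is not affected.\<close>

lemma grand_maximal_scale_le:
  fixes f :: "'a::euclidean_space distribution"
  assumes R: "0 < R"
  shows "grand_maximal N (scale_distr R f) x \<le> grand_maximal N f (x /\<^sub>R R)"
  unfolding grand_maximal_def[of N "scale_distr R f"]
proof (intro SUP_least)
  fix \<phi> :: "'a \<Rightarrow> complex" and yt assume \<phi>: "\<phi> \<in> test_class N" and "yt \<in> {(y, t). norm (y - x) < t}"
  then obtain y t where yt: "yt = (y, t)" "norm (y - x) < t" by auto
  have "norm (y /\<^sub>R R - x /\<^sub>R R) < t / R"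
    using R yt(2) by (simp add: scaleR_diff_right[symmetric] divide_inverse_commute)
  moreover have "conv_distr (dilate t \<phi>) (scale_distr R f) y = conv_distr (dilate (t / R) \<phi>) f (y /\<^sub>R R)"
    by (simp add: conv_distr_scale[OF R] dilate_dilate)
  ultimately show "(case yt of (y, t) \<Rightarrow> ennreal (norm (conv_distr (dilate t \<phi>) (scale_distr R f) y))) \<le> grand_maximal N f (x /\<^sub>R R)"
    unfolding grand_maximal_def
    by (intro SUP_upper2[OF \<phi>] SUP_upper2[of "(y /\<^sub>R R, t / R)"]) (auto simp: yt)
qed

text \<open>Superlevel sets are stretched by \<open>R\<close>, so their measure grows by
  \<open>R ^ n\<close> and the quasi-norm by \<open>R powr (n / p)\<close>. The factors for
  \<open>R\<close> and \<open>1 / R\<close> cancel in the end.\<close>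

lemma weak_Hardy_norm_scale:
  fixes f :: "'a::euclidean_space distribution"
  assumes p: "0 < p" and R: "0 < R" and A: "0 \<le> A" "weak_Hardy_norm N p f \<le> ennreal A"
  shows "weak_Hardy_norm N p (scale_distr R f) \<le> ennreal (R powr (real DIM('a) / p) * A)"
proof -
  have "emeasure lebesgue {x. ennreal r < grand_maximal N (scale_distr R f) x} \<le> ennreal ((R powr (real DIM('a) / p) * A / r) powr p)"
    if r: "0 < r" for r
  proof -
    let ?S = "{x. ennreal r < grand_maximal N f x}"
    have "{x. ennreal r < grand_maximal N (scale_distr R f) x} \<subseteq> (\<lambda>x. R *\<^sub>R x + 0) ` ?S"
    proof
      fix x assume "x \<in> {x. ennreal r < grand_maximal N (scale_distr R f) x}"
      then have "x /\<^sub>R R \<in> ?S" using grand_maximal_scale_le[OF R, of N f x] by (auto intro: less_le_trans)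
      moreover have "x = R *\<^sub>R (x /\<^sub>R R) + 0" using R by simp
      ultimately show "x \<in> (\<lambda>x. R *\<^sub>R x + 0) ` ?S" by blast
    qed
    moreover have "(\<lambda>x. R *\<^sub>R x + 0) ` ?S \<in> sets lebesgue"
    proof -
      have "open ((\<lambda>x. R *\<^sub>R x) ` ?S)" using R open_scaling[OF _ open_grand_maximal, of R] by auto
      then show ?thesis by (simp add: borel_open sets_completionI_sets)
    qed
    ultimately have "emeasure lebesgue {x. ennreal r < grand_maximal N (scale_distr R f) x} \<le> emeasure lebesgue ((\<lambda>x. R *\<^sub>R x + 0) ` ?S)"
      by (intro emeasure_mono)
    also have "\<dots> = ennreal (R ^ DIM('a)) * emeasure lebesgue ?S"
      using emeasure_lebesgue_affine[of R 0 ?S] R by simp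
    also have "\<dots> \<le> ennreal (R ^ DIM('a)) * ennreal ((A / r) powr p)"
      using A r weak_Lp_norm_le_iff[OF p, of A "grand_maximal N f"]
      by (intro mult_left_mono) (auto simp: weak_Hardy_norm_def)
    also have "\<dots> = ennreal (R ^ DIM('a) * (A / r) powr p)" using R by (simp add: ennreal_mult)
    also have "R ^ DIM('a) * (A / r) powr p = (R powr (real DIM('a) / p) * A / r) powr p"
    proof -
      have "(R powr (real DIM('a) / p) * (A / r)) powr p = (R powr (real DIM('a) / p)) powr p * (A / r) powr p"
        by (rule powr_mult)
      also have "(R powr (real DIM('a) / p)) powr p = R ^ DIM('a)" using p R by (simp add: powr_powr powr_realpow)
      finally show ?thesis by simp
    qed
    finally show ?thesis .
  qed
  then show ?thesis
    unfolding weak_Hardy_norm_def using A by (subst weak_Lp_norm_le_iff[OF p]) simp_all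
qed

text \<open>One change of variables in the convolution and one in the pairing remove
  \<open>R\<close> from the operator. The cutoff becomes \<open>dilate R \<psi>\<close>, whose
  transform is 1 on the unit ball if that of \<open>\<psi>\<close> is 1 on the ball of radius
  \<open>R\<close>.\<close>

lemma bochner_riesz_scale:
  fixes f :: "'a::euclidean_space distribution"
  assumes R: "0 < R"
  shows "distr_of_fun (bochner_riesz \<psi> \<delta> R f) =
    scale_distr (1 / R) (distr_of_fun (conv (br_kernel \<delta>) (conv_distr (dilate R \<psi>) (scale_distr R f))))"
proof -
  let ?F = "conv_distr (dilate R \<psi>) (scale_distr R f)"
  have F: "conv_distr \<psi> f y = ?F (R *\<^sub>R y)" for y
    using R by (simp add: conv_distr_scale dilate_dilate)
  have BR: "bochner_riesz \<psi> \<delta> R f x = conv (br_kernel \<delta>) ?F (R *\<^sub>R x)" for x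
  proof -
    have "conv (br_kernel \<delta>) ?F (R *\<^sub>R x) = \<bar>R\<bar> ^ DIM('a) *\<^sub>R (\<integral>y. br_kernel \<delta> (R *\<^sub>R x - (0 + R *\<^sub>R y)) * ?F (0 + R *\<^sub>R y) \<partial>lborel)"
      unfolding conv_def using R by (intro integral_lborel_affine) simp
    also have "\<dots> = (\<integral>y. \<bar>R\<bar> ^ DIM('a) *\<^sub>R (br_kernel \<delta> (R *\<^sub>R x - (0 + R *\<^sub>R y)) * ?F (0 + R *\<^sub>R y)) \<partial>lborel)"
      by simp
    also have "\<dots> = bochner_riesz \<psi> \<delta> R f x"
      unfolding bochner_riesz_def conv_def F using R
      by (intro Bochner_Integration.integral_cong refl) (simp add: dilate_def scaleR_diff_right power_one_over)
    finally show ?thesis by simp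
  qed
  show ?thesis
  proof
    fix \<phi> :: "'a \<Rightarrow> complex"
    let ?T = "conv (br_kernel \<delta>) ?F"
    have "scale_distr (1 / R) (distr_of_fun ?T) \<phi> = (\<integral>x. ?T x * dilate R \<phi> x \<partial>lborel)"
      by (simp add: scale_distr_def distr_of_fun_def)
    also have "\<dots> = \<bar>R\<bar> ^ DIM('a) *\<^sub>R (\<integral>x. ?T (0 + R *\<^sub>R x) * dilate R \<phi> (0 + R *\<^sub>R x) \<partial>lborel)"
      using R by (intro integral_lborel_affine) simp
    also have "\<dots> = (\<integral>x. \<bar>R\<bar> ^ DIM('a) *\<^sub>R (?T (0 + R *\<^sub>R x) * dilate R \<phi> (0 + R *\<^sub>R x)) \<partial>lborel)"
      by simp
    also have "\<dots> = distr_of_fun (bochner_riesz \<psi> \<delta> R f) \<phi>"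
      unfolding distr_of_fun_def BR using R
      by (intro Bochner_Integration.integral_cong refl) (simp add: dilate_def)
    finally show "distr_of_fun (bochner_riesz \<psi> \<delta> R f) \<phi> = scale_distr (1 / R) (distr_of_fun ?T) \<phi>" by simp
  qed
qed

lemma br_cutoff_dilate:
  fixes \<psi> :: "'a::euclidean_space \<Rightarrow> complex"
  assumes R: "0 < R" and \<psi>: "br_cutoff R \<psi>"
  shows "dilate R \<psi> \<in> schwartz" and "norm \<xi> \<le> 1 \<Longrightarrow> fourier (dilate R \<psi>) \<xi> = 1"
proof -
  have s: "\<psi> \<in> schwartz" and one: "norm \<eta> \<le> R \<Longrightarrow> fourier \<psi> \<eta> = 1" for \<eta>
    using \<psi> by (auto simp: br_cutoff_def subset_iff)
  show "dilate R \<psi> \<in> schwartz" by (rule schwartz_dilate[OF s R])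
  assume \<xi>: "norm \<xi> \<le> 1"
  have "fourier (dilate R \<psi>) \<xi> = \<bar>R\<bar> ^ DIM('a) *\<^sub>R (\<integral>x. dilate R \<psi> (0 + R *\<^sub>R x) * cchar ((0 + R *\<^sub>R x) \<bullet> \<xi>) \<partial>lborel)"
    unfolding fourier_cchar using R by (intro integral_lborel_affine) simp
  also have "\<dots> = (\<integral>x. \<bar>R\<bar> ^ DIM('a) *\<^sub>R (dilate R \<psi> (0 + R *\<^sub>R x) * cchar ((0 + R *\<^sub>R x) \<bullet> \<xi>)) \<partial>lborel)"
    by simp
  also have "\<dots> = fourier \<psi> (R *\<^sub>R \<xi>)"
    unfolding fourier_cchar using R
    by (intro Bochner_Integration.integral_cong refl) (simp add: dilate_def)
  also have "\<dots> = 1" using R \<xi> by (intro one) (simp add: mult_left_le)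
  finally show "fourier (dilate R \<psi>) \<xi> = 1" .
qed

theorem corollary1p4:
  fixes p \<delta> :: real and N :: nat
  assumes "0 < p" and "p \<le> 1"
    and "\<lfloor>real DIM('a::euclidean_space) * (1 / p - 1)\<rfloor> \<le> int N"
    and "\<delta> > real DIM('a) / p - (real DIM('a) + 1) / 2"
    and "\<not> (\<exists>k::nat. k > 0 \<and> \<delta> - (real DIM('a) - 1) / 2 = real k)"
  shows "\<exists>C>0. \<forall>f \<in> (weak_Hardy N p :: 'a distribution set). \<forall>R>0. \<forall>\<psi>. br_cutoff R \<psi> \<longrightarrow>
           distr_of_fun (bochner_riesz \<psi> \<delta> R f) \<in> weak_Hardy N p \<and>
           weak_Hardy_norm N p (distr_of_fun (bochner_riesz \<psi> \<delta> R f))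
             \<le> ennreal C * weak_Hardy_norm N p f"
proof (cases "\<exists>\<psi>0 :: 'a \<Rightarrow> complex. \<psi>0 \<in> schwartz \<and> (\<forall>\<xi>. norm \<xi> \<le> 1 \<longrightarrow> fourier \<psi>0 \<xi> = 1)")
  \<comment> \<open>The constant has to be fixed before \<open>\<psi>\<close> is given, yet the
    decomposition needs some cutoff. If no Schwartz function has transform 1 on the unit ball,
    rescaling shows that \<open>br_cutoff R \<psi>\<close> never holds.\<close>
  case False
  then have "\<not> br_cutoff R \<psi>" if "0 < R" for R and \<psi> :: "'a \<Rightarrow> complex"
    using br_cutoff_dilate[OF that, of \<psi>] by blast
  then show ?thesis by (intro exI[of _ 1]) auto
next
  case True
  then obtain \<psi>0 :: "'a \<Rightarrow> complex" where \<psi>0: "\<psi>0 \<in> schwartz" "\<And>\<xi>. norm \<xi> \<le> 1 \<Longrightarrow> fourier \<psi>0 \<xi> = 1" by blast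
  obtain C where C: "0 < C" and unit: "\<And>f \<psi> A. \<lbrakk>tempered f; 0 < A; weak_Hardy_norm N p f \<le> ennreal A;
      \<psi> \<in> schwartz; \<And>\<xi>::'a. norm \<xi> \<le> 1 \<Longrightarrow> fourier \<psi> \<xi> = 1\<rbrakk> \<Longrightarrow>
    tempered (distr_of_fun (conv (br_kernel \<delta>) (conv_distr \<psi> f))) \<and>
    weak_Hardy_norm N p (distr_of_fun (conv (br_kernel \<delta>) (conv_distr \<psi> f))) \<le> ennreal (C * A)"
    using weak_Hardy_br_unit[OF assms(1-4) \<psi>0] by blast
  have main: "distr_of_fun (bochner_riesz \<psi> \<delta> R f) \<in> weak_Hardy N p \<and>
      weak_Hardy_norm N p (distr_of_fun (bochner_riesz \<psi> \<delta> R f)) \<le> ennreal C * weak_Hardy_norm N p f"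
    if fW: "f \<in> weak_Hardy N p" and R: "0 < R" and \<psi>: "br_cutoff R \<psi>" for f :: "'a distribution" and R \<psi>
  proof -
    let ?T = "distr_of_fun (bochner_riesz \<psi> \<delta> R f)"
    let ?q = "real DIM('a) / p"
    have f: "tempered f" and "weak_Hardy_norm N p f < \<infinity>"
      using fW by (auto simp: weak_Hardy_def weak_Lp_def weak_Hardy_norm_def)
    then obtain a where a: "0 \<le> a" "weak_Hardy_norm N p f = ennreal a" by (cases "weak_Hardy_norm N p f") auto
    have R': "0 < 1 / R" using R by simp
    \<comment> \<open>The estimate at scale one asks for a positive bound, while the norm
      \<open>a\<close> of \<open>f\<close> may be 0; hence an arbitrary positive
      \<open>A \<ge> a\<close>.\<close>
    have est: "tempered ?T \<and> weak_Hardy_norm N p ?T \<le> ennreal (C * A)" if A: "0 < A" "a \<le> A" for A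
    proof -
      have "weak_Hardy_norm N p f \<le> ennreal A" using a A by (simp add: ennreal_leI)
      then have "weak_Hardy_norm N p (scale_distr R f) \<le> ennreal (R powr ?q * A)"
        using A by (intro weak_Hardy_norm_scale assms R) auto
      moreover have "0 < R powr ?q * A" using R A by simp
      ultimately have *: "tempered (distr_of_fun (conv (br_kernel \<delta>) (conv_distr (dilate R \<psi>) (scale_distr R f))))"
        "weak_Hardy_norm N p (distr_of_fun (conv (br_kernel \<delta>) (conv_distr (dilate R \<psi>) (scale_distr R f)))) \<le> ennreal (C * (R powr ?q * A))"
        using unit[OF tempered_scale_distr[OF f R]] br_cutoff_dilate[OF R \<psi>] by blast+
      have "tempered ?T" unfolding bochner_riesz_scale[OF R] by (rule tempered_scale_distr[OF *(1) R'])
      moreover have "weak_Hardy_norm N p ?T \<le> ennreal ((1 / R) powr ?q * (C * (R powr ?q * A)))"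
        unfolding bochner_riesz_scale[OF R] using C A by (intro weak_Hardy_norm_scale[OF assms(1) R' _ *(2)]) auto
      moreover have "(1 / R) powr ?q * (C * (R powr ?q * A)) = C * A"
        using R by (simp add: powr_divide)
      ultimately show ?thesis by simp
    qed
    have norm: "weak_Hardy_norm N p ?T \<le> ennreal C * weak_Hardy_norm N p f"
    proof (rule ennreal_le_epsilon)
      \<comment> \<open>The choice \<open>A = a + e / C\<close> loses only \<open>e\<close>, so
        letting \<open>e\<close> tend to 0 recovers the bound by the norm itself.\<close>
      fix e :: real assume e: "0 < e"
      have "weak_Hardy_norm N p ?T \<le> ennreal (C * (a + e / C))"
        using est[of "a + e / C"] a e C by (simp add: add_nonneg_pos)
      also have "C * (a + e / C) = C * a + e" using C by (simp add: distrib_left)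
      also have "ennreal (C * a + e) = ennreal C * weak_Hardy_norm N p f + ennreal e"
        using a C e by (simp add: ennreal_mult)
      finally show "weak_Hardy_norm N p ?T \<le> ennreal C * weak_Hardy_norm N p f + ennreal e" .
    qed
    have "weak_Hardy_norm N p ?T \<le> ennreal (C * (a + 1))" using est[of "a + 1"] a by simp
    then have "weak_Hardy_norm N p ?T < \<infinity>" by (rule le_less_trans) simp
    moreover have "tempered ?T" using est[of "a + 1"] a by simp
    ultimately have "?T \<in> weak_Hardy N p"
      using grand_maximal_measurable_lebesgue by (simp add: weak_Hardy_def weak_Lp_def weak_Hardy_norm_def)
    with norm show ?thesis by blast
  qed
  show ?thesis using C main by blast
qed

end
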